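(* Let $B=C^*(D_1,\preceq,\mathcal{M})$, let $\mathcal{E}$ be the $C^*$-correspondence over $B$ (with left action $\phi$) described in the context, and let $K$ be the closed two-sided ideal of $B$ generated by $\iota_1(1,-1)$. Then $K$ is contained in the ideal $J_{\mathcal{E}}=\phi^{-1}(\mathcal{K}(\mathcal{E}))\cap(\ker\phi)^{\perp}$.
   Context: A $*$-semigroup is a semigroup with an involutive map $*$ satisfying $(ab)^*=b^*a^*$; $S^{\rm sa}$ denotes its selfadjoint elements. The $*$-semigroup $A$: let $A_c$ be the set of finite nonempty sequences $(n_0,\dots,n_k)$ of nonzero integers with alternating signs; multiplication is concatenation, where the last entry of the left factor and the first entry of the right factor are added into a single entry if they have the same sign; $(n_0,\dots,n_k)^*=(-n_k,\dots,-n_0)$. $A$ is the quotient of $A_c$ by the congruence generated by $(n_0,\dots,n_k)\sim(n_0,\dots,n_{i-1},n_i+n_{i+1}+n_{i+2},n_{i+3},\dots,n_k)$ whenever $0\le i\le k-2$ and $n_{i+1}=\pm1$. Each element of $A$ has a unique reduced representative $(n_0,\dots,n_k)$, one with $n_j\ne\pm1$ for $1\le j\le k-1$. Let $\tau:A\to\mathbb{Z}$, $\tau(n_0,\dots,n_k)=\sum n_i$ (a homomorphism), $A^0=\tau^{-1}(0)$, and let $A_+$ be the set of reduced words with $k\ge1$, $n_0<0$, $n_k>0$. An element $p$ of a semigroup $S$ is irreducible in $S$ if it is not a product of two elements of $S$, or whenever $p=mn$ with $m,n\in S$ then $p=m$ or $p=n$; $\operatorname{Irr}(S)$ is the set of these,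 and $\operatorname{Irr}_+(A^0)=\operatorname{Irr}(A^0)\cap A_+$. $D_1$ is the $*$-subsemigroup of $A$ generated by $(1,-1)$ and $\operatorname{Irr}_+(A^0)$. The $*$-map $\alpha:D_1\to D_1$ is $\alpha(n)=(-1)\,n\,(1)$ (product in $A$). Matricial order: for a row $[w_i]=[w_1,\dots,w_k]$ with entries in $A$, $[w_i]^*[w_j]$ is the $k\times k$ matrix with entries $w_i^*w_j$, and $a[w_i]=[aw_i]$ for $a\in A$. $\mathcal{M}_k(A)$ is the set of all matrices $[w_i]^*[w_j]$. Its partial order $\preceq$ is generated (reflexively and transitively) by: if $(-1,1)[w_i]=[w_i]$ and $[u_i]$ is any row with $[w_i]=(-1)[u_i]$ then $[w_i]^*[w_j]\preceq[u_i]^*[u_j]$; if $(1,-1)[w_i]=[w_i]$ and $[u_i]$ is any row with $[w_i]=(1)[u_i]$ then $[w_i]^*[w_j]\preceq[u_i]^*[u_j]$. $\mathcal{M}_k(D_1)$ is the set of matrices in $\mathcal{M}_k(A)$ with all entries in $D_1$, with the restricted order; $\mathcal{M}_1(D_1)=D_1^{\rm sa}$. A complete order representation of $D_1$ in a $C^*$-algebra $C$ is a $*$-semigroup homomorphism $\gamma:D_1\to C$ (multiplicative semigroup of $C$) such that for all $k$, $[a_{ij}]\preceq[b_{ij}]$ in $\mathcal{M}_k(D_1)$ implies $[\gamma(a_{ij})]\le[\gamma(b_{ij})]$ in $\mathrm{M}_k(C)$. $B=C^*(D_1,\preceq,\mathcal{M})$ is the $C^*$-algebra with a complete order representation $\iota_1:D_1\to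 B$ that is universal: every complete order representation $\gamma:D_1\to C$ is $\pi_\gamma\circ\iota_1$ for a unique $*$-homomorphism $\pi_\gamma:B\to C$. The correspondence: on $X=\mathbb{C}[D_1]\otimes_{\rm alg}B$ define the $B$-valued sesquilinear form $\langle s\otimes c,t\otimes d\rangle=c^*\beta(s^*t)d$ with $\beta=\iota_1\circ\alpha$; it is positive semidefinite. With $N=\{x:\langle x,x\rangle=0\}$, $\mathcal{E}$ is the right Hilbert $B$-module completing $X/N$, with left action $\phi:B\to\mathcal{L}(\mathcal{E})$ determined by $\phi(\iota_1(s))(t\otimes c)=st\otimes c$. $\mathcal{K}(\mathcal{E})=\overline{\rm span}\{\theta_{x,y}:x,y\in\mathcal{E}\}$ with $\theta_{x,y}(z)=x\langle y,z\rangle$. For an ideal $I$ of $B$, $I^\perp=\{b\in B: bI=0\}$. *)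

theory Defs
  imports Complex_Main "HOL-Library.FuncSet" "HOL-Algebra.Module" "HOL-Algebra.AbelCoset"
begin

section \<open>The star-semigroup A\<close>

definition alternating :: "int list \<Rightarrow> bool" where
  "alternating ns \<longleftrightarrow> ns \<noteq> [] \<and> 0 \<notin> set ns \<and> successively (\<lambda>x y. x * y < 0) ns"

definition join :: "int list \<Rightarrow> int list \<Rightarrow> int list" where
  "join xs ys =
     (if sgn (last xs) = sgn (hd ys) then butlast xs @ [last xs + hd ys] @ tl ys else xs @ ys)"

lemma sgn_add_same: "sgn (x::int) = sgn y \<Longrightarrow> sgn (x + y) = sgn y"
  by (auto simp: sgn_if split: if_splits)

lemma alternating_append:
  assumes "xs \<noteq> []" "ys \<noteq> []"
  shows "alternating (xs @ ys) \<longleftrightarrow> alternating xs \<and> alternating ys \<and> last xs * hd ys < 0"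
  using assms by (auto simp: alternating_def successively_append_iff)

lemma mult_neg_sgn: "(x::int) * y < 0 \<longleftrightarrow> x \<noteq> 0 \<and> y \<noteq> 0 \<and> sgn x \<noteq> sgn y"
  by (auto simp: mult_less_0_iff sgn_if)

lemma alternating_append':
  "alternating (xs @ ys) \<longleftrightarrow>
    (if xs = [] then alternating ys else if ys = [] then alternating xs
     else alternating xs \<and> alternating ys \<and> sgn (last xs) \<noteq> sgn (hd ys))"
proof (cases "xs = [] \<or> ys = []")
  case False
  have "last xs \<noteq> 0" if "alternating xs"
    using that by (metis alternating_def last_in_set)
  moreover have "hd ys \<noteq> 0" if "alternating ys"
    using that by (metis alternating_def hd_in_set)
  ultimately show ?thesis
    using False alternating_append[of xs ys] mult_neg_sgn by auto
qed auto

lemma alternating_Cons: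
  "alternating (x # ys) \<longleftrightarrow> x \<noteq> 0 \<and> (ys = [] \<or> (alternating ys \<and> sgn x \<noteq> sgn (hd ys)))"
  using alternating_append'[of "[x]" ys] by (auto simp: alternating_def)

lemma alternating_not_Nil [simp]: "\<not> alternating []"
  by (simp add: alternating_def)

lemma join_snoc_Cons:
  "join (xs @ [x]) (y # ys) = (if sgn x = sgn y then xs @ (x + y) # ys else xs @ x # y # ys)"
  by (simp add: join_def)

lemma alternating_join:
  assumes "alternating xs" "alternating ys"
  shows "alternating (join xs ys)"
proof -
  obtain us x where xs: "xs = us @ [x]" using assms(1) by (cases xs rule: rev_cases) auto
  obtain y vs where ys: "ys = y # vs" using assms(2) by (cases ys) auto
  have s: "sgn x = sgn y \<Longrightarrow> x + y \<noteq> 0 \<and> sgn (x + y) = sgn y"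
    using assms unfolding xs ys by (auto simp: alternating_append' alternating_Cons sgn_if split: if_splits)
  show ?thesis using assms s unfolding xs ys join_snoc_Cons
    by (auto simp: alternating_append' alternating_Cons split: if_splits)
qed

lemma join_assoc:
  assumes "alternating xs" "alternating ys" "alternating zs"
  shows "join (join xs ys) zs = join xs (join ys zs)"
proof -
  obtain us x where xs: "xs = us @ [x]" using assms(1) by (cases xs rule: rev_cases) auto
  obtain z ws where zs: "zs = z # ws" using assms(3) by (cases zs) auto
  show ?thesis
  proof (cases "\<exists>y. ys = [y]")
    case True
    then obtain y where ys: "ys = [y]" by blast
    have 1: "sgn x = sgn y \<Longrightarrow> sgn (x + y) = sgn y" by (rule sgn_add_same)
    have 2: "sgn y = sgn z \<Longrightarrow> sgn (y + z) = sgn y" by (metis sgn_add_same)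
    have "join [y] (z # ws) = (if sgn y = sgn z then (y + z) # ws else y # z # ws)"
      using join_snoc_Cons[of "[]" y z ws] by simp
    moreover have "join (us @ [x, y]) (z # ws) =
        (if sgn y = sgn z then us @ x # (y + z) # ws else us @ x # y # z # ws)"
      using join_snoc_Cons[of "us @ [x]" y z ws] by simp
    ultimately show ?thesis using 1 2
      by (auto simp: xs ys zs join_snoc_Cons)
  next
    case False
    then obtain y vs y' where ys: "ys = y # vs @ [y']"
      using assms(2) by (metis alternating_not_Nil append_Cons neq_Nil_conv rev_exhaust self_append_conv2)
    have a: "join (y # vs @ [y']) (z # ws) =
        (if sgn y' = sgn z then y # vs @ (y' + z) # ws else y # vs @ y' # z # ws)"
      using join_snoc_Cons[of "y # vs" y' z ws] by simp
    have b: "join (us @ c # vs @ [y']) (z # ws) =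
        (if sgn y' = sgn z then us @ c # vs @ (y' + z) # ws else us @ c # vs @ y' # z # ws)" for c
      using join_snoc_Cons[of "us @ c # vs" y' z ws] by simp
    have c: "join (us @ x # y # vs @ [y']) (z # ws) =
        (if sgn y' = sgn z then us @ x # y # vs @ (y' + z) # ws
         else us @ x # y # vs @ y' # z # ws)"
      using join_snoc_Cons[of "us @ x # y # vs" y' z ws] by simp
    show ?thesis
      by (simp add: xs ys zs join_snoc_Cons a b c)
  qed
qed

definition rev_neg :: "int list \<Rightarrow> int list" where
  "rev_neg ns = rev (map uminus ns)"

lemma alternating_rev_neg: "alternating xs \<Longrightarrow> alternating (rev_neg xs)"
  by (auto simp: alternating_def rev_neg_def successively_map mult.commute)

lemma rev_neg_join:
  assumes "alternating xs" "alternating ys"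
  shows "rev_neg (join xs ys) = join (rev_neg ys) (rev_neg xs)"
proof -
  obtain us x where xs: "xs = us @ [x]" using assms(1) by (cases xs rule: rev_cases) auto
  obtain y vs where ys: "ys = y # vs" using assms(2) by (cases ys) auto
  show ?thesis unfolding xs ys
    by (auto simp: rev_neg_def join_snoc_Cons sgn_minus)
qed

lemma sum_list_join: "alternating xs \<Longrightarrow> alternating ys \<Longrightarrow>
    sum_list (join xs ys) = sum_list xs + sum_list ys"
  by (cases xs rule: rev_cases; cases ys) (auto simp: join_snoc_Cons)

text \<open>The type \<open>alt_seq\<close> is A_c; its quotient \<open>alt_sg\<close> below is A.\<close>

typedef alt_seq = "{ns. alternating ns}"
  by (rule exI[of _ "[1]"]) (simp add: alternating_def)

setup_lifting type_definition_alt_seq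

lift_definition seq_mult :: "alt_seq \<Rightarrow> alt_seq \<Rightarrow> alt_seq" is join
  by (rule alternating_join)

lift_definition seq_star :: "alt_seq \<Rightarrow> alt_seq" is rev_neg
  by (rule alternating_rev_neg)

lift_definition seq_tau :: "alt_seq \<Rightarrow> int" is sum_list .

lemma seq_mult_assoc: "seq_mult (seq_mult x y) z = seq_mult x (seq_mult y z)"
  by transfer (rule join_assoc)

lemma seq_star_mult: "seq_star (seq_mult x y) = seq_mult (seq_star y) (seq_star x)"
  by transfer (rule rev_neg_join)

lemma seq_star_star: "seq_star (seq_star x) = x"
  by transfer (simp add: rev_neg_def rev_map o_def)

lemma seq_tau_mult: "seq_tau (seq_mult x y) = seq_tau x + seq_tau y"
  by transfer (rule sum_list_join)

inductive seq_cong :: "alt_seq \<Rightarrow> alt_seq \<Rightarrow> bool" where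
  contract: "\<lbrakk>Rep_alt_seq x = us @ [a, b, c] @ vs; b = 1 \<or> b = -1;
     Rep_alt_seq y = us @ [a + b + c] @ vs\<rbrakk> \<Longrightarrow> seq_cong x y"
| refl: "seq_cong x x"
| sym: "seq_cong x y \<Longrightarrow> seq_cong y x"
| trans: "seq_cong x y \<Longrightarrow> seq_cong y z \<Longrightarrow> seq_cong x z"
| mult: "seq_cong x y \<Longrightarrow> seq_cong x' y' \<Longrightarrow> seq_cong (seq_mult x x') (seq_mult y y')"

lemma seq_cong_star: "seq_cong x y \<Longrightarrow> seq_cong (seq_star x) (seq_star y)"
proof (induction rule: seq_cong.induct)
  case (contract x us a b c vs y)
  show ?case
  proof (rule seq_cong.contract)
    show "Rep_alt_seq (seq_star x) = rev_neg vs @ [- c, - b, - a] @ rev_neg us"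
      by (simp add: seq_star.rep_eq contract rev_neg_def)
    show "Rep_alt_seq (seq_star y) = rev_neg vs @ [- c + - b + - a] @ rev_neg us"
      by (simp add: seq_star.rep_eq contract rev_neg_def)
    show "- b = 1 \<or> - b = - 1" using contract by auto
  qed
qed (auto simp: seq_star_mult intro: seq_cong.intros(2-5))

lemma seq_cong_tau: "seq_cong x y \<Longrightarrow> seq_tau x = seq_tau y"
proof (induction rule: seq_cong.induct)
  case (contract x us a b c vs y)
  then show ?case by (simp add: seq_tau.rep_eq)
qed (auto simp: seq_tau_mult)

quotient_type alt_sg = alt_seq / seq_cong
  by (rule equivpI) (auto intro!: reflpI sympI transpI intro: seq_cong.intros(2-4))

instantiation alt_sg :: semigroup_mult
begin
lift_definition times_alt_sg :: "alt_sg \<Rightarrow> alt_sg \<Rightarrow> alt_sg" is seq_mult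
  by (rule seq_cong.mult)
instance by standard (transfer, simp add: seq_mult_assoc seq_cong.refl)
end

lift_definition sg_star :: "alt_sg \<Rightarrow> alt_sg" is seq_star
  by (rule seq_cong_star)

lift_definition tau :: "alt_sg \<Rightarrow> int" is seq_tau
  by (rule seq_cong_tau)

lemma sg_star_mult: "sg_star (x * y) = sg_star y * sg_star x"
  by transfer (simp add: seq_star_mult seq_cong.refl)

lemma sg_star_star: "sg_star (sg_star x) = x"
  by transfer (simp add: seq_star_star seq_cong.refl)

lemma tau_mult: "tau (x * y) = tau x + tau y"
  by transfer (rule seq_tau_mult)

text \<open>The class of a sequence; meaningful only for alternating sequences.\<close>

definition word :: "int list \<Rightarrow> alt_sg" where
  "word ns = abs_alt_sg (Abs_alt_seq ns)"

definition reduced :: "int list \<Rightarrow> bool" where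
  "reduced ns \<longleftrightarrow> alternating ns \<and> (\<forall>j. 1 \<le> j \<and> j < length ns - 1 \<longrightarrow> \<bar>ns ! j\<bar> \<noteq> 1)"

definition A0 :: "alt_sg set" where
  "A0 = {a. tau a = 0}"

definition A_plus :: "alt_sg set" where
  "A_plus = {word ns | ns. reduced ns \<and> length ns \<ge> 2 \<and> hd ns < 0 \<and> last ns > 0}"

definition Irr :: "'s::semigroup_mult set \<Rightarrow> 's set" where
  "Irr S = {p \<in> S. \<not> (\<exists>m\<in>S. \<exists>n\<in>S. p = m * n) \<or>
                   (\<forall>m\<in>S. \<forall>n\<in>S. p = m * n \<longrightarrow> p = m \<or> p = n)}"

definition Irr_plus_A0 :: "alt_sg set" where
  "Irr_plus_A0 = Irr A0 \<inter> A_plus"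

inductive_set D1 :: "alt_sg set" where
  D1_gen: "word [1, -1] \<in> D1"
| D1_irr: "p \<in> Irr_plus_A0 \<Longrightarrow> p \<in> D1"
| D1_mult: "a \<in> D1 \<Longrightarrow> b \<in> D1 \<Longrightarrow> a * b \<in> D1"
| D1_star: "a \<in> D1 \<Longrightarrow> sg_star a \<in> D1"

definition alpha :: "alt_sg \<Rightarrow> alt_sg" where
  "alpha n = word [-1] * n * word [1]"

section \<open>The matricial order\<close>

text \<open>Rows are lists and square matrices are lists of rows, so that the size of a matrix is part
  of the data.\<close>

definition gram :: "alt_sg list \<Rightarrow> alt_sg list list" where
  "gram ws = map (\<lambda>x. map (\<lambda>y. sg_star x * y) ws) ws"

definition Mat_A :: "nat \<Rightarrow> alt_sg list list set" where
  "Mat_A k = {gram ws | ws. length ws = k}"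

inductive mat_step :: "alt_sg list list \<Rightarrow> alt_sg list list \<Rightarrow> bool" where
  "\<lbrakk>map ((*) (word [-1, 1])) ws = ws; ws = map ((*) (word [-1])) us\<rbrakk>
     \<Longrightarrow> mat_step (gram ws) (gram us)"
| "\<lbrakk>map ((*) (word [1, -1])) ws = ws; ws = map ((*) (word [1])) us\<rbrakk>
     \<Longrightarrow> mat_step (gram ws) (gram us)"

definition mat_preceq :: "nat \<Rightarrow> alt_sg list list \<Rightarrow> alt_sg list list \<Rightarrow> bool" where
  "mat_preceq k a b \<longleftrightarrow> a \<in> Mat_A k \<and> b \<in> Mat_A k \<and> mat_step\<^sup>*\<^sup>* a b"

definition Mat_D1 :: "nat \<Rightarrow> alt_sg list list set" where
  "Mat_D1 k = {a \<in> Mat_A k. \<forall>i<k. \<forall>j<k. a ! i ! j \<in> D1}"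

section \<open>C*-algebras\<close>

text \<open>Complex vector spaces are modules, in the sense of HOL-Algebra, over the following ring.\<close>

definition complex_ring :: "complex ring" where
  "complex_ring = \<lparr>carrier = UNIV, mult = (*), one = 1, zero = 0, add = (+)\<rparr>"

text \<open>C*-algebras are not assumed unital: \<open>one\<close> is inherited from the record for rings and
  carries no meaning.\<close>

record 'c cstar = "(complex, 'c) module" +
  cadj :: "'c \<Rightarrow> 'c"
  cnorm :: "'c \<Rightarrow> real"

definition complete_wrt :: "'a set \<Rightarrow> ('a \<Rightarrow> 'a \<Rightarrow> real) \<Rightarrow> bool" where
  "complete_wrt S d \<longleftrightarrow>
     (\<forall>s. range s \<subseteq> S \<and> (\<forall>e>0. \<exists>N::nat. \<forall>m\<ge>N. \<forall>n\<ge>N. d (s m) (s n) < e)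
        \<longrightarrow> (\<exists>x\<in>S. (\<lambda>n. d (s n) x) \<longlonglongrightarrow> 0))"

locale cstar_algebra = module complex_ring C for C :: "'c cstar" (structure) +
  assumes mult_closed: "\<lbrakk>x \<in> carrier C; y \<in> carrier C\<rbrakk> \<Longrightarrow> x \<otimes> y \<in> carrier C"
    and mult_assoc: "\<lbrakk>x \<in> carrier C; y \<in> carrier C; z \<in> carrier C\<rbrakk>
      \<Longrightarrow> (x \<otimes> y) \<otimes> z = x \<otimes> (y \<otimes> z)"
    and distr_left: "\<lbrakk>x \<in> carrier C; y \<in> carrier C; z \<in> carrier C\<rbrakk>
      \<Longrightarrow> (x \<oplus> y) \<otimes> z = x \<otimes> z \<oplus> y \<otimes> z"
    and distr_right: "\<lbrakk>x \<in> carrier C; y \<in> carrier C; z \<in> carrier C\<rbrakk>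
      \<Longrightarrow> z \<otimes> (x \<oplus> y) = z \<otimes> x \<oplus> z \<otimes> y"
    and smult_mult_left: "\<lbrakk>x \<in> carrier C; y \<in> carrier C\<rbrakk> \<Longrightarrow> (c \<odot> x) \<otimes> y = c \<odot> (x \<otimes> y)"
    and smult_mult_right: "\<lbrakk>x \<in> carrier C; y \<in> carrier C\<rbrakk> \<Longrightarrow> x \<otimes> (c \<odot> y) = c \<odot> (x \<otimes> y)"
    and cadj_closed: "x \<in> carrier C \<Longrightarrow> cadj C x \<in> carrier C"
    and cadj_cadj: "x \<in> carrier C \<Longrightarrow> cadj C (cadj C x) = x"
    and cadj_add: "\<lbrakk>x \<in> carrier C; y \<in> carrier C\<rbrakk> \<Longrightarrow> cadj C (x \<oplus> y) = cadj C x \<oplus> cadj C y"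
    and cadj_smult: "x \<in> carrier C \<Longrightarrow> cadj C (c \<odot> x) = cnj c \<odot> cadj C x"
    and cadj_mult: "\<lbrakk>x \<in> carrier C; y \<in> carrier C\<rbrakk> \<Longrightarrow> cadj C (x \<otimes> y) = cadj C y \<otimes> cadj C x"
    and cnorm_nonneg: "x \<in> carrier C \<Longrightarrow> 0 \<le> cnorm C x"
    and cnorm_eq_0: "x \<in> carrier C \<Longrightarrow> cnorm C x = 0 \<longleftrightarrow> x = \<zero>"
    and cnorm_triangle: "\<lbrakk>x \<in> carrier C; y \<in> carrier C\<rbrakk>
      \<Longrightarrow> cnorm C (x \<oplus> y) \<le> cnorm C x + cnorm C y"
    and cnorm_smult: "x \<in> carrier C \<Longrightarrow> cnorm C (c \<odot> x) = cmod c * cnorm C x"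
    and cnorm_mult: "\<lbrakk>x \<in> carrier C; y \<in> carrier C\<rbrakk>
      \<Longrightarrow> cnorm C (x \<otimes> y) \<le> cnorm C x * cnorm C y"
    and cstar_identity: "x \<in> carrier C \<Longrightarrow> cnorm C (cadj C x \<otimes> x) = (cnorm C x)\<^sup>2"
    and complete: "complete_wrt (carrier C) (\<lambda>x y. cnorm C (x \<ominus> y))"

definition star_hom :: "'b cstar \<Rightarrow> 'c cstar \<Rightarrow> ('b \<Rightarrow> 'c) set" where
  "star_hom B C = {h. h \<in> carrier B \<rightarrow> carrier C \<and>
     (\<forall>x\<in>carrier B. \<forall>y\<in>carrier B. h (x \<oplus>\<^bsub>B\<^esub> y) = h x \<oplus>\<^bsub>C\<^esub> h y) \<and>
     (\<forall>c. \<forall>x\<in>carrier B. h (c \<odot>\<^bsub>B\<^esub> x) = c \<odot>\<^bsub>C\<^esub> h x) \<and>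
     (\<forall>x\<in>carrier B. \<forall>y\<in>carrier B. h (x \<otimes>\<^bsub>B\<^esub> y) = h x \<otimes>\<^bsub>C\<^esub> h y) \<and>
     (\<forall>x\<in>carrier B. h (cadj B x) = cadj C (h x))}"

definition cstar_pos :: "'c cstar \<Rightarrow> 'c \<Rightarrow> bool" where
  "cstar_pos C x \<longleftrightarrow> (\<exists>y\<in>carrier C. x = cadj C y \<otimes>\<^bsub>C\<^esub> y)"

text \<open>The order of the C*-algebra \<open>M\<^sub>k(C)\<close>: as in \<open>cstar_pos\<close>, positive means of the form \<open>X\<^sup>* X\<close>.\<close>

definition mat_pos :: "'c cstar \<Rightarrow> nat \<Rightarrow> (nat \<Rightarrow> nat \<Rightarrow> 'c) \<Rightarrow> bool" where
  "mat_pos C k M \<longleftrightarrow> (\<exists>X. (\<forall>i<k. \<forall>j<k. X i j \<in> carrier C) \<and>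
     (\<forall>i<k. \<forall>j<k. M i j = (\<Oplus>\<^bsub>C\<^esub>l\<in>{..<k}. cadj C (X l i) \<otimes>\<^bsub>C\<^esub> X l j)))"

definition mat_le :: "'c cstar \<Rightarrow> nat \<Rightarrow> (nat \<Rightarrow> nat \<Rightarrow> 'c) \<Rightarrow> (nat \<Rightarrow> nat \<Rightarrow> 'c) \<Rightarrow> bool" where
  "mat_le C k M N \<longleftrightarrow> mat_pos C k (\<lambda>i j. N i j \<ominus>\<^bsub>C\<^esub> M i j)"

definition complete_order_rep :: "'c cstar \<Rightarrow> (alt_sg \<Rightarrow> 'c) \<Rightarrow> bool" where
  "complete_order_rep C g \<longleftrightarrow>
     g \<in> D1 \<rightarrow> carrier C \<and>
     (\<forall>s\<in>D1. \<forall>t\<in>D1. g (s * t) = g s \<otimes>\<^bsub>C\<^esub> g t) \<and>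
     (\<forall>s\<in>D1. g (sg_star s) = cadj C (g s)) \<and>
     (\<forall>k. \<forall>a\<in>Mat_D1 k. \<forall>b\<in>Mat_D1 k. mat_preceq k a b \<longrightarrow>
        mat_le C k (\<lambda>i j. g (a ! i ! j)) (\<lambda>i j. g (b ! i ! j)))"

text \<open>The universal property against all C*-algebras whose elements have type \<open>'c\<close>.
  Homomorphisms are taken extensional on the carrier so that uniqueness makes sense.\<close>

definition universal_for :: "'c itself \<Rightarrow> 'b cstar \<Rightarrow> (alt_sg \<Rightarrow> 'b) \<Rightarrow> bool" where
  "universal_for T B \<iota> \<longleftrightarrow>
     (\<forall>(C::'c cstar) g. cstar_algebra C \<and> complete_order_rep C g \<longrightarrow>
        (\<exists>!h. h \<in> star_hom B C \<inter> extensional (carrier B) \<and> (\<forall>s\<in>D1. g s = h (\<iota> s))))"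

text \<open>\<open>B\<close> together with \<open>\<iota>\<close> is the C*-algebra C*(D1, \<open>\<preceq>\<close>, M). HOL cannot quantify over all
  types inside a formula, but the two types used below imply the universal property against
  C*-algebras on any type. Indeed, the C*-subalgebra of \<open>C\<close> generated by the image of a
  representation of \<open>D1\<close> injects into \<^typ>\<open>nat \<Rightarrow> alt_sg \<Rightarrow> complex\<close> (send an element to
  a sequence of linear combinations of \<open>D1\<close> that converges to it), so existence of
  factorizations into any \<open>C\<close> follows from the second type. Applying the first type to the
  C*-subalgebra of \<open>B\<close> generated by \<open>\<iota> ` D1\<close> and to \<open>B\<close> shows that \<open>\<iota> ` D1\<close> generates \<open>B\<close>, whence
  uniqueness of factorizations into any \<open>C\<close>.\<close>

definition universal_cstar :: "'b cstar \<Rightarrow> (alt_sg \<Rightarrow> 'b) \<Rightarrow> bool" where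
  "universal_cstar B \<iota> \<longleftrightarrow> cstar_algebra B \<and> complete_order_rep B \<iota> \<and>
     universal_for TYPE('b) B \<iota> \<and> universal_for TYPE(nat \<Rightarrow> alt_sg \<Rightarrow> complex) B \<iota>"

definition norm_closure :: "'c cstar \<Rightarrow> 'c set \<Rightarrow> 'c set" where
  "norm_closure C S = {x \<in> carrier C. \<forall>e>0. \<exists>y\<in>S. cnorm C (x \<ominus>\<^bsub>C\<^esub> y) < e}"

definition complex_span :: "'c cstar \<Rightarrow> 'c set \<Rightarrow> 'c set" where
  "complex_span C S = \<Inter>{H. submodule H complex_ring C \<and> S \<subseteq> H}"

definition closed_ideal :: "'b cstar \<Rightarrow> 'b set \<Rightarrow> bool" where
  "closed_ideal B I \<longleftrightarrow> submodule I complex_ring B \<and>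
     (\<forall>b\<in>carrier B. \<forall>x\<in>I. b \<otimes>\<^bsub>B\<^esub> x \<in> I \<and> x \<otimes>\<^bsub>B\<^esub> b \<in> I) \<and> norm_closure B I \<subseteq> I"

definition closed_ideal_gen :: "'b cstar \<Rightarrow> 'b set \<Rightarrow> 'b set" where
  "closed_ideal_gen B S = \<Inter>{I. closed_ideal B I \<and> S \<subseteq> I}"

definition annihilator :: "'b cstar \<Rightarrow> 'b set \<Rightarrow> 'b set" where
  "annihilator B I = {b \<in> carrier B. \<forall>x\<in>I. b \<otimes>\<^bsub>B\<^esub> x = \<zero>\<^bsub>B\<^esub>}"

section \<open>Hilbert modules\<close>

text \<open>Again \<open>mult\<close> and \<open>one\<close> of the underlying ring record carry no meaning; \<open>smult\<close> is the scalar
  multiplication and \<open>ract\<close> the right action of the C*-algebra.\<close>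

record ('b, 'e) hmod = "(complex, 'e) module" +
  ract :: "'e \<Rightarrow> 'b \<Rightarrow> 'e"
  inn :: "'e \<Rightarrow> 'e \<Rightarrow> 'b"

definition hnorm :: "'b cstar \<Rightarrow> ('b, 'e) hmod \<Rightarrow> 'e \<Rightarrow> real" where
  "hnorm B E x = sqrt (cnorm B (inn E x x))"

locale hilbert_module = B: cstar_algebra B + E: module complex_ring E
  for B :: "'b cstar" and E :: "('b, 'e) hmod" +
  assumes ract_closed: "\<lbrakk>x \<in> carrier E; b \<in> carrier B\<rbrakk> \<Longrightarrow> ract E x b \<in> carrier E"
    and ract_mult: "\<lbrakk>x \<in> carrier E; b \<in> carrier B; c \<in> carrier B\<rbrakk>
      \<Longrightarrow> ract E x (b \<otimes>\<^bsub>B\<^esub> c) = ract E (ract E x b) c"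
    and ract_add_left: "\<lbrakk>x \<in> carrier E; y \<in> carrier E; b \<in> carrier B\<rbrakk>
      \<Longrightarrow> ract E (x \<oplus>\<^bsub>E\<^esub> y) b = ract E x b \<oplus>\<^bsub>E\<^esub> ract E y b"
    and ract_add_right: "\<lbrakk>x \<in> carrier E; b \<in> carrier B; c \<in> carrier B\<rbrakk>
      \<Longrightarrow> ract E x (b \<oplus>\<^bsub>B\<^esub> c) = ract E x b \<oplus>\<^bsub>E\<^esub> ract E x c"
    and ract_smult_left: "\<lbrakk>x \<in> carrier E; b \<in> carrier B\<rbrakk>
      \<Longrightarrow> ract E (z \<odot>\<^bsub>E\<^esub> x) b = z \<odot>\<^bsub>E\<^esub> ract E x b"
    and ract_smult_right: "\<lbrakk>x \<in> carrier E; b \<in> carrier B\<rbrakk>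
      \<Longrightarrow> ract E x (z \<odot>\<^bsub>B\<^esub> b) = z \<odot>\<^bsub>E\<^esub> ract E x b"
    and inn_closed: "\<lbrakk>x \<in> carrier E; y \<in> carrier E\<rbrakk> \<Longrightarrow> inn E x y \<in> carrier B"
    and inn_add_right: "\<lbrakk>x \<in> carrier E; y \<in> carrier E; y' \<in> carrier E\<rbrakk>
      \<Longrightarrow> inn E x (y \<oplus>\<^bsub>E\<^esub> y') = inn E x y \<oplus>\<^bsub>B\<^esub> inn E x y'"
    and inn_smult_right: "\<lbrakk>x \<in> carrier E; y \<in> carrier E\<rbrakk>
      \<Longrightarrow> inn E x (z \<odot>\<^bsub>E\<^esub> y) = z \<odot>\<^bsub>B\<^esub> inn E x y"
    and inn_ract_right: "\<lbrakk>x \<in> carrier E; y \<in> carrier E; b \<in> carrier B\<rbrakk>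
      \<Longrightarrow> inn E x (ract E y b) = inn E x y \<otimes>\<^bsub>B\<^esub> b"
    and inn_cadj: "\<lbrakk>x \<in> carrier E; y \<in> carrier E\<rbrakk> \<Longrightarrow> cadj B (inn E x y) = inn E y x"
    and inn_pos: "x \<in> carrier E \<Longrightarrow> cstar_pos B (inn E x x)"
    and inn_eq_0: "x \<in> carrier E \<Longrightarrow> inn E x x = \<zero>\<^bsub>B\<^esub> \<Longrightarrow> x = \<zero>\<^bsub>E\<^esub>"
    and complete: "complete_wrt (carrier E) (\<lambda>x y. hnorm B E (x \<ominus>\<^bsub>E\<^esub> y))"

definition is_adjoint :: "('b, 'e) hmod \<Rightarrow> ('e \<Rightarrow> 'e) \<Rightarrow> ('e \<Rightarrow> 'e) \<Rightarrow> bool" where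
  "is_adjoint E T S \<longleftrightarrow> (\<forall>x\<in>carrier E. \<forall>y\<in>carrier E. inn E (T x) y = inn E x (S y))"

text \<open>The C*-algebra \<open>\<L>(E)\<close>; its elements are functions that are extensional on the carrier of \<open>E\<close>.\<close>

definition adjointable_ops :: "'b cstar \<Rightarrow> ('b, 'e) hmod \<Rightarrow> ('e \<Rightarrow> 'e) cstar" where
  "adjointable_ops B E =
    \<lparr>carrier = {T \<in> carrier E \<rightarrow>\<^sub>E carrier E. \<exists>S \<in> carrier E \<rightarrow>\<^sub>E carrier E. is_adjoint E T S},
     mult = (\<lambda>T S. compose (carrier E) T S),
     one = (\<lambda>x\<in>carrier E. x),
     zero = (\<lambda>x\<in>carrier E. \<zero>\<^bsub>E\<^esub>),
     add = (\<lambda>T S. \<lambda>x\<in>carrier E. T x \<oplus>\<^bsub>E\<^esub> S x),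
     smult = (\<lambda>z T. \<lambda>x\<in>carrier E. z \<odot>\<^bsub>E\<^esub> T x),
     cadj = (\<lambda>T. THE S. S \<in> carrier E \<rightarrow>\<^sub>E carrier E \<and> is_adjoint E T S),
     cnorm = (\<lambda>T. SUP x\<in>{x \<in> carrier E. hnorm B E x \<le> 1}. hnorm B E (T x))\<rparr>"

definition theta :: "('b, 'e) hmod \<Rightarrow> 'e \<Rightarrow> 'e \<Rightarrow> ('e \<Rightarrow> 'e)" where
  "theta E x y = (\<lambda>z\<in>carrier E. ract E x (inn E y z))"

definition compact_ops :: "'b cstar \<Rightarrow> ('b, 'e) hmod \<Rightarrow> ('e \<Rightarrow> 'e) set" where
  "compact_ops B E = norm_closure (adjointable_ops B E)
     (complex_span (adjointable_ops B E) {theta E x y | x y. x \<in> carrier E \<and> y \<in> carrier E})"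

section \<open>The correspondence\<close>

text \<open>Since \<open>D1\<close> is a basis of \<open>\<complex>[D1]\<close>, the algebraic tensor product \<open>\<complex>[D1] \<otimes> B\<close> is the space of
  finitely supported functions from \<open>D1\<close> to \<open>B\<close>, with \<open>t \<otimes> c\<close> the function \<open>elem_tensor B t c\<close>
  supported at \<open>t\<close>. Functions are extended by 0 off \<open>D1\<close>.\<close>

definition X_space :: "'b cstar \<Rightarrow> (alt_sg \<Rightarrow> 'b) set" where
  "X_space B = {f. range f \<subseteq> carrier B \<and> finite {t. f t \<noteq> \<zero>\<^bsub>B\<^esub>} \<and> (\<forall>t. t \<notin> D1 \<longrightarrow> f t = \<zero>\<^bsub>B\<^esub>)}"

definition elem_tensor :: "'b cstar \<Rightarrow> alt_sg \<Rightarrow> 'b \<Rightarrow> (alt_sg \<Rightarrow> 'b)" where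
  "elem_tensor B t c = (\<lambda>s. if s = t then c else \<zero>\<^bsub>B\<^esub>)"

text \<open>The sesquilinear extension of \<open>\<langle>s \<otimes> c, t \<otimes> d\<rangle> = c\<^sup>* \<beta>(s\<^sup>* t) d\<close>.\<close>

definition X_form :: "'b cstar \<Rightarrow> (alt_sg \<Rightarrow> 'b) \<Rightarrow> (alt_sg \<Rightarrow> 'b) \<Rightarrow> (alt_sg \<Rightarrow> 'b) \<Rightarrow> 'b" where
  "X_form B \<beta> f g =
     (\<Oplus>\<^bsub>B\<^esub>s\<in>{s. f s \<noteq> \<zero>\<^bsub>B\<^esub>}. \<Oplus>\<^bsub>B\<^esub>t\<in>{t. g t \<noteq> \<zero>\<^bsub>B\<^esub>}.
        cadj B (f s) \<otimes>\<^bsub>B\<^esub> \<beta> (sg_star s * t) \<otimes>\<^bsub>B\<^esub> g t)"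

text \<open>\<open>E\<close> is the completion of X/N, and \<open>q\<close> is the canonical map \<open>X \<rightarrow> X/N \<rightarrow> E\<close>: it preserves the
  module structure and the form, hence has kernel N, and has dense range.\<close>

definition hilbert_completion ::
  "'b cstar \<Rightarrow> (alt_sg \<Rightarrow> 'b) \<Rightarrow> ('b, 'e) hmod \<Rightarrow> ((alt_sg \<Rightarrow> 'b) \<Rightarrow> 'e) \<Rightarrow> bool" where
  "hilbert_completion B \<beta> E q \<longleftrightarrow> hilbert_module B E \<and>
     q \<in> X_space B \<rightarrow> carrier E \<and>
     (\<forall>f\<in>X_space B. \<forall>g\<in>X_space B. q (\<lambda>t. f t \<oplus>\<^bsub>B\<^esub> g t) = q f \<oplus>\<^bsub>E\<^esub> q g) \<and>
     (\<forall>z. \<forall>f\<in>X_space B. q (\<lambda>t. z \<odot>\<^bsub>B\<^esub> f t) = z \<odot>\<^bsub>E\<^esub> q f) \<and>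
     (\<forall>f\<in>X_space B. \<forall>b\<in>carrier B. q (\<lambda>t. f t \<otimes>\<^bsub>B\<^esub> b) = ract E (q f) b) \<and>
     (\<forall>f\<in>X_space B. \<forall>g\<in>X_space B. inn E (q f) (q g) = X_form B \<beta> f g) \<and>
     (\<forall>x\<in>carrier E. \<forall>e>0. \<exists>f\<in>X_space B. hnorm B E (x \<ominus>\<^bsub>E\<^esub> q f) < e)"

definition left_action ::
  "'b cstar \<Rightarrow> (alt_sg \<Rightarrow> 'b) \<Rightarrow> ('b, 'e) hmod \<Rightarrow> ((alt_sg \<Rightarrow> 'b) \<Rightarrow> 'e) \<Rightarrow> ('b \<Rightarrow> 'e \<Rightarrow> 'e) \<Rightarrow> bool"
where
  "left_action B \<iota> E q \<phi> \<longleftrightarrow> \<phi> \<in> star_hom B (adjointable_ops B E) \<and>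
     (\<forall>s\<in>D1. \<forall>t\<in>D1. \<forall>c\<in>carrier B.
        \<phi> (\<iota> s) (q (elem_tensor B t c)) = q (elem_tensor B (s * t) c))"

definition J_ideal :: "'b cstar \<Rightarrow> ('b, 'e) hmod \<Rightarrow> ('b \<Rightarrow> 'e \<Rightarrow> 'e) \<Rightarrow> 'b set" where
  "J_ideal B E \<phi> = {b \<in> carrier B. \<phi> b \<in> compact_ops B E} \<inter>
     annihilator B (a_kernel B (adjointable_ops B E) \<phi>)"

end

theory Submission
  imports Defs
begin

text \<open>
  Write \<open>u = (1)\<close> and \<open>u\<^sup>* = (-1)\<close>. These two letters generate \<open>A\<close>, and the congruence says that
  \<open>u u\<^sup>* u = u\<close> and \<open>u\<^sup>* u u\<^sup>* = u\<^sup>*\<close>: so \<open>A\<close> is the free star-semigroup on a partial isometry. Put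
  \<open>p = u u\<^sup>* = (1,-1)\<close> and \<open>r = u\<^sup>* u = (-1,1)\<close>; then \<open>\<alpha>(n) = u\<^sup>* n u\<close>. As \<open>J_ideal\<close> is a closed ideal,
  only \<open>\<iota>(p) \<in> J_ideal\<close> has to be shown, and this consists of two parts.

  Compactness. Since \<open>\<alpha>(s p t) = \<alpha>(s) \<alpha>(t)\<close>, the vectors \<open>p \<otimes> \<iota>(\<alpha> t) c\<close> and \<open>p t \<otimes> c\<close> of the
  correspondence are equal. Hence \<open>\<phi>(\<iota> p)\<close> is the rank one operator \<open>\<theta>\<close> of the vector
  \<open>\<eta> = p \<otimes> \<iota>(r)\<close> with itself (\<open>phi_pp_theta\<close>).

  Annihilation of \<open>ker \<phi>\<close>. The map \<open>b \<mapsto> \<langle>\<eta>, \<phi>(b) \<eta>\<rangle>\<close> is linear and continuous and sends \<open>\<iota>(n)\<close> to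
  \<open>\<iota>(\<alpha> n)\<close>. If \<open>\<iota>(p n p)\<close> can be recovered from \<open>\<iota>(\<alpha> n)\<close> by an endomorphism \<open>h\<close> of \<open>B\<close>, then
  \<open>\<iota>(p) b \<iota>(p) = h \<langle>\<eta>, \<phi>(b) \<eta>\<rangle>\<close> for every \<open>b\<close> in the closed span of \<open>\<iota>(D1)\<close>, which is \<open>B\<close>
  (\<open>universal_dense\<close>). For \<open>b\<close> in the kernel, applying this to \<open>b b\<^sup>*\<close> gives \<open>\<iota>(p) b = 0\<close>. As
  \<open>u \<alpha>(n) u\<^sup>* = p n p\<close>, the endomorphism should extend \<open>\<iota>(m) \<mapsto> \<iota>(u m u\<^sup>*)\<close>. View an element of \<open>A\<close> as
  a lattice path. The elements of \<open>D1\<close> are exactly the loops of height at most 1 (\<open>D1_iff\<close>),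
  and \<open>u m u\<^sup>*\<close> is again in \<open>D1\<close> if the loop \<open>m\<close> stays below its starting point. On the other elements
  of \<open>D1\<close> the value 0 is prescribed. The result is a complete order representation of \<open>D1\<close>
  in \<open>B\<close> (\<open>raise_rep\<close>), because heights do not grow along the order, and the
  universal property of \<open>B\<close> yields \<open>h\<close>.

  The analytic part develops the required theory of C*-algebras from the norm axioms. Square roots
  come from the iteration \<open>d \<mapsto> (k + d\<^sup>2) / 2\<close>. They lead to the theorem of Kelley and Vaught that
  \<open>z\<^sup>* z\<close> is positive (\<open>pos_cadj_mult\<close>), first in unital algebras and then, through the algebra of
  adjointable operators, in all of them. This gives the Cauchy-Schwarz inequality for Hilbert
  modules, the fact that star-homomorphisms are contractive, and the fact that a positive matrix
  with entries in a C*-subalgebra is of the form \<open>Y\<^sup>* Y\<close> over that subalgebra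
  (\<open>mat_pos_sub\<close>). The last fact makes \<open>\<iota>\<close> a complete order representation in the closed span of
  \<open>\<iota>(D1)\<close>, whence density by the uniqueness of factorizations.
\<close>

section \<open>Letter words and their normal forms\<close>

text \<open>A word in the two letters \<open>u\<close> (\<open>True\<close>) and \<open>u\<^sup>*\<close> (\<open>False\<close>) is in normal form if no three consecutive
  letters alternate. Putting one letter in front of a normal form creates at most one
  alternating triple, at the very beginning, and removing two of its letters restores normality.\<close>

fun cons_nf :: "bool \<Rightarrow> bool list \<Rightarrow> bool list" where
  "cons_nf x (y # z # w) = (if y \<noteq> x \<and> z = x then z # w else x # y # z # w)"
| "cons_nf x w = x # w"

definition nf :: "bool list \<Rightarrow> bool list" where
  "nf w = foldr cons_nf w []"

fun no_alt :: "bool list \<Rightarrow> bool" where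
  "no_alt (x # y # z # w) \<longleftrightarrow> \<not> (x \<noteq> y \<and> y \<noteq> z) \<and> no_alt (y # z # w)"
| "no_alt w \<longleftrightarrow> True"

lemma nf_simps [simp]: "nf [] = []" "nf (x # w) = cons_nf x (nf w)"
  by (simp_all add: nf_def)

lemma no_alt_tl: "no_alt (x # w) \<Longrightarrow> no_alt w"
  by (cases w; cases "tl w") auto

lemma no_alt_cons_nf: "no_alt w \<Longrightarrow> no_alt (cons_nf x w)"
  by (induction x w rule: cons_nf.induct) (auto dest: no_alt_tl)

lemma no_alt_foldr: "no_alt s \<Longrightarrow> no_alt (foldr cons_nf w s)"
  by (induction w) (auto simp: no_alt_cons_nf)

lemma no_alt_nf: "no_alt (nf w)"
  by (induction w) (auto simp: no_alt_cons_nf)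

lemma cons_nf_no_alt: "no_alt (x # w) \<Longrightarrow> cons_nf x w = x # w"
  by (induction x w rule: cons_nf.induct) auto

lemma nf_no_alt: "no_alt w \<Longrightarrow> nf w = w"
proof (induction w)
  case (Cons x w)
  then show ?case using no_alt_tl[OF Cons.prems] by (simp add: cons_nf_no_alt)
qed simp

text \<open>The two relations of \<open>A\<close> hold for the action of the letters on normal forms; hence normal forms
  are an invariant of the elements of \<open>A\<close>.\<close>

lemma cons_nf_alt: "no_alt s \<Longrightarrow> y \<noteq> x \<Longrightarrow> cons_nf x (cons_nf y (cons_nf x s)) = cons_nf x s"
proof (cases s)
  case (Cons a t)
  assume *: "no_alt s" "y \<noteq> x"
  show ?thesis
  proof (cases t)
    case Nil then show ?thesis using Cons * by auto
  next
    case t: (Cons b r)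
    show ?thesis using * unfolding Cons t by (cases r) auto
  qed
qed auto

lemma foldr_cons_nf: "no_alt s \<Longrightarrow> foldr cons_nf (cons_nf x w) s = cons_nf x (foldr cons_nf w s)"
  by (induction x w rule: cons_nf.induct) (auto simp: cons_nf_alt no_alt_foldr)

lemma nf_append: "nf (v @ w) = foldr cons_nf v (nf w)"
  by (induction v) auto

lemma nf_nf_append: "nf (nf v @ w) = nf (v @ w)"
  by (induction v) (auto simp: nf_append foldr_cons_nf no_alt_nf)

lemma nf_append_nf: "nf (v @ nf w) = nf (v @ w)"
  by (simp add: nf_append nf_no_alt no_alt_nf)

lemma cons_nf_neq_Nil [simp]: "cons_nf x w \<noteq> []"
  by (induction x w rule: cons_nf.induct) auto

lemma hd_cons_nf [simp]: "hd (cons_nf x w) = x"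
  by (induction x w rule: cons_nf.induct) auto

lemma last_cons_nf: "w \<noteq> [] \<Longrightarrow> last (cons_nf x w) = last w"
  by (induction x w rule: cons_nf.induct) auto

lemma nf_eq_Nil [simp]: "nf w = [] \<longleftrightarrow> w = []"
  by (cases w) auto

lemma hd_nf: "hd (nf w) = hd w"
  by (cases w) auto

lemma last_nf: "last (nf w) = last w"
  by (induction w) (auto simp: last_cons_nf)

lemma no_alt_appendD: "no_alt (v @ w) \<Longrightarrow> no_alt v \<and> no_alt w"
proof (induction v rule: no_alt.induct)
  case (1 x y z v)
  then show ?case by simp
qed (auto dest: no_alt_tl)

section \<open>Heights\<close>

definition slope :: "bool \<Rightarrow> int" where
  "slope x = (if x then 1 else - 1)"

lemma slope_simps [simp]: "slope True = 1" "slope False = - 1"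
  by (simp_all add: slope_def)

fun height :: "bool list \<Rightarrow> int" where
  "height [] = 0"
| "height (x # w) = max 0 (slope x + height w)"

abbreviation "wsum w \<equiv> sum_list (map slope w)"

lemma height_nonneg [simp]: "0 \<le> height w"
  by (cases w) auto

text \<open>A word is a lattice path that starts at 0; \<open>wsum\<close> is its end point and \<open>height\<close> its maximum. Both
  survive the reduction to normal form, since \<open>x y x\<close> and \<open>x\<close> have the same end point and maximum.\<close>

lemma wsum_cons_nf: "wsum (cons_nf x w) = slope x + wsum w"
  by (induction x w rule: cons_nf.induct) (auto simp: slope_def)

lemma height_cons_nf: "height (cons_nf x w) = max 0 (slope x + height w)"
proof (induction x w rule: cons_nf.induct)
  case (1 x y z w)
  have "height w \<ge> 0" by simp
  then show ?case by (cases x; cases y; cases z) (simp_all add: max_def)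
qed auto

lemma wsum_nf: "wsum (nf w) = wsum w"
  by (induction w) (auto simp: wsum_cons_nf)

lemma height_nf: "height (nf w) = height w"
  by (induction w) (auto simp: height_cons_nf)

lemma height_append: "height (v @ w) = max (height v) (wsum v + height w)"
  by (induction v) (auto simp: )

lemma wsum_le_height: "wsum w \<le> height w"
  by (induction w) auto

lemma wsum_rev_Not: "wsum (rev (map Not w)) = - wsum w"
proof (induction w)
  case (Cons x w)
  then show ?case by (cases x) simp_all
qed simp

text \<open>The reversed path has the same values, seen from the end point.\<close>

lemma height_rev_Not: "height (rev (map Not w)) = height w - wsum w"
proof (induction w)
  case (Cons x w)
  have 1: "wsum w \<le> height w" by (rule wsum_le_height)
  have "height (rev (map Not (x # w))) = height (rev (map Not w) @ [\<not> x])" by simp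
  also have "\<dots> = max (height w - wsum w) (- wsum w + height [\<not> x])"
    by (simp only: height_append Cons.IH wsum_rev_Not)
  also have "height [\<not> x] = max 0 (- slope x)" by (cases x) simp_all
  finally have "height (rev (map Not (x # w))) = max (height w - wsum w) (- wsum w + max 0 (- slope x))" .
  moreover have "wsum (x # w) = slope x + wsum w" "height (x # w) = max 0 (slope x + height w)" by simp_all
  ultimately show ?case using 1 height_nonneg[of w]
    by (cases x) (auto simp: max_def simp del: height_nonneg)
qed auto

section \<open>From integer sequences to letter words\<close>

definition expand :: "int list \<Rightarrow> bool list" where
  "expand ns = concat (map (\<lambda>n. replicate (nat \<bar>n\<bar>) (n > 0)) ns)"

lemma expand_simps [simp]:
  "expand [] = []" "expand (n # ns) = replicate (nat \<bar>n\<bar>) (n > 0) @ expand ns"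
  "expand (ms @ ns) = expand ms @ expand ns"
  by (simp_all add: expand_def)

lemma expand_join:
  assumes "alternating xs" "alternating ys"
  shows "expand (join xs ys) = expand xs @ expand ys"
proof -
  obtain us x where xs: "xs = us @ [x]" using assms(1) by (cases xs rule: rev_cases) auto
  obtain y vs where ys: "ys = y # vs" using assms(2) by (cases ys) auto
  have "x \<noteq> 0" "y \<noteq> 0" using assms by (auto simp: xs ys alternating_def)
  then have "replicate (nat \<bar>x + y\<bar>) (x + y > 0) = replicate (nat \<bar>x\<bar>) (x > 0) @ replicate (nat \<bar>y\<bar>) (y > 0)"
    if "sgn x = sgn y"
    using that by (auto simp: sgn_if replicate_add[symmetric] nat_add_distrib[symmetric] split: if_splits)
  then show ?thesis by (auto simp: xs ys join_snoc_Cons)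
qed

lemma expand_rev_neg: "0 \<notin> set xs \<Longrightarrow> expand (rev_neg xs) = rev (map Not (expand xs))"
  by (induction xs) (auto simp: rev_neg_def)

lemma wsum_expand: "0 \<notin> set xs \<Longrightarrow> wsum (expand xs) = sum_list xs"
  by (induction xs) (auto simp: slope_def sum_list_replicate map_replicate)

lemma expand_eq_Nil: "0 \<notin> set xs \<Longrightarrow> expand xs = [] \<longleftrightarrow> xs = []"
  by (cases xs) auto

lemma hd_expand: "0 \<notin> set xs \<Longrightarrow> xs \<noteq> [] \<Longrightarrow> hd (expand xs) \<longleftrightarrow> hd xs > 0"
  by (cases xs) (auto simp: hd_append)

lemma last_expand: "0 \<notin> set xs \<Longrightarrow> xs \<noteq> [] \<Longrightarrow> last (expand xs) \<longleftrightarrow> last xs > 0"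
  by (cases xs rule: rev_cases) (auto simp: last_append)

lemma alternatingD: "alternating xs \<Longrightarrow> 0 \<notin> set xs \<and> xs \<noteq> []"
  by (auto simp: alternating_def)

lemma alternating_infix: "alternating (us @ ms @ vs) \<Longrightarrow> ms \<noteq> [] \<Longrightarrow> alternating ms"
  by (auto simp: alternating_def successively_append_iff)

text \<open>With \<open>a\<close> and \<open>c\<close> of one sign and \<open>b = \<plusminus>1\<close> of the other, the expansion of \<open>a, b, c\<close> contains exactly
  one removable triple, at the position of \<open>b\<close>.\<close>

lemma nf_contract:
  assumes "alternating (us @ [a, b, c] @ vs)" "b = 1 \<or> b = - 1"
  shows "nf (expand (us @ [a, b, c] @ vs)) = nf (expand (us @ [a + b + c] @ vs))"
proof -
  have alt: "alternating [a, b, c]"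
    using assms(1) by (rule alternating_infix) simp
  define x where "x \<longleftrightarrow> a > 0"
  have sg: "(a > 0 \<and> b = - 1 \<and> c > 0) \<or> (a < 0 \<and> b = 1 \<and> c < 0)"
    using alt assms(2) by (auto simp: alternating_Cons sgn_if split: if_splits)
  define m n where "m = nat (\<bar>a\<bar> - 1)" and "n = nat (\<bar>c\<bar> - 1)"
  have s: "nat \<bar>a\<bar> = Suc m" "nat \<bar>c\<bar> = Suc n" "b > 0 \<longleftrightarrow> \<not> x" "a > 0 \<longleftrightarrow> x"
    "c > 0 \<longleftrightarrow> x" "nat \<bar>b\<bar> = Suc 0" "nat \<bar>a + b + c\<bar> = m + Suc n" "a + b + c > 0 \<longleftrightarrow> x"
    using sg by (auto simp: x_def m_def n_def)
  have 1: "expand [a, b, c] = replicate m x @ [x, \<not> x, x] @ replicate n x"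
    unfolding expand_simps s by (simp add: replicate_app_Cons_same)
  have 2: "expand [a + b + c] = replicate m x @ [x] @ replicate n x"
    unfolding expand_simps s replicate_add by simp
  have "nf ([x, \<not> x, x] @ w) = nf ([x] @ w)" for w
    by (simp add: cons_nf_alt no_alt_nf)
  then have 3: "nf (v @ [x, \<not> x, x] @ w) = nf (v @ [x] @ w)" for v w
    by (metis nf_append)
  show ?thesis
    unfolding expand_simps(3) 1 2 using 3 by (metis append.assoc)
qed

lift_definition seq_nf :: "alt_seq \<Rightarrow> bool list" is "\<lambda>ns. nf (expand ns)" .

lemma seq_nf_mult: "seq_nf (seq_mult x y) = nf (seq_nf x @ seq_nf y)"
  by transfer (simp add: expand_join nf_nf_append nf_append_nf)

lemma seq_cong_nf: "seq_cong x y \<Longrightarrow> seq_nf x = seq_nf y"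
proof (induction rule: seq_cong.induct)
  case (contract x us a b c vs y)
  have "alternating (Rep_alt_seq x)" using Rep_alt_seq by auto
  then show ?case using contract nf_contract[of us a b c vs] by (simp add: seq_nf.rep_eq)
qed (auto simp: seq_nf_mult)

text \<open>The normal form of an element of \<open>A\<close>; by \<open>ev_NF\<close> below it determines the element.\<close>

lift_definition NF :: "alt_sg \<Rightarrow> bool list" is seq_nf
  by (rule seq_cong_nf)

lemma NF_mult: "NF (a * b) = nf (NF a @ NF b)"
  by transfer (rule seq_nf_mult)

lemma no_alt_NF: "no_alt (NF a)"
  by transfer (transfer, rule no_alt_nf)

lemma NF_nonempty [simp]: "NF a \<noteq> []"
  by transfer (transfer, use alternatingD expand_eq_Nil in auto)

lemma tau_NF: "tau a = wsum (NF a)"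
  by transfer (transfer, use alternatingD wsum_nf wsum_expand in auto)

text \<open>Unlike the entries of a representing sequence, the maximum of the path depends only on the class
  in \<open>A\<close>.\<close>

definition peak :: "alt_sg \<Rightarrow> int" where
  "peak a = height (NF a)"

lemma peak_mult: "peak (a * b) = max (peak a) (tau a + peak b)"
  by (simp add: peak_def NF_mult height_nf height_append tau_NF)

lemma tau_star: "tau (sg_star a) = - tau a"
proof transfer
  fix x show "seq_tau (seq_star x) = - seq_tau x"
  proof transfer
    fix xs :: "int list"
    show "sum_list (rev_neg xs) = - sum_list xs" by (induction xs) (auto simp: rev_neg_def)
  qed
qed

lemma peak_star: "peak (sg_star a) = peak a - tau a"
  unfolding tau_NF peak_def
  by transfer (transfer, use alternatingD expand_rev_neg height_rev_Not in \<open>auto simp: height_nf wsum_nf\<close>)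

lemma peak_nonneg: "0 \<le> peak a" by (simp add: peak_def)

lemma tau_le_peak: "tau a \<le> peak a" by (simp add: peak_def tau_NF wsum_le_height)

section \<open>Evaluation of letter words\<close>

fun ev :: "bool list \<Rightarrow> alt_sg" where
  "ev [] = undefined"
| "ev [x] = (if x then word [1] else word [- 1])"
| "ev (x # y # w) = (if x then word [1] else word [- 1]) * ev (y # w)"

lemma ev_Cons: "w \<noteq> [] \<Longrightarrow> ev (x # w) = (if x then word [1] else word [- 1]) * ev w"
  by (cases w) auto

lemma ev_append: "v \<noteq> [] \<Longrightarrow> w \<noteq> [] \<Longrightarrow> ev (v @ w) = ev v * ev w"
proof (induction v)
  case (Cons x v)
  then show ?case
    by (cases "v = []") (auto simp: ev_Cons mult.assoc)
qed simp

lemma word_join: "alternating xs \<Longrightarrow> alternating ys \<Longrightarrow> word (join xs ys) = word xs * word ys"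
  unfolding word_def
  by (simp add: times_alt_sg.abs_eq seq_mult.abs_eq eq_onp_same_args)

lemma word_rep: "a = word (Rep_alt_seq (rep_alt_sg a))"
  by (simp add: word_def Rep_alt_seq_inverse Quotient3_abs_rep[OF Quotient3_alt_sg])

lemma alternating_Rep: "alternating (Rep_alt_seq x)"
  using Rep_alt_seq by auto

lemma alternating_single: "alternating [n] \<longleftrightarrow> n \<noteq> 0"
  by (simp add: alternating_Cons)

lemma word_contract:
  assumes "alternating (us @ [a, b, c] @ vs)" "b = 1 \<or> b = - 1"
  shows "alternating (us @ [a + b + c] @ vs)" "word (us @ [a, b, c] @ vs) = word (us @ [a + b + c] @ vs)"
proof -
  have "alternating [a, b, c]"
    using assms(1) by (rule alternating_infix) simp
  then have "(a > 0 \<and> b = - 1 \<and> c > 0) \<or> (a < 0 \<and> b = 1 \<and> c < 0)"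
    using assms(2) by (auto simp: alternating_Cons sgn_if split: if_splits)
  then have "sgn (a + b + c) = sgn a" "sgn (a + b + c) = sgn c" "a + b + c \<noteq> 0"
    by auto
  then show *: "alternating (us @ [a + b + c] @ vs)"
    using assms(1) by (auto simp: alternating_append' alternating_Cons split: if_splits)
  have "seq_cong (Abs_alt_seq (us @ [a, b, c] @ vs)) (Abs_alt_seq (us @ [a + b + c] @ vs))"
    by (rule seq_cong.contract[OF _ assms(2)])
      (use assms(1) * in \<open>simp_all add: Abs_alt_seq_inverse\<close>)
  then show "word (us @ [a, b, c] @ vs) = word (us @ [a + b + c] @ vs)"
    by (simp add: word_def alt_sg.abs_eq_iff)
qed

abbreviation "up \<equiv> word [1]"
abbreviation "down \<equiv> word [- 1]"

lemma up_down: "up * down = word [1, - 1]" "down * up = word [- 1, 1]"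
  using word_join[of "[1]" "[-1]"] word_join[of "[-1]" "[1]"]
  by (simp_all add: alternating_single join_def)

lemma up_down_up: "up * (down * up) = up" "down * (up * down) = down"
proof -
  have a: "alternating [- 1, 1]" "alternating [1, - 1]" "alternating [1, -1, 1]" "alternating [-1, 1, -1]"
    by (auto simp: alternating_Cons)
  have "up * (down * up) = word [1, -1, 1]" 
    unfolding up_down using word_join[of "[1]" "[-1,1]"] a by (simp add: alternating_single join_def)
  also have "\<dots> = up" using word_contract(2)[of "[]" 1 "-1" 1 "[]"] a by simp
  finally show "up * (down * up) = up" .
  have "down * (up * down) = word [-1, 1, -1]" 
    unfolding up_down using word_join[of "[-1]" "[1,-1]"] a by (simp add: alternating_single join_def)
  also have "\<dots> = down" using word_contract(2)[of "[]" "-1" "1" "-1" "[]"] a by simp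
  finally show "down * (up * down) = down" .
qed

lemma sg_star_word: "alternating xs \<Longrightarrow> sg_star (word xs) = word (rev_neg xs)"
  unfolding word_def by (simp add: sg_star.abs_eq seq_star.abs_eq eq_onp_same_args)

lemma star_letters: "sg_star up = down" "sg_star down = up"
  by (simp_all add: sg_star_word alternating_single rev_neg_def)

lemma word_single:
  "n > 0 \<Longrightarrow> word [int n] = ev (replicate n True)" "n > 0 \<Longrightarrow> word [- int n] = ev (replicate n False)"
proof (induction n)
  case (Suc n)
  { case 1
    show ?case
    proof (cases "n = 0")
      case False
      then have "word [int (Suc n)] = word [1] * word [int n]"
        using word_join[of "[1]" "[int n]"] by (simp add: alternating_single join_def)
      then show ?thesis using Suc(1) False by (simp add: ev_Cons)
    qed simp
  next
    case 2
    show ?case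
    proof (cases "n = 0")
      case False
      then have "word [- int (Suc n)] = word [- 1] * word [- int n]"
        using word_join[of "[- 1]" "[- int n]"] by (simp add: alternating_single join_def)
      then show ?thesis using Suc(2) False by (simp add: ev_Cons)
    qed simp }
qed auto

lemma word_single': "n \<noteq> 0 \<Longrightarrow> word [n] = ev (replicate (nat \<bar>n\<bar>) (n > 0))"
  using word_single[of "nat \<bar>n\<bar>"] by (cases "n > 0") auto

lemma word_ev: "alternating xs \<Longrightarrow> word xs = ev (expand xs)"
proof (induction xs)
  case (Cons x xs)
  show ?case
  proof (cases "xs = []")
    case True
    then show ?thesis using Cons.prems by (simp add: alternating_single word_single')
  next
    case False
    then have a: "alternating xs" "x \<noteq> 0" "sgn x \<noteq> sgn (hd xs)" using Cons.prems by (auto simp: alternating_Cons)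
    then have "word (x # xs) = word [x] * word xs"
      using word_join[of "[x]" xs] by (simp add: alternating_single join_def)
    also have "\<dots> = ev (expand [x] @ expand xs)"
      using a Cons.IH alternatingD[OF a(1)] by (simp add: word_single' ev_append expand_eq_Nil)
    finally show ?thesis by simp
  qed
qed simp

lemma ev_cons_nf: "ev (cons_nf x w) = ev (x # w)"
proof (induction x w rule: cons_nf.induct)
  case (1 x y z w)
  have "ev (x # y # x # w) = ev (x # w)" if "y \<noteq> x"
  proof (cases "w = []")
    case True then show ?thesis using that up_down_up by auto
  next
    case False
    then have "ev (x # y # x # w) = ev [x, y, x] * ev w" using ev_append[of "[x, y, x]" w] by simp
    also have "ev [x, y, x] = ev [x]" using that up_down_up by auto
    finally show ?thesis using False by (simp add: ev_Cons)
  qed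
  then show ?case by auto
qed auto

lemma ev_nf: "ev (nf w) = ev w"
proof (induction w)
  case (Cons x w)
  then show ?case by (cases "w = []") (auto simp: ev_cons_nf ev_Cons)
qed simp

text \<open>Every element of \<open>A\<close> is the product of the letters of its normal form.\<close>

lemma ev_NF: "ev (NF a) = a"
proof -
  let ?xs = "Rep_alt_seq (rep_alt_sg a)"
  have "NF a = nf (expand ?xs)"
    by (subst word_rep) (simp add: word_def NF.abs_eq seq_nf.rep_eq Rep_alt_seq_inverse)
  then show ?thesis using word_ev[OF alternating_Rep] word_rep[of a] by (simp add: ev_nf)
qed

lemma NF_word: "alternating xs \<Longrightarrow> NF (word xs) = nf (expand xs)"
  by (simp add: word_def NF.abs_eq seq_nf.rep_eq Abs_alt_seq_inverse)

lemma NF_ev: "w \<noteq> [] \<Longrightarrow> NF (ev w) = nf w"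
proof (induction w rule: ev.induct)
  case (3 x y w)
  have "NF (word [if x then 1 else - 1]) = [x]"
    by (cases x) (auto simp: NF_word alternating_single)
  then have "NF (ev (x # y # w)) = nf ([x] @ nf (y # w))" using 3 by (auto simp: NF_mult split: if_splits)
  then show ?case using nf_append_nf[of "[x]" "y # w"] by simp
qed (auto simp: NF_word alternating_single)

lemma tau_ev: "w \<noteq> [] \<Longrightarrow> tau (ev w) = wsum w" by (simp add: tau_NF NF_ev wsum_nf)
lemma peak_ev: "w \<noteq> [] \<Longrightarrow> peak (ev w) = height w" by (simp add: peak_def NF_ev height_nf)

section \<open>The semigroup D1 in terms of heights\<close>

lemma hd_NF_A_plus: "a \<in> A_plus \<Longrightarrow> \<not> hd (NF a)"
  using alternatingD by (fastforce simp: A_plus_def reduced_def NF_word hd_nf hd_expand)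

text \<open>A representing sequence of minimal length admits no contraction.\<close>

lemma ex_reduced: "\<exists>ns. reduced ns \<and> word ns = a"
proof -
  define P where "P ns \<longleftrightarrow> alternating ns \<and> word ns = a" for ns
  have "P (Rep_alt_seq (rep_alt_sg a))" using word_rep alternating_Rep by (simp add: P_def)
  then obtain ns where ns: "P ns" "\<And>ms. P ms \<Longrightarrow> length ns \<le> length ms"
    using ex_has_least_nat[of P _ length] by blast
  have "\<bar>ns ! j\<bar> \<noteq> 1" if j: "1 \<le> j" "j < length ns - 1" for j
  proof
    assume 1: "\<bar>ns ! j\<bar> = 1"
    define us where "us = take (j - 1) ns"
    define vs where "vs = drop (j + 2) ns"
    have *: "ns = us @ [ns ! (j - 1), ns ! j, ns ! (j + 1)] @ vs"
    proof -
      have "drop (j - 1) ns = ns ! (j - 1) # ns ! j # ns ! (j + 1) # vs"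
        using j by (simp add: Cons_nth_drop_Suc[symmetric] vs_def)
      then show ?thesis using append_take_drop_id[of "j - 1" ns] by (simp add: us_def)
    qed
    have "alternating (us @ [ns ! (j - 1), ns ! j, ns ! (j + 1)] @ vs)"
      using ns(1) * by (simp add: P_def)
    from word_contract[OF this] have "P (us @ [ns ! (j - 1) + ns ! j + ns ! (j + 1)] @ vs)"
      using 1 * ns(1) unfolding P_def by (auto simp: abs_if split: if_splits)
    from ns(2)[OF this] show False by (subst (asm) *) simp
  qed
  then show ?thesis using ns(1) by (auto simp: P_def reduced_def)
qed

lemma A_plusI:
  assumes "\<not> hd (NF a)" "last (NF a)"
  shows "a \<in> A_plus"
proof -
  obtain ns where ns: "reduced ns" "word ns = a" using ex_reduced by blast
  then have a: "alternating ns" by (simp add: reduced_def)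
  note nz = alternatingD[OF a]
  have h: "\<not> hd ns > 0" "last ns > 0"
    using assms nz by (auto simp: ns(2)[symmetric] NF_word[OF a] hd_nf last_nf hd_expand last_expand)
  moreover have "hd ns \<noteq> 0" using nz hd_in_set by force
  ultimately have "hd ns < 0" by linarith
  moreover have "length ns \<ge> 2" using h nz by (cases ns; cases "tl ns") auto
  ultimately show ?thesis using ns h(2) by (auto simp: A_plus_def)
qed

text \<open>Cut the path where it reaches height 1 for the first time.\<close>

lemma height_first_passage:
  assumes "height w \<ge> 1"
  shows "\<exists>x y. w = x @ True # y \<and> wsum x = 0 \<and> height x = 0"
  using assms
proof (induction w rule: rev_induct)
  case (snoc z w)
  show ?case
  proof (cases "height w \<ge> 1")
    case True
    then show ?thesis using snoc.IH by (metis append.assoc append_Cons)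
  next
    case False
    then have h: "height w = 0" using height_nonneg[of w] by linarith
    moreover have "wsum w \<le> 0" using wsum_le_height[of w] h by simp
    moreover have "max (height w) (wsum w + height [z]) \<ge> 1" using snoc.prems by (simp only: height_append)
    ultimately have "z" "wsum w = 0" by (cases z; simp)+
    then show ?thesis using h by blast
  qed
qed simp

text \<open>If the loop of an irreducible element went above 0, cutting it at the first passage to height 1
  would be a factorization in \<open>A0\<close>. The left factor has smaller peak than the product, and the right
  one starts with the other letter, so neither is the product itself.\<close>

lemma Irr_plus_A0_peak:
  assumes "a \<in> Irr_plus_A0"
  shows "tau a = 0" "peak a = 0"
proof -
  have a: "a \<in> Irr A0" "a \<in> A_plus" using assms by (auto simp: Irr_plus_A0_def)
  then show t: "tau a = 0" by (auto simp: Irr_def A0_def)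
  show "peak a = 0"
  proof (rule ccontr)
    assume "peak a \<noteq> 0"
    then have "height (NF a) \<ge> 1" using height_nonneg[of "NF a"] unfolding peak_def by linarith
    then obtain x y where xy: "NF a = x @ True # y" "wsum x = 0" "height x = 0"
      using height_first_passage by blast
    have x: "x \<noteq> []" using hd_NF_A_plus[OF a(2)] xy by auto
    have m: "ev x \<in> A0" using x xy by (simp add: A0_def tau_ev)
    have n: "ev (True # y) \<in> A0"
    proof -
      have "wsum (True # y) = 0" using xy t by (simp add: tau_NF)
      then show ?thesis using tau_ev[of "True # y"] by (simp only: A0_def mem_Collect_eq) simp
    qed
    have "a = ev x * ev (True # y)" using ev_NF[of a] xy x by (simp add: ev_append)
    then consider "a = ev x" | "a = ev (True # y)" using a(1) m n unfolding Irr_def by blast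
    then show False
    proof cases
      case 1 then show False using \<open>peak a \<noteq> 0\<close> x xy by (simp add: peak_ev)
    next
      case 2
      then have "hd (NF a)" by (simp add: NF_ev hd_nf)
      then show False using hd_NF_A_plus[OF a(2)] by simp
    qed
  qed
qed

lemma D1_height: "a \<in> D1 \<Longrightarrow> tau a = 0 \<and> peak a \<le> 1"
proof (induction rule: D1.induct)
  case D1_gen
  have "alternating [1, - 1]" by (simp add: alternating_Cons)
  then have "NF (word [1, - 1]) = [True, False]" by (simp add: NF_word)
  then show ?case by (simp add: tau_NF peak_def)
qed (auto simp: Irr_plus_A0_peak tau_mult peak_mult tau_star peak_star)

lemma NF_letters: "NF (word [1, - 1]) = [True, False]" "NF (word [- 1, 1]) = [False, True]"
  "NF (word [1]) = [True]" "NF (word [- 1]) = [False]"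
  by (simp_all add: NF_word alternating_Cons)

lemma NF_inject: "NF a = NF b \<Longrightarrow> a = b"
  by (metis ev_NF)

lemma down_absorb_left: "\<not> hd (NF a) \<Longrightarrow> word [- 1, 1] * a = a"
proof -
  assume "\<not> hd (NF a)"
  then obtain w where w: "NF a = False # w" by (cases "NF a") auto
  have "NF (word [- 1, 1] * a) = nf ([False, True, False] @ w)"
    by (simp only: NF_mult NF_letters w) simp
  also have "\<dots> = nf (False # w)" by (simp add: cons_nf_alt no_alt_nf)
  also have "\<dots> = NF a" using w no_alt_NF[of a] by (simp only: nf_no_alt)
  finally show ?thesis by (rule NF_inject)
qed

lemma up_absorb_right: "last (NF a) \<Longrightarrow> a * word [- 1, 1] = a"
proof -
  assume "last (NF a)"
  then obtain w where w: "NF a = w @ [True]" by (cases "NF a" rule: rev_cases) auto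
  have "NF (a * word [- 1, 1]) = nf (w @ nf [True, False, True])"
    by (simp only: NF_mult NF_letters w nf_append_nf) simp
  also have "\<dots> = nf (w @ [True])" by simp
  also have "\<dots> = NF a" using w no_alt_NF[of a] by (metis nf_no_alt)
  finally show ?thesis by (rule NF_inject)
qed

lemma hd_last_NF_peak0:
  assumes "tau a = 0" "peak a = 0"
  shows "\<not> hd (NF a)" "last (NF a)"
proof -
  show "\<not> hd (NF a)"
  proof
    assume "hd (NF a)"
    then obtain w where "NF a = True # w" by (cases "NF a") auto
    then show False using assms(2) height_nonneg[of w] by (simp add: peak_def)
  qed
  show "last (NF a)"
  proof (rule ccontr)
    assume "\<not> last (NF a)"
    then obtain w where w: "NF a = w @ [False]" by (cases "NF a" rule: rev_cases) auto
    then have "wsum w = 1" "height w = 0" using assms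
      by (auto simp: peak_def tau_NF height_append) (metis peak_def height_nonneg max.orderE max.cobounded1 order_antisym w)?
    then show False using wsum_le_height[of w] by simp
  qed
qed

text \<open>A reduced loop below 0, other than \<open>u\<^sup>* u\<close> itself, has to go down by two steps at its start: after
  \<open>u\<^sup>* u\<close>, the letter \<open>u\<close> would lead above 0, and \<open>u\<^sup>*\<close> would complete an alternating triple.\<close>

lemma no_alt_start:
  assumes "no_alt w" "wsum w = 0" "height w = 0" "w \<noteq> []" "w \<noteq> [False, True]"
  shows "\<exists>v. w = False # False # v"
proof -
  obtain x v where 1: "w = x # v" using assms by (cases w) auto
  have "\<not> x"
  proof
    assume "x"
    then show False using assms(3) height_nonneg[of v] unfolding 1 by (simp del: height_nonneg)
  qed
  moreover obtain y v' where 2: "v = y # v'" using assms 1 by (cases v) (auto simp: slope_def split: if_splits)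
  moreover have "\<not> y"
  proof
    assume y: "y"
    obtain z v'' where 3: "v' = z # v''" using assms 1 2 y \<open>\<not> x\<close> by (cases v') auto
    have "z" using assms(1) 1 2 3 y \<open>\<not> x\<close> by auto
    then show False using assms(3) 1 2 3 y \<open>\<not> x\<close> height_nonneg[of v''] by auto
  qed
  ultimately show ?thesis using 1 by auto
qed

lemma no_alt_end:
  assumes "no_alt w" "wsum w = 0" "height w = 0" "w \<noteq> []" "w \<noteq> [False, True]"
  shows "\<exists>v. w = v @ [True, True]"
proof -
  have pre: "wsum u \<le> 0" if "w = u @ v" for u v
    using that assms(3) wsum_le_height[of u] by (simp add: height_append)
  obtain x v where 1: "w = v @ [x]" using assms by (cases w rule: rev_cases) auto
  have "x" using pre[of v "[x]"] assms(2) 1 by (cases x) auto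
  moreover obtain y v' where 2: "v = v' @ [y]"
    using assms 1 by (cases v rule: rev_cases) (auto simp: slope_def split: if_splits)
  moreover have "y"
  proof (rule ccontr)
    assume y: "\<not> y"
    obtain z v'' where 3: "v' = v'' @ [z]" using assms 1 2 y \<open>x\<close> by (cases v' rule: rev_cases) auto
    have "no_alt [z, y, x]" using no_alt_appendD[of v'' "[z,y,x]"] assms(1) 1 2 3 by simp
    then have "\<not> z" using y \<open>x\<close> by auto
    then show False using pre[of v'' "[z, y, x]"] assms(2) 1 2 3 y \<open>x\<close> by auto
  qed
  ultimately show ?thesis using 1 by auto
qed

lemma no_alt_append_join:
  "no_alt (v @ [True, True]) \<Longrightarrow> no_alt (False # False # w) \<Longrightarrow> no_alt ((v @ [True, True]) @ False # False # w)"
proof (induction v rule: no_alt.induct)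
  case ("2_3" x y)
  then show ?case by auto
qed auto

text \<open>In a factorization \<open>a = m n\<close> in \<open>A0\<close> both loops stay below 0. A factor \<open>u\<^sup>* u\<close> is absorbed by the other
  one. If neither factor is \<open>u\<^sup>* u\<close>, then the normal forms of \<open>m\<close> and \<open>n\<close> can be concatenated without
  reduction, and the path of \<open>a\<close> returns to 0 in between, contrary to the assumption.\<close>

lemma excursion_Irr:
  assumes "tau a = 0" "peak a = 0"
    and exc: "\<And>x y. NF a = x @ y \<Longrightarrow> x \<noteq> [] \<Longrightarrow> y \<noteq> [] \<Longrightarrow> wsum x \<noteq> 0"
  shows "a \<in> Irr_plus_A0"
proof -
  have "m = a \<or> n = a" if mn: "m \<in> A0" "n \<in> A0" "a = m * n" for m n
  proof (rule ccontr)
    assume ne: "\<not> (m = a \<or> n = a)"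
    have t: "tau m = 0" "tau n = 0" using mn by (auto simp: A0_def)
    then have h: "peak m = 0" "peak n = 0"
      using assms(2) peak_nonneg[of m] peak_nonneg[of n] by (auto simp: mn(3) peak_mult)
    have "NF m \<noteq> [False, True]"
    proof
      assume "NF m = [False, True]"
      then have "m = word [- 1, 1]" by (metis NF_inject NF_letters(2))
      then show False using ne mn down_absorb_left hd_last_NF_peak0 t h by metis
    qed
    then obtain v where v: "NF m = v @ [True, True]"
      using no_alt_end[of "NF m"] no_alt_NF t h by (auto simp: peak_def tau_NF)
    have "NF n \<noteq> [False, True]"
    proof
      assume "NF n = [False, True]"
      then have "n = word [- 1, 1]" by (metis NF_inject NF_letters(2))
      then show False using ne mn up_absorb_right hd_last_NF_peak0 t h by metis
    qed
    then obtain w where w: "NF n = False # False # w"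
      using no_alt_start[of "NF n"] no_alt_NF t h by (auto simp: peak_def tau_NF)
    have "no_alt (NF m @ NF n)"
      using no_alt_append_join no_alt_NF v w by metis
    then have "NF a = NF m @ NF n" by (simp add: mn(3) NF_mult nf_no_alt)
    then show False using exc[of "NF m" "NF n"] t by (simp add: tau_NF)
  qed
  then have "a \<in> Irr A0" using assms(1) unfolding Irr_def by (simp add: A0_def) metis
  moreover have "a \<in> A_plus" using hd_last_NF_peak0[OF assms(1,2)] by (intro A_plusI)
  ultimately show ?thesis by (simp add: Irr_plus_A0_def)
qed

text \<open>Cut the loop at its returns to 0. A piece without intermediate return is \<open>u u\<^sup>*\<close> if it starts
  upwards, and irreducible if it starts downwards.\<close>

lemma height_D1: "tau a = 0 \<Longrightarrow> peak a \<le> 1 \<Longrightarrow> a \<in> D1"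
proof (induction "length (NF a)" arbitrary: a rule: less_induct)
  case less
  show ?case
  proof (cases "\<exists>x y. NF a = x @ y \<and> x \<noteq> [] \<and> y \<noteq> [] \<and> wsum x = 0")
    case True
    then obtain x y where xy: "NF a = x @ y" "x \<noteq> []" "y \<noteq> []" "wsum x = 0" by blast
    have na: "no_alt x" "no_alt y" using no_alt_appendD no_alt_NF xy(1) by metis+
    then have nf: "NF (ev x) = x" "NF (ev y) = y" using xy by (simp_all add: NF_ev nf_no_alt)
    have "max (height x) (height y) \<le> 1" using less.prems(2) xy by (simp add: peak_def height_append)
    moreover have "wsum y = 0" using less.prems(1) xy by (simp add: tau_NF)
    ultimately have "ev x \<in> D1" "ev y \<in> D1"
      using less.hyps[of "ev x"] less.hyps[of "ev y"] xy nf by (auto simp: peak_def tau_NF)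
    moreover have "a = ev x * ev y" using ev_NF[of a] xy by (simp add: ev_append)
    ultimately show ?thesis by (simp add: D1_mult)
  next
    case False
    then have exc: "wsum x \<noteq> 0" if "NF a = x @ y" "x \<noteq> []" "y \<noteq> []" for x y using that by blast
    show ?thesis
    proof (cases "hd (NF a)")
      case True
      then obtain w where 1: "NF a = True # w" by (cases "NF a") auto
      obtain b v where 2: "w = b # v" using less.prems(1) 1 by (cases w) (auto simp: tau_NF)
      have "\<not> b"
      proof
        assume "b"
        then show False using less.prems(2) height_nonneg[of v] unfolding peak_def 1 2
          by (simp del: height_nonneg)
      qed
      moreover have "v = []" using exc[of "[True, b]" v] 1 2 \<open>\<not> b\<close> by auto
      ultimately have "NF a = [True, False]" using 1 2 by simp
      then have "a = word [1, - 1]" by (metis NF_inject NF_letters(1))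
      then show ?thesis by (simp add: D1_gen)
    next
      case hd: False
      have "height (NF a) = 0"
      proof (rule ccontr)
        assume "height (NF a) \<noteq> 0"
        then have "height (NF a) \<ge> 1" using height_nonneg[of "NF a"] by linarith
        then obtain x y where xy: "NF a = x @ True # y" "wsum x = 0"
          using height_first_passage by blast
        then have "x \<noteq> []" using hd by auto
        then show False using exc[of x "True # y"] xy by simp
      qed
      then show ?thesis using excursion_Irr[of a] exc less.prems(1) by (auto simp: peak_def intro: D1_irr)
    qed
  qed
qed

theorem D1_iff: "a \<in> D1 \<longleftrightarrow> tau a = 0 \<and> peak a \<le> 1"
  using D1_height height_D1 by blast

lemma tau_peak_letters: "tau up = 1" "peak up = 1" "tau down = - 1" "peak down = 0"
  by (simp_all add: tau_NF peak_def NF_letters)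

text \<open>Conjugation by \<open>u\<close> lowers the path by one unit and closes it up again; so \<open>\<alpha>\<close> maps
  \<open>D1\<close> to the loops that stay below 0.\<close>

lemma tau_peak_alpha: "tau (alpha a) = tau a" "peak (alpha a) = max 0 (max (peak a - 1) (tau a))"
  by (auto simp: alpha_def tau_mult peak_mult tau_peak_letters)

lemma alpha_D1: "a \<in> D1 \<Longrightarrow> alpha a \<in> D1"
  by (auto simp: D1_iff tau_peak_alpha)

section \<open>Complex vector spaces\<close>

lemma complex_ring_simps [simp]:
  "carrier complex_ring = UNIV" "mult complex_ring = (*)" "one complex_ring = 1"
  "zero complex_ring = 0" "add complex_ring = (+)"
  by (simp_all add: complex_ring_def)

lemma complex_cring: "cring complex_ring"
  by (rule cringI; (rule abelian_groupI comm_monoidI)?)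
    (auto simp: algebra_simps intro: exI[of _ "- _"] simp: eq_neg_iff_add_eq_0 add.commute)

lemma complex_a_inv [simp]: "a_inv complex_ring c = - c"
proof -
  interpret cring complex_ring by (rule complex_cring)
  show ?thesis using minus_equality[of "- c" c] by simp
qed

locale cmodule = module complex_ring M for M (structure)
begin

lemma scale_closed [simp, intro]: "x \<in> carrier M \<Longrightarrow> c \<odot> x \<in> carrier M"
  by simp

lemma scale_simps:
  "x \<in> carrier M \<Longrightarrow> a \<odot> (b \<odot> x) = (a * b) \<odot> x"
  "x \<in> carrier M \<Longrightarrow> 1 \<odot> x = x"
  "x \<in> carrier M \<Longrightarrow> 0 \<odot> x = \<zero>"
  "c \<odot> \<zero> = \<zero>"
  "x \<in> carrier M \<Longrightarrow> y \<in> carrier M \<Longrightarrow> c \<odot> (x \<oplus> y) = c \<odot> x \<oplus> c \<odot> y"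
  using smult_assoc1[of a b x] smult_one[of x] smult_l_null[of x] smult_r_null[of c]
    smult_r_distr[of c x y] by simp_all

lemma scale_add: "x \<in> carrier M \<Longrightarrow> (a + b) \<odot> x = a \<odot> x \<oplus> b \<odot> x"
  using smult_l_distr[of a b x] by simp

lemma neg_eq_scale: "x \<in> carrier M \<Longrightarrow> \<ominus> x = (- 1) \<odot> x"
  using smult_l_minus[of 1 x] smult_one[of x] by simp

lemma diff_eq_scale: "x \<in> carrier M \<Longrightarrow> y \<in> carrier M \<Longrightarrow> x \<ominus> y = x \<oplus> (- 1) \<odot> y"
  by (simp add: a_minus_def neg_eq_scale)

lemma diff_self: "x \<in> carrier M \<Longrightarrow> x \<ominus> x = \<zero>"
  by (simp add: a_minus_def M.r_neg)

lemma diff_eq_zero: "x \<in> carrier M \<Longrightarrow> y \<in> carrier M \<Longrightarrow> x \<ominus> y = \<zero> \<longleftrightarrow> x = y"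
  by (metis M.r_neg M.minus_closed M.minus_equality M.minus_minus a_minus_def M.a_inv_closed M.a_comm)

text \<open>Linear identities are checked on coefficients: \<open>f\<close> is the linear map that sends the
  standard basis to the given vectors.\<close>

lemma lin2:
  assumes "x \<in> carrier M" "y \<in> carrier M"
  obtains f where "x = f 1 0" "y = f 0 1" "\<zero> = f 0 0" "\<And>a b. f a b \<in> carrier M"
    "\<And>a b a' b'. f a b \<oplus> f a' b' = f (a + a') (b + b')"
    "\<And>a b a' b'. f a b \<ominus> f a' b' = f (a - a') (b - b')"
    "\<And>c a b. c \<odot> f a b = f (c * a) (c * b)"
proof -
  define f where "f a b = a \<odot> x \<oplus> b \<odot> y" for a b
  have ad: "f a b \<oplus> f a' b' = f (a + a') (b + b')" for a b a' b'
    using assms by (simp add: f_def scale_add M.a_ac)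
  have sm: "c \<odot> f a b = f (c * a) (c * b)" for c a b
    using assms by (simp add: f_def scale_simps)
  have cl: "f a b \<in> carrier M" for a b using assms by (simp add: f_def)
  have df: "f a b \<ominus> f a' b' = f (a - a') (b - b')" for a b a' b'
    by (simp only: diff_eq_scale[OF cl cl] sm ad) simp
  have b: "x = f 1 0" "y = f 0 1" "\<zero> = f 0 0"
    using assms by (simp_all add: f_def scale_simps)
  show thesis by (rule that[OF b cl ad df sm])
qed

lemma lin3:
  assumes "x \<in> carrier M" "y \<in> carrier M" "z \<in> carrier M"
  obtains f where "x = f 1 0 0" "y = f 0 1 0" "z = f 0 0 1" "\<zero> = f 0 0 0" "\<And>a b c. f a b c \<in> carrier M"
    "\<And>a b c a' b' c'. f a b c \<oplus> f a' b' c' = f (a + a') (b + b') (c + c')"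
    "\<And>a b c a' b' c'. f a b c \<ominus> f a' b' c' = f (a - a') (b - b') (c - c')"
    "\<And>t a b c. t \<odot> f a b c = f (t * a) (t * b) (t * c)"
proof -
  define f where "f a b c = a \<odot> x \<oplus> (b \<odot> y \<oplus> c \<odot> z)" for a b c
  have ad: "f a b c \<oplus> f a' b' c' = f (a + a') (b + b') (c + c')" for a b c a' b' c'
    using assms by (simp add: f_def scale_add M.a_ac)
  have sm: "t \<odot> f a b c = f (t * a) (t * b) (t * c)" for t c a b
    using assms by (simp add: f_def scale_simps)
  have cl: "f a b c \<in> carrier M" for a b c using assms by (simp add: f_def)
  have df: "f a b c \<ominus> f a' b' c' = f (a - a') (b - b') (c - c')" for a b c a' b' c'
    by (simp only: diff_eq_scale[OF cl cl] sm ad) simp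
  have b: "x = f 1 0 0" "y = f 0 1 0" "z = f 0 0 1" "\<zero> = f 0 0 0"
    using assms by (simp_all add: f_def scale_simps)
  show thesis by (rule that[OF b cl ad df sm])
qed

lemma lin5:
  assumes "x \<in> carrier M" "y \<in> carrier M" "z \<in> carrier M" "u \<in> carrier M" "v \<in> carrier M"
  obtains f where "x = f 1 0 0 0 0" "y = f 0 1 0 0 0" "z = f 0 0 1 0 0" "u = f 0 0 0 1 0"
    "v = f 0 0 0 0 1" "\<zero> = f 0 0 0 0 0" "\<And>a b c d e. f a b c d e \<in> carrier M"
    "\<And>a b c d e a' b' c' d' e'. f a b c d e \<oplus> f a' b' c' d' e' = f (a + a') (b + b') (c + c') (d + d') (e + e')"
    "\<And>a b c d e a' b' c' d' e'. f a b c d e \<ominus> f a' b' c' d' e' = f (a - a') (b - b') (c - c') (d - d') (e - e')"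
    "\<And>t a b c d e. t \<odot> f a b c d e = f (t * a) (t * b) (t * c) (t * d) (t * e)"
proof -
  define f where "f a b c d e = a \<odot> x \<oplus> (b \<odot> y \<oplus> (c \<odot> z \<oplus> (d \<odot> u \<oplus> e \<odot> v)))" for a b c d e
  have ad: "f a b c d e \<oplus> f a' b' c' d' e' = f (a + a') (b + b') (c + c') (d + d') (e + e')" for a b c d e a' b' c' d' e'
    using assms by (simp add: f_def scale_add M.a_ac)
  have sm: "t \<odot> f a b c d e = f (t * a) (t * b) (t * c) (t * d) (t * e)" for t c a b d e
    using assms by (simp add: f_def scale_simps)
  have cl: "f a b c d e \<in> carrier M" for a b c d e using assms by (simp add: f_def)
  have df: "f a b c d e \<ominus> f a' b' c' d' e' = f (a - a') (b - b') (c - c') (d - d') (e - e')" for a b c d e a' b' c' d' e'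
    by (simp only: diff_eq_scale[OF cl cl] sm ad) simp
  have b: "x = f 1 0 0 0 0" "y = f 0 1 0 0 0" "z = f 0 0 1 0 0" "u = f 0 0 0 1 0" "v = f 0 0 0 0 1" "\<zero> = f 0 0 0 0 0"
    using assms by (simp_all add: f_def scale_simps)
  show thesis by (rule that[OF b cl ad df sm])
qed

end

sublocale cstar_algebra \<subseteq> cmodule C ..

lemma LIMSEQ_of_abs_le:
  fixes f g :: "nat \<Rightarrow> real"
  assumes b: "\<And>n. \<bar>f n - x\<bar> \<le> g n" and g: "g \<longlonglongrightarrow> 0"
  shows "f \<longlonglongrightarrow> x"
proof (rule LIMSEQ_I)
  fix r :: real assume "r > 0"
  then obtain N where "\<forall>n\<ge>N. norm (g n - 0) < r" using LIMSEQ_D[OF g] by blast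
  then have "\<forall>n\<ge>N. norm (f n - x) < r" using b by (fastforce intro: order.strict_trans1)
  then show "\<exists>N. \<forall>n\<ge>N. norm (f n - x) < r" by blast
qed

section \<open>Limits and square roots in C*-algebras\<close>

text \<open>The iteration for the square root of \<open>1 - k\<close> in the scalar case \<open>k = 1\<close>. It dominates the
  iteration for every \<open>k\<close> of norm at most 1.\<close>

definition sqrt_majorant :: "nat \<Rightarrow> real" where
  "sqrt_majorant n = ((\<lambda>t. (1 + t\<^sup>2) / 2) ^^ n) 0"

lemma sqrt_majorant_simps [simp]:
  "sqrt_majorant 0 = 0" "sqrt_majorant (Suc n) = (1 + (sqrt_majorant n)\<^sup>2) / 2"
  by (simp_all add: sqrt_majorant_def)

lemma sqrt_majorant_bounds: "0 \<le> sqrt_majorant n" "sqrt_majorant n \<le> 1"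
  by (induction n) (auto simp: power_le_one)

lemma sqrt_majorant_incseq: "incseq sqrt_majorant"
proof (rule incseq_SucI)
  fix n
  have "(1 + (sqrt_majorant n)\<^sup>2) / 2 - sqrt_majorant n = (1 - sqrt_majorant n)\<^sup>2 / 2"
    by (simp add: power2_eq_square algebra_simps diff_divide_distrib add_divide_distrib)
  also have "\<dots> \<ge> 0" by simp
  finally show "sqrt_majorant n \<le> sqrt_majorant (Suc n)" by simp
qed

lemma sqrt_majorant_LIMSEQ: "sqrt_majorant \<longlonglongrightarrow> 1"
proof -
  obtain L where L: "sqrt_majorant \<longlonglongrightarrow> L"
    using incseq_convergent[OF sqrt_majorant_incseq, of 1] sqrt_majorant_bounds(2) by blast
  have "(\<lambda>n. (1 + (sqrt_majorant n)\<^sup>2) / 2) \<longlonglongrightarrow> (1 + L\<^sup>2) / 2"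
    by (rule tendsto_divide[OF tendsto_add[OF tendsto_const tendsto_power[OF L]] tendsto_const]) simp
  moreover have "(\<lambda>n. sqrt_majorant (Suc n)) \<longlonglongrightarrow> L" using L by (rule LIMSEQ_Suc)
  ultimately have "L = (1 + L\<^sup>2) / 2" using LIMSEQ_unique by (simp only: sqrt_majorant_simps)
  then have "(L - 1)\<^sup>2 = 0" by (simp add: power2_eq_square algebra_simps)
  then show ?thesis using L by simp
qed

definition closed_star_subalgebra :: "'c cstar \<Rightarrow> 'c set \<Rightarrow> bool" where
  "closed_star_subalgebra C S \<longleftrightarrow> submodule S complex_ring C \<and>
     (\<forall>x\<in>S. \<forall>y\<in>S. x \<otimes>\<^bsub>C\<^esub> y \<in> S) \<and> (\<forall>x\<in>S. cadj C x \<in> S) \<and> norm_closure C S \<subseteq> S"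

context cstar_algebra
begin

lemmas closed [simp, intro] = mult_closed cadj_closed

lemma diff_closed [simp, intro]: "x \<in> carrier C \<Longrightarrow> y \<in> carrier C \<Longrightarrow> x \<ominus> y \<in> carrier C"
  by (rule M.minus_closed)

lemma norm_zero [simp]: "cnorm C \<zero> = 0"
  using cnorm_eq_0 by simp

lemma norm_neg: "x \<in> carrier C \<Longrightarrow> cnorm C (\<ominus> x) = cnorm C x"
  by (simp add: neg_eq_scale cnorm_smult)

lemma norm_diff_triangle: "x \<in> carrier C \<Longrightarrow> y \<in> carrier C \<Longrightarrow> cnorm C (x \<ominus> y) \<le> cnorm C x + cnorm C y"
  using cnorm_triangle[of x "\<ominus> y"] by (simp add: a_minus_def norm_neg)

lemma norm_diff_commute: "x \<in> carrier C \<Longrightarrow> y \<in> carrier C \<Longrightarrow> cnorm C (x \<ominus> y) = cnorm C (y \<ominus> x)"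
proof -
  assume *: "x \<in> carrier C" "y \<in> carrier C"
  have "x \<ominus> y = (- 1) \<odot> (y \<ominus> x)" by (rule lin2[OF *], simp)
  then show ?thesis using cnorm_smult[of "y \<ominus> x" "-1"] * by simp
qed

lemma norm_diff_trans: "x \<in> carrier C \<Longrightarrow> y \<in> carrier C \<Longrightarrow> z \<in> carrier C
    \<Longrightarrow> cnorm C (x \<ominus> z) \<le> cnorm C (x \<ominus> y) + cnorm C (y \<ominus> z)"
proof -
  assume *: "x \<in> carrier C" "y \<in> carrier C" "z \<in> carrier C"
  have "x \<ominus> z = (x \<ominus> y) \<oplus> (y \<ominus> z)"
    by (rule lin3[OF *], simp)
  then show ?thesis using cnorm_triangle * by simp
qed

lemma norm_cadj: "x \<in> carrier C \<Longrightarrow> cnorm C (cadj C x) = cnorm C x"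
proof -
  have le: "cnorm C x \<le> cnorm C (cadj C x)" if x: "x \<in> carrier C" for x
  proof (cases "cnorm C x = 0")
    case False
    have "cnorm C x * cnorm C x \<le> cnorm C (cadj C x) * cnorm C x"
      using cstar_identity[OF x] cnorm_mult[of "cadj C x" x] x by (simp add: power2_eq_square)
    then show ?thesis using False cnorm_nonneg[OF x] by (simp add: mult_le_cancel_right)
  qed (use cnorm_nonneg x in auto)
  assume x: "x \<in> carrier C"
  show ?thesis using le[OF x] le[of "cadj C x"] x by (simp add: cadj_cadj)
qed

lemma norm_self_adjoint_square:
  "x \<in> carrier C \<Longrightarrow> cadj C x = x \<Longrightarrow> cnorm C (x \<otimes> x) = (cnorm C x)\<^sup>2"
  using cstar_identity[of x] by simp

lemma zero_mult [simp]: "x \<in> carrier C \<Longrightarrow> \<zero> \<otimes> x = \<zero>" "x \<in> carrier C \<Longrightarrow> x \<otimes> \<zero> = \<zero>"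
  using smult_mult_left[of \<zero> x 0] smult_mult_right[of x \<zero> 0] by (simp_all add: scale_simps)

lemma cadj_zero [simp]: "cadj C \<zero> = \<zero>"
  using cadj_smult[of \<zero> 0] by (simp add: scale_simps)

lemma cadj_diff: "x \<in> carrier C \<Longrightarrow> y \<in> carrier C \<Longrightarrow> cadj C (x \<ominus> y) = cadj C x \<ominus> cadj C y"
  by (simp add: diff_eq_scale cadj_add cadj_smult)

lemma diff_mult:
  "\<lbrakk>x \<in> carrier C; y \<in> carrier C; z \<in> carrier C\<rbrakk> \<Longrightarrow> (x \<ominus> y) \<otimes> z = x \<otimes> z \<ominus> y \<otimes> z"
  "\<lbrakk>x \<in> carrier C; y \<in> carrier C; z \<in> carrier C\<rbrakk> \<Longrightarrow> z \<otimes> (x \<ominus> y) = z \<otimes> x \<ominus> z \<otimes> y"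
  by (simp_all add: diff_eq_scale distr_left distr_right smult_mult_left smult_mult_right)

lemmas star_algebra_simps = distr_left distr_right diff_mult smult_mult_left smult_mult_right
  mult_assoc cadj_add cadj_diff cadj_smult cadj_mult cadj_cadj

definition clim :: "(nat \<Rightarrow> 'c) \<Rightarrow> 'c \<Rightarrow> bool" where
  "clim s x \<longleftrightarrow> range s \<subseteq> carrier C \<and> x \<in> carrier C \<and> (\<lambda>n. cnorm C (s n \<ominus> x)) \<longlonglongrightarrow> 0"

lemma climD: "clim s x \<Longrightarrow> s n \<in> carrier C" "clim s x \<Longrightarrow> x \<in> carrier C"
  by (auto simp: clim_def)

lemma climI:
  assumes "\<And>n. s n \<in> carrier C" "x \<in> carrier C" "\<And>n. cnorm C (s n \<ominus> x) \<le> e n" "e \<longlonglongrightarrow> 0"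
  shows "clim s x"
proof -
  have "(\<lambda>n. cnorm C (s n \<ominus> x)) \<longlonglongrightarrow> 0"
    by (rule tendsto_sandwich[OF _ _ tendsto_const assms(4)])
      (use assms cnorm_nonneg in \<open>auto intro!: always_eventually\<close>)
  then show ?thesis using assms unfolding clim_def by auto
qed

lemma clim_Suc: "clim s x \<Longrightarrow> clim (\<lambda>n. s (Suc n)) x"
  unfolding clim_def using LIMSEQ_Suc[of "\<lambda>n. cnorm C (s n \<ominus> x)"] by auto

lemma clim_const: "x \<in> carrier C \<Longrightarrow> clim (\<lambda>_. x) x"
  by (simp add: clim_def diff_self)

lemma clim_unique: assumes "clim s x" "clim s y" shows "x = y"
proof -
  note c = climD[OF assms(1)] climD[OF assms(2)]
  have 1: "(\<lambda>n. cnorm C (s n \<ominus> x) + cnorm C (s n \<ominus> y)) \<longlonglongrightarrow> 0"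
    using assms unfolding clim_def by (intro tendsto_add_zero) auto
  have "cnorm C (x \<ominus> y) \<le> cnorm C (s n \<ominus> x) + cnorm C (s n \<ominus> y)" for n
    using norm_diff_trans[of x "s n" y] norm_diff_commute[of x "s n"] c by simp
  then have "cnorm C (x \<ominus> y) \<le> 0"
    by (intro LIMSEQ_le_const[OF 1]) blast
  then show ?thesis using cnorm_nonneg[of "x \<ominus> y"] cnorm_eq_0[of "x \<ominus> y"] c diff_eq_zero by fastforce
qed

lemma clim_add: assumes "clim s x" "clim t y" shows "clim (\<lambda>n. s n \<oplus> t n) (x \<oplus> y)"
proof (rule climI)
  note c = climD[OF assms(1)] climD[OF assms(2)]
  show "(\<lambda>n. cnorm C (s n \<ominus> x) + cnorm C (t n \<ominus> y)) \<longlonglongrightarrow> 0"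
    using assms unfolding clim_def by (intro tendsto_add_zero) auto
  show "cnorm C ((s n \<oplus> t n) \<ominus> (x \<oplus> y)) \<le> cnorm C (s n \<ominus> x) + cnorm C (t n \<ominus> y)" for n
  proof -
    have "(s n \<oplus> t n) \<ominus> (x \<oplus> y) = (s n \<ominus> x) \<oplus> (t n \<ominus> y)"
      using c by (simp add: diff_eq_scale scale_simps M.a_ac)
    then show ?thesis using cnorm_triangle c by simp
  qed
qed (use climD[OF assms(1)] climD[OF assms(2)] in auto)

lemma clim_smult: assumes "clim s x" shows "clim (\<lambda>n. c \<odot> s n) (c \<odot> x)"
proof (rule climI)
  show "(\<lambda>n. cmod c * cnorm C (s n \<ominus> x)) \<longlonglongrightarrow> 0"
    using assms unfolding clim_def by (intro tendsto_mult_right_zero) auto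
  show "cnorm C (c \<odot> s n \<ominus> c \<odot> x) \<le> cmod c * cnorm C (s n \<ominus> x)" for n
  proof -
    have "c \<odot> s n \<ominus> c \<odot> x = c \<odot> (s n \<ominus> x)"
      using climD[OF assms] by (simp add: diff_eq_scale scale_simps mult.commute)
    then show ?thesis using cnorm_smult climD[OF assms] by simp
  qed
qed (use climD[OF assms(1)] in auto)

lemma clim_cadj: assumes "clim s x" shows "clim (\<lambda>n. cadj C (s n)) (cadj C x)"
  using assms climD[OF assms] unfolding clim_def
  by (auto simp: cadj_diff[symmetric] norm_cadj)

lemma clim_norm: assumes "clim s x" shows "(\<lambda>n. cnorm C (s n)) \<longlonglongrightarrow> cnorm C x"
proof -
  note c = climD[OF assms]
  have "\<bar>cnorm C (s n) - cnorm C x\<bar> \<le> cnorm C (s n \<ominus> x)" for n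
  proof -
    have 1: "(s n \<ominus> x) \<oplus> x = s n" by (rule lin2[OF c(1)[of n] c(2)], simp)
    have 2: "(x \<ominus> s n) \<oplus> s n = x" by (rule lin2[OF c(1)[of n] c(2)], simp)
    show ?thesis using cnorm_triangle[of "s n \<ominus> x" x] cnorm_triangle[of "x \<ominus> s n" "s n"] c 1 2
        norm_diff_commute[of x "s n"] by simp
  qed
  moreover have "(\<lambda>n. cnorm C (s n \<ominus> x)) \<longlonglongrightarrow> 0" using assms unfolding clim_def by simp
  ultimately show ?thesis by (rule LIMSEQ_of_abs_le)
qed

lemma clim_norm_le: assumes "clim s x" "\<And>n. cnorm C (s n) \<le> r" shows "cnorm C x \<le> r"
  by (rule LIMSEQ_le_const2[OF clim_norm[OF assms(1)]]) (use assms(2) in blast)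

lemma clim_mult: assumes "clim s x" "clim t y" shows "clim (\<lambda>n. s n \<otimes> t n) (x \<otimes> y)"
proof (rule climI)
  note c = climD[OF assms(1)] climD[OF assms(2)]
  have "(\<lambda>n. cnorm C (s n) * cnorm C (t n \<ominus> y) + cnorm C (s n \<ominus> x) * cnorm C y) \<longlonglongrightarrow>
      cnorm C x * 0 + 0 * cnorm C y"
    using assms clim_norm[OF assms(1)] unfolding clim_def
    by (intro tendsto_add tendsto_mult tendsto_const) auto
  then show "(\<lambda>n. cnorm C (s n) * cnorm C (t n \<ominus> y) + cnorm C (s n \<ominus> x) * cnorm C y) \<longlonglongrightarrow> 0" by simp
  show "cnorm C (s n \<otimes> t n \<ominus> x \<otimes> y) \<le> cnorm C (s n) * cnorm C (t n \<ominus> y) + cnorm C (s n \<ominus> x) * cnorm C y" for n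
  proof -
    have "s n \<otimes> t n \<ominus> x \<otimes> y = s n \<otimes> (t n \<ominus> y) \<oplus> (s n \<ominus> x) \<otimes> y"
      using c by (simp add: diff_mult)
        (rule lin3[of "s n \<otimes> t n" "x \<otimes> y" "s n \<otimes> y"], simp_all)
    then have "cnorm C (s n \<otimes> t n \<ominus> x \<otimes> y) \<le> cnorm C (s n \<otimes> (t n \<ominus> y)) + cnorm C ((s n \<ominus> x) \<otimes> y)"
      using c by (simp add: cnorm_triangle)
    also have "\<dots> \<le> cnorm C (s n) * cnorm C (t n \<ominus> y) + cnorm C (s n \<ominus> x) * cnorm C y"
      using c by (intro add_mono cnorm_mult) auto
    finally show ?thesis .
  qed
qed (use climD[OF assms(1)] climD[OF assms(2)] in auto)

lemma clim_diff: assumes "clim s x" "clim t y" shows "clim (\<lambda>n. s n \<ominus> t n) (x \<ominus> y)"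
  using clim_add[OF assms(1) clim_smult[OF assms(2), of "-1"]] climD[OF assms(1)] climD[OF assms(2)]
  by (simp add: diff_eq_scale)

lemma clim_closed:
  assumes "clim s x" "\<And>n. s n \<in> S" "norm_closure C S \<subseteq> S"
  shows "x \<in> S"
proof -
  note c = climD[OF assms(1)]
  have "\<exists>y\<in>S. cnorm C (x \<ominus> y) < e" if "e > 0" for e
  proof -
    have "\<forall>\<^sub>F n in sequentially. cnorm C (s n \<ominus> x) < e"
      using assms(1) that order_tendstoD(2) unfolding clim_def by blast
    then obtain n where "cnorm C (s n \<ominus> x) < e" by (meson eventually_happens sequentially_bot)
    then show ?thesis using assms(2)[of n] norm_diff_commute c by metis
  qed
  then show ?thesis using assms(3) c by (auto simp: norm_closure_def)
qed

lemma clim_complete: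
  assumes "\<And>n. s n \<in> carrier C" "\<And>n j. cnorm C (s (n + j) \<ominus> s n) \<le> e n" "e \<longlonglongrightarrow> 0"
  obtains x where "clim s x"
proof -
  have "\<exists>N. \<forall>m\<ge>N. \<forall>n\<ge>N. cnorm C (s m \<ominus> s n) < r" if r: "r > 0" for r
  proof -
    have "\<exists>N. \<forall>n\<ge>N. norm (e n - 0) < r" by (rule LIMSEQ_D[OF assms(3) r])
    then obtain N where N: "\<forall>n\<ge>N. norm (e n - 0) < r" ..
    have le: "cnorm C (s m \<ominus> s n) < r" if "m \<ge> n" "n \<ge> N" for m n
    proof -
      have "cnorm C (s m \<ominus> s n) \<le> e n" using assms(2)[of n "m - n"] that by simp
      moreover have "norm (e n - 0) < r" using N that(2) by blast
      ultimately show ?thesis by simp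
    qed
    have "cnorm C (s m \<ominus> s n) < r" if "m \<ge> N" "n \<ge> N" for m n
      using le[of n m] le[of m n] that norm_diff_commute[OF assms(1) assms(1), of m n]
      by (cases "n \<le> m") simp_all
    then show ?thesis by blast
  qed
  moreover have "range s \<subseteq> carrier C" using assms(1) by blast
  ultimately have "\<exists>x\<in>carrier C. (\<lambda>n. cnorm C (s n \<ominus> x)) \<longlonglongrightarrow> 0"
    using complete unfolding complete_wrt_def by blast
  then obtain x where "x \<in> carrier C" "(\<lambda>n. cnorm C (s n \<ominus> x)) \<longlonglongrightarrow> 0" ..
  then have "clim s x" using assms(1) unfolding clim_def by blast
  then show thesis by (rule that)
qed

primrec sqrt_iter :: "'c \<Rightarrow> nat \<Rightarrow> 'c" where
  "sqrt_iter k 0 = \<zero>"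
| "sqrt_iter k (Suc n) = (1 / 2) \<odot> (k \<oplus> sqrt_iter k n \<otimes> sqrt_iter k n)"

lemma sqrt_iter_closed [simp]: "k \<in> carrier C \<Longrightarrow> sqrt_iter k n \<in> carrier C"
  by (induction n) auto

lemma sqrt_iter_norm:
  assumes "k \<in> carrier C" "cnorm C k \<le> 1"
  shows "cnorm C (sqrt_iter k n) \<le> sqrt_majorant n"
proof (induction n)
  case (Suc n)
  let ?x = "sqrt_iter k n"
  have "cnorm C (k \<oplus> ?x \<otimes> ?x) \<le> 1 + cnorm C ?x * cnorm C ?x"
    using assms cnorm_triangle[of k "?x \<otimes> ?x"] cnorm_mult[of ?x ?x] by simp
  also have "cnorm C ?x * cnorm C ?x \<le> (sqrt_majorant n)\<^sup>2"
    using Suc cnorm_nonneg[of ?x] assms by (simp add: power2_eq_square mult_mono')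
  finally show ?case using assms by (simp add: cnorm_smult)
qed simp

text \<open>From \<open>x\<^sup>2 - y\<^sup>2 = x (x - y) + (x - y) y\<close> the increments are bounded, by induction, by those of the
  scalar iteration.\<close>

lemma sqrt_iter_diff:
  assumes "k \<in> carrier C" "cnorm C k \<le> 1"
  shows "cnorm C (sqrt_iter k (n + j) \<ominus> sqrt_iter k n) \<le> sqrt_majorant (n + j) - sqrt_majorant n"
proof (induction n)
  case 0
  then show ?case using sqrt_iter_norm[OF assms] assms
    by (simp add: diff_eq_scale scale_simps)
next
  case (Suc n)
  let ?x = "sqrt_iter k (n + j)" and ?y = "sqrt_iter k n"
  let ?p = "sqrt_majorant (n + j)" and ?q = "sqrt_majorant n"
  have c: "?x \<in> carrier C" "?y \<in> carrier C" using assms by auto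
  have pq: "?q \<le> ?p" using sqrt_majorant_incseq by (simp add: incseq_def)
  have "sqrt_iter k (Suc n + j) \<ominus> sqrt_iter k (Suc n) = (1 / 2) \<odot> (?x \<otimes> (?x \<ominus> ?y) \<oplus> (?x \<ominus> ?y) \<otimes> ?y)"
    using c assms by (simp add: diff_mult) (rule lin5[of k "?x \<otimes> ?x" "?x \<otimes> ?y" "?y \<otimes> ?y" \<zero>], simp_all)
  then have "cnorm C (sqrt_iter k (Suc n + j) \<ominus> sqrt_iter k (Suc n)) =
      1 / 2 * cnorm C (?x \<otimes> (?x \<ominus> ?y) \<oplus> (?x \<ominus> ?y) \<otimes> ?y)"
    using c by (simp add: cnorm_smult)
  also have "\<dots> \<le> 1 / 2 * (cnorm C ?x * cnorm C (?x \<ominus> ?y) + cnorm C (?x \<ominus> ?y) * cnorm C ?y)"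
    using c cnorm_triangle[of "?x \<otimes> (?x \<ominus> ?y)" "(?x \<ominus> ?y) \<otimes> ?y"] cnorm_mult[of ?x "?x \<ominus> ?y"]
      cnorm_mult[of "?x \<ominus> ?y" ?y] by simp
  also have "\<dots> = 1 / 2 * ((cnorm C ?x + cnorm C ?y) * cnorm C (?x \<ominus> ?y))" by (simp add: algebra_simps)
  also have "\<dots> \<le> 1 / 2 * ((?p + ?q) * (?p - ?q))"
    using Suc.IH sqrt_iter_norm[OF assms, of "n + j"] sqrt_iter_norm[OF assms, of n] sqrt_majorant_bounds pq
      cnorm_nonneg c by (intro mult_left_mono mult_mono add_mono) auto
  also have "\<dots> = sqrt_majorant (Suc n + j) - sqrt_majorant (Suc n)"
    by (simp add: power2_eq_square field_simps)
  finally show ?case .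
qed

text \<open>The last equation says that \<open>1 - d\<close> is a square root of \<open>1 - k\<close>. In this form it does not refer to a
  unit of the algebra.\<close>

lemma sqrt_exists:
  assumes k: "k \<in> carrier C" "cnorm C k \<le> 1"
  obtains d where "clim (sqrt_iter k) d" "cnorm C d \<le> 1" "d \<oplus> d = k \<oplus> d \<otimes> d"
proof -
  have "(\<lambda>n. 1 - sqrt_majorant n) \<longlonglongrightarrow> 1 - 1"
    by (rule tendsto_diff[OF tendsto_const sqrt_majorant_LIMSEQ])
  then have "(\<lambda>n. 1 - sqrt_majorant n) \<longlonglongrightarrow> 0" by simp
  moreover have "cnorm C (sqrt_iter k (n + j) \<ominus> sqrt_iter k n) \<le> 1 - sqrt_majorant n" for n j
    using sqrt_iter_diff[OF k, of n j] sqrt_majorant_bounds(2)[of "n + j"] by linarith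
  ultimately obtain d where d: "clim (sqrt_iter k) d"
    using clim_complete[of "sqrt_iter k"] k by (metis sqrt_iter_closed)
  note c = climD[OF d]
  have "clim (\<lambda>n. sqrt_iter k (Suc n)) ((1 / 2) \<odot> (k \<oplus> d \<otimes> d))"
    unfolding sqrt_iter.simps by (intro clim_smult clim_add clim_mult clim_const d k)
  then have e: "(1 / 2) \<odot> (k \<oplus> d \<otimes> d) = d" using clim_unique clim_Suc[OF d] by blast
  have "k \<oplus> d \<otimes> d = 2 \<odot> ((1 / 2) \<odot> (k \<oplus> d \<otimes> d))" using c k by (simp add: scale_simps(1,2))
  also have "\<dots> = 2 \<odot> d" by (simp only: e)
  also have "\<dots> = d \<oplus> d" using scale_add[of d 1 1] c by (simp add: scale_simps)
  finally have "d \<oplus> d = k \<oplus> d \<otimes> d" by simp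
  moreover have "cnorm C d \<le> 1"
    using clim_norm_le[OF d] sqrt_iter_norm[OF k] sqrt_majorant_bounds(2) order_trans by blast
  ultimately show thesis using that d by simp
qed

lemma sqrt_iter_cadj: "k \<in> carrier C \<Longrightarrow> cadj C k = k \<Longrightarrow> cadj C (sqrt_iter k n) = sqrt_iter k n"
  by (induction n) (auto simp: cadj_smult cadj_add cadj_mult)

lemma sqrt_iter_commute:
  "k \<in> carrier C \<Longrightarrow> x \<in> carrier C \<Longrightarrow> k \<otimes> x = x \<otimes> k \<Longrightarrow> sqrt_iter k n \<otimes> x = x \<otimes> sqrt_iter k n"
proof (induction n)
  case (Suc n)
  then have "sqrt_iter k n \<otimes> (sqrt_iter k n \<otimes> x) = x \<otimes> (sqrt_iter k n \<otimes> sqrt_iter k n)"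
    by (metis mult_assoc sqrt_iter_closed)
  then show ?case using Suc by (simp add: smult_mult_left smult_mult_right distr_left distr_right mult_assoc)
qed simp

lemma clim_self_adjoint:
  assumes "clim s x" "\<And>n. cadj C (s n) = s n"
  shows "cadj C x = x"
proof -
  have "clim s (cadj C x)" using clim_cadj[OF assms(1)] by (simp add: assms(2))
  then show ?thesis using assms(1) by (rule clim_unique)
qed

lemma clim_commute:
  assumes "clim s x" "y \<in> carrier C" "\<And>n. s n \<otimes> y = y \<otimes> s n"
  shows "x \<otimes> y = y \<otimes> x"
proof -
  have "clim (\<lambda>n. s n \<otimes> y) (y \<otimes> x)"
    using clim_mult[OF clim_const[OF assms(2)] assms(1)] by (simp add: assms(3))
  with clim_mult[OF assms(1) clim_const[OF assms(2)]] show ?thesis by (rule clim_unique)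
qed

end

context cstar_algebra
begin

section \<open>Positive elements of unital C*-algebras\<close>

lemma subalgebraD:
  assumes "closed_star_subalgebra C S"
  shows "S \<subseteq> carrier C" "\<zero> \<in> S" "\<And>x y. x \<in> S \<Longrightarrow> y \<in> S \<Longrightarrow> x \<oplus> y \<in> S" "\<And>c x. x \<in> S \<Longrightarrow> c \<odot> x \<in> S"
    "\<And>x y. x \<in> S \<Longrightarrow> y \<in> S \<Longrightarrow> x \<ominus> y \<in> S" "\<And>x y. x \<in> S \<Longrightarrow> y \<in> S \<Longrightarrow> x \<otimes> y \<in> S"
    "\<And>x. x \<in> S \<Longrightarrow> cadj C x \<in> S" "norm_closure C S \<subseteq> S"
proof -
  have sub: "submodule S complex_ring C" using assms by (simp add: closed_star_subalgebra_def)
  note E = submoduleE[OF sub]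
  show "S \<subseteq> carrier C" by (rule E(1))
  show add: "x \<in> S \<Longrightarrow> y \<in> S \<Longrightarrow> x \<oplus> y \<in> S" for x y by (rule E(5))
  show "x \<in> S \<Longrightarrow> c \<odot> x \<in> S" for c x using E(4)[of c x] by simp
  show "x \<in> S \<Longrightarrow> y \<in> S \<Longrightarrow> x \<ominus> y \<in> S" for x y unfolding a_minus_def by (intro E(5) E(6))
  obtain x where "x \<in> S" using E(2) by blast
  then have "x \<oplus> \<ominus> x \<in> S" by (intro E(5) E(6))
  then show "\<zero> \<in> S" using \<open>x \<in> S\<close> E(1) M.r_neg[of x] by auto
qed (use assms in \<open>auto simp: closed_star_subalgebra_def\<close>)

lemma norm_real_smult: "x \<in> carrier C \<Longrightarrow> 0 \<le> t \<Longrightarrow> cnorm C (complex_of_real t \<odot> x) = t * cnorm C x"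
  by (simp add: cnorm_smult)

lemma norm_sq_le_1: assumes "x \<in> carrier C" "cnorm C (cadj C x \<otimes> x) \<le> 1" shows "cnorm C x \<le> 1"
  by (rule power2_le_imp_le) (use assms cstar_identity[OF assms(1)] in simp_all)

text \<open>Positivity is defined by self-adjoint square roots, since these are what the square root iteration
  provides. By \<open>pos_cadj_mult\<close> below it agrees with \<open>cstar_pos\<close> in
  unital algebras.\<close>

definition pos :: "'c \<Rightarrow> bool" where
  "pos x \<longleftrightarrow> (\<exists>s\<in>carrier C. cadj C s = s \<and> x = s \<otimes> s)"

lemma posI: "s \<in> carrier C \<Longrightarrow> cadj C s = s \<Longrightarrow> pos (s \<otimes> s)"
  by (auto simp: pos_def)

lemma pos_closed: "pos x \<Longrightarrow> x \<in> carrier C"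
  by (auto simp: pos_def)

lemma pos_self_adjoint: "pos x \<Longrightarrow> cadj C x = x"
  by (auto simp: pos_def cadj_mult)

lemma pos_scale:
  assumes "pos x" "0 \<le> t"
  shows "pos (complex_of_real t \<odot> x)"
proof -
  obtain s where s: "s \<in> carrier C" "cadj C s = s" "x = s \<otimes> s" using assms(1) by (auto simp: pos_def)
  have "pos ((complex_of_real (sqrt t) \<odot> s) \<otimes> (complex_of_real (sqrt t) \<odot> s))"
    using s by (intro posI) (auto simp: cadj_smult)
  moreover have "(complex_of_real (sqrt t) \<odot> s) \<otimes> (complex_of_real (sqrt t) \<odot> s) = complex_of_real t \<odot> x"
    using s assms(2) by (simp add: smult_mult_left smult_mult_right scale_simps(1) of_real_mult[symmetric] del: of_real_mult)
  ultimately show ?thesis by simp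
qed

end

locale unital_cstar = cstar_algebra +
  assumes one_mem [simp, intro]: "\<one> \<in> carrier C"
    and one_left [simp]: "x \<in> carrier C \<Longrightarrow> \<one> \<otimes> x = x"
    and one_right [simp]: "x \<in> carrier C \<Longrightarrow> x \<otimes> \<one> = x"
begin

lemma cadj_one [simp]: "cadj C \<one> = \<one>"
  using one_left[of "cadj C \<one>"] cadj_mult[of "cadj C \<one>" \<one>] by (simp add: cadj_cadj)

lemma norm_one_le: "cnorm C \<one> \<le> 1"
proof -
  have "cnorm C \<one> = (cnorm C \<one>)\<^sup>2" using cstar_identity[of \<one>] by simp
  then have "cnorm C \<one> * (cnorm C \<one> - 1) = 0" by (simp add: power2_eq_square algebra_simps)
  then show ?thesis by auto
qed

text \<open>The element \<open>s + i r\<close> is unitary; \<open>s\<close> and \<open>s\<^sup>2 - r\<^sup>2\<close> are the real parts of it and of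
  its square.\<close>

lemma unitary_pair:
  assumes "s \<in> carrier C" "r \<in> carrier C" "cadj C s = s" "cadj C r = r" "r \<otimes> s = s \<otimes> r"
    and one: "s \<otimes> s \<oplus> r \<otimes> r = \<one>"
  shows "cnorm C s \<le> 1" "cnorm C (s \<otimes> s \<ominus> r \<otimes> r) \<le> 1"
proof -
  define u where "u = s \<oplus> \<i> \<odot> r"
  have u: "u \<in> carrier C" using assms by (simp add: u_def)
  have au: "cadj C u = s \<oplus> (- \<i>) \<odot> r"
    using assms by (simp add: u_def cadj_add cadj_smult)
  have "cadj C u \<otimes> u = s \<otimes> s \<oplus> r \<otimes> r"
    unfolding au unfolding u_def using assms(1-5)
    by (simp add: star_algebra_simps) (rule lin3[of "s \<otimes> s" "s \<otimes> r" "r \<otimes> r"], simp_all)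
  then have "cnorm C (cadj C u \<otimes> u) \<le> 1" using norm_one_le one by simp
  then have n: "cnorm C u \<le> 1" by (rule norm_sq_le_1[OF u])
  then have na: "cnorm C (cadj C u) \<le> 1" using u by (simp add: norm_cadj)
  have "s = (1 / 2) \<odot> (u \<oplus> cadj C u)"
    unfolding au unfolding u_def using assms(1-5) by - (rule lin2[of s r], simp_all)
  moreover have "cnorm C ((1 / 2) \<odot> (u \<oplus> cadj C u)) \<le> 1"
    using u n na cnorm_triangle[of u "cadj C u"] by (simp add: cnorm_smult)
  ultimately show "cnorm C s \<le> 1" by simp
  have "s \<otimes> s \<ominus> r \<otimes> r = (1 / 2) \<odot> (u \<otimes> u \<oplus> cadj C u \<otimes> cadj C u)"
    unfolding au unfolding u_def using assms(1-5)
    by (simp add: star_algebra_simps) (rule lin3[of "s \<otimes> s" "s \<otimes> r" "r \<otimes> r"], simp_all)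
  moreover have "cnorm C (u \<otimes> u) \<le> 1" "cnorm C (cadj C u \<otimes> cadj C u) \<le> 1"
    using cnorm_mult[of u u] cnorm_mult[of "cadj C u" "cadj C u"] n na u
      mult_le_one[OF n cnorm_nonneg[OF u] n] mult_le_one[OF na _ na] cnorm_nonneg[of "cadj C u"] by auto
  ultimately show "cnorm C (s \<otimes> s \<ominus> r \<otimes> r) \<le> 1"
    using u cnorm_triangle[of "u \<otimes> u" "cadj C u \<otimes> cadj C u"] by (simp add: cnorm_smult)
qed

lemma sqrt_one_minus:
  assumes k: "k \<in> carrier C" "cadj C k = k" "cnorm C k \<le> 1"
  obtains r where "r \<in> carrier C" "cadj C r = r" "r \<otimes> r = \<one> \<ominus> k" "cnorm C (\<one> \<ominus> r) \<le> 1"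
    "\<And>x. x \<in> carrier C \<Longrightarrow> k \<otimes> x = x \<otimes> k \<Longrightarrow> r \<otimes> x = x \<otimes> r"
proof -
  obtain d where d: "clim (sqrt_iter k) d" "cnorm C d \<le> 1" "d \<oplus> d = k \<oplus> d \<otimes> d"
    using sqrt_exists[OF k(1,3)] by blast
  note c = climD(2)[OF d(1)]
  have sa: "cadj C d = d" using clim_self_adjoint[OF d(1)] sqrt_iter_cadj[OF k(1,2)] by blast
  define r where "r = \<one> \<ominus> d"
  have r: "r \<in> carrier C" "cadj C r = r" using c sa by (auto simp: r_def cadj_diff)
  have "r \<otimes> r = \<one> \<ominus> (d \<oplus> d) \<oplus> d \<otimes> d"
    unfolding r_def using c by (simp add: star_algebra_simps) (rule lin3[of \<one> d "d \<otimes> d"], simp_all)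
  also have "\<dots> = \<one> \<ominus> k"
    unfolding d(3) using c k by - (rule lin3[of \<one> k "d \<otimes> d"], simp_all)
  finally have rr: "r \<otimes> r = \<one> \<ominus> k" .
  have "\<one> \<ominus> r = d" unfolding r_def by (rule lin2[of \<one> d], use c in simp_all)
  then have n: "cnorm C (\<one> \<ominus> r) \<le> 1" using d(2) by simp
  have com: "r \<otimes> x = x \<otimes> r" if "x \<in> carrier C" "k \<otimes> x = x \<otimes> k" for x
    using clim_commute[OF d(1) that(1) sqrt_iter_commute[OF k(1) that]] that(1) c
    by (simp add: r_def diff_mult)
  show thesis by (rule that[OF r rr n com])
qed

lemma pos_if_norm:
  assumes "x \<in> carrier C" "cadj C x = x" "cnorm C (\<one> \<ominus> x) \<le> 1"
  obtains s where "s \<in> carrier C" "cadj C s = s" "s \<otimes> s = x" "cnorm C (\<one> \<ominus> s) \<le> 1"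
    "\<And>y. y \<in> carrier C \<Longrightarrow> x \<otimes> y = y \<otimes> x \<Longrightarrow> s \<otimes> y = y \<otimes> s"
proof -
  have k: "\<one> \<ominus> x \<in> carrier C" "cadj C (\<one> \<ominus> x) = \<one> \<ominus> x" using assms by (simp_all add: cadj_diff)
  obtain r where r: "r \<in> carrier C" "cadj C r = r" "r \<otimes> r = \<one> \<ominus> (\<one> \<ominus> x)" "cnorm C (\<one> \<ominus> r) \<le> 1"
    "\<And>y. y \<in> carrier C \<Longrightarrow> (\<one> \<ominus> x) \<otimes> y = y \<otimes> (\<one> \<ominus> x) \<Longrightarrow> r \<otimes> y = y \<otimes> r"
    using sqrt_one_minus[OF k assms(3)] by blast
  have e: "\<one> \<ominus> (\<one> \<ominus> x) = x" by (rule lin2[of \<one> x], use assms in simp_all)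
  have "r \<otimes> y = y \<otimes> r" if "y \<in> carrier C" "x \<otimes> y = y \<otimes> x" for y
    using r(5)[OF that(1)] that assms by (simp add: diff_mult)
  then show thesis using that[OF r(1,2)] r(3,4) e by simp
qed

lemma pos_if: "x \<in> carrier C \<Longrightarrow> cadj C x = x \<Longrightarrow> cnorm C (\<one> \<ominus> x) \<le> 1 \<Longrightarrow> pos x"
  by (erule (2) pos_if_norm) (auto simp: pos_def)

text \<open>For \<open>r = (1 - s\<^sup>2)\<^sup>1\<^sup>/\<^sup>2\<close> the norm of \<open>s\<^sup>2 - r\<^sup>2 = 2 s\<^sup>2 - 1\<close> is at most 1 by \<open>unitary_pair\<close>. Together with
  \<open>pos_if_norm\<close> this describes positive elements of norm at most 1 by the condition
  \<open>\<parallel>1 - x\<parallel> \<le> 1\<close>, which is convex.\<close>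

lemma norm_one_minus_square:
  assumes s: "s \<in> carrier C" "cadj C s = s" "cnorm C s \<le> 1"
  shows "cnorm C (\<one> \<ominus> s \<otimes> s) \<le> 1"
proof -
  have k: "s \<otimes> s \<in> carrier C" "cadj C (s \<otimes> s) = s \<otimes> s" using s by (simp_all add: cadj_mult)
  have "cnorm C (s \<otimes> s) \<le> 1"
    using cnorm_mult[OF s(1) s(1)] mult_le_one[OF s(3) cnorm_nonneg[OF s(1)] s(3)] by linarith
  then obtain r where r: "r \<in> carrier C" "cadj C r = r" "r \<otimes> r = \<one> \<ominus> s \<otimes> s"
    "\<And>x. x \<in> carrier C \<Longrightarrow> (s \<otimes> s) \<otimes> x = x \<otimes> (s \<otimes> s) \<Longrightarrow> r \<otimes> x = x \<otimes> r"
    using sqrt_one_minus[OF k] by blast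
  have "r \<otimes> s = s \<otimes> r" using r(4)[OF s(1)] s by (simp add: mult_assoc)
  moreover have "s \<otimes> s \<oplus> r \<otimes> r = \<one>" unfolding r(3) by (rule lin2[of \<one> "s \<otimes> s"], use s in simp_all)
  ultimately have n: "cnorm C (s \<otimes> s \<ominus> r \<otimes> r) \<le> 1" using unitary_pair s r by blast
  have "\<one> \<ominus> s \<otimes> s = (1 / 2) \<odot> (\<one> \<ominus> (s \<otimes> s \<ominus> r \<otimes> r))"
    unfolding r(3) by (rule lin2[of \<one> "s \<otimes> s"], use s in simp_all)
  then have "cnorm C (\<one> \<ominus> s \<otimes> s) = 1 / 2 * cnorm C (\<one> \<ominus> (s \<otimes> s \<ominus> r \<otimes> r))"
    using s(1) r(1) by (simp add: cnorm_smult)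
  also have "\<dots> \<le> 1" using norm_diff_triangle[of \<one> "s \<otimes> s \<ominus> r \<otimes> r"] n norm_one_le s(1) r(1) by simp
  finally show ?thesis .
qed

lemma pos_norm_one_minus: assumes "pos x" "cnorm C x \<le> 1" shows "cnorm C (\<one> \<ominus> x) \<le> 1"
proof -
  obtain s where s: "s \<in> carrier C" "cadj C s = s" "x = s \<otimes> s" using assms(1) by (auto simp: pos_def)
  have "cnorm C s \<le> 1" using norm_sq_le_1[of s] assms(2) s by simp
  then show ?thesis using norm_one_minus_square s by simp
qed

lemma pos_scaled_norm:
  assumes "pos x" "cnorm C x \<le> t" "0 < t"
  shows "cnorm C (\<one> \<ominus> complex_of_real (1 / t) \<odot> x) \<le> 1"
proof (rule pos_norm_one_minus)
  show "pos (complex_of_real (1 / t) \<odot> x)" using assms by (intro pos_scale) auto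
  show "cnorm C (complex_of_real (1 / t) \<odot> x) \<le> 1"
    using assms pos_closed[OF assms(1)] norm_real_smult[of x "1 / t"]
    by (simp add: divide_le_eq del: of_real_divide)
qed

lemma pos_norm_minus:
  assumes "pos x" "cnorm C x \<le> t" "0 < t"
  shows "cnorm C (complex_of_real t \<odot> \<one> \<ominus> x) \<le> t"
proof -
  note c = pos_closed[OF assms(1)]
  have "complex_of_real t \<odot> \<one> \<ominus> x = complex_of_real t \<odot> (\<one> \<ominus> complex_of_real (1 / t) \<odot> x)"
    by (rule lin2[of \<one> x], use c assms(3) in simp_all)
  then show ?thesis using pos_scaled_norm[OF assms] c assms(3) norm_real_smult[of "\<one> \<ominus> complex_of_real (1 / t) \<odot> x" t]
    by simp
qed

lemma pos_sqrt:
  assumes "pos x"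
  obtains s where "s \<in> carrier C" "cadj C s = s" "s \<otimes> s = x" "pos s"
    "\<And>y. y \<in> carrier C \<Longrightarrow> x \<otimes> y = y \<otimes> x \<Longrightarrow> s \<otimes> y = y \<otimes> s"
proof -
  note c = pos_closed[OF assms]
  define t where "t = cnorm C x + 1"
  have t: "t > 0" "cnorm C x \<le> t" using cnorm_nonneg[OF c] by (auto simp: t_def)
  define x' where "x' = complex_of_real (1 / t) \<odot> x"
  have x': "x' \<in> carrier C" "cadj C x' = x'"
    using c pos_self_adjoint[OF assms] by (simp_all add: x'_def cadj_smult)
  obtain s where s: "s \<in> carrier C" "cadj C s = s" "s \<otimes> s = x'" "cnorm C (\<one> \<ominus> s) \<le> 1"
    "\<And>y. y \<in> carrier C \<Longrightarrow> x' \<otimes> y = y \<otimes> x' \<Longrightarrow> s \<otimes> y = y \<otimes> s"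
    using pos_if_norm[OF x'] pos_scaled_norm[OF assms t(2,1)] unfolding x'_def by blast
  define u where "u = complex_of_real (sqrt t) \<odot> s"
  have u: "u \<in> carrier C" "cadj C u = u" using s by (simp_all add: u_def cadj_smult)
  have "u \<otimes> u = complex_of_real t \<odot> (s \<otimes> s)"
    using s(1) t by (simp add: u_def smult_mult_left smult_mult_right scale_simps(1) of_real_mult[symmetric] del: of_real_mult)
  also have "\<dots> = x" unfolding s(3) x'_def using t c by (simp add: scale_simps(1,2))
  finally have uu: "u \<otimes> u = x" .
  have p: "pos u" unfolding u_def using t s by (intro pos_scale pos_if) auto
  have com: "u \<otimes> y = y \<otimes> u" if "y \<in> carrier C" "x \<otimes> y = y \<otimes> x" for y
    using s(5)[OF that(1)] that s(1) c by (simp add: u_def x'_def smult_mult_left smult_mult_right)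
  show thesis by (rule that[OF u uu p com])
qed

text \<open>After scaling, \<open>\<parallel>1 - x\<parallel> \<le> 1\<close> and \<open>\<parallel>1 - y\<parallel> \<le> 1\<close> imply the same for \<open>(x + y) / 2\<close>.\<close>

lemma pos_add:
  assumes "pos x" "pos y"
  shows "pos (x \<oplus> y)"
proof -
  note c = pos_closed[OF assms(1)] pos_closed[OF assms(2)]
  define t where "t = cnorm C x + cnorm C y + 1"
  have t: "t > 0" "cnorm C x \<le> t" "cnorm C y \<le> t" using cnorm_nonneg c by (auto simp: t_def add_nonneg_pos)
  define x' y' where "x' = complex_of_real (1 / t) \<odot> x" and "y' = complex_of_real (1 / t) \<odot> y"
  have n: "cnorm C (\<one> \<ominus> x') \<le> 1" "cnorm C (\<one> \<ominus> y') \<le> 1"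
    unfolding x'_def y'_def using assms t by (simp_all only: pos_scaled_norm)
  have c': "x' \<in> carrier C" "y' \<in> carrier C" using c by (auto simp: x'_def y'_def)
  define z where "z = (1 / 2) \<odot> (x' \<oplus> y')"
  have z: "z \<in> carrier C" "cadj C z = z" using c c' pos_self_adjoint assms
    by (auto simp: z_def x'_def y'_def cadj_add cadj_smult)
  have "\<one> \<ominus> z = (1 / 2) \<odot> ((\<one> \<ominus> x') \<oplus> (\<one> \<ominus> y'))"
    unfolding z_def by (rule lin3[of \<one> x' y'], use c' in simp_all)
  then have "cnorm C (\<one> \<ominus> z) \<le> 1"
    using cnorm_triangle[of "\<one> \<ominus> x'" "\<one> \<ominus> y'"] n c' by (simp add: cnorm_smult)
  then have "pos (complex_of_real (2 * t) \<odot> z)" using z t by (intro pos_scale pos_if) auto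
  moreover have "complex_of_real (2 * t) \<odot> z = x \<oplus> y"
    unfolding z_def x'_def y'_def by (rule lin2[of x y], use c t in simp_all)
  ultimately show ?thesis by simp
qed

text \<open>\<open>1 - x = (1 - (x + y)) + y\<close> is positive, and it has a square root that commutes with a square root of \<open>x\<close>.
  So \<open>unitary_pair\<close> applies to these two roots.\<close>

lemma pos_add_norm_le_1:
  assumes "pos x" "pos y" "cnorm C (x \<oplus> y) \<le> 1"
  shows "cnorm C x \<le> 1"
proof -
  note c = pos_closed[OF assms(1)] pos_closed[OF assms(2)]
  have sa: "cadj C x = x" "cadj C y = y" using pos_self_adjoint assms by auto
  have "\<one> \<ominus> (\<one> \<ominus> (x \<oplus> y)) = x \<oplus> y" by (rule lin3[of \<one> x y], use c in simp_all)
  then have "pos (\<one> \<ominus> (x \<oplus> y))" using assms(3) c sa by (intro pos_if) (auto simp: cadj_diff cadj_add)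
  then have "pos ((\<one> \<ominus> (x \<oplus> y)) \<oplus> y)" using assms(2) by (rule pos_add)
  moreover have "(\<one> \<ominus> (x \<oplus> y)) \<oplus> y = \<one> \<ominus> x" by (rule lin3[of \<one> x y], use c in simp_all)
  ultimately have "pos (\<one> \<ominus> x)" by simp
  then obtain r where r: "r \<in> carrier C" "cadj C r = r" "r \<otimes> r = \<one> \<ominus> x"
    "\<And>y. y \<in> carrier C \<Longrightarrow> (\<one> \<ominus> x) \<otimes> y = y \<otimes> (\<one> \<ominus> x) \<Longrightarrow> r \<otimes> y = y \<otimes> r"
    using pos_sqrt by blast
  obtain s where s: "s \<in> carrier C" "cadj C s = s" "x = s \<otimes> s" using assms(1) by (auto simp: pos_def)
  have "r \<otimes> s = s \<otimes> r" using r(4)[OF s(1)] s by (simp add: diff_mult mult_assoc)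
  moreover have "s \<otimes> s \<oplus> r \<otimes> r = \<one>" unfolding r(3) s(3)[symmetric] by (rule lin2[of \<one> x], use c in simp_all)
  ultimately have "cnorm C s \<le> 1" using unitary_pair s r by blast
  then show ?thesis using cnorm_mult[of s s] s mult_le_one[of "cnorm C s" "cnorm C s"] cnorm_nonneg[of s] by auto
qed

lemma pos_norm_mono:
  assumes "pos x" "pos y"
  shows "cnorm C x \<le> cnorm C (x \<oplus> y)"
proof (rule field_le_epsilon)
  fix e :: real assume e: "e > 0"
  note c = pos_closed[OF assms(1)] pos_closed[OF assms(2)]
  define t where "t = cnorm C (x \<oplus> y) + e"
  have t: "t > 0" using e cnorm_nonneg[of "x \<oplus> y"] c by (simp add: t_def)
  let ?c = "complex_of_real (1 / t)"
  have "cnorm C (?c \<odot> x \<oplus> ?c \<odot> y) = 1 / t * cnorm C (x \<oplus> y)"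
    using norm_real_smult[of "x \<oplus> y" "1 / t"] c t by (simp add: scale_simps)
  also have "\<dots> \<le> 1" using t e by (simp add: t_def)
  finally have "cnorm C (?c \<odot> x) \<le> 1"
    using assms t by (intro pos_add_norm_le_1[of "?c \<odot> x" "?c \<odot> y"] pos_scale) auto
  then show "cnorm C x \<le> cnorm C (x \<oplus> y) + e"
    using norm_real_smult[of x "1 / t"] c t
    by (simp add: t_def[symmetric] divide_le_eq del: of_real_divide)
qed

lemma pos_cube:
  assumes "pos h"
  shows "pos (h \<otimes> (h \<otimes> h))"
proof -
  note c = pos_closed[OF assms] pos_self_adjoint[OF assms]
  obtain s where s: "s \<in> carrier C" "cadj C s = s" "h = s \<otimes> s" using assms by (auto simp: pos_def)
  have sh: "s \<otimes> h = h \<otimes> s" using s by (simp add: mult_assoc)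
  have "pos ((h \<otimes> s) \<otimes> (h \<otimes> s))"
    using s c sh by (intro posI) (auto simp: cadj_mult)
  moreover have "(h \<otimes> s) \<otimes> (h \<otimes> s) = h \<otimes> (h \<otimes> h)"
    using s(1) by (simp add: s(3) mult_assoc)
  ultimately show ?thesis by simp
qed

text \<open>Let \<open>k = y y\<^sup>*\<close> and let \<open>e\<close> be the common norm of \<open>h\<close> and \<open>k\<close>. As \<open>y h = - k y\<close>, the element
  \<open>w = y (e + h)\<close> equals \<open>(e - k) y\<close>, so \<open>\<parallel>w\<parallel>\<^sup>2 \<le> e\<^sup>3\<close>. On the other hand
  \<open>- w\<^sup>* w = e\<^sup>2 h + 2 e h\<^sup>2 + h\<^sup>3\<close> has norm at least \<open>2 e \<parallel>h\<parallel>\<^sup>2 = 2 e\<^sup>3\<close>.\<close>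

lemma opposite_squares_zero:
  assumes y: "y \<in> carrier C" and h: "pos h" and k: "pos (y \<otimes> cadj C y)"
    and yh: "h \<oplus> cadj C y \<otimes> y = \<zero>"
  shows "h = \<zero>"
proof (rule ccontr)
  assume "h \<noteq> \<zero>"
  define k where "k = y \<otimes> cadj C y"
  define e where "e = cnorm C h"
  let ?e = "complex_of_real e"
  note c = pos_closed[OF h] y
  have sa: "cadj C h = h" by (rule pos_self_adjoint[OF h])
  have kc: "k \<in> carrier C" using y by (simp add: k_def)
  have e0: "e > 0" using \<open>h \<noteq> \<zero>\<close> cnorm_eq_0[OF c(1)] cnorm_nonneg[OF c(1)] by (simp add: e_def)
  have yy: "cadj C y \<otimes> y = (- 1) \<odot> h"
    using yh c by (metis M.minus_equality M.minus_minus M.a_inv_closed neg_eq_scale mult_closed cadj_closed)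
  have "(cnorm C y)\<^sup>2 = e" using cstar_identity[OF y] yy c by (simp add: e_def cnorm_smult)
  moreover have "cnorm C k = (cnorm C y)\<^sup>2"
    using cstar_identity[of "cadj C y"] y by (simp add: k_def cadj_cadj norm_cadj)
  ultimately have ny: "(cnorm C y)\<^sup>2 = e" and nk: "cnorm C k = e" by auto
  define w where "w = y \<otimes> (?e \<odot> \<one> \<oplus> h)"
  have wc: "w \<in> carrier C" using c by (simp add: w_def)
  have yhk: "y \<otimes> h = (- 1) \<odot> (k \<otimes> y)"
  proof -
    have "k \<otimes> y = y \<otimes> ((- 1) \<odot> h)" using c by (simp add: k_def mult_assoc yy)
    then show ?thesis using c by (simp add: smult_mult_right scale_simps(1,2))
  qed
  have "w = (?e \<odot> \<one> \<ominus> k) \<otimes> y"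
    unfolding w_def using c kc
    by (simp add: star_algebra_simps yhk) (rule lin2[of y "k \<otimes> y"], simp_all)
  then have "cnorm C w \<le> cnorm C (?e \<odot> \<one> \<ominus> k) * cnorm C y" using cnorm_mult c kc by simp
  also have "\<dots> \<le> e * cnorm C y"
    using pos_norm_minus[of k e] k nk e0 cnorm_nonneg[OF y] by (intro mult_right_mono) (auto simp: k_def)
  finally have "(cnorm C w)\<^sup>2 \<le> (e * cnorm C y)\<^sup>2"
    using cnorm_nonneg[OF wc] by (intro power_mono) auto
  then have up: "(cnorm C w)\<^sup>2 \<le> e ^ 3" using ny by (simp add: power_mult_distrib power3_eq_cube power2_eq_square[of e])
  have "cadj C w \<otimes> w = (?e \<odot> \<one> \<oplus> h) \<otimes> ((cadj C y \<otimes> y) \<otimes> (?e \<odot> \<one> \<oplus> h))"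
    unfolding w_def using c sa by (simp add: cadj_mult cadj_add cadj_smult mult_assoc)
  also have "\<dots> = (- 1) \<odot> (complex_of_real (2 * e) \<odot> (h \<otimes> h) \<oplus> (complex_of_real (e\<^sup>2) \<odot> h \<oplus> h \<otimes> (h \<otimes> h)))"
    unfolding yy using c
    by (simp add: star_algebra_simps) (rule lin3[of h "h \<otimes> h" "h \<otimes> (h \<otimes> h)"], simp_all add: power2_eq_square)
  finally have w2: "cadj C w \<otimes> w = \<dots>" .
  have "2 * e * e\<^sup>2 = cnorm C (complex_of_real (2 * e) \<odot> (h \<otimes> h))"
    using norm_real_smult[of "h \<otimes> h" "2 * e"] e0 c sa norm_self_adjoint_square[OF c(1) sa] by (simp add: e_def)
  also have "\<dots> \<le> cnorm C (complex_of_real (2 * e) \<odot> (h \<otimes> h) \<oplus> (complex_of_real (e\<^sup>2) \<odot> h \<oplus> h \<otimes> (h \<otimes> h)))"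
    using h e0 c sa by (intro pos_norm_mono pos_add pos_scale pos_cube posI) auto
  also have "\<dots> = (cnorm C w)\<^sup>2"
    using cstar_identity[OF wc] w2 c by (simp add: cnorm_smult)
  finally have "2 * e ^ 3 \<le> e ^ 3" using up by (simp add: power3_eq_cube power2_eq_square)
  then show False using e0 by simp
qed

text \<open>Kaplansky's argument: let \<open>a = z\<^sup>* z\<close>, \<open>b = |a|\<close> and \<open>n = b - a\<close>, twice the negative part of \<open>a\<close>. For \<open>y = z n\<close>
  both \<open>- y\<^sup>* y = n b n\<close> and \<open>y y\<^sup>* = (y y\<^sup>* + y\<^sup>* y) + n b n\<close> are positive, which is only possible if they
  vanish. Then \<open>n = 0\<close> and \<open>a = |a|\<close>.\<close>

theorem pos_cadj_mult:
  assumes z: "z \<in> carrier C"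
  shows "pos (cadj C z \<otimes> z)"
proof -
  define a where "a = cadj C z \<otimes> z"
  have a: "a \<in> carrier C" "cadj C a = a" using z by (simp_all add: a_def cadj_mult cadj_cadj)
  obtain b where b: "b \<in> carrier C" "cadj C b = b" "b \<otimes> b = a \<otimes> a" "pos b"
    "\<And>y. y \<in> carrier C \<Longrightarrow> (a \<otimes> a) \<otimes> y = y \<otimes> (a \<otimes> a) \<Longrightarrow> b \<otimes> y = y \<otimes> b"
    using pos_sqrt[OF posI[OF a]] by blast
  have ba: "b \<otimes> a = a \<otimes> b" using b(5)[OF a(1)] a by (simp add: mult_assoc)
  define n where "n = b \<ominus> a"
  have n: "n \<in> carrier C" "cadj C n = n" using a b(1,2) by (simp_all add: n_def cadj_diff)
  have an: "a \<otimes> n = (- 1) \<odot> (b \<otimes> n)"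
    unfolding n_def using a b(1) by (simp add: diff_mult ba b(3)) (rule lin2[of "a \<otimes> b" "a \<otimes> a"], simp_all)
  have bn: "b \<otimes> n = n \<otimes> b" using a b(1) by (simp add: n_def diff_mult ba)
  obtain s where s: "s \<in> carrier C" "cadj C s = s" "s \<otimes> s = b"
    "\<And>y. y \<in> carrier C \<Longrightarrow> b \<otimes> y = y \<otimes> b \<Longrightarrow> s \<otimes> y = y \<otimes> s"
    using pos_sqrt[OF b(4)] by blast
  have sn: "s \<otimes> n = n \<otimes> s" using s(4)[OF n(1) bn] .
  define h where "h = (s \<otimes> n) \<otimes> (s \<otimes> n)"
  have hp: "pos h" unfolding h_def using s n sn by (intro posI) (auto simp: cadj_mult)
  have hc: "h \<in> carrier C" using hp by (rule pos_closed)
  have h: "h = n \<otimes> (b \<otimes> n)"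
    unfolding h_def s(3)[symmetric] using s(1) n sn by (simp add: mult_assoc)
  define y where "y = z \<otimes> n"
  have y: "y \<in> carrier C" using z n by (simp add: y_def)
  have "cadj C y \<otimes> y = n \<otimes> (a \<otimes> n)"
    unfolding y_def a_def using z n by (simp add: cadj_mult mult_assoc)
  also have "\<dots> = (- 1) \<odot> h" unfolding an h using n b by (simp add: smult_mult_right)
  finally have yy: "cadj C y \<otimes> y = (- 1) \<odot> h" .
  have yh: "h \<oplus> cadj C y \<otimes> y = \<zero>" unfolding yy by (rule lin2[of h h], use hc in simp_all)
  \<comment> \<open>Twice the real part and, up to sign, twice the imaginary part of \<open>y\<close>; half the sum of their squares is \<open>y\<^sup>* y + y y\<^sup>*\<close>.\<close>
  define p q where "p = y \<oplus> cadj C y" and "q = \<i> \<odot> (y \<ominus> cadj C y)"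
  have pq: "p \<in> carrier C" "q \<in> carrier C" using y by (simp_all add: p_def q_def)
  have psa: "cadj C p = p" using y by (simp add: p_def cadj_add cadj_cadj M.a_comm)
  have qsa: "cadj C q = q"
    unfolding q_def using y by (simp add: cadj_smult cadj_diff cadj_cadj) (rule lin2[of y "cadj C y"], simp_all)
  have "y \<otimes> cadj C y = (complex_of_real (1 / 2) \<odot> (p \<otimes> p) \<oplus> complex_of_real (1 / 2) \<odot> (q \<otimes> q)) \<oplus> (- 1) \<odot> (cadj C y \<otimes> y)"
    unfolding p_def q_def using y
    by (simp add: star_algebra_simps) (rule lin5[of "y \<otimes> y" "y \<otimes> cadj C y" "cadj C y \<otimes> y" "cadj C y \<otimes> cadj C y" y], simp_all)
  also have "\<dots> = (complex_of_real (1 / 2) \<odot> (p \<otimes> p) \<oplus> complex_of_real (1 / 2) \<odot> (q \<otimes> q)) \<oplus> h"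
    unfolding yy using hc by (simp add: scale_simps(1,2))
  finally have "pos (y \<otimes> cadj C y)"
    using pos_add[OF pos_add[OF pos_scale[OF posI[OF pq(1) psa], of "1/2"] pos_scale[OF posI[OF pq(2) qsa], of "1/2"]] hp]
    by simp
  then have "h = \<zero>" by (rule opposite_squares_zero[OF y hp _ yh])
  have snz: "s \<otimes> n = \<zero>"
  proof -
    have "cadj C (s \<otimes> n) = s \<otimes> n" using s n sn by (simp add: cadj_mult)
    then have "(cnorm C (s \<otimes> n))\<^sup>2 = 0"
      using norm_self_adjoint_square[of "s \<otimes> n"] \<open>h = \<zero>\<close> s n by (simp add: h_def)
    then show ?thesis using cnorm_eq_0[of "s \<otimes> n"] s n by simp
  qed
  have bn0: "b \<otimes> n = \<zero>" using mult_assoc[of s s n] s(1,3) n(1) snz by simp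
  then have an0: "a \<otimes> n = \<zero>" using an by (simp add: scale_simps)
  have "n \<otimes> n = b \<otimes> n \<ominus> a \<otimes> n" using a(1) b(1) n(1) diff_mult(1)[of b a n] by (simp only: n_def)
  then have "n \<otimes> n = \<zero>" using bn0 an0 by (simp add: diff_self)
  then have "n = \<zero>" using norm_self_adjoint_square[OF n] cnorm_eq_0[OF n(1)] by simp
  then have "b = a" using diff_eq_zero[OF b(1) a(1)] by (simp add: n_def)
  then show ?thesis using b(4) by (simp add: a_def)
qed

theorem norm_sum_squares_mono:
  assumes "x \<in> carrier C" "y \<in> carrier C"
  shows "cnorm C (cadj C x \<otimes> x) \<le> cnorm C (cadj C x \<otimes> x \<oplus> cadj C y \<otimes> y)"
  using assms by (intro pos_norm_mono pos_cadj_mult)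

text \<open>The subalgebra need not contain the unit. The iterates for \<open>1 - a\<close> have the form \<open>t\<^sub>n - y\<^sub>n\<close> with \<open>y\<^sub>n\<close> in
  the subalgebra and scalars \<open>t\<^sub>n\<close> that tend to 1; so \<open>y\<^sub>n\<close> tends to the square root of \<open>a\<close>.\<close>

theorem pos_sqrt_subalgebra:
  assumes S: "closed_star_subalgebra C S" and a: "pos a" "a \<in> S"
  obtains s where "s \<in> S" "cadj C s = s" "s \<otimes> s = a"
proof -
  note S' = subalgebraD[OF S]
  note c = pos_closed[OF a(1)]
  define t where "t = cnorm C a + 1"
  have t: "t > 0" "cnorm C a \<le> t" using cnorm_nonneg[OF c] by (auto simp: t_def)
  define a' where "a' = complex_of_real (1 / t) \<odot> a"
  have a': "a' \<in> S" "a' \<in> carrier C" "cadj C a' = a'"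
    using c a S' pos_self_adjoint[OF a(1)] by (simp_all add: a'_def cadj_smult)
  define k where "k = \<one> \<ominus> a'"
  have "cnorm C k \<le> 1" using pos_scaled_norm[OF a(1) t(2,1)] by (simp only: k_def a'_def)
  then have k: "k \<in> carrier C" "cadj C k = k" "cnorm C k \<le> 1"
    using a' by (simp_all add: k_def cadj_diff)
  obtain d where d: "clim (sqrt_iter k) d" "cnorm C d \<le> 1" "d \<oplus> d = k \<oplus> d \<otimes> d"
    using sqrt_exists[OF k(1,3)] by blast
  note dc = climD(2)[OF d(1)]
  let ?p = "\<lambda>n. complex_of_real (sqrt_majorant n)"
  have mem: "?p n \<odot> \<one> \<ominus> sqrt_iter k n \<in> S" for n
  proof (induction n)
    case 0
    then show ?case using S'(2) by (simp add: scale_simps diff_self)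
  next
    case (Suc n)
    let ?x = "sqrt_iter k n"
    define y where "y = ?p n \<odot> \<one> \<ominus> ?x"
    have y: "y \<in> S" "y \<in> carrier C" using Suc k by (simp_all add: y_def)
    have x: "?x = ?p n \<odot> \<one> \<ominus> y" unfolding y_def by (rule lin2[of \<one> ?x], use k in simp_all)
    have "?p (Suc n) \<odot> \<one> \<ominus> sqrt_iter k (Suc n) = (1 / 2) \<odot> a' \<oplus> (?p n \<odot> y \<ominus> (1 / 2) \<odot> (y \<otimes> y))"
      unfolding sqrt_iter.simps k_def[symmetric] x unfolding k_def using y(2) a'(2)
      by (simp add: star_algebra_simps) (rule lin5[of \<one> a' y "y \<otimes> y" y], simp_all add: power2_eq_square field_simps)
    also have "\<dots> \<in> S" using y a' S' by simp
    finally show ?case .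
  qed
  have "clim (\<lambda>n. ?p n \<odot> \<one>) \<one>"
  proof (rule climI)
    have "(\<lambda>n. 1 - sqrt_majorant n) \<longlonglongrightarrow> 1 - 1"
      by (rule tendsto_diff[OF tendsto_const sqrt_majorant_LIMSEQ])
    then show "(\<lambda>n. 1 - sqrt_majorant n) \<longlonglongrightarrow> 0" by simp
    show "cnorm C (?p n \<odot> \<one> \<ominus> \<one>) \<le> 1 - sqrt_majorant n" for n
    proof -
      have "?p n \<odot> \<one> \<ominus> \<one> = complex_of_real (sqrt_majorant n - 1) \<odot> \<one>"
        by (rule lin2[of \<one> \<one>], simp_all)
      then have "cnorm C (?p n \<odot> \<one> \<ominus> \<one>) = (1 - sqrt_majorant n) * cnorm C \<one>"
        using cnorm_smult[of \<one> "complex_of_real (sqrt_majorant n - 1)"] sqrt_majorant_bounds(2)[of n]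
        by (simp only: norm_of_real one_mem) simp
      also have "\<dots> \<le> (1 - sqrt_majorant n) * 1"
        using norm_one_le sqrt_majorant_bounds(2)[of n] by (intro mult_left_mono) auto
      finally show ?thesis by simp
    qed
  qed auto
  then have "clim (\<lambda>n. ?p n \<odot> \<one> \<ominus> sqrt_iter k n) (\<one> \<ominus> d)" using d(1) by (rule clim_diff)
  then have dS: "\<one> \<ominus> d \<in> S" using mem S'(8) by (rule clim_closed)
  define r where "r = \<one> \<ominus> d"
  have sa: "cadj C d = d" using clim_self_adjoint[OF d(1)] sqrt_iter_cadj[OF k(1,2)] by blast
  have r: "r \<in> S" "cadj C r = r" "r \<in> carrier C" using dS sa dc by (auto simp: r_def cadj_diff)
  have "r \<otimes> r = \<one> \<ominus> (d \<oplus> d) \<oplus> d \<otimes> d"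
    unfolding r_def using dc by (simp add: star_algebra_simps) (rule lin3[of \<one> d "d \<otimes> d"], simp_all)
  also have "\<dots> = a'"
    unfolding d(3) k_def using dc a' by - (rule lin3[of \<one> a' "d \<otimes> d"], simp_all)
  finally have rr: "r \<otimes> r = a'" .
  define s where "s = complex_of_real (sqrt t) \<odot> r"
  have "s \<in> S" "cadj C s = s" using r S' by (auto simp: s_def cadj_smult)
  moreover have "s \<otimes> s = complex_of_real t \<odot> (r \<otimes> r)"
    using r(3) t by (simp add: s_def smult_mult_left smult_mult_right scale_simps(1) of_real_mult[symmetric] del: of_real_mult)
  then have "s \<otimes> s = a" unfolding rr a'_def using t c by (simp add: scale_simps(1,2))
  ultimately show thesis using that by blast
qed

end

section \<open>Adjointable operators\<close>

locale ip_module = B: cstar_algebra B + E: cmodule E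
  for B :: "'b cstar" and E :: "('b, 'e) hmod" +
  assumes ract_closed: "\<lbrakk>x \<in> carrier E; b \<in> carrier B\<rbrakk> \<Longrightarrow> ract E x b \<in> carrier E"
    and inn_closed: "\<lbrakk>x \<in> carrier E; y \<in> carrier E\<rbrakk> \<Longrightarrow> inn E x y \<in> carrier B"
    and inn_add_right: "\<lbrakk>x \<in> carrier E; y \<in> carrier E; y' \<in> carrier E\<rbrakk>
      \<Longrightarrow> inn E x (y \<oplus>\<^bsub>E\<^esub> y') = inn E x y \<oplus>\<^bsub>B\<^esub> inn E x y'"
    and inn_smult_right: "\<lbrakk>x \<in> carrier E; y \<in> carrier E\<rbrakk>
      \<Longrightarrow> inn E x (z \<odot>\<^bsub>E\<^esub> y) = z \<odot>\<^bsub>B\<^esub> inn E x y"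
    and inn_ract_right: "\<lbrakk>x \<in> carrier E; y \<in> carrier E; b \<in> carrier B\<rbrakk>
      \<Longrightarrow> inn E x (ract E y b) = inn E x y \<otimes>\<^bsub>B\<^esub> b"
    and inn_cadj: "\<lbrakk>x \<in> carrier E; y \<in> carrier E\<rbrakk> \<Longrightarrow> cadj B (inn E x y) = inn E y x"
    and inn_eq_0: "x \<in> carrier E \<Longrightarrow> inn E x x = \<zero>\<^bsub>B\<^esub> \<Longrightarrow> x = \<zero>\<^bsub>E\<^esub>"
begin

abbreviation nm :: "'e \<Rightarrow> real" where "nm \<equiv> hnorm B E"
abbreviation L where "L \<equiv> adjointable_ops B E"

lemmas mem [simp, intro] = ract_closed inn_closed

lemma diff_closed [simp, intro]: "x \<in> carrier E \<Longrightarrow> y \<in> carrier E \<Longrightarrow> x \<ominus>\<^bsub>E\<^esub> y \<in> carrier E"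
  by (rule E.M.minus_closed)

lemma inn_zero [simp]: "x \<in> carrier E \<Longrightarrow> inn E x \<zero>\<^bsub>E\<^esub> = \<zero>\<^bsub>B\<^esub>"
  using inn_smult_right[of x x 0] by (simp add: E.scale_simps B.scale_simps)

lemma inn_diff_right: "\<lbrakk>x \<in> carrier E; y \<in> carrier E; y' \<in> carrier E\<rbrakk>
    \<Longrightarrow> inn E x (y \<ominus>\<^bsub>E\<^esub> y') = inn E x y \<ominus>\<^bsub>B\<^esub> inn E x y'"
  by (simp add: E.diff_eq_scale B.diff_eq_scale inn_add_right inn_smult_right)

lemma inn_add_left: "\<lbrakk>x \<in> carrier E; x' \<in> carrier E; y \<in> carrier E\<rbrakk>
    \<Longrightarrow> inn E (x \<oplus>\<^bsub>E\<^esub> x') y = inn E x y \<oplus>\<^bsub>B\<^esub> inn E x' y"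
  using inn_cadj[of y "x \<oplus>\<^bsub>E\<^esub> x'"] by (simp add: inn_add_right B.cadj_add inn_cadj)

lemma inn_smult_left: "\<lbrakk>x \<in> carrier E; y \<in> carrier E\<rbrakk>
    \<Longrightarrow> inn E (z \<odot>\<^bsub>E\<^esub> x) y = cnj z \<odot>\<^bsub>B\<^esub> inn E x y"
  using inn_cadj[of y "z \<odot>\<^bsub>E\<^esub> x"] by (simp add: inn_smult_right B.cadj_smult inn_cadj)

lemma inn_diff_left: "\<lbrakk>x \<in> carrier E; x' \<in> carrier E; y \<in> carrier E\<rbrakk>
    \<Longrightarrow> inn E (x \<ominus>\<^bsub>E\<^esub> x') y = inn E x y \<ominus>\<^bsub>B\<^esub> inn E x' y"
  by (simp add: E.diff_eq_scale B.diff_eq_scale inn_add_left inn_smult_left)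

lemma inn_ract_left: "\<lbrakk>x \<in> carrier E; y \<in> carrier E; b \<in> carrier B\<rbrakk>
    \<Longrightarrow> inn E (ract E x b) y = cadj B b \<otimes>\<^bsub>B\<^esub> inn E x y"
  using inn_cadj[of y "ract E x b"] by (simp add: inn_ract_right B.cadj_mult inn_cadj)

lemma eqI:
  assumes "x \<in> carrier E" "y \<in> carrier E" "\<And>z. z \<in> carrier E \<Longrightarrow> inn E x z = inn E y z"
  shows "x = y"
proof -
  have "inn E (x \<ominus>\<^bsub>E\<^esub> y) (x \<ominus>\<^bsub>E\<^esub> y) = \<zero>\<^bsub>B\<^esub>"
    using assms by (simp add: inn_diff_left B.diff_self)
  then have "x \<ominus>\<^bsub>E\<^esub> y = \<zero>\<^bsub>E\<^esub>" using inn_eq_0 assms by simp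
  then show ?thesis using E.diff_eq_zero assms by simp
qed

lemma nm_nonneg [simp]: "x \<in> carrier E \<Longrightarrow> 0 \<le> nm x"
  by (simp add: hnorm_def B.cnorm_nonneg)

lemma nm_sq: "x \<in> carrier E \<Longrightarrow> (nm x)\<^sup>2 = cnorm B (inn E x x)"
  by (simp add: hnorm_def B.cnorm_nonneg)

lemma nm_zero [simp]: "nm \<zero>\<^bsub>E\<^esub> = 0"
  by (simp add: hnorm_def)

lemma nm_eq_0: "x \<in> carrier E \<Longrightarrow> nm x = 0 \<longleftrightarrow> x = \<zero>\<^bsub>E\<^esub>"
  using inn_eq_0[of x] B.cnorm_eq_0[of "inn E x x"] by (auto simp: hnorm_def)

lemma nm_smult: "x \<in> carrier E \<Longrightarrow> nm (z \<odot>\<^bsub>E\<^esub> x) = cmod z * nm x"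
  by (simp add: hnorm_def inn_smult_left inn_smult_right B.cnorm_smult real_sqrt_mult)

end

text \<open>The Cauchy-Schwarz inequality is an axiom here instead of the positivity of the inner
  product. For a C*-algebra over itself it is obvious, and the theory of adjointable operators in this
  case is what proves it for all Hilbert modules.\<close>

locale cs_module = ip_module B E for B :: "'b cstar" and E :: "('b, 'e) hmod" +
  assumes complete: "complete_wrt (carrier E) (\<lambda>x y. hnorm B E (x \<ominus>\<^bsub>E\<^esub> y))"
    and cauchy_schwarz: "\<lbrakk>x \<in> carrier E; y \<in> carrier E\<rbrakk>
      \<Longrightarrow> cnorm B (inn E x y) \<le> hnorm B E x * hnorm B E y"
begin

lemma nm_triangle:
  assumes "x \<in> carrier E" "y \<in> carrier E"
  shows "nm (x \<oplus>\<^bsub>E\<^esub> y) \<le> nm x + nm y"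
proof (rule power2_le_imp_le)
  have "(nm (x \<oplus>\<^bsub>E\<^esub> y))\<^sup>2 = cnorm B ((inn E x x \<oplus>\<^bsub>B\<^esub> inn E y x) \<oplus>\<^bsub>B\<^esub> (inn E x y \<oplus>\<^bsub>B\<^esub> inn E y y))"
    using assms by (simp add: nm_sq inn_add_left inn_add_right)
  also have "\<dots> \<le> (cnorm B (inn E x x) + cnorm B (inn E y x)) + (cnorm B (inn E x y) + cnorm B (inn E y y))"
    using assms by (intro order_trans[OF B.cnorm_triangle] add_mono B.cnorm_triangle) auto
  also have "\<dots> \<le> (nm x * nm x + nm y * nm x) + (nm x * nm y + nm y * nm y)"
    using assms by (intro add_mono cauchy_schwarz)
  also have "\<dots> = (nm x + nm y)\<^sup>2" by (simp add: power2_eq_square algebra_simps)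
  finally show "(nm (x \<oplus>\<^bsub>E\<^esub> y))\<^sup>2 \<le> (nm x + nm y)\<^sup>2" .
qed (use assms in simp)

lemma nm_diff_commute:
  assumes "x \<in> carrier E" "y \<in> carrier E"
  shows "nm (x \<ominus>\<^bsub>E\<^esub> y) = nm (y \<ominus>\<^bsub>E\<^esub> x)"
proof -
  have "x \<ominus>\<^bsub>E\<^esub> y = (- 1) \<odot>\<^bsub>E\<^esub> (y \<ominus>\<^bsub>E\<^esub> x)" by (rule E.lin2[OF assms], simp)
  then show ?thesis using nm_smult[of "y \<ominus>\<^bsub>E\<^esub> x" "-1"] assms by simp
qed

lemma nm_diff_trans:
  assumes "x \<in> carrier E" "y \<in> carrier E" "z \<in> carrier E"
  shows "nm (x \<ominus>\<^bsub>E\<^esub> z) \<le> nm (x \<ominus>\<^bsub>E\<^esub> y) + nm (y \<ominus>\<^bsub>E\<^esub> z)"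
proof -
  have "x \<ominus>\<^bsub>E\<^esub> z = (x \<ominus>\<^bsub>E\<^esub> y) \<oplus>\<^bsub>E\<^esub> (y \<ominus>\<^bsub>E\<^esub> z)" by (rule E.lin3[OF assms], simp)
  then show ?thesis using nm_triangle assms by simp
qed

definition elim :: "(nat \<Rightarrow> 'e) \<Rightarrow> 'e \<Rightarrow> bool" where
  "elim s x \<longleftrightarrow> range s \<subseteq> carrier E \<and> x \<in> carrier E \<and> (\<lambda>n. nm (s n \<ominus>\<^bsub>E\<^esub> x)) \<longlonglongrightarrow> 0"

lemma elimD: "elim s x \<Longrightarrow> s n \<in> carrier E" "elim s x \<Longrightarrow> x \<in> carrier E"
  by (auto simp: elim_def)

lemma elim_inn_left:
  assumes "elim s x" "y \<in> carrier E"
  shows "B.clim (\<lambda>n. inn E (s n) y) (inn E x y)"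
proof (rule B.climI)
  note c = elimD[OF assms(1)]
  show "inn E (s n) y \<in> carrier B" "inn E x y \<in> carrier B" for n using c assms by auto
  show "cnorm B (inn E (s n) y \<ominus>\<^bsub>B\<^esub> inn E x y) \<le> nm (s n \<ominus>\<^bsub>E\<^esub> x) * nm y" for n
    using cauchy_schwarz[of "s n \<ominus>\<^bsub>E\<^esub> x" y] c assms by (simp add: inn_diff_left)
  show "(\<lambda>n. nm (s n \<ominus>\<^bsub>E\<^esub> x) * nm y) \<longlonglongrightarrow> 0"
    using assms unfolding elim_def by (intro tendsto_mult_left_zero) auto
qed

lemma elim_inn_right:
  assumes "elim s x" "y \<in> carrier E"
  shows "B.clim (\<lambda>n. inn E y (s n)) (inn E y x)"
  using B.clim_cadj[OF elim_inn_left[OF assms]] elimD[OF assms(1)] assms(2) by (simp add: inn_cadj)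

lemma elim_nm_diff_le:
  assumes "elim s x" "y \<in> carrier E" "\<And>n. n \<ge> N \<Longrightarrow> nm (y \<ominus>\<^bsub>E\<^esub> s n) \<le> r"
  shows "nm (y \<ominus>\<^bsub>E\<^esub> x) \<le> r"
proof -
  note c = elimD[OF assms(1)]
  have 1: "(\<lambda>n. r + nm (s n \<ominus>\<^bsub>E\<^esub> x)) \<longlonglongrightarrow> r + 0"
    using assms(1) unfolding elim_def by (intro tendsto_add tendsto_const) auto
  have "nm (y \<ominus>\<^bsub>E\<^esub> x) \<le> r + nm (s n \<ominus>\<^bsub>E\<^esub> x)" if "n \<ge> N" for n
    using nm_diff_trans[OF assms(2) c(1)[of n] c(2)] assms(3)[OF that] by simp
  then have "nm (y \<ominus>\<^bsub>E\<^esub> x) \<le> r + 0" by (intro LIMSEQ_le_const[OF 1]) blast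
  then show ?thesis by simp
qed

lemma elim_complete:
  assumes "\<And>n. s n \<in> carrier E"
    and "\<And>r. r > 0 \<Longrightarrow> \<exists>N. \<forall>m\<ge>N. \<forall>n\<ge>N. nm (s m \<ominus>\<^bsub>E\<^esub> s n) < r"
  obtains x where "elim s x"
proof -
  have "range s \<subseteq> carrier E" using assms(1) by blast
  then have "\<exists>x\<in>carrier E. (\<lambda>n. nm (s n \<ominus>\<^bsub>E\<^esub> x)) \<longlonglongrightarrow> 0"
    using complete assms(2) unfolding complete_wrt_def by blast
  then obtain x where "x \<in> carrier E" "(\<lambda>n. nm (s n \<ominus>\<^bsub>E\<^esub> x)) \<longlonglongrightarrow> 0" ..
  then have "elim s x" using assms(1) unfolding elim_def by blast
  then show thesis by (rule that)
qed

lemma L_simps: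
  "carrier L = {T \<in> carrier E \<rightarrow>\<^sub>E carrier E. \<exists>S \<in> carrier E \<rightarrow>\<^sub>E carrier E. is_adjoint E T S}"
  "T \<otimes>\<^bsub>L\<^esub> S = compose (carrier E) T S"
  "\<one>\<^bsub>L\<^esub> = (\<lambda>x\<in>carrier E. x)"
  "\<zero>\<^bsub>L\<^esub> = (\<lambda>x\<in>carrier E. \<zero>\<^bsub>E\<^esub>)"
  "T \<oplus>\<^bsub>L\<^esub> S = (\<lambda>x\<in>carrier E. T x \<oplus>\<^bsub>E\<^esub> S x)"
  "z \<odot>\<^bsub>L\<^esub> T = (\<lambda>x\<in>carrier E. z \<odot>\<^bsub>E\<^esub> T x)"
  "cadj L T = (THE S. S \<in> carrier E \<rightarrow>\<^sub>E carrier E \<and> is_adjoint E T S)"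
  "cnorm L T = (SUP x\<in>{x \<in> carrier E. nm x \<le> 1}. nm (T x))"
  by (simp_all add: adjointable_ops_def)

lemma L_apply:
  "x \<in> carrier E \<Longrightarrow> (T \<otimes>\<^bsub>L\<^esub> S) x = T (S x)"
  "x \<in> carrier E \<Longrightarrow> \<one>\<^bsub>L\<^esub> x = x"
  "x \<in> carrier E \<Longrightarrow> \<zero>\<^bsub>L\<^esub> x = \<zero>\<^bsub>E\<^esub>"
  "x \<in> carrier E \<Longrightarrow> (T \<oplus>\<^bsub>L\<^esub> S) x = T x \<oplus>\<^bsub>E\<^esub> S x"
  "x \<in> carrier E \<Longrightarrow> (z \<odot>\<^bsub>L\<^esub> T) x = z \<odot>\<^bsub>E\<^esub> T x"
  by (simp_all add: L_simps compose_eq)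

lemma L_mem [simp, intro]: "T \<in> carrier L \<Longrightarrow> x \<in> carrier E \<Longrightarrow> T x \<in> carrier E"
  by (auto simp: L_simps)

lemma L_ext: "T \<in> carrier L \<Longrightarrow> S \<in> carrier L \<Longrightarrow> (\<And>x. x \<in> carrier E \<Longrightarrow> T x = S x) \<Longrightarrow> T = S"
  unfolding L_simps by (blast intro: PiE_ext)

lemma L_I:
  assumes "T \<in> extensional (carrier E)" "\<And>x. x \<in> carrier E \<Longrightarrow> T x \<in> carrier E"
    "\<And>x. x \<in> carrier E \<Longrightarrow> S x \<in> carrier E"
    "\<And>x y. x \<in> carrier E \<Longrightarrow> y \<in> carrier E \<Longrightarrow> inn E (T x) y = inn E x (S y)"
  shows "T \<in> carrier L"
proof -
  have "(\<lambda>x\<in>carrier E. S x) \<in> carrier E \<rightarrow>\<^sub>E carrier E" "is_adjoint E T (\<lambda>x\<in>carrier E. S x)"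
    using assms by (auto simp: is_adjoint_def)
  then show ?thesis using assms(1,2) unfolding L_simps by (auto simp: PiE_def)
qed

lemma adj_ex1:
  assumes "T \<in> carrier L"
  shows "\<exists>!S. S \<in> carrier E \<rightarrow>\<^sub>E carrier E \<and> is_adjoint E T S"
proof -
  obtain S where S: "S \<in> carrier E \<rightarrow>\<^sub>E carrier E" "is_adjoint E T S" using assms by (auto simp: L_simps)
  have "S' = S" if S': "S' \<in> carrier E \<rightarrow>\<^sub>E carrier E" "is_adjoint E T S'" for S'
  proof (rule PiE_ext[OF S'(1) S(1)])
    fix x assume x: "x \<in> carrier E"
    have m: "S' x \<in> carrier E" "S x \<in> carrier E" using S S' x by auto
    show "S' x = S x"
    proof (rule eqI[OF m])
      fix z assume z: "z \<in> carrier E"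
      have "inn E z (S' x) = inn E z (S x)" using S(2) S'(2) x z unfolding is_adjoint_def by metis
      then have "cadj B (inn E z (S' x)) = cadj B (inn E z (S x))" by simp
      then show "inn E (S' x) z = inn E (S x) z" using inn_cadj z m by simp
    qed
  qed
  then show ?thesis using S by blast
qed

lemma adj:
  assumes "T \<in> carrier L"
  shows "cadj L T \<in> carrier L"
    and "\<And>x y. x \<in> carrier E \<Longrightarrow> y \<in> carrier E \<Longrightarrow> inn E (T x) y = inn E x (cadj L T y)"
    and "\<And>x y. x \<in> carrier E \<Longrightarrow> y \<in> carrier E \<Longrightarrow> inn E (cadj L T x) y = inn E x (T y)"
proof -
  have a: "cadj L T \<in> carrier E \<rightarrow>\<^sub>E carrier E \<and> is_adjoint E T (cadj L T)"
    unfolding L_simps(7) by (rule theI'[OF adj_ex1[OF assms]])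
  then show 2: "\<And>x y. x \<in> carrier E \<Longrightarrow> y \<in> carrier E \<Longrightarrow> inn E (T x) y = inn E x (cadj L T y)"
    by (auto simp: is_adjoint_def)
  show 3: "inn E (cadj L T x) y = inn E x (T y)" if xy: "x \<in> carrier E" "y \<in> carrier E" for x y
  proof -
    have m: "cadj L T x \<in> carrier E" using a xy by auto
    have "cadj B (inn E (T y) x) = cadj B (inn E y (cadj L T x))" using 2[OF xy(2,1)] by simp
    then show ?thesis using inn_cadj xy m L_mem[OF assms] by simp
  qed
  show "cadj L T \<in> carrier L"
    using a assms 3 by (intro L_I[where S = T]) (auto simp: PiE_def)
qed

lemma adjI:
  assumes "T \<in> carrier L" "S \<in> carrier L"
    "\<And>x y. x \<in> carrier E \<Longrightarrow> y \<in> carrier E \<Longrightarrow> inn E (T x) y = inn E x (S y)"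
  shows "cadj L T = S"
proof -
  have "S \<in> carrier E \<rightarrow>\<^sub>E carrier E \<and> is_adjoint E T S"
    using assms by (auto simp: L_simps is_adjoint_def)
  then show ?thesis unfolding L_simps(7) using adj_ex1[OF assms(1)] by (rule the1_equality[rotated])
qed

lemma L_linear:
  assumes T: "T \<in> carrier L"
  shows "x \<in> carrier E \<Longrightarrow> y \<in> carrier E \<Longrightarrow> T (x \<oplus>\<^bsub>E\<^esub> y) = T x \<oplus>\<^bsub>E\<^esub> T y"
    and "x \<in> carrier E \<Longrightarrow> T (z \<odot>\<^bsub>E\<^esub> x) = z \<odot>\<^bsub>E\<^esub> T x"
    and "x \<in> carrier E \<Longrightarrow> b \<in> carrier B \<Longrightarrow> T (ract E x b) = ract E (T x) b"
  using adj[OF T] T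
  by (auto intro!: eqI simp: inn_add_left inn_smult_left inn_ract_left)

lemma L_diff: "T \<in> carrier L \<Longrightarrow> x \<in> carrier E \<Longrightarrow> y \<in> carrier E \<Longrightarrow> T (x \<ominus>\<^bsub>E\<^esub> y) = T x \<ominus>\<^bsub>E\<^esub> T y"
  by (simp add: E.diff_eq_scale L_linear)

lemma L_closed:
  "\<zero>\<^bsub>L\<^esub> \<in> carrier L" "\<one>\<^bsub>L\<^esub> \<in> carrier L"
  "T \<in> carrier L \<Longrightarrow> S \<in> carrier L \<Longrightarrow> T \<oplus>\<^bsub>L\<^esub> S \<in> carrier L"
  "T \<in> carrier L \<Longrightarrow> z \<odot>\<^bsub>L\<^esub> T \<in> carrier L"
  "T \<in> carrier L \<Longrightarrow> S \<in> carrier L \<Longrightarrow> T \<otimes>\<^bsub>L\<^esub> S \<in> carrier L"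
proof -
  have z0: "inn E \<zero>\<^bsub>E\<^esub> y = \<zero>\<^bsub>B\<^esub>" if "y \<in> carrier E" for y
    using inn_cadj[of y "\<zero>\<^bsub>E\<^esub>"] that by simp
  show "\<zero>\<^bsub>L\<^esub> \<in> carrier L"
    by (rule L_I[where S = "\<lambda>_. \<zero>\<^bsub>E\<^esub>"]) (auto simp: L_simps z0)
  show "\<one>\<^bsub>L\<^esub> \<in> carrier L"
    by (rule L_I[where S = "\<lambda>x. x"]) (auto simp: L_simps)
  show "T \<oplus>\<^bsub>L\<^esub> S \<in> carrier L" if "T \<in> carrier L" "S \<in> carrier L"
    using that adj[OF that(1)] adj[OF that(2)]
    by (intro L_I[where S = "\<lambda>x. cadj L T x \<oplus>\<^bsub>E\<^esub> cadj L S x"])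
      (auto simp: L_apply inn_add_left inn_add_right, auto simp: L_simps)
  show "z \<odot>\<^bsub>L\<^esub> T \<in> carrier L" if "T \<in> carrier L"
    using that adj[OF that]
    by (intro L_I[where S = "\<lambda>x. cnj z \<odot>\<^bsub>E\<^esub> cadj L T x"])
      (auto simp: L_apply inn_smult_left inn_smult_right, auto simp: L_simps)
  show "T \<otimes>\<^bsub>L\<^esub> S \<in> carrier L" if "T \<in> carrier L" "S \<in> carrier L"
    using that adj[OF that(1)] adj[OF that(2)]
    by (intro L_I[where S = "\<lambda>x. cadj L S (cadj L T x)"])
      (auto simp: L_apply, auto simp: L_simps compose_def)
qed

lemma L_module: "module complex_ring L"
proof (rule moduleI)
  show "cring complex_ring" by (rule complex_cring)
  show "abelian_group L"
  proof (rule abelian_groupI)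
    fix T assume T: "T \<in> carrier L"
    have "(- 1) \<odot>\<^bsub>L\<^esub> T \<oplus>\<^bsub>L\<^esub> T = \<zero>\<^bsub>L\<^esub>"
      by (rule L_ext) (use T L_closed in \<open>auto simp: L_apply E.neg_eq_scale[symmetric] E.M.l_neg\<close>)
    then show "\<exists>S\<in>carrier L. S \<oplus>\<^bsub>L\<^esub> T = \<zero>\<^bsub>L\<^esub>" using L_closed(4)[OF T] by blast
  qed (auto intro!: L_ext L_closed simp: L_apply E.M.a_ac)
qed (auto intro!: L_ext L_closed simp: L_apply E.scale_simps E.scale_add)

sublocale L: cmodule L
  using L_module by (simp add: cmodule_def)

lemma L_minus_apply: "T \<in> carrier L \<Longrightarrow> S \<in> carrier L \<Longrightarrow> x \<in> carrier E \<Longrightarrow> (T \<ominus>\<^bsub>L\<^esub> S) x = T x \<ominus>\<^bsub>E\<^esub> S x"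
  by (simp add: L.diff_eq_scale E.diff_eq_scale L_apply L_closed)

definition op_bound :: "('e \<Rightarrow> 'e) \<Rightarrow> real \<Rightarrow> bool" where
  "op_bound T c \<longleftrightarrow> 0 \<le> c \<and> (\<forall>x\<in>carrier E. nm (T x) \<le> c * nm x)"

lemma op_bound_adj:
  assumes T: "T \<in> carrier L" and "op_bound T c"
  shows "op_bound (cadj L T) c"
  unfolding op_bound_def
proof (intro conjI ballI)
  show "0 \<le> c" using assms(2) by (simp add: op_bound_def)
  fix x assume x: "x \<in> carrier E"
  note a = adj[OF T]
  let ?y = "cadj L T x"
  have y: "?y \<in> carrier E" using a x by auto
  have "(nm ?y)\<^sup>2 = cnorm B (inn E x (T ?y))" using nm_sq[OF y] a(3)[OF x y] by simp
  also have "\<dots> \<le> nm x * nm (T ?y)" using x y T by (intro cauchy_schwarz) auto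
  also have "\<dots> \<le> nm x * (c * nm ?y)"
    using assms(2) x y by (intro mult_left_mono) (auto simp: op_bound_def)
  finally have *: "nm ?y * nm ?y \<le> (c * nm x) * nm ?y" by (simp add: power2_eq_square mult_ac)
  show "nm ?y \<le> c * nm x"
  proof (cases "nm ?y = 0")
    case True then show ?thesis using \<open>0 \<le> c\<close> x by simp
  next
    case False
    then have "nm ?y > 0" using nm_nonneg[OF y] by linarith
    then show ?thesis using * by simp
  qed
qed

text \<open>Move from \<open>y0\<close> by \<open>\<plusminus> w\<close>, where \<open>w\<close> is the multiple of \<open>v\<close> of norm \<open>r\<close>. The two values of the pairing
  differ by an element of norm \<open>2 r \<parallel>v\<parallel>\<close>, so that one of them has at least half that norm.\<close>

lemma large_pairing:
  assumes "v \<in> carrier E" "y0 \<in> carrier E" "0 < r"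
  shows "\<exists>y\<in>carrier E. nm (y \<ominus>\<^bsub>E\<^esub> y0) \<le> r \<and> r * nm v \<le> cnorm B (inn E v y)"
proof (cases "nm v = 0")
  case True
  then show ?thesis using assms by (intro bexI[of _ y0]) (auto simp: E.diff_self B.cnorm_nonneg)
next
  case False
  then have v: "nm v > 0" using nm_nonneg[OF assms(1)] by linarith
  define w where "w = complex_of_real (r / nm v) \<odot>\<^bsub>E\<^esub> v"
  have w: "w \<in> carrier E" "nm w = r" using assms v by (auto simp: w_def nm_smult norm_divide)
  have "cnorm B (inn E v w) = r / nm v * (nm v)\<^sup>2"
    using assms v unfolding w_def by (simp add: inn_smult_right B.cnorm_smult nm_sq norm_divide)
  then have vw: "cnorm B (inn E v w) = r * nm v" using v by (simp add: power2_eq_square)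
  define p q where "p = y0 \<oplus>\<^bsub>E\<^esub> w" and "q = y0 \<ominus>\<^bsub>E\<^esub> w"
  have pq: "p \<in> carrier E" "q \<in> carrier E" using assms w by (auto simp: p_def q_def)
  have "p \<ominus>\<^bsub>E\<^esub> y0 = w" "q \<ominus>\<^bsub>E\<^esub> y0 = (- 1) \<odot>\<^bsub>E\<^esub> w"
    unfolding p_def q_def by (rule E.lin2[OF assms(2) w(1)], simp)+
  then have n: "nm (p \<ominus>\<^bsub>E\<^esub> y0) = r" "nm (q \<ominus>\<^bsub>E\<^esub> y0) = r" using w by (auto simp: nm_smult)
  have m: "inn E v y0 \<in> carrier B" "inn E v w \<in> carrier B" using assms w by auto
  have "inn E v w = (1 / 2) \<odot>\<^bsub>B\<^esub> (inn E v p \<ominus>\<^bsub>B\<^esub> inn E v q)"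
    unfolding p_def q_def using assms w by (simp add: inn_add_right inn_diff_right) (rule B.lin2[OF m], simp)
  then have "cnorm B (inn E v w) \<le> 1 / 2 * (cnorm B (inn E v p) + cnorm B (inn E v q))"
    using B.norm_diff_triangle[of "inn E v p" "inn E v q"] assms pq by (simp add: B.cnorm_smult)
  then have "r * nm v \<le> cnorm B (inn E v p) \<or> r * nm v \<le> cnorm B (inn E v q)"
    unfolding vw by argo
  then show ?thesis
  proof
    assume "r * nm v \<le> cnorm B (inn E v p)"
    then show ?thesis using n pq by (intro bexI[of _ p]) simp_all
  next
    assume "r * nm v \<le> cnorm B (inn E v q)"
    then show ?thesis using n pq by (intro bexI[of _ q]) simp_all
  qed
qed

text \<open>An everywhere defined adjoint forces boundedness, by a gliding hump: if \<open>\<parallel>T x\<^sub>n\<parallel> > 4\<^sup>n\<close> for vectors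
  \<open>x\<^sub>n\<close> of norm at most 1, choose successive points \<open>y\<^sub>n\<close> at distances at most \<open>3\<^sup>-\<^sup>n\<close> with \<open>\<langle>T x\<^sub>n, y\<^sub>n\<^sub>+\<^sub>1\<rangle>\<close> of norm at least
  \<open>3\<^sup>-\<^sup>n \<parallel>T x\<^sub>n\<parallel>\<close>. For the limit \<open>z\<close> half of this survives, but \<open>\<langle>T x\<^sub>n, z\<rangle> = \<langle>x\<^sub>n, T\<^sup>* z\<rangle>\<close> is bounded.\<close>

lemma adjointable_bounded:
  assumes T: "T \<in> carrier L"
  shows "\<exists>c. op_bound T c"
proof (rule ccontr)
  assume nb: "\<nexists>c. op_bound T c"
  have "\<exists>x\<in>carrier E. nm x \<le> 1 \<and> nm (T x) > 4 ^ n" for n :: nat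
  proof -
    have "\<not> op_bound T (4 ^ n)" using nb by blast
    then obtain x where x: "x \<in> carrier E" "nm (T x) > 4 ^ n * nm x" by (auto simp: op_bound_def not_le)
    have "nm x \<noteq> 0"
    proof
      assume "nm x = 0"
      then have "x = \<zero>\<^bsub>E\<^esub>" using nm_eq_0 x by simp
      then have "T x = \<zero>\<^bsub>E\<^esub>" using L_linear(2)[OF T x(1), of 0] x by (simp add: E.scale_simps T)
      then show False using x \<open>nm x = 0\<close> by simp
    qed
    then have p: "nm x > 0" using nm_nonneg[OF x(1)] by linarith
    let ?x = "complex_of_real (1 / nm x) \<odot>\<^bsub>E\<^esub> x"
    have "nm ?x = 1" "nm (T ?x) = nm (T x) / nm x"
      using x p T by (simp_all add: nm_smult L_linear norm_divide)
    then show ?thesis using x p by (intro bexI[of _ ?x]) (auto simp: less_divide_eq)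
  qed
  then obtain x where x: "\<And>n. x n \<in> carrier E" "\<And>n. nm (x n) \<le> 1" "\<And>n. nm (T (x n)) > 4 ^ n"
    by metis
  define r where "r n = (1 / 3 :: real) ^ n" for n
  have r0: "r n > 0" for n by (simp add: r_def)
  have "\<exists>y'. y \<in> carrier E \<longrightarrow> y' \<in> carrier E \<and> nm (y' \<ominus>\<^bsub>E\<^esub> y) \<le> r n \<and> r n * nm (T (x n)) \<le> cnorm B (inn E (T (x n)) y')"
    for y n using large_pairing[of "T (x n)" y "r n"] r0[of n] x(1)[of n] T by blast
  then obtain g where g: "\<And>y n. y \<in> carrier E \<Longrightarrow> g y n \<in> carrier E \<and> nm (g y n \<ominus>\<^bsub>E\<^esub> y) \<le> r n \<and>
      r n * nm (T (x n)) \<le> cnorm B (inn E (T (x n)) (g y n))"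
    by metis
  define y where "y = rec_nat \<zero>\<^bsub>E\<^esub> (\<lambda>n z. g z n)"
  have y0: "y 0 = \<zero>\<^bsub>E\<^esub>" and yS: "y (Suc n) = g (y n) n" for n by (simp_all add: y_def)
  have yc: "y n \<in> carrier E" for n by (induction n) (auto simp: y0 yS g)
  have step: "nm (y (n + j) \<ominus>\<^bsub>E\<^esub> y n) \<le> 3 / 2 * (r n - r (n + j))" for n j
  proof (induction j)
    case 0 then show ?case using yc by (simp add: E.diff_self)
  next
    case (Suc j)
    have 1: "nm (y (n + Suc j) \<ominus>\<^bsub>E\<^esub> y n) \<le> nm (y (n + Suc j) \<ominus>\<^bsub>E\<^esub> y (n + j)) + nm (y (n + j) \<ominus>\<^bsub>E\<^esub> y n)"
      by (rule nm_diff_trans[OF yc yc yc])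
    have 2: "nm (y (n + Suc j) \<ominus>\<^bsub>E\<^esub> y (n + j)) \<le> r (n + j)"
      using g[OF yc[of "n + j"], of "n + j"] by (simp only: add_Suc_right yS)
    have 3: "r (n + Suc j) = r (n + j) / 3" by (simp add: r_def)
    show ?case using 1 2 Suc.IH unfolding 3 by argo
  qed
  have step': "nm (y m \<ominus>\<^bsub>E\<^esub> y n) \<le> 3 / 2 * r n" if "n \<le> m" for m n
    using step[of n "m - n"] that r0[of m] by simp
  have rl: "r \<longlonglongrightarrow> 0" unfolding r_def by (rule LIMSEQ_power_zero) simp
  have "\<exists>N. \<forall>m\<ge>N. \<forall>n\<ge>N. nm (y m \<ominus>\<^bsub>E\<^esub> y n) < e" if e: "e > 0" for e
  proof -
    have "\<exists>N. \<forall>n\<ge>N. norm (r n - 0) < e / 2" by (rule LIMSEQ_D[OF rl]) (use e in simp)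
    then obtain N where N: "\<forall>n\<ge>N. norm (r n - 0) < e / 2" ..
    have le: "nm (y m \<ominus>\<^bsub>E\<^esub> y n) < e" if "n \<ge> N" "n \<le> m" for m n
    proof -
      have "norm (r n - 0) < e / 2" using N that(1) by blast
      then have "r n < e / 2" using abs_ge_self[of "r n"] by simp
      then show ?thesis using step'[OF that(2)] e by argo
    qed
    have "nm (y m \<ominus>\<^bsub>E\<^esub> y n) < e" if "m \<ge> N" "n \<ge> N" for m n
      using le[of n m] le[of m n] that nm_diff_commute[OF yc yc, of m n]
      by (cases "n \<le> m") simp_all
    then show ?thesis by blast
  qed
  then obtain z where z: "elim y z" using elim_complete[of y] yc by blast
  note zc = elimD(2)[OF z]
  have zy: "nm (y (Suc n) \<ominus>\<^bsub>E\<^esub> z) \<le> 1 / 2 * r n" for n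
  proof (rule elim_nm_diff_le[OF z yc])
    show "nm (y (Suc n) \<ominus>\<^bsub>E\<^esub> y m) \<le> 1 / 2 * r n" if "m \<ge> Suc n" for m
      using step'[OF that] nm_diff_commute[OF yc yc, of m "Suc n"] by (simp add: r_def)
  qed
  let ?S = "cadj L T"
  have Sz: "?S z \<in> carrier E" using adj[OF T] zc by auto
  have big: "(4 / 3) ^ n \<le> 2 * nm (?S z)" for n
  proof -
    let ?v = "T (x n)"
    have v: "?v \<in> carrier E" using T x by auto
    have d: "y (Suc n) \<ominus>\<^bsub>E\<^esub> z \<in> carrier E" using yc zc by auto
    have m: "inn E ?v z \<in> carrier B" "inn E ?v (y (Suc n) \<ominus>\<^bsub>E\<^esub> z) \<in> carrier B" using v zc d by auto
    have yz: "y (Suc n) = z \<oplus>\<^bsub>E\<^esub> (y (Suc n) \<ominus>\<^bsub>E\<^esub> z)" by (rule E.lin2[OF yc[of "Suc n"] zc], simp)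
    have "r n * nm ?v \<le> cnorm B (inn E ?v (y (Suc n)))" using g[OF yc] by (simp add: yS)
    also have "inn E ?v (y (Suc n)) = inn E ?v z \<oplus>\<^bsub>B\<^esub> inn E ?v (y (Suc n) \<ominus>\<^bsub>E\<^esub> z)"
      by (subst yz) (rule inn_add_right[OF v zc d])
    also have "cnorm B \<dots> \<le> cnorm B (inn E ?v z) + cnorm B (inn E ?v (y (Suc n) \<ominus>\<^bsub>E\<^esub> z))"
      by (rule B.cnorm_triangle[OF m])
    also have "cnorm B (inn E ?v z) \<le> nm (x n) * nm (?S z)"
      using cauchy_schwarz[OF x(1)[of n] Sz] adj(2)[OF T x(1)[of n] zc] by simp
    also have "\<dots> \<le> 1 * nm (?S z)" using x(2)[of n] Sz by (intro mult_right_mono) auto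
    also have "cnorm B (inn E ?v (y (Suc n) \<ominus>\<^bsub>E\<^esub> z)) \<le> nm ?v * nm (y (Suc n) \<ominus>\<^bsub>E\<^esub> z)"
      by (rule cauchy_schwarz[OF v d])
    also have "\<dots> \<le> nm ?v * (1 / 2 * r n)" using zy v by (intro mult_left_mono) auto
    finally have "r n * nm ?v \<le> 2 * nm (?S z)" by (simp add: algebra_simps)
    moreover have "r n * 4 ^ n \<le> r n * nm ?v" using x(3)[of n] r0[of n] by (intro mult_left_mono) auto
    moreover have "r n * 4 ^ n = (4 / 3) ^ n" by (simp add: r_def power_mult_distrib[symmetric])
    ultimately show ?thesis by linarith
  qed
  obtain n where "2 * nm (?S z) < (4 / 3 :: real) ^ n"
    using real_arch_pow[of "4 / 3" "2 * nm (?S z)"] by auto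
  then show False using big[of n] by linarith
qed

lemma norm_L_bdd:
  assumes "T \<in> carrier L"
  shows "bdd_above ((\<lambda>x. nm (T x)) ` {x \<in> carrier E. nm x \<le> 1})"
proof -
  obtain c where c: "op_bound T c" using adjointable_bounded[OF assms] by blast
  have "nm (T x) \<le> c" if "x \<in> carrier E" "nm x \<le> 1" for x
  proof -
    have "nm (T x) \<le> c * nm x" "c \<ge> 0" using c that by (auto simp: op_bound_def)
    moreover have "c * nm x \<le> c * 1" using that \<open>c \<ge> 0\<close> by (intro mult_left_mono) auto
    ultimately show ?thesis by linarith
  qed
  then show ?thesis by (intro bdd_aboveI[of _ c]) auto
qed

lemma norm_L_nonneg: "T \<in> carrier L \<Longrightarrow> 0 \<le> cnorm L T"
proof -
  assume T: "T \<in> carrier L"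
  have "nm (T \<zero>\<^bsub>E\<^esub>) \<le> cnorm L T"
    unfolding L_simps(8) by (intro cSUP_upper norm_L_bdd[OF T]) simp
  moreover have "0 \<le> nm (T \<zero>\<^bsub>E\<^esub>)" using T by auto
  ultimately show ?thesis by linarith
qed

lemma norm_L_bound: assumes T: "T \<in> carrier L" and x: "x \<in> carrier E" shows "nm (T x) \<le> cnorm L T * nm x"
proof (cases "nm x = 0")
  case True
  then have "x = \<zero>\<^bsub>E\<^esub>" using nm_eq_0 x by simp
  then have "T x = \<zero>\<^bsub>E\<^esub>" using L_linear(2)[OF T x(1), of 0] x by (simp add: E.scale_simps T)
  then show ?thesis using True by simp
next
  case False
  then have p: "nm x > 0" using nm_nonneg[OF x] by linarith
  let ?x = "complex_of_real (1 / nm x) \<odot>\<^bsub>E\<^esub> x"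
  have "?x \<in> carrier E" "nm ?x = 1" "nm (T ?x) = nm (T x) / nm x"
    using x p T by (simp_all add: nm_smult L_linear norm_divide)
  moreover have "nm (T ?x) \<le> cnorm L T" if "?x \<in> carrier E" "nm ?x = 1"
    unfolding L_simps(8) using that by (intro cSUP_upper norm_L_bdd[OF T]) simp
  ultimately show ?thesis using p by (simp add: divide_le_eq)
qed

lemma norm_L_op_bound: "T \<in> carrier L \<Longrightarrow> op_bound T (cnorm L T)"
  by (simp add: op_bound_def norm_L_bound norm_L_nonneg)

lemma norm_L_le:
  assumes "T \<in> carrier L" "op_bound T c"
  shows "cnorm L T \<le> c"
  unfolding L_simps(8)
proof (rule cSUP_least)
  have "\<zero>\<^bsub>E\<^esub> \<in> {x \<in> carrier E. nm x \<le> 1}" by simp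
  then show "{x \<in> carrier E. nm x \<le> 1} \<noteq> {}" by blast
  fix x assume "x \<in> {x \<in> carrier E. nm x \<le> 1}"
  then have x: "x \<in> carrier E" "nm x \<le> 1" by auto
  have "nm (T x) \<le> c * nm x" "c \<ge> 0" using assms(2) x by (auto simp: op_bound_def)
  moreover have "c * nm x \<le> c * 1" using x \<open>c \<ge> 0\<close> by (intro mult_left_mono) auto
  ultimately show "nm (T x) \<le> c" by linarith
qed

lemma norm_L_adj_le: "T \<in> carrier L \<Longrightarrow> cnorm L (cadj L T) \<le> cnorm L T"
  by (intro norm_L_le adj op_bound_adj norm_L_op_bound)

lemma adj_adj: "T \<in> carrier L \<Longrightarrow> cadj L (cadj L T) = T"
  using adj[of T] by (intro adjI) auto

text \<open>Pointwise limits of a Cauchy sequence and of the sequence of adjoints exist, and they are adjoint to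
  each other by continuity of the inner product.\<close>

lemma L_complete: "complete_wrt (carrier L) (\<lambda>T S. cnorm L (T \<ominus>\<^bsub>L\<^esub> S))"
  unfolding complete_wrt_def
proof (intro allI impI, elim conjE)
  fix T :: "nat \<Rightarrow> 'e \<Rightarrow> 'e"
  assume "range T \<subseteq> carrier L" and cau: "\<forall>e>0. \<exists>N. \<forall>m\<ge>N. \<forall>n\<ge>N. cnorm L (T m \<ominus>\<^bsub>L\<^esub> T n) < e"
  then have T: "T n \<in> carrier L" for n by blast
  define S where "S n = cadj L (T n)" for n
  have S: "S n \<in> carrier L" for n using adj(1)[OF T] by (simp add: S_def)
  have bT: "nm (T m x \<ominus>\<^bsub>E\<^esub> T n x) \<le> cnorm L (T m \<ominus>\<^bsub>L\<^esub> T n) * nm x" if "x \<in> carrier E" for m n x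
    using norm_L_bound[OF L.M.minus_closed[OF T[of m] T[of n]] that] T that by (simp add: L_minus_apply)
  have bS: "nm (S m x \<ominus>\<^bsub>E\<^esub> S n x) \<le> cnorm L (T m \<ominus>\<^bsub>L\<^esub> T n) * nm x" if x: "x \<in> carrier E" for m n x
  proof -
    have D: "T m \<ominus>\<^bsub>L\<^esub> T n \<in> carrier L" "S m \<ominus>\<^bsub>L\<^esub> S n \<in> carrier L" using T S by (auto intro: L.M.minus_closed)
    have e: "cadj L (T m \<ominus>\<^bsub>L\<^esub> T n) = S m \<ominus>\<^bsub>L\<^esub> S n"
      by (rule adjI[OF D]) (use T S adj[OF T] in \<open>auto simp: L_minus_apply inn_diff_left inn_diff_right S_def\<close>)
    have "nm (S m x \<ominus>\<^bsub>E\<^esub> S n x) \<le> cnorm L (S m \<ominus>\<^bsub>L\<^esub> S n) * nm x"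
      using norm_L_bound[OF D(2) x] S x by (simp add: L_minus_apply)
    also have "\<dots> \<le> cnorm L (T m \<ominus>\<^bsub>L\<^esub> T n) * nm x"
      using norm_L_adj_le[OF D(1)] x unfolding e by (intro mult_right_mono) auto
    finally show ?thesis .
  qed
  have lim: "\<exists>z. elim (\<lambda>n. F n x) z" if x: "x \<in> carrier E" and F: "\<And>n. F n \<in> carrier L"
    and bF: "\<And>m n. nm (F m x \<ominus>\<^bsub>E\<^esub> F n x) \<le> cnorm L (T m \<ominus>\<^bsub>L\<^esub> T n) * nm x" for F x
  proof -
    have "\<exists>N. \<forall>m\<ge>N. \<forall>n\<ge>N. nm (F m x \<ominus>\<^bsub>E\<^esub> F n x) < r" if r: "r > 0" for r
    proof -
      have p: "nm x + 1 > 0" using nm_nonneg[OF x] by linarith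
      then have "r / (nm x + 1) > 0" using r by simp
      then obtain N where N: "\<forall>m\<ge>N. \<forall>n\<ge>N. cnorm L (T m \<ominus>\<^bsub>L\<^esub> T n) < r / (nm x + 1)" using cau by blast
      have "nm (F m x \<ominus>\<^bsub>E\<^esub> F n x) < r" if "m \<ge> N" "n \<ge> N" for m n
      proof -
        have "cnorm L (T m \<ominus>\<^bsub>L\<^esub> T n) * nm x \<le> r / (nm x + 1) * nm x"
          using N that x by (intro mult_right_mono) (auto intro: less_imp_le)
        also have "\<dots> < r" using p r by (simp add: field_simps)
        finally show ?thesis using bF[of m n] by linarith
      qed
      then show ?thesis by blast
    qed
    then show ?thesis using elim_complete[of "\<lambda>n. F n x"] F x by blast
  qed
  have "\<forall>x\<in>carrier E. \<exists>z. elim (\<lambda>n. T n x) z" "\<forall>x\<in>carrier E. \<exists>z. elim (\<lambda>n. S n x) z"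
    using lim[OF _ T bT] lim[OF _ S bS] by auto
  then obtain T' S' where T': "\<And>x. x \<in> carrier E \<Longrightarrow> elim (\<lambda>n. T n x) (T' x)"
    and S': "\<And>x. x \<in> carrier E \<Longrightarrow> elim (\<lambda>n. S n x) (S' x)" by metis
  define U where "U = (\<lambda>x\<in>carrier E. T' x)"
  have U: "U \<in> carrier L"
  proof (rule L_I[where S = S'])
    show "U \<in> extensional (carrier E)" by (simp add: U_def)
    show "U x \<in> carrier E" "S' x \<in> carrier E" if "x \<in> carrier E" for x
      using elimD(2)[OF T'[OF that]] elimD(2)[OF S'[OF that]] that by (auto simp: U_def)
    show "inn E (U x) y = inn E x (S' y)" if "x \<in> carrier E" "y \<in> carrier E" for x y
    proof -
      have "B.clim (\<lambda>n. inn E (T n x) y) (inn E x (S' y))"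
        using elim_inn_right[OF S'[OF that(2)] that(1)] adj(2)[OF T that] by (simp add: S_def)
      then show ?thesis using B.clim_unique[OF elim_inn_left[OF T'[OF that(1)] that(2)]] that by (simp add: U_def)
    qed
  qed
  have "(\<lambda>n. cnorm L (T n \<ominus>\<^bsub>L\<^esub> U)) \<longlonglongrightarrow> 0"
  proof (rule LIMSEQ_I)
    fix r :: real assume r: "r > 0"
    then obtain N where N: "\<forall>m\<ge>N. \<forall>n\<ge>N. cnorm L (T m \<ominus>\<^bsub>L\<^esub> T n) < r / 2" using cau half_gt_zero by blast
    have "norm (cnorm L (T n \<ominus>\<^bsub>L\<^esub> U) - 0) < r" if n: "n \<ge> N" for n
    proof -
      have D: "T n \<ominus>\<^bsub>L\<^esub> U \<in> carrier L" using T U by (auto intro: L.M.minus_closed)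
      have "op_bound (T n \<ominus>\<^bsub>L\<^esub> U) (r / 2)"
        unfolding op_bound_def
      proof (intro conjI ballI)
        fix x assume x: "x \<in> carrier E"
        have "nm (T n x \<ominus>\<^bsub>E\<^esub> T' x) \<le> r / 2 * nm x"
        proof (rule elim_nm_diff_le[OF T'[OF x], of _ N])
          show "T n x \<in> carrier E" using T x by auto
          show "nm (T n x \<ominus>\<^bsub>E\<^esub> T m x) \<le> r / 2 * nm x" if "m \<ge> N" for m
          proof -
            have "cnorm L (T n \<ominus>\<^bsub>L\<^esub> T m) \<le> r / 2" using N n that less_imp_le by blast
            then have "cnorm L (T n \<ominus>\<^bsub>L\<^esub> T m) * nm x \<le> r / 2 * nm x"
              using x by (intro mult_right_mono) auto
            then show ?thesis using bT[OF x, of n m] by linarith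
          qed
        qed
        then show "nm ((T n \<ominus>\<^bsub>L\<^esub> U) x) \<le> r / 2 * nm x" using T U x by (simp add: L_minus_apply U_def)
      qed (use r in simp)
      then have "cnorm L (T n \<ominus>\<^bsub>L\<^esub> U) \<le> r / 2" by (rule norm_L_le[OF D])
      then show ?thesis using norm_L_nonneg[OF D] r by simp
    qed
    then show "\<exists>N. \<forall>n\<ge>N. norm (cnorm L (T n \<ominus>\<^bsub>L\<^esub> U) - 0) < r" by blast
  qed
  then show "\<exists>U\<in>carrier L. (\<lambda>n. cnorm L (T n \<ominus>\<^bsub>L\<^esub> U)) \<longlonglongrightarrow> 0" using U by blast
qed

theorem L_cstar: "cstar_algebra L"
proof (rule cstar_algebra.intro[OF L_module], unfold_locales)
  fix T S :: "'e \<Rightarrow> 'e" and c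
  assume T: "T \<in> carrier L"
  note a = adj[OF T]
  show "cadj L T \<in> carrier L" by (rule a)
  show "cadj L (cadj L T) = T" by (rule adj_adj[OF T])
  show "cadj L (c \<odot>\<^bsub>L\<^esub> T) = cnj c \<odot>\<^bsub>L\<^esub> cadj L T"
    by (rule adjI) (use T a in \<open>auto intro: L_closed simp: L_apply inn_smult_left inn_smult_right\<close>)
  show "0 \<le> cnorm L T" by (rule norm_L_nonneg[OF T])
  show "cnorm L T = 0 \<longleftrightarrow> T = \<zero>\<^bsub>L\<^esub>"
  proof
    assume 0: "cnorm L T = 0"
    show "T = \<zero>\<^bsub>L\<^esub>"
    proof (rule L_ext[OF T L_closed(1)])
      fix x assume x: "x \<in> carrier E"
      have "nm (T x) \<le> 0" using norm_L_bound[OF T x] 0 by simp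
      moreover have "0 \<le> nm (T x)" using T x by auto
      ultimately have "nm (T x) = 0" by linarith
      then show "T x = \<zero>\<^bsub>L\<^esub> x" using nm_eq_0[of "T x"] T x by (auto simp: L_apply)
    qed
  next
    assume "T = \<zero>\<^bsub>L\<^esub>"
    then have "op_bound T 0" by (simp add: op_bound_def L_apply)
    then show "cnorm L T = 0" using norm_L_le[OF T] norm_L_nonneg[OF T] by force
  qed
  show "cnorm L (c \<odot>\<^bsub>L\<^esub> T) = cmod c * cnorm L T"
  proof -
    have le: "cnorm L (c \<odot>\<^bsub>L\<^esub> T) \<le> cmod c * cnorm L T" if T: "T \<in> carrier L" for c T
      using that norm_L_bound[OF T] norm_L_nonneg[OF T]
      by (intro norm_L_le L_closed) (auto simp: op_bound_def L_apply nm_smult mult.assoc intro!: mult_left_mono)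
    show ?thesis
    proof (cases "c = 0")
      case True
      then have "cnorm L (c \<odot>\<^bsub>L\<^esub> T) \<le> 0" using le[OF T, of c] by simp
      then show ?thesis using True norm_L_nonneg[OF L_closed(4)[OF T, of c]] by simp
    next
      case False
      have "T = (1 / c) \<odot>\<^bsub>L\<^esub> (c \<odot>\<^bsub>L\<^esub> T)" using T False by (simp add: L.scale_simps(1,2))
      then have "cnorm L T \<le> cmod (1 / c) * cnorm L (c \<odot>\<^bsub>L\<^esub> T)"
        using le[OF L_closed(4)[OF T, of c], of "1 / c"] by simp
      then have "cmod c * cnorm L T \<le> cnorm L (c \<odot>\<^bsub>L\<^esub> T)"
        using False by (simp add: norm_divide field_simps)
      then show ?thesis using le[OF T, of c] by simp
    qed
  qed
  show "cnorm L (cadj L T \<otimes>\<^bsub>L\<^esub> T) = (cnorm L T)\<^sup>2"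
  proof (rule antisym)
    have c: "cadj L T \<otimes>\<^bsub>L\<^esub> T \<in> carrier L" using T a by (auto intro: L_closed)
    have "op_bound (cadj L T \<otimes>\<^bsub>L\<^esub> T) ((cnorm L T)\<^sup>2)"
      unfolding op_bound_def
    proof (intro conjI ballI)
      fix x assume x: "x \<in> carrier E"
      have "nm (cadj L T (T x)) \<le> cnorm L T * nm (T x)"
        using op_bound_adj[OF T norm_L_op_bound[OF T]] T x by (auto simp: op_bound_def)
      also have "\<dots> \<le> cnorm L T * (cnorm L T * nm x)"
        using norm_L_bound[OF T x] norm_L_nonneg[OF T] by (intro mult_left_mono)
      finally show "nm ((cadj L T \<otimes>\<^bsub>L\<^esub> T) x) \<le> (cnorm L T)\<^sup>2 * nm x"
        using x by (simp add: L_apply power2_eq_square mult.assoc)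
    qed simp
    then show "cnorm L (cadj L T \<otimes>\<^bsub>L\<^esub> T) \<le> (cnorm L T)\<^sup>2" by (rule norm_L_le[OF c])
    let ?m = "cnorm L (cadj L T \<otimes>\<^bsub>L\<^esub> T)"
    have m: "0 \<le> ?m" by (rule norm_L_nonneg[OF c])
    have "op_bound T (sqrt ?m)"
      unfolding op_bound_def
    proof (intro conjI ballI)
      fix x assume x: "x \<in> carrier E"
      have Tx: "T x \<in> carrier E" using T x by auto
      have "(nm (T x))\<^sup>2 = cnorm B (inn E x ((cadj L T \<otimes>\<^bsub>L\<^esub> T) x))"
        using nm_sq[OF Tx] a(2)[OF x Tx] x by (simp add: L_apply)
      also have "\<dots> \<le> nm x * nm ((cadj L T \<otimes>\<^bsub>L\<^esub> T) x)" using x c by (intro cauchy_schwarz) auto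
      also have "\<dots> \<le> nm x * (?m * nm x)" using norm_L_bound[OF c x] x by (intro mult_left_mono) auto
      also have "\<dots> = (sqrt ?m * nm x)\<^sup>2" using m by (simp add: power_mult_distrib power2_eq_square)
      finally have sq: "(nm (T x))\<^sup>2 \<le> (sqrt ?m * nm x)\<^sup>2" .
      show "nm (T x) \<le> sqrt ?m * nm x"
        by (rule power2_le_imp_le[OF sq]) (use m x in simp)
    qed (use m in simp)
    then have "cnorm L T \<le> sqrt ?m" by (rule norm_L_le[OF T])
    then have "(cnorm L T)\<^sup>2 \<le> (sqrt ?m)\<^sup>2" using norm_L_nonneg[OF T] by (intro power_mono)
    then show "(cnorm L T)\<^sup>2 \<le> ?m" using m by simp
  qed
next
  fix T S :: "'e \<Rightarrow> 'e" and c
  assume TS: "T \<in> carrier L" "S \<in> carrier L"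
  note a = adj[OF TS(1)] and b = adj[OF TS(2)]
  show "T \<otimes>\<^bsub>L\<^esub> S \<in> carrier L" using TS by (rule L_closed)
  show "c \<odot>\<^bsub>L\<^esub> T \<otimes>\<^bsub>L\<^esub> S = c \<odot>\<^bsub>L\<^esub> (T \<otimes>\<^bsub>L\<^esub> S)"
    by (rule L_ext) (use TS in \<open>auto intro: L_closed simp: L_apply\<close>)
  show "T \<otimes>\<^bsub>L\<^esub> (c \<odot>\<^bsub>L\<^esub> S) = c \<odot>\<^bsub>L\<^esub> (T \<otimes>\<^bsub>L\<^esub> S)"
    by (rule L_ext) (use TS in \<open>auto intro: L_closed simp: L_apply L_linear\<close>)
  show "cadj L (T \<oplus>\<^bsub>L\<^esub> S) = cadj L T \<oplus>\<^bsub>L\<^esub> cadj L S"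
    by (rule adjI) (use TS a b in \<open>auto intro: L_closed simp: L_apply inn_add_left inn_add_right\<close>)
  show "cadj L (T \<otimes>\<^bsub>L\<^esub> S) = cadj L S \<otimes>\<^bsub>L\<^esub> cadj L T"
    by (rule adjI) (use TS a b in \<open>auto intro: L_closed simp: L_apply\<close>)
  show "cnorm L (T \<oplus>\<^bsub>L\<^esub> S) \<le> cnorm L T + cnorm L S"
  proof (intro norm_L_le L_closed TS)
    have "nm (T x \<oplus>\<^bsub>E\<^esub> S x) \<le> (cnorm L T + cnorm L S) * nm x" if x: "x \<in> carrier E" for x
      using nm_triangle[of "T x" "S x"] norm_L_bound[OF TS(1) x] norm_L_bound[OF TS(2) x] TS x
      by (auto simp: distrib_right)
    then show "op_bound (T \<oplus>\<^bsub>L\<^esub> S) (cnorm L T + cnorm L S)"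
      using norm_L_nonneg[OF TS(1)] norm_L_nonneg[OF TS(2)] by (simp add: op_bound_def L_apply)
  qed
  show "cnorm L (T \<otimes>\<^bsub>L\<^esub> S) \<le> cnorm L T * cnorm L S"
  proof (intro norm_L_le L_closed TS)
    have "nm (T (S x)) \<le> cnorm L T * cnorm L S * nm x" if x: "x \<in> carrier E" for x
    proof -
      have "nm (T (S x)) \<le> cnorm L T * nm (S x)" using norm_L_bound[OF TS(1), of "S x"] TS x by auto
      also have "\<dots> \<le> cnorm L T * (cnorm L S * nm x)"
        using norm_L_bound[OF TS(2) x] norm_L_nonneg[OF TS(1)] by (intro mult_left_mono)
      finally show ?thesis by (simp add: mult.assoc)
    qed
    then show "op_bound (T \<otimes>\<^bsub>L\<^esub> S) (cnorm L T * cnorm L S)"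
      using norm_L_nonneg[OF TS(1)] norm_L_nonneg[OF TS(2)] by (simp add: op_bound_def L_apply)
  qed
next
  fix T S R :: "'e \<Rightarrow> 'e"
  assume TS: "T \<in> carrier L" "S \<in> carrier L" "R \<in> carrier L"
  show "T \<otimes>\<^bsub>L\<^esub> S \<otimes>\<^bsub>L\<^esub> R = T \<otimes>\<^bsub>L\<^esub> (S \<otimes>\<^bsub>L\<^esub> R)"
    by (rule L_ext) (use TS in \<open>auto intro: L_closed simp: L_apply\<close>)
  show "(T \<oplus>\<^bsub>L\<^esub> S) \<otimes>\<^bsub>L\<^esub> R = T \<otimes>\<^bsub>L\<^esub> R \<oplus>\<^bsub>L\<^esub> S \<otimes>\<^bsub>L\<^esub> R"
    by (rule L_ext) (use TS in \<open>auto intro: L_closed simp: L_apply\<close>)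
  show "R \<otimes>\<^bsub>L\<^esub> (T \<oplus>\<^bsub>L\<^esub> S) = R \<otimes>\<^bsub>L\<^esub> T \<oplus>\<^bsub>L\<^esub> R \<otimes>\<^bsub>L\<^esub> S"
    by (rule L_ext) (use TS in \<open>auto intro: L_closed simp: L_apply L_linear\<close>)
next
  show "complete_wrt (carrier L) (\<lambda>x y. cnorm L (x \<ominus>\<^bsub>L\<^esub> y))" by (rule L_complete)
qed

theorem L_unital: "unital_cstar L"
proof (rule unital_cstar.intro[OF L_cstar], unfold_locales)
  show "\<one>\<^bsub>L\<^esub> \<in> carrier L" by (rule L_closed)
  fix T assume T: "T \<in> carrier L"
  show "\<one>\<^bsub>L\<^esub> \<otimes>\<^bsub>L\<^esub> T = T" by (rule L_ext) (use T in \<open>auto intro: L_closed simp: L_apply\<close>)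
  show "T \<otimes>\<^bsub>L\<^esub> \<one>\<^bsub>L\<^esub> = T" by (rule L_ext) (use T in \<open>auto intro: L_closed simp: L_apply\<close>)
qed

end

section \<open>Norm monotonicity, contractivity and the Cauchy-Schwarz inequality\<close>

text \<open>A C*-algebra as a Hilbert module over itself.\<close>

definition self_mod :: "'b cstar \<Rightarrow> ('b, 'b) hmod" where
  "self_mod B = \<lparr>carrier = carrier B, mult = mult B, one = one B, zero = zero B, add = add B,
     smult = smult B, ract = (\<lambda>x b. x \<otimes>\<^bsub>B\<^esub> b), inn = (\<lambda>x y. cadj B x \<otimes>\<^bsub>B\<^esub> y)\<rparr>"

lemma self_mod_simps [simp]:
  "carrier (self_mod B) = carrier B" "zero (self_mod B) = zero B" "add (self_mod B) = add B"
  "smult (self_mod B) = smult B" "ract (self_mod B) = (\<lambda>x b. x \<otimes>\<^bsub>B\<^esub> b)"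
  "inn (self_mod B) = (\<lambda>x y. cadj B x \<otimes>\<^bsub>B\<^esub> y)"
  by (simp_all add: self_mod_def)

lemma self_mod_a_inv: "a_inv (self_mod B) = a_inv B"
  by (rule ext) (simp add: a_inv_def m_inv_def)

lemma self_mod_minus [simp]: "a_minus (self_mod B) = a_minus B"
  by (intro ext) (simp add: a_minus_def self_mod_a_inv)

context cstar_algebra
begin

lemma self_module: "module complex_ring (self_mod C)"
proof (rule moduleI)
  show "cring complex_ring" by (rule complex_cring)
  show "abelian_group (self_mod C)"
    by (rule abelian_groupI) (auto simp: M.a_ac intro: M.l_neg bexI[of _ "\<ominus> _"])
qed (simp_all add: scale_simps scale_add)

lemma self_hnorm: "x \<in> carrier C \<Longrightarrow> hnorm C (self_mod C) x = cnorm C x"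
  by (simp add: hnorm_def cstar_identity cnorm_nonneg)

lemma self_cs: "cs_module C (self_mod C)"
proof (intro cs_module.intro ip_module.intro)
  show "cstar_algebra C" by (rule cstar_algebra_axioms)
  show "cmodule (self_mod C)" using self_module by (simp add: cmodule_def)
  show "ip_module_axioms C (self_mod C)"
  proof (unfold_locales, unfold self_mod_simps)
    fix x assume x: "x \<in> carrier C" "cadj C x \<otimes> x = \<zero>"
    then have "(cnorm C x)\<^sup>2 = 0" using cstar_identity[OF x(1)] by simp
    then show "x = \<zero>" using cnorm_eq_0 x by simp
  qed (auto simp: distr_right smult_mult_right mult_assoc cadj_mult cadj_cadj)
  show "cs_module_axioms C (self_mod C)"
  proof (rule cs_module_axioms.intro)
    show "complete_wrt (carrier (self_mod C)) (\<lambda>x y. hnorm C (self_mod C) (x \<ominus>\<^bsub>self_mod C\<^esub> y))"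
      unfolding complete_wrt_def
    proof (intro allI impI, elim conjE)
      fix s :: "nat \<Rightarrow> 'c"
      assume s: "range s \<subseteq> carrier (self_mod C)"
        and c: "\<forall>e>0. \<exists>N. \<forall>m\<ge>N. \<forall>n\<ge>N. hnorm C (self_mod C) (s m \<ominus>\<^bsub>self_mod C\<^esub> s n) < e"
      have sm: "s n \<in> carrier C" for n using s by auto
      have e: "hnorm C (self_mod C) (x \<ominus> y) = cnorm C (x \<ominus> y)" if "x \<in> carrier C" "y \<in> carrier C" for x y
        using self_hnorm[of "x \<ominus> y"] that by simp
      have "\<exists>x\<in>carrier C. (\<lambda>n. cnorm C (s n \<ominus> x)) \<longlonglongrightarrow> 0"
        using complete[unfolded complete_wrt_def, rule_format, of s] s c by (simp add: e sm)
      then show "\<exists>x\<in>carrier (self_mod C). (\<lambda>n. hnorm C (self_mod C) (s n \<ominus>\<^bsub>self_mod C\<^esub> x)) \<longlonglongrightarrow> 0"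
        by (auto simp: e sm)
    qed
    fix x y assume "x \<in> carrier (self_mod C)" "y \<in> carrier (self_mod C)"
    then show "cnorm C (inn (self_mod C) x y) \<le> hnorm C (self_mod C) x * hnorm C (self_mod C) y"
      using cnorm_mult[of "cadj C x" y] by (simp add: self_hnorm norm_cadj)
  qed
qed

interpretation S: cs_module C "self_mod C" by (rule self_cs)
interpretation SL: unital_cstar "adjointable_ops C (self_mod C)" by (rule S.L_unital)

text \<open>Left multiplication embeds the algebra isometrically in the unital algebra of adjointable operators
  of this module. This is a substitute for adjoining a unit.\<close>

definition left_mult :: "'c \<Rightarrow> 'c \<Rightarrow> 'c" where
  "left_mult b = (\<lambda>x\<in>carrier C. b \<otimes> x)"

abbreviation LC where "LC \<equiv> adjointable_ops C (self_mod C)"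

lemma left_mult_apply [simp]: "x \<in> carrier C \<Longrightarrow> left_mult b x = b \<otimes> x"
  by (simp add: left_mult_def)

lemma left_mult_mem [simp]: "b \<in> carrier C \<Longrightarrow> left_mult b \<in> carrier LC"
  by (rule S.L_I[where S = "\<lambda>x. cadj C b \<otimes> x"]) (auto simp: left_mult_def cadj_mult mult_assoc)

lemma left_mult_hom:
  assumes a: "a \<in> carrier C" and b: "b \<in> carrier C"
  shows "left_mult (a \<oplus> b) = left_mult a \<oplus>\<^bsub>LC\<^esub> left_mult b"
    "left_mult (a \<otimes> b) = left_mult a \<otimes>\<^bsub>LC\<^esub> left_mult b"
    "left_mult (c \<odot> a) = c \<odot>\<^bsub>LC\<^esub> left_mult a"
    "left_mult (cadj C a) = cadj LC (left_mult a)"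
proof -
  show "left_mult (a \<oplus> b) = left_mult a \<oplus>\<^bsub>LC\<^esub> left_mult b"
    by (rule S.L_ext) (use a b in \<open>auto simp: S.L_apply distr_left intro: S.L_closed\<close>)
  show "left_mult (a \<otimes> b) = left_mult a \<otimes>\<^bsub>LC\<^esub> left_mult b"
    by (rule S.L_ext) (use a b in \<open>auto simp: S.L_apply mult_assoc intro: S.L_closed\<close>)
  show "left_mult (c \<odot> a) = c \<odot>\<^bsub>LC\<^esub> left_mult a"
    by (rule S.L_ext) (use a b in \<open>auto simp: S.L_apply smult_mult_left intro: S.L_closed\<close>)
  show "left_mult (cadj C a) = cadj LC (left_mult a)"
    by (rule S.adjI[symmetric]) (use a in \<open>auto simp: cadj_mult mult_assoc\<close>)
qed

lemma left_mult_diff: "a \<in> carrier C \<Longrightarrow> b \<in> carrier C \<Longrightarrow> left_mult (a \<ominus> b) = left_mult a \<ominus>\<^bsub>LC\<^esub> left_mult b"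
  by (simp add: diff_eq_scale S.L.diff_eq_scale left_mult_hom)

lemma left_mult_norm:
  assumes a: "a \<in> carrier C"
  shows "cnorm LC (left_mult a) = cnorm C a"
proof (rule antisym)
  have "S.op_bound (left_mult a) (cnorm C a)"
    using a by (auto simp: S.op_bound_def self_hnorm cnorm_nonneg cnorm_mult)
  then show "cnorm LC (left_mult a) \<le> cnorm C a" using S.norm_L_le a by simp
  have "cnorm C (a \<otimes> cadj C a) \<le> cnorm LC (left_mult a) * cnorm C a"
    using S.norm_L_bound[of "left_mult a" "cadj C a"] a by (simp add: self_hnorm norm_cadj)
  moreover have "cnorm C (a \<otimes> cadj C a) = (cnorm C a)\<^sup>2"
    using cstar_identity[of "cadj C a"] a by (simp add: cadj_cadj norm_cadj)
  ultimately have *: "cnorm C a * cnorm C a \<le> cnorm LC (left_mult a) * cnorm C a"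
    by (simp add: power2_eq_square)
  show "cnorm C a \<le> cnorm LC (left_mult a)"
  proof (cases "cnorm C a = 0")
    case True then show ?thesis using SL.cnorm_nonneg a by simp
  next
    case False
    then have "cnorm C a > 0" using cnorm_nonneg[OF a] by linarith
    then show ?thesis using * by simp
  qed
qed

lemma left_mult_inj: "a \<in> carrier C \<Longrightarrow> b \<in> carrier C \<Longrightarrow> left_mult a = left_mult b \<Longrightarrow> a = b"
proof -
  assume *: "a \<in> carrier C" "b \<in> carrier C" "left_mult a = left_mult b"
  have "cnorm C (a \<ominus> b) = cnorm LC (left_mult a \<ominus>\<^bsub>LC\<^esub> left_mult b)"
    using left_mult_norm[of "a \<ominus> b"] left_mult_diff[OF *(1,2)] * by simp
  also have "\<dots> = 0" using * by (simp add: S.L.diff_self)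
  finally show ?thesis using cnorm_eq_0[of "a \<ominus> b"] diff_eq_zero * by simp
qed

lemma left_mult_subalgebra: "closed_star_subalgebra LC (left_mult ` carrier C)"
  unfolding closed_star_subalgebra_def
proof (intro conjI ballI)
  show "submodule (left_mult ` carrier C) complex_ring LC"
  proof (rule S.L.submoduleI)
    show "left_mult ` carrier C \<subseteq> carrier LC" by auto
    have "left_mult (0 \<odot> \<zero>) = \<zero>\<^bsub>LC\<^esub>" using left_mult_hom(3)[of \<zero> \<zero> 0] by (simp add: S.L.scale_simps)
    then show "\<zero>\<^bsub>LC\<^esub> \<in> left_mult ` carrier C" by (metis M.zero_closed image_eqI scale_closed)
    show "\<ominus>\<^bsub>LC\<^esub> a \<in> left_mult ` carrier C" if a: "a \<in> left_mult ` carrier C" for a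
    proof -
      obtain x where "x \<in> carrier C" "a = left_mult x" using a by blast
      then have "\<ominus>\<^bsub>LC\<^esub> a = left_mult ((- 1) \<odot> x)" by (simp add: S.L.neg_eq_scale left_mult_hom(3)[of x x])
      then show ?thesis using \<open>x \<in> carrier C\<close> by simp
    qed
    show "a \<oplus>\<^bsub>LC\<^esub> b \<in> left_mult ` carrier C" if "a \<in> left_mult ` carrier C" "b \<in> left_mult ` carrier C" for a b
      using that left_mult_hom(1)[symmetric] by auto
    show "c \<odot>\<^bsub>LC\<^esub> a \<in> left_mult ` carrier C" if "a \<in> left_mult ` carrier C" for c a
      using that left_mult_hom(3)[symmetric] by auto
  qed
  show "a \<otimes>\<^bsub>LC\<^esub> b \<in> left_mult ` carrier C" if "a \<in> left_mult ` carrier C" "b \<in> left_mult ` carrier C" for a b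
    using that left_mult_hom(2)[symmetric] by auto
  show "cadj LC a \<in> left_mult ` carrier C" if "a \<in> left_mult ` carrier C" for a
    using that left_mult_hom(4)[symmetric] by auto
  show "norm_closure LC (left_mult ` carrier C) \<subseteq> left_mult ` carrier C"
  proof
    fix T assume T: "T \<in> norm_closure LC (left_mult ` carrier C)"
    then have Tc: "T \<in> carrier LC" by (simp add: norm_closure_def)
    have "\<exists>x\<in>carrier C. cnorm LC (T \<ominus>\<^bsub>LC\<^esub> left_mult x) < (1 / 2) ^ n" for n :: nat
      using T unfolding norm_closure_def by (auto simp: Bex_def)
    then obtain x where x: "\<And>n. x n \<in> carrier C" "\<And>n. cnorm LC (T \<ominus>\<^bsub>LC\<^esub> left_mult (x n)) < (1 / 2) ^ n"
      by metis
    have x': "cnorm LC (left_mult (x n) \<ominus>\<^bsub>LC\<^esub> T) \<le> (1 / 2) ^ n" for n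
      using x(2)[of n] SL.norm_diff_commute[of T "left_mult (x n)"] Tc x(1)[of n] by simp
    have l: "(\<lambda>n. 2 * (1 / 2) ^ n :: real) \<longlonglongrightarrow> 0"
      by (intro tendsto_mult_right_zero LIMSEQ_power_zero) simp
    have "cnorm C (x (n + j) \<ominus> x n) \<le> 2 * (1 / 2) ^ n" for n j
    proof -
      have "cnorm C (x (n + j) \<ominus> x n) = cnorm LC (left_mult (x (n + j)) \<ominus>\<^bsub>LC\<^esub> left_mult (x n))"
        using left_mult_norm[of "x (n + j) \<ominus> x n"] left_mult_diff x(1) by simp
      also have "\<dots> \<le> cnorm LC (left_mult (x (n + j)) \<ominus>\<^bsub>LC\<^esub> T) + cnorm LC (T \<ominus>\<^bsub>LC\<^esub> left_mult (x n))"
        using x(1) Tc by (intro SL.norm_diff_trans) auto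
      also have "\<dots> \<le> (1 / 2) ^ (n + j) + (1 / 2) ^ n"
        using x'[of "n + j"] x(2)[of n] by linarith
      also have "(1 / 2 :: real) ^ (n + j) \<le> (1 / 2) ^ n" by (rule power_decreasing) auto
      finally show ?thesis by simp
    qed
    then obtain y where y: "clim x y" using clim_complete[of x, OF x(1) _ l] by blast
    have "SL.clim (\<lambda>n. left_mult (x n)) (left_mult y)"
      unfolding SL.clim_def using y climD[OF y] unfolding clim_def
      by (auto simp: left_mult_diff[symmetric] left_mult_norm)
    moreover have "SL.clim (\<lambda>n. left_mult (x n)) T"
      by (rule SL.climI[where e = "\<lambda>n. (1 / 2) ^ n"]) (use x x' Tc in \<open>auto intro!: LIMSEQ_power_zero\<close>)
    ultimately show "T \<in> left_mult ` carrier C" using SL.clim_unique climD(2)[OF y] by blast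
  qed
qed

theorem norm_sum_squares_mono:
  assumes x: "x \<in> carrier C" and y: "y \<in> carrier C"
  shows "cnorm C (cadj C x \<otimes> x) \<le> cnorm C (cadj C x \<otimes> x \<oplus> cadj C y \<otimes> y)"
  using SL.norm_sum_squares_mono[of "left_mult x" "left_mult y"] x y
  by (simp add: left_mult_hom[symmetric] left_mult_norm)

theorem cstar_pos_add:
  assumes "cstar_pos C a" "cstar_pos C b"
  shows "cstar_pos C (a \<oplus> b)"
proof -
  obtain x y where x: "x \<in> carrier C" "a = cadj C x \<otimes> x" and y: "y \<in> carrier C" "b = cadj C y \<otimes> y"
    using assms unfolding cstar_pos_def by blast
  have c: "a \<oplus> b \<in> carrier C" using x y by simp
  have "left_mult (a \<oplus> b) = cadj LC (left_mult x) \<otimes>\<^bsub>LC\<^esub> left_mult x \<oplus>\<^bsub>LC\<^esub> cadj LC (left_mult y) \<otimes>\<^bsub>LC\<^esub> left_mult y"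
    using x y by (simp add: left_mult_hom)
  then have "SL.pos (left_mult (a \<oplus> b))" using x y by (simp add: SL.pos_add SL.pos_cadj_mult)
  then obtain s where s: "s \<in> left_mult ` carrier C" "cadj LC s = s" "s \<otimes>\<^bsub>LC\<^esub> s = left_mult (a \<oplus> b)"
    using SL.pos_sqrt_subalgebra[OF left_mult_subalgebra _ imageI[OF c]] by blast
  then obtain w where w: "w \<in> carrier C" "s = left_mult w" by blast
  have "left_mult (cadj C w \<otimes> w) = left_mult (a \<oplus> b)" using w s by (simp add: left_mult_hom)
  then have "cadj C w \<otimes> w = a \<oplus> b" using left_mult_inj w c by simp
  then show ?thesis using w unfolding cstar_pos_def by metis
qed

end

text \<open>If \<open>\<parallel>b\<parallel> \<le> 1\<close>, then \<open>1 - b\<^sup>* b\<close> has a square root \<open>1 - d\<close> with \<open>d\<close> in the algebra, and the image of this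
  relation shows that \<open>x\<^sup>* x\<close> is the sum of the squares of \<open>h(b) x\<close> and \<open>x - h(d) x\<close>.\<close>

theorem star_hom_contractive:
  assumes B: "cstar_algebra B" and C: "cstar_algebra C" and h: "h \<in> star_hom B C" and b: "b \<in> carrier B"
  shows "cnorm C (h b) \<le> cnorm B b"
proof -
  interpret B: cstar_algebra B by (rule B)
  interpret C: cstar_algebra C by (rule C)
  have hc: "h x \<in> carrier C" if "x \<in> carrier B" for x using h that by (auto simp: star_hom_def)
  note hh = h[unfolded star_hom_def, simplified]
  have 1: "cnorm C (h b) \<le> 1" if b: "b \<in> carrier B" and n: "cnorm B b \<le> 1" for b
  proof -
    define k where "k = cadj B b \<otimes>\<^bsub>B\<^esub> b"
    have k: "k \<in> carrier B" "cadj B k = k" using b by (auto simp: k_def B.cadj_mult B.cadj_cadj)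
    have "cnorm B k \<le> 1" using B.cstar_identity[OF b] n B.cnorm_nonneg[OF b] by (simp add: k_def power_le_one)
    then obtain d where d: "B.clim (B.sqrt_iter k) d" "d \<oplus>\<^bsub>B\<^esub> d = k \<oplus>\<^bsub>B\<^esub> d \<otimes>\<^bsub>B\<^esub> d"
      using B.sqrt_exists[OF k(1)] by blast
    note dc = B.climD(2)[OF d(1)]
    have sa: "cadj B d = d" using B.clim_self_adjoint[OF d(1)] B.sqrt_iter_cadj[OF k] by blast
    define D where "D = h d"
    have D: "D \<in> carrier C" "cadj C D = D" using hc[OF dc] hh dc sa unfolding D_def by (simp, metis)
    have DD: "D \<oplus>\<^bsub>C\<^esub> D = cadj C (h b) \<otimes>\<^bsub>C\<^esub> h b \<oplus>\<^bsub>C\<^esub> D \<otimes>\<^bsub>C\<^esub> D"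
    proof -
      have "h (d \<oplus>\<^bsub>B\<^esub> d) = D \<oplus>\<^bsub>C\<^esub> D" using hh dc by (simp add: D_def)
      moreover have "h (k \<oplus>\<^bsub>B\<^esub> d \<otimes>\<^bsub>B\<^esub> d) = cadj C (h b) \<otimes>\<^bsub>C\<^esub> h b \<oplus>\<^bsub>C\<^esub> D \<otimes>\<^bsub>C\<^esub> D"
        using hh dc b k(1) by (simp add: D_def k_def)
      ultimately show ?thesis using d(2) by simp
    qed
    have hb: "h b \<in> carrier C" by (rule hc[OF b])
    define x where "x = cadj C (h b)"
    have x: "x \<in> carrier C" using hb by (simp add: x_def)
    define w where "w = x \<ominus>\<^bsub>C\<^esub> D \<otimes>\<^bsub>C\<^esub> x"
    define z where "z = h b \<otimes>\<^bsub>C\<^esub> x"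
    have wz: "w \<in> carrier C" "z \<in> carrier C" using x D hb by (auto simp: w_def z_def)
    let ?xx = "cadj C x \<otimes>\<^bsub>C\<^esub> x" and ?xDx = "cadj C x \<otimes>\<^bsub>C\<^esub> (D \<otimes>\<^bsub>C\<^esub> x)"
      and ?xDDx = "cadj C x \<otimes>\<^bsub>C\<^esub> (D \<otimes>\<^bsub>C\<^esub> (D \<otimes>\<^bsub>C\<^esub> x))" and ?zz = "cadj C z \<otimes>\<^bsub>C\<^esub> z"
    have e: "?xDx \<oplus>\<^bsub>C\<^esub> ?xDx = ?zz \<oplus>\<^bsub>C\<^esub> ?xDDx"
    proof -
      have "cadj C x \<otimes>\<^bsub>C\<^esub> ((D \<oplus>\<^bsub>C\<^esub> D) \<otimes>\<^bsub>C\<^esub> x) = cadj C x \<otimes>\<^bsub>C\<^esub> ((cadj C (h b) \<otimes>\<^bsub>C\<^esub> h b \<oplus>\<^bsub>C\<^esub> D \<otimes>\<^bsub>C\<^esub> D) \<otimes>\<^bsub>C\<^esub> x)"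
        by (simp only: DD)
      then show ?thesis using x D(1) hb by (simp add: z_def C.distr_left C.distr_right C.mult_assoc C.cadj_mult)
    qed
    have "cadj C w \<otimes>\<^bsub>C\<^esub> w = ?xx \<ominus>\<^bsub>C\<^esub> (?xDx \<oplus>\<^bsub>C\<^esub> ?xDx) \<oplus>\<^bsub>C\<^esub> ?xDDx"
      unfolding w_def using x D
      by (simp add: C.star_algebra_simps) (rule C.lin3[of ?xx ?xDx ?xDDx], simp_all)
    then have ww: "cadj C w \<otimes>\<^bsub>C\<^esub> w = ?xx \<ominus>\<^bsub>C\<^esub> (?zz \<oplus>\<^bsub>C\<^esub> ?xDDx) \<oplus>\<^bsub>C\<^esub> ?xDDx" by (simp only: e)
    have "?zz \<oplus>\<^bsub>C\<^esub> cadj C w \<otimes>\<^bsub>C\<^esub> w = ?xx"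
      unfolding ww by (rule C.lin3[of ?xx ?zz ?xDDx], use x D wz in simp_all)
    then have "cnorm C ?zz \<le> cnorm C ?xx" using C.norm_sum_squares_mono[OF wz(2,1)] by simp
    then have "(cnorm C z)\<^sup>2 \<le> (cnorm C x)\<^sup>2" using C.cstar_identity x wz by simp
    then have "cnorm C z \<le> cnorm C x" by (rule power2_le_imp_le[OF _ C.cnorm_nonneg[OF x]])
    moreover have "cnorm C x = cnorm C (h b)" using hb by (simp add: x_def C.norm_cadj)
    moreover have "cnorm C z = (cnorm C (h b))\<^sup>2"
      using C.cstar_identity[OF x] hb by (simp add: z_def x_def C.cadj_cadj C.norm_cadj)
    ultimately have *: "cnorm C (h b) * cnorm C (h b) \<le> 1 * cnorm C (h b)" by (simp add: power2_eq_square)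
    show ?thesis
    proof (cases "cnorm C (h b) = 0")
      case False
      then have "cnorm C (h b) > 0" using C.cnorm_nonneg[OF hb] by linarith
      then show ?thesis using * mult_le_cancel_right by simp
    qed simp
  qed
  show ?thesis
  proof (cases "cnorm B b = 0")
    case True
    then have "b = \<zero>\<^bsub>B\<^esub>" using B.cnorm_eq_0 b by simp
    moreover have "h (0 \<odot>\<^bsub>B\<^esub> b) = 0 \<odot>\<^bsub>C\<^esub> h b" using hh b by simp
    ultimately have "h b = \<zero>\<^bsub>C\<^esub>" using hc[OF b] by (simp add: B.scale_simps C.scale_simps)
    then show ?thesis using True by simp
  next
    case False
    then have p: "cnorm B b > 0" using B.cnorm_nonneg[OF b] by linarith
    let ?c = "complex_of_real (1 / cnorm B b)"
    have "cnorm B (?c \<odot>\<^bsub>B\<^esub> b) = 1" using p b B.norm_real_smult[of b "1 / cnorm B b"] by simp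
    then have "cnorm C (h (?c \<odot>\<^bsub>B\<^esub> b)) \<le> 1" using 1 b by simp
    moreover have "h (?c \<odot>\<^bsub>B\<^esub> b) = ?c \<odot>\<^bsub>C\<^esub> h b" using hh b by simp
    ultimately have "1 / cnorm B b * cnorm C (h b) \<le> 1"
      using C.norm_real_smult[OF hc[OF b], of "1 / cnorm B b"] p by (simp del: of_real_divide)
    then show ?thesis using p by (simp add: divide_le_eq)
  qed
qed

sublocale hilbert_module \<subseteq> ip_module B E
proof (intro ip_module.intro)
  show "cmodule E" by (simp add: cmodule_def E.module_axioms)
  show "ip_module_axioms B E"
    by unfold_locales (auto simp: ract_closed inn_closed inn_add_right inn_smult_right inn_ract_right inn_cadj inn_eq_0)
qed (rule B.cstar_algebra_axioms)

text \<open>For \<open>v\<close> of norm 1, \<open>g = \<langle>v, v\<rangle>\<close> and \<open>b = \<langle>v, x\<rangle>\<close>, expanding \<open>z = x - v b\<close> gives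
  \<open>\<langle>x, x\<rangle> = b\<^sup>* b + \<langle>z, z\<rangle> + b\<^sup>* (1 - g) b\<close>. The last term is a square \<open>w\<^sup>* w\<close> because \<open>1 - g\<close> has a square root, and
  the norm is monotone on sums of positive elements.\<close>

sublocale hilbert_module \<subseteq> cs_module B E
proof (unfold_locales)
  show "complete_wrt (carrier E) (\<lambda>x y. hnorm B E (x \<ominus>\<^bsub>E\<^esub> y))" by (rule complete)
  fix x y assume x: "x \<in> carrier E" and y: "y \<in> carrier E"
  show "cnorm B (inn E x y) \<le> nm x * nm y"
  proof (cases "nm y = 0")
    case True
    then have "y = \<zero>\<^bsub>E\<^esub>" using nm_eq_0 y by simp
    then show ?thesis using x by simp
  next
    case False
    then have p: "nm y > 0" using nm_nonneg[OF y] by linarith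
    let ?c = "complex_of_real (1 / nm y)"
    define v where "v = ?c \<odot>\<^bsub>E\<^esub> y"
    have v: "v \<in> carrier E" "nm v = 1" using y p by (auto simp: v_def nm_smult norm_divide)
    define g where "g = inn E v v"
    have g: "g \<in> carrier B" "cadj B g = g" "cnorm B g \<le> 1"
      using v nm_sq[of v] by (auto simp: g_def inn_cadj)
    obtain d where d: "B.clim (B.sqrt_iter g) d" "d \<oplus>\<^bsub>B\<^esub> d = g \<oplus>\<^bsub>B\<^esub> d \<otimes>\<^bsub>B\<^esub> d"
      using B.sqrt_exists[OF g(1,3)] by blast
    note dc = B.climD(2)[OF d(1)]
    have sa: "cadj B d = d" using B.clim_self_adjoint[OF d(1)] B.sqrt_iter_cadj[OF g(1,2)] by blast
    define b where "b = inn E v x"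
    have b: "b \<in> carrier B" using v x by (simp add: b_def)
    define w where "w = b \<ominus>\<^bsub>B\<^esub> d \<otimes>\<^bsub>B\<^esub> b"
    have w: "w \<in> carrier B" using b dc by (simp add: w_def)
    let ?bb = "cadj B b \<otimes>\<^bsub>B\<^esub> b" and ?bdb = "cadj B b \<otimes>\<^bsub>B\<^esub> (d \<otimes>\<^bsub>B\<^esub> b)"
      and ?bddb = "cadj B b \<otimes>\<^bsub>B\<^esub> (d \<otimes>\<^bsub>B\<^esub> (d \<otimes>\<^bsub>B\<^esub> b))" and ?bgb = "cadj B b \<otimes>\<^bsub>B\<^esub> (g \<otimes>\<^bsub>B\<^esub> b)"
    have e: "?bdb \<oplus>\<^bsub>B\<^esub> ?bdb = ?bgb \<oplus>\<^bsub>B\<^esub> ?bddb"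
    proof -
      have "cadj B b \<otimes>\<^bsub>B\<^esub> ((d \<oplus>\<^bsub>B\<^esub> d) \<otimes>\<^bsub>B\<^esub> b) = cadj B b \<otimes>\<^bsub>B\<^esub> ((g \<oplus>\<^bsub>B\<^esub> d \<otimes>\<^bsub>B\<^esub> d) \<otimes>\<^bsub>B\<^esub> b)"
        by (simp only: d(2))
      then show ?thesis using b dc g(1) by (simp add: B.distr_left B.distr_right B.mult_assoc)
    qed
    have "cadj B w \<otimes>\<^bsub>B\<^esub> w = ?bb \<ominus>\<^bsub>B\<^esub> (?bdb \<oplus>\<^bsub>B\<^esub> ?bdb) \<oplus>\<^bsub>B\<^esub> ?bddb"
      unfolding w_def using b dc sa
      by (simp add: B.star_algebra_simps) (rule B.lin3[of ?bb ?bdb ?bddb], simp_all)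
    then have ww: "cadj B w \<otimes>\<^bsub>B\<^esub> w = ?bb \<ominus>\<^bsub>B\<^esub> (?bgb \<oplus>\<^bsub>B\<^esub> ?bddb) \<oplus>\<^bsub>B\<^esub> ?bddb" by (simp only: e)
    define z where "z = x \<ominus>\<^bsub>E\<^esub> ract E v b"
    have vb: "ract E v b \<in> carrier E" using v b by auto
    have z: "z \<in> carrier E" using x vb by (simp add: z_def)
    have xv: "inn E x v = cadj B b" using inn_cadj[OF v(1) x] by (simp add: b_def)
    have zz: "inn E z z = inn E x x \<ominus>\<^bsub>B\<^esub> (?bb \<oplus>\<^bsub>B\<^esub> ?bb) \<oplus>\<^bsub>B\<^esub> ?bgb"
      unfolding z_def using x v(1) vb b g(1)
      by (simp add: inn_diff_left inn_diff_right inn_ract_left inn_ract_right xv b_def[symmetric] g_def[symmetric] B.mult_assoc B.diff_mult)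
        (rule B.lin3[of "inn E x x" ?bb ?bgb], simp_all)
    have xx: "?bb \<oplus>\<^bsub>B\<^esub> (inn E z z \<oplus>\<^bsub>B\<^esub> cadj B w \<otimes>\<^bsub>B\<^esub> w) = inn E x x"
      unfolding ww zz by (rule B.lin5[of "inn E x x" ?bb ?bgb ?bddb ?bb], use x b dc g in simp_all)
    have "cstar_pos B (cadj B w \<otimes>\<^bsub>B\<^esub> w)" unfolding cstar_pos_def using w by blast
    then have "cstar_pos B (inn E z z \<oplus>\<^bsub>B\<^esub> cadj B w \<otimes>\<^bsub>B\<^esub> w)" by (intro B.cstar_pos_add inn_pos z)
    then obtain u where u: "u \<in> carrier B" "inn E z z \<oplus>\<^bsub>B\<^esub> cadj B w \<otimes>\<^bsub>B\<^esub> w = cadj B u \<otimes>\<^bsub>B\<^esub> u"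
      unfolding cstar_pos_def by blast
    have "cnorm B ?bb \<le> cnorm B (inn E x x)"
      using B.norm_sum_squares_mono[OF b u(1)] xx u(2) by simp
    then have "(cnorm B b)\<^sup>2 \<le> (nm x)\<^sup>2" using B.cstar_identity[OF b] nm_sq[OF x] by simp
    then have nb: "cnorm B b \<le> nm x" by (rule power2_le_imp_le[OF _ nm_nonneg[OF x]])
    have "b = ?c \<odot>\<^bsub>B\<^esub> inn E y x" using x y by (simp add: b_def v_def inn_smult_left)
    then have "cnorm B b = 1 / nm y * cnorm B (inn E y x)"
      using B.norm_real_smult[of "inn E y x" "1 / nm y"] x y p by (simp del: of_real_divide)
    then have "cnorm B (inn E y x) = nm y * cnorm B b" using p by (simp add: field_simps)
    also have "\<dots> \<le> nm y * nm x" using nb p by (intro mult_left_mono) auto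
    finally show ?thesis using B.norm_cadj[of "inn E y x"] inn_cadj[OF y x] x y by (simp add: mult.commute)
  qed
qed

section \<open>Closed star-subalgebras\<close>

context cstar_algebra
begin

abbreviation "sub S \<equiv> C\<lparr>carrier := S\<rparr>"

lemma sub_a_inv:
  assumes S: "closed_star_subalgebra C S" and y: "y \<in> S"
  shows "\<ominus>\<^bsub>sub S\<^esub> y = \<ominus> y"
proof -
  note S' = subalgebraD[OF S]
  have "submodule S complex_ring C" using S by (simp add: closed_star_subalgebra_def)
  from submodule.submodule_is_module[OF this module_axioms] have m: "module complex_ring (sub S)" .
  interpret T: cmodule "sub S" using m by (simp add: cmodule_def)
  show ?thesis using T.neg_eq_scale[of y] neg_eq_scale[of y] y S'(1) by auto
qed

lemma sub_minus:
  assumes S: "closed_star_subalgebra C S" and y: "y \<in> S"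
  shows "x \<ominus>\<^bsub>sub S\<^esub> y = x \<ominus> y"
  by (simp add: a_minus_def sub_a_inv[OF assms])

theorem sub_cstar:
  assumes S: "closed_star_subalgebra C S"
  shows "cstar_algebra (sub S)"
proof -
  note S' = subalgebraD[OF S]
  have "submodule S complex_ring C" using S by (simp add: closed_star_subalgebra_def)
  from submodule.submodule_is_module[OF this module_axioms] have m: "module complex_ring (sub S)" .
  have c: "x \<in> S \<Longrightarrow> x \<in> carrier C" for x using S'(1) by blast
  have comp: "complete_wrt S (\<lambda>x y. cnorm C (x \<ominus>\<^bsub>sub S\<^esub> y))"
    unfolding complete_wrt_def
  proof (intro allI impI, elim conjE)
    fix s :: "nat \<Rightarrow> 'c"
    assume s: "range s \<subseteq> S" and cau: "\<forall>e>0. \<exists>N. \<forall>m\<ge>N. \<forall>n\<ge>N. cnorm C (s m \<ominus>\<^bsub>sub S\<^esub> s n) < e"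
    have sS: "s n \<in> S" for n using s by blast
    have "range s \<subseteq> carrier C" using s S'(1) by blast
    moreover have "\<forall>e>0. \<exists>N. \<forall>m\<ge>N. \<forall>n\<ge>N. cnorm C (s m \<ominus> s n) < e"
      using cau by (simp add: sub_minus[OF S] sS)
    ultimately have "\<exists>x\<in>carrier C. (\<lambda>n. cnorm C (s n \<ominus> x)) \<longlonglongrightarrow> 0"
      using complete unfolding complete_wrt_def by blast
    then obtain x where x: "x \<in> carrier C" "(\<lambda>n. cnorm C (s n \<ominus> x)) \<longlonglongrightarrow> 0" ..
    then have "clim s x" using \<open>range s \<subseteq> carrier C\<close> by (simp add: clim_def)
    then have "x \<in> S" using sS S'(8) by (rule clim_closed)
    then show "\<exists>x\<in>S. (\<lambda>n. cnorm C (s n \<ominus>\<^bsub>sub S\<^esub> x)) \<longlonglongrightarrow> 0"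
      using x by (intro bexI[of _ x]) (simp_all add: sub_minus[OF S])
  qed
  show ?thesis
  proof (rule cstar_algebra.intro[OF m], rule cstar_algebra_axioms.intro)
  qed (use S' comp c in \<open>auto simp: mult_assoc distr_left distr_right smult_mult_left smult_mult_right
      cadj_cadj cadj_add cadj_smult cadj_mult cnorm_nonneg cnorm_eq_0 cnorm_triangle cnorm_smult cnorm_mult cstar_identity\<close>)
qed

lemma sub_finsum:
  assumes S: "closed_star_subalgebra C S" and f: "\<And>i. i \<in> A \<Longrightarrow> f i \<in> S" and "finite A"
  shows "finsum (sub S) f A = finsum C f A"
proof -
  note S' = subalgebraD[OF S]
  interpret T: cstar_algebra "sub S" by (rule sub_cstar[OF S])
  have c: "x \<in> S \<Longrightarrow> x \<in> carrier C" for x using S'(1) by blast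
  show ?thesis using assms(3) f
  proof (induction A rule: finite_induct)
    case (insert a A)
    then show ?case using c by (simp add: T.M.finsum_insert M.finsum_insert Pi_def)
  qed (simp add: T.M.finsum_empty M.finsum_empty)
qed

lemma finsum_mem:
  assumes S: "closed_star_subalgebra C S" and f: "\<And>i. i \<in> A \<Longrightarrow> f i \<in> S" and "finite A"
  shows "finsum C f A \<in> S"
proof -
  note S' = subalgebraD[OF S]
  have c: "x \<in> S \<Longrightarrow> x \<in> carrier C" for x using S'(1) by blast
  show ?thesis using assms(3) f
  proof (induction A rule: finite_induct)
    case (insert a A)
    then show ?case using c S' by (simp add: M.finsum_insert Pi_def)
  qed (use S' in \<open>simp add: M.finsum_empty\<close>)
qed

section \<open>Finite sums\<close>

lemma fsum_cong:
  "(\<And>i. i \<in> A \<Longrightarrow> f i = g i) \<Longrightarrow> (\<And>i. i \<in> A \<Longrightarrow> g i \<in> carrier C) \<Longrightarrow> finsum C f A = finsum C g A"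
  by (rule M.finsum_cong') auto

lemma fsum_closed [simp]: "(\<And>i. i \<in> A \<Longrightarrow> f i \<in> carrier C) \<Longrightarrow> finsum C f A \<in> carrier C"
  by (rule M.finsum_closed) auto

lemma fsum_insert: "finite A \<Longrightarrow> a \<notin> A \<Longrightarrow> (\<And>i. i \<in> insert a A \<Longrightarrow> f i \<in> carrier C) \<Longrightarrow>
    finsum C f (insert a A) = f a \<oplus> finsum C f A"
  by (rule M.finsum_insert) auto

lemma fsum_add: "(\<And>i. i \<in> A \<Longrightarrow> f i \<in> carrier C) \<Longrightarrow> (\<And>i. i \<in> A \<Longrightarrow> g i \<in> carrier C) \<Longrightarrow>
    finsum C (\<lambda>i. f i \<oplus> g i) A = finsum C f A \<oplus> finsum C g A"
  by (rule M.finsum_addf) auto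

lemma fsum_hom:
  assumes "finite A" "\<And>i. i \<in> A \<Longrightarrow> f i \<in> carrier C"
    and F: "\<And>x. x \<in> carrier C \<Longrightarrow> F x \<in> carrier C" "F \<zero> = \<zero>"
      "\<And>x y. x \<in> carrier C \<Longrightarrow> y \<in> carrier C \<Longrightarrow> F (x \<oplus> y) = F x \<oplus> F y"
  shows "F (finsum C f A) = finsum C (\<lambda>i. F (f i)) A"
  using assms(1,2)
proof (induction A rule: finite_induct)
  case (insert a A)
  then show ?case using F by (simp add: fsum_insert)
qed (simp add: F M.finsum_empty)

lemma fsum_mult_right: "finite A \<Longrightarrow> (\<And>i. i \<in> A \<Longrightarrow> f i \<in> carrier C) \<Longrightarrow> b \<in> carrier C \<Longrightarrow>
    finsum C f A \<otimes> b = finsum C (\<lambda>i. f i \<otimes> b) A"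
  using fsum_hom[of A f "\<lambda>x. x \<otimes> b"] by (simp add: distr_left)

lemma fsum_mult_left: "finite A \<Longrightarrow> (\<And>i. i \<in> A \<Longrightarrow> f i \<in> carrier C) \<Longrightarrow> b \<in> carrier C \<Longrightarrow>
    b \<otimes> finsum C f A = finsum C (\<lambda>i. b \<otimes> f i) A"
  using fsum_hom[of A f "\<lambda>x. b \<otimes> x"] by (simp add: distr_right)

lemma fsum_smult: "finite A \<Longrightarrow> (\<And>i. i \<in> A \<Longrightarrow> f i \<in> carrier C) \<Longrightarrow>
    c \<odot> finsum C f A = finsum C (\<lambda>i. c \<odot> f i) A"
  using fsum_hom[of A f "\<lambda>x. c \<odot> x"] by (simp add: scale_simps)

lemma fsum_cadj: "finite A \<Longrightarrow> (\<And>i. i \<in> A \<Longrightarrow> f i \<in> carrier C) \<Longrightarrow>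
    cadj C (finsum C f A) = finsum C (\<lambda>i. cadj C (f i)) A"
  using fsum_hom[of A f "cadj C"] by (simp add: cadj_add)

lemma fsum_zero: "finsum C (\<lambda>i. \<zero>) A = \<zero>"
  by (rule M.finsum_zero)

lemma fsum_swap:
  assumes "finite A" "finite D" "\<And>i j. i \<in> A \<Longrightarrow> j \<in> D \<Longrightarrow> f i j \<in> carrier C"
  shows "finsum C (\<lambda>i. finsum C (\<lambda>j. f i j) D) A = finsum C (\<lambda>j. finsum C (\<lambda>i. f i j) A) D"
  using assms(1,3)
proof (induction A rule: finite_induct)
  case empty
  then show ?case by (simp add: M.finsum_empty fsum_zero)
next
  case (insert a A)
  have "finsum C (\<lambda>i. finsum C (\<lambda>j. f i j) D) (insert a A) = finsum C (f a) D \<oplus> finsum C (\<lambda>j. finsum C (\<lambda>i. f i j) A) D"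
    using insert by (simp add: fsum_insert)
  also have "\<dots> = finsum C (\<lambda>j. f a j \<oplus> finsum C (\<lambda>i. f i j) A) D"
    using insert by (intro fsum_add[symmetric]) auto
  also have "\<dots> = finsum C (\<lambda>j. finsum C (\<lambda>i. f i j) (insert a A)) D"
    using insert by (intro fsum_cong) (auto simp: fsum_insert)
  finally show ?case .
qed

lemma fsum_single:
  assumes "finite A" "a \<in> A" "f a \<in> carrier C" "\<And>i. i \<in> A \<Longrightarrow> i \<noteq> a \<Longrightarrow> f i = \<zero>"
  shows "finsum C f A = f a"
proof -
  have m: "f i \<in> carrier C" if "i \<in> A" for i using assms that by (cases "i = a") auto
  have "finsum C f A = finsum C f (insert a (A - {a}))" using assms(2) by (simp add: insert_absorb)
  also have "\<dots> = f a \<oplus> finsum C f (A - {a})" using assms(1,2) m by (intro fsum_insert) auto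
  also have "finsum C f (A - {a}) = finsum C (\<lambda>i. \<zero>) (A - {a})" using assms by (intro fsum_cong) auto
  finally show ?thesis using assms by (simp add: fsum_zero)
qed

lemma fsum_norm_le:
  assumes "finite A" "\<And>i. i \<in> A \<Longrightarrow> f i \<in> carrier C"
  shows "cnorm C (finsum C f A) \<le> (\<Sum>i\<in>A. cnorm C (f i))"
  using assms
proof (induction A rule: finite_induct)
  case (insert a A)
  then show ?case using cnorm_triangle[of "f a" "finsum C f A"] by (simp add: fsum_insert)
qed (simp add: M.finsum_empty)

lemma fsum_clim:
  assumes "finite A" "\<And>i. i \<in> A \<Longrightarrow> clim (\<lambda>n. f n i) (g i)"
  shows "clim (\<lambda>n. finsum C (f n) A) (finsum C g A)"
  using assms
proof (induction A rule: finite_induct)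
  case (insert a A)
  have "clim (\<lambda>n. f n a \<oplus> finsum C (f n) A) (g a \<oplus> finsum C g A)"
    using insert by (intro clim_add) auto
  moreover have "f n i \<in> carrier C" "g i \<in> carrier C" if "i \<in> insert a A" for n i
    using climD[OF insert.prems[OF that]] by auto
  ultimately show ?case using insert by (simp add: fsum_insert)
qed (simp add: M.finsum_empty clim_const)

lemma cstar_pos_zero: "cstar_pos C \<zero>"
  unfolding cstar_pos_def by (rule bexI[of _ \<zero>]) auto

lemma cstar_pos_square: "x \<in> carrier C \<Longrightarrow> cstar_pos C (cadj C x \<otimes> x)"
  unfolding cstar_pos_def by blast

lemma cstar_pos_closed: "cstar_pos C x \<Longrightarrow> x \<in> carrier C"
  unfolding cstar_pos_def by auto

lemma fsum_cstar_pos: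
  assumes "finite A" "\<And>i. i \<in> A \<Longrightarrow> cstar_pos C (f i)"
  shows "cstar_pos C (finsum C f A)"
  using assms
proof (induction A rule: finite_induct)
  case (insert a A)
  then show ?case using cstar_pos_closed by (simp add: fsum_insert cstar_pos_add)
qed (simp add: M.finsum_empty cstar_pos_zero)

text \<open>The entries of a row are bounded by the norm of the row.\<close>

lemma fsum_squares_norm_ge:
  assumes "finite A" "a \<in> A" "\<And>i. i \<in> A \<Longrightarrow> x i \<in> carrier C"
  shows "(cnorm C (x a))\<^sup>2 \<le> cnorm C (finsum C (\<lambda>i. cadj C (x i) \<otimes> x i) A)"
proof -
  let ?f = "\<lambda>i. cadj C (x i) \<otimes> x i"
  have "finsum C ?f A = finsum C ?f (insert a (A - {a}))" using assms(2) by (simp add: insert_absorb)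
  also have "\<dots> = ?f a \<oplus> finsum C ?f (A - {a})" using assms by (intro fsum_insert) auto
  finally have e: "finsum C ?f A = ?f a \<oplus> finsum C ?f (A - {a})" .
  have "cstar_pos C (finsum C ?f (A - {a}))"
    using assms by (intro fsum_cstar_pos cstar_pos_square) auto
  then obtain u where "u \<in> carrier C" "finsum C ?f (A - {a}) = cadj C u \<otimes> u" unfolding cstar_pos_def by blast
  then show ?thesis using norm_sum_squares_mono[of "x a" u] cstar_identity[of "x a"] assms e by simp
qed

end

section \<open>The Hilbert module of rows and its matrices\<close>

definition pow_mod :: "'b cstar \<Rightarrow> nat \<Rightarrow> ('b, nat \<Rightarrow> 'b) hmod" where
  "pow_mod B k = \<lparr>carrier = {..<k} \<rightarrow>\<^sub>E carrier B, mult = (\<lambda>x y. x), one = (\<lambda>i. one B),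
     zero = (\<lambda>i\<in>{..<k}. \<zero>\<^bsub>B\<^esub>), add = (\<lambda>x y. \<lambda>i\<in>{..<k}. x i \<oplus>\<^bsub>B\<^esub> y i),
     smult = (\<lambda>c x. \<lambda>i\<in>{..<k}. c \<odot>\<^bsub>B\<^esub> x i), ract = (\<lambda>x b. \<lambda>i\<in>{..<k}. x i \<otimes>\<^bsub>B\<^esub> b),
     inn = (\<lambda>x y. finsum B (\<lambda>i. cadj B (x i) \<otimes>\<^bsub>B\<^esub> y i) {..<k})\<rparr>"

lemma pow_mod_simps:
  "carrier (pow_mod B k) = {..<k} \<rightarrow>\<^sub>E carrier B"
  "zero (pow_mod B k) = (\<lambda>i\<in>{..<k}. \<zero>\<^bsub>B\<^esub>)"
  "x \<oplus>\<^bsub>pow_mod B k\<^esub> y = (\<lambda>i\<in>{..<k}. x i \<oplus>\<^bsub>B\<^esub> y i)"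
  "c \<odot>\<^bsub>pow_mod B k\<^esub> x = (\<lambda>i\<in>{..<k}. c \<odot>\<^bsub>B\<^esub> x i)"
  "ract (pow_mod B k) x b = (\<lambda>i\<in>{..<k}. x i \<otimes>\<^bsub>B\<^esub> b)"
  "inn (pow_mod B k) x y = finsum B (\<lambda>i. cadj B (x i) \<otimes>\<^bsub>B\<^esub> y i) {..<k}"
  by (simp_all add: pow_mod_def)

lemma pow_mod_ext:
  "x \<in> carrier (pow_mod B k) \<Longrightarrow> y \<in> carrier (pow_mod B k) \<Longrightarrow> (\<And>i. i < k \<Longrightarrow> x i = y i) \<Longrightarrow> x = y"
  unfolding pow_mod_simps by (rule PiE_ext) auto

lemma pow_mod_mem: "x \<in> carrier (pow_mod B k) \<Longrightarrow> i < k \<Longrightarrow> x i \<in> carrier B"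
  by (auto simp: pow_mod_simps)

context cstar_algebra
begin

abbreviation "P k \<equiv> pow_mod C k"

lemma pow_module: "cmodule (P k)"
  unfolding cmodule_def
proof (rule moduleI)
  show "cring complex_ring" by (rule complex_cring)
  show "abelian_group (P k)"
  proof (rule abelian_groupI)
    fix x assume x: "x \<in> carrier (P k)"
    have "(\<lambda>i\<in>{..<k}. \<ominus> x i) \<oplus>\<^bsub>P k\<^esub> x = \<zero>\<^bsub>P k\<^esub>" 
      using pow_mod_mem[OF x] by (auto simp: pow_mod_simps M.l_neg)
    moreover have "(\<lambda>i\<in>{..<k}. \<ominus> x i) \<in> carrier (P k)" using pow_mod_mem[OF x] by (auto simp: pow_mod_simps)
    ultimately show "\<exists>y\<in>carrier (P k). y \<oplus>\<^bsub>P k\<^esub> x = \<zero>\<^bsub>P k\<^esub>" by blast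
    show "\<zero>\<^bsub>P k\<^esub> \<oplus>\<^bsub>P k\<^esub> x = x"
      by (rule pow_mod_ext) (use x pow_mod_mem[OF x] in \<open>auto simp: pow_mod_simps\<close>)
  next
    fix x y assume x: "x \<in> carrier (P k)" and y: "y \<in> carrier (P k)"
    show "x \<oplus>\<^bsub>P k\<^esub> y \<in> carrier (P k)" "x \<oplus>\<^bsub>P k\<^esub> y = y \<oplus>\<^bsub>P k\<^esub> x"
      using pow_mod_mem[OF x] pow_mod_mem[OF y] by (auto simp: pow_mod_simps M.a_comm)
    fix z assume z: "z \<in> carrier (P k)"
    show "x \<oplus>\<^bsub>P k\<^esub> y \<oplus>\<^bsub>P k\<^esub> z = x \<oplus>\<^bsub>P k\<^esub> (y \<oplus>\<^bsub>P k\<^esub> z)"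
      using pow_mod_mem[OF x] pow_mod_mem[OF y] pow_mod_mem[OF z] by (auto simp: pow_mod_simps M.a_assoc)
  qed (auto simp: pow_mod_simps)
next
  fix x assume x: "x \<in> carrier (P k)"
  show "\<one>\<^bsub>complex_ring\<^esub> \<odot>\<^bsub>P k\<^esub> x = x"
    by (rule pow_mod_ext) (use x pow_mod_mem[OF x] in \<open>auto simp: pow_mod_simps scale_simps\<close>)
  fix a b
  show "a \<odot>\<^bsub>P k\<^esub> x \<in> carrier (P k)"
    "(a \<oplus>\<^bsub>complex_ring\<^esub> b) \<odot>\<^bsub>P k\<^esub> x = a \<odot>\<^bsub>P k\<^esub> x \<oplus>\<^bsub>P k\<^esub> b \<odot>\<^bsub>P k\<^esub> x"
    "(a \<otimes>\<^bsub>complex_ring\<^esub> b) \<odot>\<^bsub>P k\<^esub> x = a \<odot>\<^bsub>P k\<^esub> (b \<odot>\<^bsub>P k\<^esub> x)"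
    using pow_mod_mem[OF x] by (auto simp: pow_mod_simps scale_simps scale_add)
  fix y assume y: "y \<in> carrier (P k)"
  show "a \<odot>\<^bsub>P k\<^esub> (x \<oplus>\<^bsub>P k\<^esub> y) = a \<odot>\<^bsub>P k\<^esub> x \<oplus>\<^bsub>P k\<^esub> a \<odot>\<^bsub>P k\<^esub> y"
    using pow_mod_mem[OF x] pow_mod_mem[OF y] by (auto simp: pow_mod_simps scale_simps)
qed

lemma pow_minus_apply: "x \<in> carrier (P k) \<Longrightarrow> y \<in> carrier (P k) \<Longrightarrow> i < k \<Longrightarrow> (x \<ominus>\<^bsub>P k\<^esub> y) i = x i \<ominus> y i"
proof -
  interpret P: cmodule "P k" by (rule pow_module)
  show "x \<in> carrier (P k) \<Longrightarrow> y \<in> carrier (P k) \<Longrightarrow> i < k \<Longrightarrow> (x \<ominus>\<^bsub>P k\<^esub> y) i = x i \<ominus> y i"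
    using pow_mod_mem[of x C k i] pow_mod_mem[of y C k i]
    by (simp add: P.diff_eq_scale diff_eq_scale) (simp add: pow_mod_simps)
qed

lemma pow_hnorm_sq: "x \<in> carrier (P k) \<Longrightarrow> (hnorm C (P k) x)\<^sup>2 = cnorm C (finsum C (\<lambda>i. cadj C (x i) \<otimes> x i) {..<k})"
  using pow_mod_mem[of x C k] by (simp add: hnorm_def pow_mod_simps cnorm_nonneg)

lemma pow_hnorm_entry:
  assumes "x \<in> carrier (P k)" "i < k"
  shows "cnorm C (x i) \<le> hnorm C (P k) x"
proof (rule power2_le_imp_le)
  show "(cnorm C (x i))\<^sup>2 \<le> (hnorm C (P k) x)\<^sup>2"
    unfolding pow_hnorm_sq[OF assms(1)] using assms pow_mod_mem[OF assms(1)] by (intro fsum_squares_norm_ge) auto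
  show "0 \<le> hnorm C (P k) x" using pow_mod_mem[OF assms(1)] by (simp add: hnorm_def pow_mod_simps cnorm_nonneg)
qed

lemma pow_hnorm_le:
  assumes "x \<in> carrier (P k)"
  shows "hnorm C (P k) x \<le> (\<Sum>i<k. cnorm C (x i))"
proof (rule power2_le_imp_le)
  have m: "x i \<in> carrier C" if "i < k" for i using pow_mod_mem[OF assms that] .
  show p: "0 \<le> (\<Sum>i<k. cnorm C (x i))" using m by (intro sum_nonneg) (auto simp: cnorm_nonneg)
  have "(hnorm C (P k) x)\<^sup>2 \<le> (\<Sum>i<k. cnorm C (cadj C (x i) \<otimes> x i))"
    unfolding pow_hnorm_sq[OF assms] using m by (intro fsum_norm_le) auto
  also have "\<dots> = (\<Sum>i<k. cnorm C (x i) * cnorm C (x i))"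
    using m by (intro sum.cong) (auto simp: cstar_identity power2_eq_square)
  also have "\<dots> \<le> (\<Sum>i<k. cnorm C (x i) * (\<Sum>i<k. cnorm C (x i)))"
    using m by (intro sum_mono mult_left_mono member_le_sum) (auto simp: cnorm_nonneg)
  also have "\<dots> = (\<Sum>i<k. cnorm C (x i))\<^sup>2" by (simp add: power2_eq_square sum_distrib_right)
  finally show "(hnorm C (P k) x)\<^sup>2 \<le> (\<Sum>i<k. cnorm C (x i))\<^sup>2" .
qed

lemma clim_of_cauchy:
  assumes "\<And>n. s n \<in> carrier C" "\<And>e. e > 0 \<Longrightarrow> \<exists>N. \<forall>m\<ge>N. \<forall>n\<ge>N. cnorm C (s m \<ominus> s n) < e"
  shows "\<exists>x. clim s x"
proof -
  have r: "range s \<subseteq> carrier C" using assms(1) by blast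
  then have "\<exists>x\<in>carrier C. (\<lambda>n. cnorm C (s n \<ominus> x)) \<longlonglongrightarrow> 0"
    using complete assms(2) unfolding complete_wrt_def by blast
  then obtain x where "x \<in> carrier C" "(\<lambda>n. cnorm C (s n \<ominus> x)) \<longlonglongrightarrow> 0" ..
  then show ?thesis using r unfolding clim_def by blast
qed

theorem pow_hilbert: "hilbert_module C (P k)"
proof (intro hilbert_module.intro)
  show "cstar_algebra C" by (rule cstar_algebra_axioms)
  show "module complex_ring (P k)" using pow_module by (simp add: cmodule_def)
  interpret P: cmodule "P k" by (rule pow_module)
  show "hilbert_module_axioms C (P k)"
  proof (rule hilbert_module_axioms.intro)
    fix x b assume x: "x \<in> carrier (P k)" and b: "b \<in> carrier C"
    note mx = pow_mod_mem[OF x]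
    show "ract (P k) x b \<in> carrier (P k)" using mx b by (auto simp: pow_mod_simps)
    fix c assume c: "c \<in> carrier C"
    show "ract (P k) x (b \<otimes> c) = ract (P k) (ract (P k) x b) c"
      "ract (P k) x (b \<oplus> c) = ract (P k) x b \<oplus>\<^bsub>P k\<^esub> ract (P k) x c"
      using mx b c by (auto simp: pow_mod_simps mult_assoc distr_right)
  next
    fix x y b assume x: "x \<in> carrier (P k)" and y: "y \<in> carrier (P k)" and b: "b \<in> carrier C"
    note mx = pow_mod_mem[OF x] pow_mod_mem[OF y]
    show "ract (P k) (x \<oplus>\<^bsub>P k\<^esub> y) b = ract (P k) x b \<oplus>\<^bsub>P k\<^esub> ract (P k) y b"
      using mx b by (auto simp: pow_mod_simps distr_left)
    show "inn (P k) x (ract (P k) y b) = inn (P k) x y \<otimes> b"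
      using mx b fsum_mult_right[of "{..<k}" "\<lambda>i. cadj C (x i) \<otimes> y i" b]
      by (simp add: pow_mod_simps) (intro fsum_cong; simp add: mult_assoc)
  next
    fix x b and z :: complex assume x: "x \<in> carrier (P k)" and b: "b \<in> carrier C"
    note mx = pow_mod_mem[OF x]
    show "ract (P k) (z \<odot>\<^bsub>P k\<^esub> x) b = z \<odot>\<^bsub>P k\<^esub> ract (P k) x b"
      "ract (P k) x (z \<odot> b) = z \<odot>\<^bsub>P k\<^esub> ract (P k) x b"
      using mx b by (auto simp: pow_mod_simps smult_mult_left smult_mult_right)
  next
    fix x y assume x: "x \<in> carrier (P k)" and y: "y \<in> carrier (P k)"
    note mx = pow_mod_mem[OF x] pow_mod_mem[OF y]
    show "inn (P k) x y \<in> carrier C" using mx by (simp add: pow_mod_simps)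
    show "cadj C (inn (P k) x y) = inn (P k) y x"
      using mx fsum_cadj[of "{..<k}" "\<lambda>i. cadj C (x i) \<otimes> y i"]
      by (simp add: pow_mod_simps) (intro fsum_cong; simp add: cadj_mult cadj_cadj)
    show "inn (P k) x (z \<odot>\<^bsub>P k\<^esub> y) = z \<odot> inn (P k) x y" for z
      using mx fsum_smult[of "{..<k}" "\<lambda>i. cadj C (x i) \<otimes> y i" z]
      by (simp add: pow_mod_simps) (intro fsum_cong; simp add: smult_mult_right)
    fix y' assume y': "y' \<in> carrier (P k)"
    note mx' = pow_mod_mem[OF y']
    have "inn (P k) x (y \<oplus>\<^bsub>P k\<^esub> y') = finsum C (\<lambda>i. cadj C (x i) \<otimes> y i \<oplus> cadj C (x i) \<otimes> y' i) {..<k}"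
      unfolding pow_mod_simps using mx mx' by (intro fsum_cong) (simp_all add: distr_right)
    also have "\<dots> = inn (P k) x y \<oplus> inn (P k) x y'"
      using mx mx' by (simp only: pow_mod_simps) (intro fsum_add; simp)
    finally show "inn (P k) x (y \<oplus>\<^bsub>P k\<^esub> y') = inn (P k) x y \<oplus> inn (P k) x y'" .
  next
    fix x assume x: "x \<in> carrier (P k)"
    note mx = pow_mod_mem[OF x]
    show "cstar_pos C (inn (P k) x x)"
      using mx by (simp add: pow_mod_simps) (intro fsum_cstar_pos cstar_pos_square; simp)
    assume 0: "inn (P k) x x = \<zero>"
    show "x = \<zero>\<^bsub>P k\<^esub>"
    proof (rule pow_mod_ext[OF x])
      show "\<zero>\<^bsub>P k\<^esub> \<in> carrier (P k)" by (rule P.M.zero_closed)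
      fix i assume i: "i < k"
      have "cnorm C (x i) \<le> 0" using pow_hnorm_entry[OF x i] 0 by (simp add: hnorm_def)
      then have "cnorm C (x i) = 0" using cnorm_nonneg[OF mx[OF i]] by linarith
      then show "x i = \<zero>\<^bsub>P k\<^esub> i" using cnorm_eq_0[OF mx[OF i]] i by (simp add: pow_mod_simps)
    qed
  next
    show "complete_wrt (carrier (P k)) (\<lambda>x y. hnorm C (P k) (x \<ominus>\<^bsub>P k\<^esub> y))"
      unfolding complete_wrt_def
    proof (intro allI impI, elim conjE)
      fix s :: "nat \<Rightarrow> nat \<Rightarrow> 'c"
      assume "range s \<subseteq> carrier (P k)"
        and cau: "\<forall>e>0. \<exists>N. \<forall>m\<ge>N. \<forall>n\<ge>N. hnorm C (P k) (s m \<ominus>\<^bsub>P k\<^esub> s n) < e"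
      then have s: "s n \<in> carrier (P k)" for n by blast
      have "\<exists>z. clim (\<lambda>n. s n i) z" if i: "i < k" for i
      proof (rule clim_of_cauchy)
        show "s n i \<in> carrier C" for n by (rule pow_mod_mem[OF s i])
        fix e :: real assume "e > 0"
        then obtain N where N: "\<forall>m\<ge>N. \<forall>n\<ge>N. hnorm C (P k) (s m \<ominus>\<^bsub>P k\<^esub> s n) < e" using cau by blast
        have "cnorm C (s m i \<ominus> s n i) \<le> hnorm C (P k) (s m \<ominus>\<^bsub>P k\<^esub> s n)" for m n
          using pow_hnorm_entry[OF P.M.minus_closed[OF s s] i, of m n] pow_minus_apply[OF s s i, of m n] by simp
        then show "\<exists>N. \<forall>m\<ge>N. \<forall>n\<ge>N. cnorm C (s m i \<ominus> s n i) < e"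
          using N order.strict_trans1 by blast
      qed
      then obtain z where z: "\<And>i. i < k \<Longrightarrow> clim (\<lambda>n. s n i) (z i)" by metis
      define x where "x = (\<lambda>i\<in>{..<k}. z i)"
      have x: "x \<in> carrier (P k)" using climD(2)[OF z] by (auto simp: x_def pow_mod_simps)
      have "(\<lambda>n. \<Sum>i<k. cnorm C (s n i \<ominus> z i)) \<longlonglongrightarrow> (\<Sum>i<k. 0)"
        using z unfolding clim_def by (intro tendsto_sum) auto
      then have l: "(\<lambda>n. \<Sum>i<k. cnorm C (s n i \<ominus> z i)) \<longlonglongrightarrow> 0" by simp
      have "\<bar>hnorm C (P k) (s n \<ominus>\<^bsub>P k\<^esub> x) - 0\<bar> \<le> (\<Sum>i<k. cnorm C (s n i \<ominus> z i))" for n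
      proof -
        have m: "s n \<ominus>\<^bsub>P k\<^esub> x \<in> carrier (P k)" by (rule P.M.minus_closed[OF s x])
        have "hnorm C (P k) (s n \<ominus>\<^bsub>P k\<^esub> x) \<le> (\<Sum>i<k. cnorm C ((s n \<ominus>\<^bsub>P k\<^esub> x) i))" by (rule pow_hnorm_le[OF m])
        also have "\<dots> = (\<Sum>i<k. cnorm C (s n i \<ominus> z i))"
          using s x by (intro sum.cong) (auto simp: pow_minus_apply x_def)
        finally have le: "hnorm C (P k) (s n \<ominus>\<^bsub>P k\<^esub> x) \<le> (\<Sum>i<k. cnorm C (s n i \<ominus> z i))" .
        have "0 \<le> hnorm C (P k) (s n \<ominus>\<^bsub>P k\<^esub> x)"
          using pow_mod_mem[OF m] by (simp add: hnorm_def pow_mod_simps cnorm_nonneg)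
        then show ?thesis using le by simp
      qed
      then have "(\<lambda>n. hnorm C (P k) (s n \<ominus>\<^bsub>P k\<^esub> x)) \<longlonglongrightarrow> 0" using l by (rule LIMSEQ_of_abs_le)
      then show "\<exists>x\<in>carrier (P k). (\<lambda>n. hnorm C (P k) (s n \<ominus>\<^bsub>P k\<^esub> x)) \<longlonglongrightarrow> 0" using x by blast
    qed
  qed
qed

end

context cstar_algebra
begin

interpretation R: hilbert_module C "P k" for k by (rule pow_hilbert)
interpretation RL: unital_cstar "adjointable_ops C (P k)" for k by (rule R.L_unital)

abbreviation "LP k \<equiv> adjointable_ops C (P k)"

definition mats :: "nat \<Rightarrow> 'c set \<Rightarrow> (nat \<Rightarrow> nat \<Rightarrow> 'c) set" where
  "mats k S = {Y. \<forall>i<k. \<forall>j<k. Y i j \<in> S}"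

text \<open>The C*-norm of a matrix is the norm of the adjointable operator by which it acts on rows.\<close>

definition mat_op :: "nat \<Rightarrow> (nat \<Rightarrow> nat \<Rightarrow> 'c) \<Rightarrow> (nat \<Rightarrow> 'c) \<Rightarrow> nat \<Rightarrow> 'c" where
  "mat_op k Y = (\<lambda>x\<in>carrier (P k). \<lambda>i\<in>{..<k}. finsum C (\<lambda>j. Y i j \<otimes> x j) {..<k})"

lemma matsD: "Y \<in> mats k S \<Longrightarrow> i < k \<Longrightarrow> j < k \<Longrightarrow> Y i j \<in> S"
  by (simp add: mats_def)

lemma mats_mono: "Y \<in> mats k S \<Longrightarrow> S \<subseteq> S' \<Longrightarrow> Y \<in> mats k S'"
  by (auto simp: mats_def)

lemma mat_op_apply: "x \<in> carrier (P k) \<Longrightarrow> i < k \<Longrightarrow> mat_op k Y x i = finsum C (\<lambda>j. Y i j \<otimes> x j) {..<k}"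
  by (simp add: mat_op_def)

lemma mat_op_closed:
  assumes "Y \<in> mats k (carrier C)" "x \<in> carrier (P k)"
  shows "mat_op k Y x \<in> carrier (P k)"
  using matsD[OF assms(1)] pow_mod_mem[OF assms(2)] assms(2)
  by (auto simp: mat_op_def pow_mod_simps(1))

lemma mat_op_inn:
  assumes Y: "Y \<in> mats k (carrier C)" and x: "x \<in> carrier (P k)" and y: "y \<in> carrier (P k)"
  shows "inn (P k) (mat_op k Y x) y = inn (P k) x (mat_op k (\<lambda>i j. cadj C (Y j i)) y)"
proof -
  note m = matsD[OF Y] pow_mod_mem[OF x] pow_mod_mem[OF y]
  have "inn (P k) (mat_op k Y x) y = finsum C (\<lambda>i. finsum C (\<lambda>j. cadj C (x j) \<otimes> (cadj C (Y i j) \<otimes> y i)) {..<k}) {..<k}"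
    unfolding pow_mod_simps
  proof (rule fsum_cong)
    fix i assume i: "i \<in> {..<k}"
    have "cadj C (mat_op k Y x i) \<otimes> y i = finsum C (\<lambda>j. cadj C (Y i j \<otimes> x j)) {..<k} \<otimes> y i"
      using m i x fsum_cadj[of "{..<k}" "\<lambda>j. Y i j \<otimes> x j"] by (simp add: mat_op_apply)
    also have "\<dots> = finsum C (\<lambda>j. cadj C (Y i j \<otimes> x j) \<otimes> y i) {..<k}"
      using m i by (intro fsum_mult_right) auto
    also have "\<dots> = finsum C (\<lambda>j. cadj C (x j) \<otimes> (cadj C (Y i j) \<otimes> y i)) {..<k}"
      using m i by (intro fsum_cong) (auto simp: cadj_mult mult_assoc)
    finally show "cadj C (mat_op k Y x i) \<otimes> y i = \<dots>" .
  qed (use m in auto)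
  also have "\<dots> = finsum C (\<lambda>j. finsum C (\<lambda>i. cadj C (x j) \<otimes> (cadj C (Y i j) \<otimes> y i)) {..<k}) {..<k}"
    using m by (intro fsum_swap) auto
  also have "\<dots> = inn (P k) x (mat_op k (\<lambda>i j. cadj C (Y j i)) y)"
    unfolding pow_mod_simps
  proof (rule fsum_cong)
    fix j assume j: "j \<in> {..<k}"
    have "finsum C (\<lambda>i. cadj C (x j) \<otimes> (cadj C (Y i j) \<otimes> y i)) {..<k} = cadj C (x j) \<otimes> finsum C (\<lambda>i. cadj C (Y i j) \<otimes> y i) {..<k}"
      using m j by (intro fsum_mult_left[symmetric]) auto
    then show "finsum C (\<lambda>i. cadj C (x j) \<otimes> (cadj C (Y i j) \<otimes> y i)) {..<k} =
        cadj C (x j) \<otimes> mat_op k (\<lambda>i j. cadj C (Y j i)) y j"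
      using j y by (simp add: mat_op_apply)
    show "cadj C (x j) \<otimes> mat_op k (\<lambda>i j. cadj C (Y j i)) y j \<in> carrier C"
      using m j y by (simp add: mat_op_apply)
  qed
  finally show ?thesis .
qed

lemma mats_cadj: "Y \<in> mats k (carrier C) \<Longrightarrow> (\<lambda>i j. cadj C (Y j i)) \<in> mats k (carrier C)"
  by (simp add: mats_def)

lemma mat_op_mem: "Y \<in> mats k (carrier C) \<Longrightarrow> mat_op k Y \<in> carrier (LP k)"
proof (rule R.L_I[where S = "mat_op k (\<lambda>i j. cadj C (Y j i))"])
  show "mat_op k Y \<in> extensional (carrier (P k))" by (simp add: mat_op_def)
qed (auto intro: mat_op_closed mats_cadj mat_op_inn)

lemma mat_op_cadj: "Y \<in> mats k (carrier C) \<Longrightarrow> cadj (LP k) (mat_op k Y) = mat_op k (\<lambda>i j. cadj C (Y j i))"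
  by (rule R.adjI) (auto intro: mat_op_mem mats_cadj mat_op_inn)

lemma mat_op_eqI:
  assumes "T \<in> carrier (LP k)" "Y \<in> mats k (carrier C)"
    "\<And>x i. x \<in> carrier (P k) \<Longrightarrow> i < k \<Longrightarrow> T x i = finsum C (\<lambda>j. Y i j \<otimes> x j) {..<k}"
  shows "T = mat_op k Y"
proof (rule R.L_ext[OF assms(1) mat_op_mem[OF assms(2)]])
  fix x assume x: "x \<in> carrier (P k)"
  show "T x = mat_op k Y x"
  proof (rule pow_mod_ext)
    show "T x \<in> carrier (P k)" using assms(1) x by auto
    show "mat_op k Y x \<in> carrier (P k)" by (rule mat_op_closed[OF assms(2) x])
    show "T x i = mat_op k Y x i" if "i < k" for i using assms(3)[OF x that] x that by (simp add: mat_op_apply)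
  qed
qed

lemma mat_op_add:
  assumes Y: "Y \<in> mats k (carrier C)" and Z: "Z \<in> mats k (carrier C)"
  shows "mat_op k Y \<oplus>\<^bsub>LP k\<^esub> mat_op k Z = mat_op k (\<lambda>i j. Y i j \<oplus> Z i j)"
proof (rule mat_op_eqI)
  show "mat_op k Y \<oplus>\<^bsub>LP k\<^esub> mat_op k Z \<in> carrier (LP k)" by (intro R.L_closed mat_op_mem Y Z)
  show "(\<lambda>i j. Y i j \<oplus> Z i j) \<in> mats k (carrier C)" using Y Z by (simp add: mats_def)
  fix x i assume x: "x \<in> carrier (P k)" and i: "i < k"
  note m = matsD[OF Y] matsD[OF Z] pow_mod_mem[OF x]
  have "(mat_op k Y \<oplus>\<^bsub>LP k\<^esub> mat_op k Z) x i = finsum C (\<lambda>j. Y i j \<otimes> x j) {..<k} \<oplus> finsum C (\<lambda>j. Z i j \<otimes> x j) {..<k}"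
    using x i by (simp add: R.L_apply) (simp add: pow_mod_simps(3) mat_op_apply)
  also have "\<dots> = finsum C (\<lambda>j. Y i j \<otimes> x j \<oplus> Z i j \<otimes> x j) {..<k}"
    using m i by (intro fsum_add[symmetric]) auto
  also have "\<dots> = finsum C (\<lambda>j. (Y i j \<oplus> Z i j) \<otimes> x j) {..<k}"
    using m i by (intro fsum_cong) (auto simp: distr_left)
  finally show "(mat_op k Y \<oplus>\<^bsub>LP k\<^esub> mat_op k Z) x i = \<dots>" .
qed

lemma mat_op_smult:
  assumes Y: "Y \<in> mats k (carrier C)"
  shows "c \<odot>\<^bsub>LP k\<^esub> mat_op k Y = mat_op k (\<lambda>i j. c \<odot> Y i j)"
proof (rule mat_op_eqI)
  show "c \<odot>\<^bsub>LP k\<^esub> mat_op k Y \<in> carrier (LP k)" by (intro R.L_closed mat_op_mem Y)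
  show "(\<lambda>i j. c \<odot> Y i j) \<in> mats k (carrier C)" using Y by (simp add: mats_def)
  fix x i assume x: "x \<in> carrier (P k)" and i: "i < k"
  note m = matsD[OF Y] pow_mod_mem[OF x]
  have "(c \<odot>\<^bsub>LP k\<^esub> mat_op k Y) x i = c \<odot> finsum C (\<lambda>j. Y i j \<otimes> x j) {..<k}"
    using x i by (simp add: R.L_apply) (simp add: pow_mod_simps(4) mat_op_apply)
  also have "\<dots> = finsum C (\<lambda>j. c \<odot> (Y i j \<otimes> x j)) {..<k}" using m i by (intro fsum_smult) auto
  also have "\<dots> = finsum C (\<lambda>j. (c \<odot> Y i j) \<otimes> x j) {..<k}"
    using m i by (intro fsum_cong) (auto simp: smult_mult_left)
  finally show "(c \<odot>\<^bsub>LP k\<^esub> mat_op k Y) x i = \<dots>" .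
qed

lemma mat_op_mult:
  assumes Y: "Y \<in> mats k (carrier C)" and Z: "Z \<in> mats k (carrier C)"
  shows "mat_op k Y \<otimes>\<^bsub>LP k\<^esub> mat_op k Z = mat_op k (\<lambda>i j. finsum C (\<lambda>l. Y i l \<otimes> Z l j) {..<k})"
proof (rule mat_op_eqI)
  show "mat_op k Y \<otimes>\<^bsub>LP k\<^esub> mat_op k Z \<in> carrier (LP k)" by (intro R.L_closed mat_op_mem Y Z)
  show "(\<lambda>i j. finsum C (\<lambda>l. Y i l \<otimes> Z l j) {..<k}) \<in> mats k (carrier C)" using Y Z by (simp add: mats_def)
  fix x i assume x: "x \<in> carrier (P k)" and i: "i < k"
  note m = matsD[OF Y] matsD[OF Z] pow_mod_mem[OF x]
  have "(mat_op k Y \<otimes>\<^bsub>LP k\<^esub> mat_op k Z) x i = finsum C (\<lambda>l. Y i l \<otimes> mat_op k Z x l) {..<k}"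
    using x i mat_op_closed[OF Z x] by (simp add: R.L_apply mat_op_apply[of _ k i])
  also have "\<dots> = finsum C (\<lambda>l. finsum C (\<lambda>j. Y i l \<otimes> Z l j \<otimes> x j) {..<k}) {..<k}"
  proof (rule fsum_cong)
    fix l assume l: "l \<in> {..<k}"
    have "Y i l \<otimes> mat_op k Z x l = finsum C (\<lambda>j. Y i l \<otimes> (Z l j \<otimes> x j)) {..<k}"
      using m i l x fsum_mult_left[of "{..<k}" "\<lambda>j. Z l j \<otimes> x j" "Y i l"] by (simp add: mat_op_apply)
    also have "\<dots> = finsum C (\<lambda>j. Y i l \<otimes> Z l j \<otimes> x j) {..<k}"
      using m i l by (intro fsum_cong) (auto simp: mult_assoc)
    finally show "Y i l \<otimes> mat_op k Z x l = \<dots>" .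
  qed (use m i in auto)
  also have "\<dots> = finsum C (\<lambda>j. finsum C (\<lambda>l. Y i l \<otimes> Z l j \<otimes> x j) {..<k}) {..<k}"
    using m i by (intro fsum_swap) auto
  also have "\<dots> = finsum C (\<lambda>j. finsum C (\<lambda>l. Y i l \<otimes> Z l j) {..<k} \<otimes> x j) {..<k}"
    using m i by (intro fsum_cong fsum_mult_right[symmetric]) auto
  finally show "(mat_op k Y \<otimes>\<^bsub>LP k\<^esub> mat_op k Z) x i = \<dots>" .
qed

lemma mat_op_entry_norm:
  assumes Y: "Y \<in> mats k (carrier C)" and i: "i < k" and j: "j < k"
  shows "cnorm C (Y i j) \<le> cnorm (LP k) (mat_op k Y)"
proof -
  note m = matsD[OF Y]
  define b where "b = cadj C (Y i j)"
  have b: "b \<in> carrier C" using m i j by (simp add: b_def)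
  define x where "x = (\<lambda>l\<in>{..<k}. if l = j then b else \<zero>)"
  have x: "x \<in> carrier (P k)" using b by (auto simp: x_def pow_mod_simps(1))
  have "hnorm C (P k) x \<le> (\<Sum>l<k. cnorm C (x l))" by (rule pow_hnorm_le[OF x])
  also have "\<dots> = (\<Sum>l<k. if l = j then cnorm C b else 0)" by (intro sum.cong) (auto simp: x_def)
  also have "\<dots> = cnorm C b" using j by simp
  finally have nx: "hnorm C (P k) x \<le> cnorm C b" .
  have "mat_op k Y x i = Y i j \<otimes> x j"
    unfolding mat_op_apply[OF x i] using m i j b by (intro fsum_single) (auto simp: x_def)
  then have e: "mat_op k Y x i = Y i j \<otimes> b" using j by (simp add: x_def)
  have n0: "0 \<le> cnorm (LP k) (mat_op k Y)" using RL.cnorm_nonneg mat_op_mem[OF Y] by blast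
  have "cnorm C (Y i j \<otimes> b) \<le> hnorm C (P k) (mat_op k Y x)"
    using pow_hnorm_entry[OF mat_op_closed[OF Y x] i] by (simp only: e)
  also have "\<dots> \<le> cnorm (LP k) (mat_op k Y) * hnorm C (P k) x"
    by (rule R.norm_L_bound[OF mat_op_mem[OF Y] x])
  also have "\<dots> \<le> cnorm (LP k) (mat_op k Y) * cnorm C b" using nx n0 by (intro mult_left_mono)
  finally have "cnorm C (Y i j \<otimes> b) \<le> cnorm (LP k) (mat_op k Y) * cnorm C b" .
  moreover have "cnorm C (Y i j \<otimes> b) = (cnorm C (Y i j))\<^sup>2" "cnorm C b = cnorm C (Y i j)"
    using cstar_identity[OF b] m[OF i j] by (simp_all add: b_def cadj_cadj norm_cadj)
  ultimately have *: "cnorm C (Y i j) * cnorm C (Y i j) \<le> cnorm (LP k) (mat_op k Y) * cnorm C (Y i j)"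
    by (simp add: power2_eq_square)
  show ?thesis
  proof (cases "cnorm C (Y i j) = 0")
    case True then show ?thesis using n0 by simp
  next
    case False
    then have "cnorm C (Y i j) > 0" using cnorm_nonneg[OF m[OF i j]] by linarith
    then show ?thesis using * by simp
  qed
qed

lemma mat_op_diff:
  assumes Y: "Y \<in> mats k (carrier C)" and Z: "Z \<in> mats k (carrier C)"
  shows "mat_op k Y \<ominus>\<^bsub>LP k\<^esub> mat_op k Z = mat_op k (\<lambda>i j. Y i j \<oplus> (- 1) \<odot> Z i j)"
proof -
  have Z': "(\<lambda>i j. (- 1) \<odot> Z i j) \<in> mats k (carrier C)" using Z by (simp add: mats_def)
  have "mat_op k Y \<ominus>\<^bsub>LP k\<^esub> mat_op k Z = mat_op k Y \<oplus>\<^bsub>LP k\<^esub> (- 1) \<odot>\<^bsub>LP k\<^esub> mat_op k Z"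
    by (rule R.L.diff_eq_scale[OF mat_op_mem[OF Y] mat_op_mem[OF Z]])
  also have "\<dots> = mat_op k (\<lambda>i j. Y i j \<oplus> (- 1) \<odot> Z i j)"
    by (simp only: mat_op_smult[OF Z] mat_op_add[OF Y Z'])
  finally show ?thesis .
qed

lemma mat_op_diff_entry:
  assumes Y: "Y \<in> mats k (carrier C)" and Z: "Z \<in> mats k (carrier C)" and "i < k" "j < k"
  shows "cnorm C (Y i j \<ominus> Z i j) \<le> cnorm (LP k) (mat_op k Y \<ominus>\<^bsub>LP k\<^esub> mat_op k Z)"
proof -
  have D: "(\<lambda>i j. Y i j \<oplus> (- 1) \<odot> Z i j) \<in> mats k (carrier C)" using Y Z by (simp add: mats_def)
  show ?thesis unfolding mat_op_diff[OF Y Z]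
    using mat_op_entry_norm[OF D assms(3,4)] matsD[OF Y assms(3,4)] matsD[OF Z assms(3,4)]
    by (simp add: diff_eq_scale)
qed

lemma mat_op_inj:
  assumes Y: "Y \<in> mats k (carrier C)" and Z: "Z \<in> mats k (carrier C)" and "mat_op k Y = mat_op k Z" "i < k" "j < k"
  shows "Y i j = Z i j"
proof -
  note m = matsD[OF Y assms(4,5)] matsD[OF Z assms(4,5)]
  have "cnorm C (Y i j \<ominus> Z i j) \<le> 0"
    using mat_op_diff_entry[OF Y Z assms(4,5)] assms(3) R.L.diff_self[OF mat_op_mem[OF Z]] by simp
  then have "cnorm C (Y i j \<ominus> Z i j) = 0" using cnorm_nonneg[of "Y i j \<ominus> Z i j"] m by force
  then show ?thesis using cnorm_eq_0[of "Y i j \<ominus> Z i j"] diff_eq_zero m by simp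
qed

text \<open>The entries of a norm convergent sequence of matrices converge, and the matrix of their limits is
  the limit operator.\<close>

lemma mat_op_norm_closed:
  assumes S: "closed_star_subalgebra C S" and T: "T \<in> norm_closure (LP k) (mat_op k ` mats k S)"
  shows "T \<in> mat_op k ` mats k S"
proof -
  note S' = subalgebraD[OF S]
  have Tc: "T \<in> carrier (LP k)" using T by (simp add: norm_closure_def)
  have "\<exists>Y\<in>mats k S. cnorm (LP k) (T \<ominus>\<^bsub>LP k\<^esub> mat_op k Y) < (1 / 2) ^ n" for n :: nat
    using T unfolding norm_closure_def by (auto simp: Bex_def)
  then obtain Y where YS: "\<And>n. Y n \<in> mats k S" and YT: "\<And>n. cnorm (LP k) (T \<ominus>\<^bsub>LP k\<^esub> mat_op k (Y n)) < (1 / 2) ^ n"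
    by metis
  have Y: "Y n \<in> mats k (carrier C)" for n using mats_mono[OF YS S'(1)] .
  have M: "mat_op k (Y n) \<in> carrier (LP k)" for n by (rule mat_op_mem[OF Y])
  have YT': "cnorm (LP k) (mat_op k (Y n) \<ominus>\<^bsub>LP k\<^esub> T) \<le> (1 / 2) ^ n" for n
    using YT[of n] RL.norm_diff_commute[OF Tc M[of n]] by simp
  have l: "(\<lambda>n. 2 * (1 / 2) ^ n :: real) \<longlonglongrightarrow> 0"
    by (intro tendsto_mult_right_zero LIMSEQ_power_zero) simp
  have l': "(\<lambda>n. (1 / 2) ^ n :: real) \<longlonglongrightarrow> 0" by (intro LIMSEQ_power_zero) simp
  have "\<exists>z. clim (\<lambda>n. Y n i j) z" if ij: "i < k" "j < k" for i j
  proof -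
    have Yc: "Y n i j \<in> carrier C" for n by (rule matsD[OF Y ij])
    have "cnorm C (Y (n + p) i j \<ominus> Y n i j) \<le> 2 * (1 / 2) ^ n" for n p
    proof -
      have "cnorm C (Y (n + p) i j \<ominus> Y n i j) \<le> cnorm (LP k) (mat_op k (Y (n + p)) \<ominus>\<^bsub>LP k\<^esub> mat_op k (Y n))"
        by (rule mat_op_diff_entry[OF Y Y ij])
      also have "\<dots> \<le> cnorm (LP k) (mat_op k (Y (n + p)) \<ominus>\<^bsub>LP k\<^esub> T) + cnorm (LP k) (T \<ominus>\<^bsub>LP k\<^esub> mat_op k (Y n))"
        by (rule RL.norm_diff_trans[OF M Tc M])
      also have "\<dots> \<le> (1 / 2) ^ (n + p) + (1 / 2) ^ n" using YT'[of "n + p"] YT[of n] by linarith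
      also have "(1 / 2 :: real) ^ (n + p) \<le> (1 / 2) ^ n" by (rule power_decreasing) auto
      finally show ?thesis by simp
    qed
    then show ?thesis using clim_complete[of "\<lambda>n. Y n i j", OF Yc _ l] by blast
  qed
  then obtain Z where Z: "\<And>i j. i < k \<Longrightarrow> j < k \<Longrightarrow> clim (\<lambda>n. Y n i j) (Z i j)" by metis
  have "Z i j \<in> S" if "i < k" "j < k" for i j
    by (rule clim_closed[OF Z[OF that] matsD[OF YS that] S'(8)])
  then have ZS: "Z \<in> mats k S" by (simp add: mats_def)
  then have Zc: "Z \<in> mats k (carrier C)" using mats_mono S'(1) by blast
  have "T = mat_op k Z"
  proof (rule mat_op_eqI[OF Tc Zc])
    fix x i assume x: "x \<in> carrier (P k)" and i: "i < k"
    have Tx: "T x \<in> carrier (P k)" using Tc x by auto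
    have 1: "clim (\<lambda>n. mat_op k (Y n) x i) (finsum C (\<lambda>j. Z i j \<otimes> x j) {..<k})"
      unfolding mat_op_apply[OF x i]
      using Z i pow_mod_mem[OF x] by (intro fsum_clim clim_mult clim_const) auto
    have 2: "clim (\<lambda>n. mat_op k (Y n) x i) (T x i)"
    proof (rule climI)
      show "mat_op k (Y n) x i \<in> carrier C" "T x i \<in> carrier C" for n
        using pow_mod_mem[OF mat_op_closed[OF Y x] i] pow_mod_mem[OF Tx i] by auto
      show "(\<lambda>n. (1 / 2) ^ n * hnorm C (P k) x) \<longlonglongrightarrow> 0" using l' by (rule tendsto_mult_left_zero)
      fix n
      have D: "mat_op k (Y n) \<ominus>\<^bsub>LP k\<^esub> T \<in> carrier (LP k)" using M Tc by (rule R.L.M.minus_closed)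
      have Dx: "(mat_op k (Y n) \<ominus>\<^bsub>LP k\<^esub> T) x \<in> carrier (P k)" using D x by auto
      have "mat_op k (Y n) x i \<ominus> T x i = (mat_op k (Y n) \<ominus>\<^bsub>LP k\<^esub> T) x i"
        by (simp add: R.L_minus_apply[OF M Tc x] pow_minus_apply[OF mat_op_closed[OF Y x] Tx i])
      then have "cnorm C (mat_op k (Y n) x i \<ominus> T x i) \<le> hnorm C (P k) ((mat_op k (Y n) \<ominus>\<^bsub>LP k\<^esub> T) x)"
        using pow_hnorm_entry[OF Dx i] by simp
      also have "\<dots> \<le> cnorm (LP k) (mat_op k (Y n) \<ominus>\<^bsub>LP k\<^esub> T) * hnorm C (P k) x"
        by (rule R.norm_L_bound[OF D x])
      also have "\<dots> \<le> (1 / 2) ^ n * hnorm C (P k) x"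
        using YT' x by (intro mult_right_mono) auto
      finally show "cnorm C (mat_op k (Y n) x i \<ominus> T x i) \<le> (1 / 2) ^ n * hnorm C (P k) x" .
    qed
    show "T x i = finsum C (\<lambda>j. Z i j \<otimes> x j) {..<k}" using clim_unique[OF 2 1] .
  qed
  then show ?thesis using ZS by blast
qed

lemma mat_op_subalgebra:
  assumes S: "closed_star_subalgebra C S"
  shows "closed_star_subalgebra (LP k) (mat_op k ` mats k S)"
  unfolding closed_star_subalgebra_def
proof (intro conjI ballI)
  note S' = subalgebraD[OF S]
  have c: "Y \<in> mats k S \<Longrightarrow> Y \<in> mats k (carrier C)" for Y using mats_mono S'(1) by blast
  have sm: "a \<odot>\<^bsub>LP k\<^esub> T \<in> mat_op k ` mats k S" if T: "T \<in> mat_op k ` mats k S" for a T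
  proof -
    obtain Y where Y: "Y \<in> mats k S" "T = mat_op k Y" using T by blast
    have "(\<lambda>i j. a \<odot> Y i j) \<in> mats k S" using Y S' by (simp add: mats_def)
    then show ?thesis using mat_op_smult[OF c[OF Y(1)]] Y by simp
  qed
  show "submodule (mat_op k ` mats k S) complex_ring (LP k)"
  proof (rule R.L.submoduleI)
    show sub: "mat_op k ` mats k S \<subseteq> carrier (LP k)" using mat_op_mem c by blast
    show "a \<odot>\<^bsub>LP k\<^esub> T \<in> mat_op k ` mats k S" if "T \<in> mat_op k ` mats k S" for a T using sm that .
    show "\<ominus>\<^bsub>LP k\<^esub> T \<in> mat_op k ` mats k S" if "T \<in> mat_op k ` mats k S" for T
      using sm[OF that, of "-1"] R.L.neg_eq_scale[of T] sub that by auto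
    show "T \<oplus>\<^bsub>LP k\<^esub> U \<in> mat_op k ` mats k S" if T: "T \<in> mat_op k ` mats k S" "U \<in> mat_op k ` mats k S" for T U
    proof -
      obtain Y Z where Y: "Y \<in> mats k S" "T = mat_op k Y" "Z \<in> mats k S" "U = mat_op k Z" using T by blast
      have "(\<lambda>i j. Y i j \<oplus> Z i j) \<in> mats k S" using Y S' by (simp add: mats_def)
      then show ?thesis using mat_op_add[OF c[OF Y(1)] c[OF Y(3)]] Y by simp
    qed
    have "(\<lambda>i j. \<zero>) \<in> mats k S" using S' by (simp add: mats_def)
    then have "0 \<odot>\<^bsub>LP k\<^esub> mat_op k (\<lambda>i j. \<zero>) \<in> mat_op k ` mats k S" by (intro sm) blast
    moreover have "mat_op k (\<lambda>i j. \<zero>) \<in> carrier (LP k)" by (rule mat_op_mem) (simp add: mats_def)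
    ultimately show "\<zero>\<^bsub>LP k\<^esub> \<in> mat_op k ` mats k S" by (simp add: R.L.scale_simps)
  qed
  show "T \<otimes>\<^bsub>LP k\<^esub> U \<in> mat_op k ` mats k S" if T: "T \<in> mat_op k ` mats k S" "U \<in> mat_op k ` mats k S" for T U
  proof -
    obtain Y Z where Y: "Y \<in> mats k S" "T = mat_op k Y" "Z \<in> mats k S" "U = mat_op k Z" using T by blast
    have "(\<lambda>i j. finsum C (\<lambda>l. Y i l \<otimes> Z l j) {..<k}) \<in> mats k S"
      using Y S' by (auto simp: mats_def intro!: finsum_mem[OF S])
    then show ?thesis using mat_op_mult[OF c[OF Y(1)] c[OF Y(3)]] Y by simp
  qed
  show "cadj (LP k) T \<in> mat_op k ` mats k S" if T: "T \<in> mat_op k ` mats k S" for T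
  proof -
    obtain Y where Y: "Y \<in> mats k S" "T = mat_op k Y" using T by blast
    have "(\<lambda>i j. cadj C (Y j i)) \<in> mats k S" using Y S' by (simp add: mats_def)
    then show ?thesis using mat_op_cadj[OF c[OF Y(1)]] Y by simp
  qed
  show "norm_closure (LP k) (mat_op k ` mats k S) \<subseteq> mat_op k ` mats k S"
    using mat_op_norm_closed[OF S] by blast
qed

lemma mat_pos_iff_pos:
  assumes S: "closed_star_subalgebra C S" and M: "M \<in> mats k S" and p: "RL.pos k (mat_op k M)"
  shows "\<exists>Y\<in>mats k S. \<forall>i<k. \<forall>j<k. M i j = finsum C (\<lambda>l. cadj C (Y l i) \<otimes> Y l j) {..<k}"
proof -
  note S' = subalgebraD[OF S]
  obtain T where T: "T \<in> mat_op k ` mats k S" "cadj (LP k) T = T" "T \<otimes>\<^bsub>LP k\<^esub> T = mat_op k M"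
    using RL.pos_sqrt_subalgebra[OF mat_op_subalgebra[OF S] p imageI[OF M]] by blast
  obtain Y where Y: "Y \<in> mats k S" "T = mat_op k Y" using T by blast
  have Yc: "Y \<in> mats k (carrier C)" "M \<in> mats k (carrier C)" using Y M mats_mono S'(1) by blast+
  have e: "mat_op k M = mat_op k (\<lambda>i j. finsum C (\<lambda>l. cadj C (Y l i) \<otimes> Y l j) {..<k})"
    using mat_op_mult[OF mats_cadj[OF Yc(1)] Yc(1)] mat_op_cadj[OF Yc(1)] T Y(2) by simp
  have "(\<lambda>i j. finsum C (\<lambda>l. cadj C (Y l i) \<otimes> Y l j) {..<k}) \<in> mats k (carrier C)"
    using Yc by (simp add: mats_def)
  then have "M i j = finsum C (\<lambda>l. cadj C (Y l i) \<otimes> Y l j) {..<k}" if "i < k" "j < k" for i j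
    using mat_op_inj[OF Yc(2) _ e that] by simp
  then show ?thesis using Y by blast
qed

lemma mat_posD:
  assumes "mat_pos C k M"
  shows "M \<in> mats k (carrier C)" "RL.pos k (mat_op k M)"
proof -
  obtain X where X: "X \<in> mats k (carrier C)" "\<And>i j. i < k \<Longrightarrow> j < k \<Longrightarrow> M i j = finsum C (\<lambda>l. cadj C (X l i) \<otimes> X l j) {..<k}"
    using assms unfolding mat_pos_def mats_def by blast
  then show M: "M \<in> mats k (carrier C)" by (simp add: mats_def)
  have "mat_op k M = cadj (LP k) (mat_op k X) \<otimes>\<^bsub>LP k\<^esub> mat_op k X"
    unfolding mat_op_cadj[OF X(1)] mat_op_mult[OF mats_cadj[OF X(1)] X(1)]
  proof (rule mat_op_eqI[OF mat_op_mem[OF M]])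
    show XX: "(\<lambda>i j. finsum C (\<lambda>l. cadj C (X l i) \<otimes> X l j) {..<k}) \<in> mats k (carrier C)"
      using X(1) by (simp add: mats_def)
    fix x i assume x: "x \<in> carrier (P k)" and i: "i < k"
    show "mat_op k M x i = finsum C (\<lambda>j. finsum C (\<lambda>l. cadj C (X l i) \<otimes> X l j) {..<k} \<otimes> x j) {..<k}"
      unfolding mat_op_apply[OF x i]
    proof (rule fsum_cong)
      fix j assume j: "j \<in> {..<k}"
      then show "M i j \<otimes> x j = finsum C (\<lambda>l. cadj C (X l i) \<otimes> X l j) {..<k} \<otimes> x j" using X(2) i by simp
      show "finsum C (\<lambda>l. cadj C (X l i) \<otimes> X l j) {..<k} \<otimes> x j \<in> carrier C"
        using matsD[OF XX i, of j] pow_mod_mem[OF x] j by (intro mult_closed) auto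
    qed
  qed
  then show "RL.pos k (mat_op k M)" using RL.pos_cadj_mult mat_op_mem[OF X(1)] by simp
qed

text \<open>A positive matrix over \<open>C\<close> is positive as an operator on rows. The matrices over \<open>S\<close> form a closed
  subalgebra of operators, and positive square roots stay in closed subalgebras.\<close>

theorem mat_pos_sub:
  assumes S: "closed_star_subalgebra C S" and p: "mat_pos C k M" and M: "M \<in> mats k S"
  shows "mat_pos (sub S) k M"
proof -
  obtain Y where Y: "Y \<in> mats k S" "\<forall>i<k. \<forall>j<k. M i j = finsum C (\<lambda>l. cadj C (Y l i) \<otimes> Y l j) {..<k}"
    using mat_pos_iff_pos[OF S M mat_posD(2)[OF p]] by blast
  have "finsum (sub S) (\<lambda>l. cadj C (Y l i) \<otimes> Y l j) {..<k} = finsum C (\<lambda>l. cadj C (Y l i) \<otimes> Y l j) {..<k}"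
    if "i < k" "j < k" for i j
    using sub_finsum[OF S, of "{..<k}" "\<lambda>l. cadj C (Y l i) \<otimes> Y l j"] Y that subalgebraD[OF S] by (simp add: mats_def)
  then show ?thesis unfolding mat_pos_def using Y by (intro exI[of _ Y]) (simp add: mats_def)
qed

lemma carrier_subalgebra: "closed_star_subalgebra C (carrier C)"
  by (auto simp: closed_star_subalgebra_def norm_closure_def carrier_is_submodule)

theorem mat_pos_add:
  assumes "mat_pos C k M" "mat_pos C k N"
  shows "mat_pos C k (\<lambda>i j. M i j \<oplus> N i j)"
proof -
  note M = mat_posD[OF assms(1)] and N = mat_posD[OF assms(2)]
  have S: "(\<lambda>i j. M i j \<oplus> N i j) \<in> mats k (carrier C)" using M(1) N(1) by (simp add: mats_def)
  have "RL.pos k (mat_op k (\<lambda>i j. M i j \<oplus> N i j))"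
    using RL.pos_add[OF M(2) N(2)] mat_op_add[OF M(1) N(1)] by simp
  then show ?thesis using mat_pos_iff_pos[OF carrier_subalgebra S] unfolding mat_pos_def mats_def by blast
qed

end

section \<open>Closed subspaces\<close>

definition closed_subspace :: "'c cstar \<Rightarrow> 'c set \<Rightarrow> bool" where
  "closed_subspace C W \<longleftrightarrow> submodule W complex_ring C \<and> norm_closure C W \<subseteq> W"

context cstar_algebra
begin

lemma norm_closure_clim:
  assumes "x \<in> norm_closure C S" "S \<subseteq> carrier C"
  obtains s where "\<And>n. s n \<in> S" "clim s x"
proof -
  have x: "x \<in> carrier C" using assms(1) by (simp add: norm_closure_def)
  have "\<exists>y\<in>S. cnorm C (x \<ominus> y) < (1 / 2) ^ n" for n :: nat
    using assms(1) unfolding norm_closure_def by (auto simp: Bex_def)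
  then obtain s where s: "\<And>n. s n \<in> S" "\<And>n. cnorm C (x \<ominus> s n) < (1 / 2) ^ n" by metis
  have sc: "s n \<in> carrier C" for n using s(1) assms(2) by blast
  have "clim s x"
  proof (rule climI[OF sc x])
    show "cnorm C (s n \<ominus> x) \<le> (1 / 2) ^ n" for n
      using s(2)[of n] norm_diff_commute[OF x sc[of n]] by simp
    show "(\<lambda>n. (1 / 2) ^ n :: real) \<longlonglongrightarrow> 0" by (intro LIMSEQ_power_zero) simp
  qed
  then show thesis using that s(1) by blast
qed

lemma closed_subspaceI:
  assumes "W \<subseteq> carrier C" "\<zero> \<in> W" "\<And>x y. x \<in> W \<Longrightarrow> y \<in> W \<Longrightarrow> x \<oplus> y \<in> W"
    "\<And>c x. x \<in> W \<Longrightarrow> c \<odot> x \<in> W" "\<And>s x. (\<And>n. s n \<in> W) \<Longrightarrow> clim s x \<Longrightarrow> x \<in> W"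
  shows "closed_subspace C W"
proof -
  have "submodule W complex_ring C"
  proof (rule submoduleI)
    show "\<ominus> a \<in> W" if "a \<in> W" for a
      using assms(4)[OF that, of "-1"] neg_eq_scale[of a] assms(1) that by auto
  qed (use assms in auto)
  moreover have "norm_closure C W \<subseteq> W"
  proof
    fix x assume "x \<in> norm_closure C W"
    then obtain s where "\<And>n. s n \<in> W" "clim s x" using norm_closure_clim assms(1) by blast
    then show "x \<in> W" by (rule assms(5))
  qed
  ultimately show ?thesis by (simp add: closed_subspace_def)
qed

lemma closed_subspaceD:
  assumes "closed_subspace C W"
  shows "W \<subseteq> carrier C" "\<zero> \<in> W" "\<And>x y. x \<in> W \<Longrightarrow> y \<in> W \<Longrightarrow> x \<oplus> y \<in> W"
    "\<And>c x. x \<in> W \<Longrightarrow> c \<odot> x \<in> W" "\<And>s x. (\<And>n. s n \<in> W) \<Longrightarrow> clim s x \<Longrightarrow> x \<in> W"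
proof -
  have sub: "submodule W complex_ring C" and cl: "norm_closure C W \<subseteq> W"
    using assms by (auto simp: closed_subspace_def)
  note E = submoduleE[OF sub]
  show "W \<subseteq> carrier C" by (rule E(1))
  show "x \<in> W \<Longrightarrow> y \<in> W \<Longrightarrow> x \<oplus> y \<in> W" for x y by (rule E(5))
  show "x \<in> W \<Longrightarrow> c \<odot> x \<in> W" for c x using E(4)[of c x] by simp
  obtain x where "x \<in> W" using E(2) by blast
  then have "x \<oplus> \<ominus> x \<in> W" by (intro E(5) E(6))
  then show "\<zero> \<in> W" using \<open>x \<in> W\<close> E(1) M.r_neg[of x] by auto
  show "x \<in> W" if "\<And>n. s n \<in> W" "clim s x" for s x
    using clim_closed[OF that(2,1) cl] .
qed

text \<open>Defined from outside, the closed span is compared with another closed subspace by checking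
  generators alone.\<close>

definition closed_span :: "'c set \<Rightarrow> 'c set" where
  "closed_span V = \<Inter>{W. closed_subspace C W \<and> V \<subseteq> W}"

lemma closed_span_least: "closed_subspace C W \<Longrightarrow> V \<subseteq> W \<Longrightarrow> closed_span V \<subseteq> W"
  by (auto simp: closed_span_def)

lemma closed_span_superset: "V \<subseteq> closed_span V"
  by (auto simp: closed_span_def)

lemma carrier_closed_subspace: "closed_subspace C (carrier C)"
  by (rule closed_subspaceI) (auto dest: climD)

lemma closed_subspace_span:
  assumes "V \<subseteq> carrier C"
  shows "closed_subspace C (closed_span V)"
proof (rule closed_subspaceI)
  show "closed_span V \<subseteq> carrier C" by (rule closed_span_least[OF carrier_closed_subspace assms])
  fix s x assume s: "\<And>n. s n \<in> closed_span V" and l: "clim s x"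
  show "x \<in> closed_span V"
    unfolding closed_span_def
  proof (rule InterI)
    fix W assume W: "W \<in> {W. closed_subspace C W \<and> V \<subseteq> W}"
    then have "s n \<in> W" for n using s by (auto simp: closed_span_def)
    then show "x \<in> W" using closed_subspaceD(5)[OF _ _ l] W by blast
  qed
qed (auto simp: closed_span_def dest: closed_subspaceD)

theorem closed_span_star_subalgebra:
  assumes V: "V \<subseteq> carrier C" and m: "\<And>x y. x \<in> V \<Longrightarrow> y \<in> V \<Longrightarrow> x \<otimes> y \<in> V"
    and a: "\<And>x. x \<in> V \<Longrightarrow> cadj C x \<in> V"
  shows "closed_star_subalgebra C (closed_span V)"
proof -
  let ?S = "closed_span V"
  note S = closed_subspace_span[OF V]
  note S' = closed_subspaceD[OF S]
  note sup = closed_span_superset[of V]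
  have c: "x \<in> ?S \<Longrightarrow> x \<in> carrier C" for x using S'(1) by blast
  have pre: "closed_subspace C {x \<in> carrier C. F x \<in> ?S}"
    if "\<And>x y. x \<in> carrier C \<Longrightarrow> y \<in> carrier C \<Longrightarrow> F (x \<oplus> y) = F x \<oplus> F y" "F \<zero> = \<zero>"
      "\<And>c x. x \<in> carrier C \<Longrightarrow> \<exists>c'. F (c \<odot> x) = c' \<odot> F x"
      "\<And>s x. clim s x \<Longrightarrow> clim (\<lambda>n. F (s n)) (F x)" for F
  proof (rule closed_subspaceI)
    show "c \<odot> x \<in> {x \<in> carrier C. F x \<in> ?S}" if x: "x \<in> {x \<in> carrier C. F x \<in> ?S}" for c x
    proof -
      obtain c' where "F (c \<odot> x) = c' \<odot> F x"
        using x \<open>\<And>c x. x \<in> carrier C \<Longrightarrow> \<exists>c'. F (c \<odot> x) = c' \<odot> F x\<close>[of x c] by blast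
      then show ?thesis using x S'(4)[of "F x" c'] by simp
    qed
    show "x \<in> {x \<in> carrier C. F x \<in> ?S}" if s: "\<And>n. s n \<in> {x \<in> carrier C. F x \<in> ?S}" and l: "clim s x" for s x
      using S'(5)[OF _ \<open>\<And>s x. clim s x \<Longrightarrow> clim (\<lambda>n. F (s n)) (F x)\<close>[OF l]] s climD(2)[OF l] by blast
  qed (use that S' in auto)
  have r: "x \<otimes> v \<in> ?S" if x: "x \<in> ?S" and v: "v \<in> V" for x v
  proof -
    have vc: "v \<in> carrier C" using v V by blast
    have "closed_subspace C {x \<in> carrier C. x \<otimes> v \<in> ?S}"
      using vc by (intro pre) (auto simp: distr_left smult_mult_left intro: clim_mult clim_const)
    moreover have "V \<subseteq> {x \<in> carrier C. x \<otimes> v \<in> ?S}" using m v V sup by auto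
    ultimately have "?S \<subseteq> {x \<in> carrier C. x \<otimes> v \<in> ?S}" by (rule closed_span_least)
    then show ?thesis using x by blast
  qed
  have mm: "x \<otimes> y \<in> ?S" if x: "x \<in> ?S" and y: "y \<in> ?S" for x y
  proof -
    have "closed_subspace C {y \<in> carrier C. x \<otimes> y \<in> ?S}"
      using c[OF x] by (intro pre) (auto simp: distr_right smult_mult_right intro: clim_mult clim_const)
    moreover have "V \<subseteq> {y \<in> carrier C. x \<otimes> y \<in> ?S}" using r[OF x] V by auto
    ultimately have "?S \<subseteq> {y \<in> carrier C. x \<otimes> y \<in> ?S}" by (rule closed_span_least)
    then show ?thesis using y by blast
  qed
  have "closed_subspace C {x \<in> carrier C. cadj C x \<in> ?S}"
    by (intro pre) (auto simp: cadj_add cadj_smult intro: clim_cadj)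
  moreover have "V \<subseteq> {x \<in> carrier C. cadj C x \<in> ?S}" using a V sup by auto
  ultimately have "?S \<subseteq> {x \<in> carrier C. cadj C x \<in> ?S}" by (rule closed_span_least)
  then show ?thesis using S mm by (auto simp: closed_star_subalgebra_def closed_subspace_def)
qed

lemma mat_pos_cong:
  assumes "mat_pos C k M" "\<And>i j. i < k \<Longrightarrow> j < k \<Longrightarrow> M i j = N i j"
  shows "mat_pos C k N"
  using assms unfolding mat_pos_def by auto

lemma mat_pos_row:
  assumes x: "\<And>i. i < k \<Longrightarrow> x i \<in> carrier C"
    and M: "\<And>i j. i < k \<Longrightarrow> j < k \<Longrightarrow> M i j = cadj C (x i) \<otimes> x j"
  shows "mat_pos C k M"
  unfolding mat_pos_def
proof (intro exI[of _ "\<lambda>l i. if l = 0 then x i else \<zero>"] conjI allI impI)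
  fix i j assume ij: "i < k" "j < k"
  then have "(\<Oplus>l\<in>{..<k}. cadj C (if l = 0 then x i else \<zero>) \<otimes> (if l = 0 then x j else \<zero>)) = cadj C (x i) \<otimes> x j"
    using x fsum_single[of "{..<k}" 0 "\<lambda>l. cadj C (if l = 0 then x i else \<zero>) \<otimes> (if l = 0 then x j else \<zero>)"] by simp
  then show "M i j = (\<Oplus>l\<in>{..<k}. cadj C (if l = 0 then x i else \<zero>) \<otimes> (if l = 0 then x j else \<zero>))"
    using M ij by simp
qed (use x in auto)

text \<open>Rows and columns of zeros do not affect positivity.\<close>

lemma mat_pos_pad:
  assumes M: "mat_pos C (length I) M" and I: "distinct I" "set I \<subseteq> {..<k}"
    and N: "\<And>p r. p < length I \<Longrightarrow> r < length I \<Longrightarrow> N (I ! p) (I ! r) = M p r"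
    and N0: "\<And>i j. i < k \<Longrightarrow> j < k \<Longrightarrow> i \<notin> set I \<or> j \<notin> set I \<Longrightarrow> N i j = \<zero>"
  shows "mat_pos C k N"
proof -
  let ?n = "length I"
  have nk: "?n \<le> k" using card_mono[OF _ I(2)] distinct_card[OF I(1)] by simp
  obtain X where X: "\<And>l i. l < ?n \<Longrightarrow> i < ?n \<Longrightarrow> X l i \<in> carrier C"
    "\<And>i j. i < ?n \<Longrightarrow> j < ?n \<Longrightarrow> M i j = (\<Oplus>l\<in>{..<?n}. cadj C (X l i) \<otimes> X l j)"
    using M unfolding mat_pos_def by blast
  define pos where "pos i = (THE p. p < ?n \<and> I ! p = i)" for i
  have pos: "pos i < ?n" "I ! pos i = i" if "i \<in> set I" for i
  proof -
    have "\<exists>!p. p < ?n \<and> I ! p = i" using that I(1) by (metis in_set_conv_nth nth_eq_iff_index_eq)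
    from theI'[OF this] show "pos i < ?n" "I ! pos i = i" by (auto simp: pos_def)
  qed
  define Y where "Y l i = (if l < ?n \<and> i \<in> set I then X l (pos i) else \<zero>)" for l i
  have Yc: "Y l i \<in> carrier C" for l i using X(1) pos(1) by (auto simp: Y_def)
  have "N i j = (\<Oplus>l\<in>{..<k}. cadj C (Y l i) \<otimes> Y l j)" if ij: "i < k" "j < k" for i j
  proof (cases "i \<in> set I \<and> j \<in> set I")
    case False
    have "(\<Oplus>l\<in>{..<k}. cadj C (Y l i) \<otimes> Y l j) = (\<Oplus>l\<in>{..<k}. \<zero>)"
    proof (rule fsum_cong)
      fix l
      have "Y l i = \<zero> \<or> Y l j = \<zero>" using False by (auto simp: Y_def)
      then show "cadj C (Y l i) \<otimes> Y l j = \<zero>" using Yc by auto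
    qed simp
    then show ?thesis using N0[OF ij] False by (simp only: fsum_zero) blast
  next
    case True
    then have p: "pos i < ?n" "pos j < ?n" "I ! pos i = i" "I ! pos j = j" using pos by auto
    have "{..<k} = {..<?n} \<union> {?n..<k}" using nk by auto
    moreover have "(\<Oplus>l\<in>{..<?n} \<union> {?n..<k}. cadj C (Y l i) \<otimes> Y l j) =
        (\<Oplus>l\<in>{..<?n}. cadj C (Y l i) \<otimes> Y l j) \<oplus> (\<Oplus>l\<in>{?n..<k}. cadj C (Y l i) \<otimes> Y l j)"
      using Yc by (intro M.finsum_Un_disjoint) auto
    moreover have "(\<Oplus>l\<in>{?n..<k}. cadj C (Y l i) \<otimes> Y l j) = (\<Oplus>l\<in>{?n..<k}. \<zero>)"
      by (rule fsum_cong) (auto simp: Y_def)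
    moreover have "(\<Oplus>l\<in>{..<?n}. cadj C (Y l i) \<otimes> Y l j) = (\<Oplus>l\<in>{..<?n}. cadj C (X l (pos i)) \<otimes> X l (pos j))"
      using True X(1) p by (intro fsum_cong) (auto simp: Y_def)
    ultimately have "(\<Oplus>l\<in>{..<k}. cadj C (Y l i) \<otimes> Y l j) = M (pos i) (pos j)"
      using X(2)[OF p(1,2)] Yc X(1) p by (simp add: fsum_zero)
    then show ?thesis using N[OF p(1,2)] p by simp
  qed
  then show ?thesis unfolding mat_pos_def using Yc by (intro exI[of _ Y]) blast
qed

end

section \<open>The universal algebra is the closed span of the generators\<close>

lemma complete_order_repD:
  assumes "complete_order_rep C g"
  shows "s \<in> D1 \<Longrightarrow> g s \<in> carrier C"
    "s \<in> D1 \<Longrightarrow> t \<in> D1 \<Longrightarrow> g (s * t) = g s \<otimes>\<^bsub>C\<^esub> g t"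
    "s \<in> D1 \<Longrightarrow> g (sg_star s) = cadj C (g s)"
    "a \<in> Mat_D1 k \<Longrightarrow> b \<in> Mat_D1 k \<Longrightarrow> mat_preceq k a b \<Longrightarrow>
       mat_pos C k (\<lambda>i j. g (b ! i ! j) \<ominus>\<^bsub>C\<^esub> g (a ! i ! j))"
  using assms unfolding complete_order_rep_def mat_le_def by (blast+)

text \<open>By \<open>mat_pos_sub\<close>, \<open>\<iota>\<close> is also a complete order representation in the closed span \<open>S\<close> of \<open>\<iota>(D1)\<close>. The
  resulting homomorphism from \<open>B\<close> to \<open>S\<close>, followed by the inclusion, and the identity of \<open>B\<close> both
  factor \<open>\<iota>\<close> through itself. So they are equal.\<close>

theorem universal_dense:
  assumes U: "universal_cstar B \<iota>" and W: "closed_subspace B W" "\<iota> ` D1 \<subseteq> W"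
  shows "carrier B \<subseteq> W"
proof -
  have cB: "cstar_algebra B" and rep: "complete_order_rep B \<iota>" and uni: "universal_for TYPE('a) B \<iota>"
    using U by (auto simp: universal_cstar_def)
  interpret B: cstar_algebra B by (rule cB)
  note R = complete_order_repD[OF rep]
  define S where "S = B.closed_span (\<iota> ` D1)"
  have sub: "\<iota> ` D1 \<subseteq> carrier B" using R(1) by blast
  have "closed_star_subalgebra B (B.closed_span (\<iota> ` D1))"
  proof (rule B.closed_span_star_subalgebra[OF sub])
    show "x \<otimes>\<^bsub>B\<^esub> y \<in> \<iota> ` D1" if "x \<in> \<iota> ` D1" "y \<in> \<iota> ` D1" for x y
      using that R(2)[symmetric] D1_mult by auto
    show "cadj B x \<in> \<iota> ` D1" if "x \<in> \<iota> ` D1" for x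
      using that R(3)[symmetric] D1_star by auto
  qed
  then have S: "closed_star_subalgebra B S" by (simp add: S_def)
  note S' = B.subalgebraD[OF S]
  have iS: "\<iota> s \<in> S" if "s \<in> D1" for s
    unfolding S_def using that by (intro subsetD[OF B.closed_span_superset] imageI)
  define B0 where "B0 = B\<lparr>carrier := S\<rparr>"
  have cB0: "cstar_algebra B0" unfolding B0_def by (rule B.sub_cstar[OF S])
  have "complete_order_rep B0 \<iota>"
    unfolding complete_order_rep_def
  proof (intro conjI ballI allI impI)
    show "\<iota> \<in> D1 \<rightarrow> carrier B0" using iS by (simp add: B0_def)
    show "\<And>s t. s \<in> D1 \<Longrightarrow> t \<in> D1 \<Longrightarrow> \<iota> (s * t) = \<iota> s \<otimes>\<^bsub>B0\<^esub> \<iota> t" using R(2) by (simp add: B0_def)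
    show "\<And>s. s \<in> D1 \<Longrightarrow> \<iota> (sg_star s) = cadj B0 (\<iota> s)" using R(3) by (simp add: B0_def)
    fix k a b assume ab: "a \<in> Mat_D1 k" "b \<in> Mat_D1 k" "mat_preceq k a b"
    have m: "\<iota> (a ! i ! j) \<in> S" "\<iota> (b ! i ! j) \<in> S" if "i < k" "j < k" for i j
      using ab that iS by (auto simp: Mat_D1_def)
    have "mat_pos (B\<lparr>carrier := S\<rparr>) k (\<lambda>i j. \<iota> (b ! i ! j) \<ominus>\<^bsub>B\<^esub> \<iota> (a ! i ! j))"
      using R(4)[OF ab] m S'(5) by (intro B.mat_pos_sub[OF S]) (auto simp: B.mats_def)
    then have "mat_pos B0 k (\<lambda>i j. \<iota> (b ! i ! j) \<ominus>\<^bsub>B\<^esub> \<iota> (a ! i ! j))" by (simp only: B0_def)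
    then have "mat_pos B0 k (\<lambda>i j. \<iota> (b ! i ! j) \<ominus>\<^bsub>B0\<^esub> \<iota> (a ! i ! j))"
      by (rule cstar_algebra.mat_pos_cong[OF cB0]) (simp add: B0_def B.sub_minus[OF S] m)
    then show "mat_le B0 k (\<lambda>i j. \<iota> (a ! i ! j)) (\<lambda>i j. \<iota> (b ! i ! j))" by (simp add: mat_le_def)
  qed
  then obtain h where h: "h \<in> star_hom B B0" "h \<in> extensional (carrier B)" "\<And>s. s \<in> D1 \<Longrightarrow> \<iota> s = h (\<iota> s)"
    using uni cB0 unfolding universal_for_def by blast
  have hB: "h \<in> star_hom B B" using h(1) S'(1) unfolding star_hom_def B0_def by (auto simp: Pi_def)
  define d where "d = (\<lambda>x\<in>carrier B. x)"
  have dB: "d \<in> star_hom B B" "d \<in> extensional (carrier B)" "\<And>s. s \<in> D1 \<Longrightarrow> \<iota> s = d (\<iota> s)"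
    using R(1) by (auto simp: d_def star_hom_def)
  have "\<exists>!h. h \<in> star_hom B B \<inter> extensional (carrier B) \<and> (\<forall>s\<in>D1. \<iota> s = h (\<iota> s))"
    using uni cB rep unfolding universal_for_def by blast
  then have "h = d" using hB h(2,3) dB by blast
  have "carrier B \<subseteq> S"
  proof
    fix x assume x: "x \<in> carrier B"
    then have "h x \<in> S" using h(1) unfolding star_hom_def B0_def by auto
    then show "x \<in> S" using \<open>h = d\<close> x by (simp add: d_def)
  qed
  then show ?thesis using B.closed_span_least[OF W] by (auto simp: S_def)
qed

section \<open>Undoing the conjugation\<close>

text \<open>If \<open>m\<close> is a loop of height 1, then \<open>u m u\<^sup>*\<close> has height 2 and lies outside \<open>D1\<close>. The value 0
  is consistent with products because the height of a product of loops is the maximum of the heights.\<close>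

definition raise :: "'b cstar \<Rightarrow> (alt_sg \<Rightarrow> 'b) \<Rightarrow> alt_sg \<Rightarrow> 'b" where
  "raise B \<iota> m = (if peak m \<le> 0 then \<iota> (up * m * down) else \<zero>\<^bsub>B\<^esub>)"

lemma down_up_absorb: "tau t = 0 \<Longrightarrow> peak t \<le> 0 \<Longrightarrow> down * (up * t) = t"
  using down_absorb_left[OF hd_last_NF_peak0(1)] peak_nonneg[of t] by (simp add: mult.assoc[symmetric] up_down)

lemma length_gram [simp]: "length (gram ws) = length ws"
  by (simp add: gram_def)

lemma gram_nth [simp]: "i < length ws \<Longrightarrow> j < length ws \<Longrightarrow> gram ws ! i ! j = sg_star (ws ! i) * ws ! j"
  by (simp add: gram_def)

lemma gram_Mat_A: "gram ws \<in> Mat_A (length ws)"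
  by (auto simp: Mat_A_def)

lemma gram_Mat_A_length: "gram ws \<in> Mat_A k \<Longrightarrow> length ws = k"
proof -
  assume "gram ws \<in> Mat_A k"
  then obtain ws' where "gram ws = gram ws'" "length ws' = k" unfolding Mat_A_def by blast
  then show ?thesis using length_gram by metis
qed

lemma gram_Mat_D1:
  "gram ws \<in> Mat_D1 k \<longleftrightarrow> length ws = k \<and> (\<forall>i<k. \<forall>j<k. sg_star (ws ! i) * ws ! j \<in> D1)"
  using gram_Mat_A gram_Mat_A_length by (auto simp: Mat_D1_def)

lemma raise_closed: "complete_order_rep B \<iota> \<Longrightarrow> cstar_algebra B \<Longrightarrow> m \<in> D1 \<Longrightarrow> raise B \<iota> m \<in> carrier B"
proof -
  assume rep: "complete_order_rep B \<iota>" and cB: "cstar_algebra B" and m: "m \<in> D1"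
  interpret B: cstar_algebra B by (rule cB)
  show ?thesis using complete_order_repD(1)[OF rep, of "up * m * down"] m
    by (auto simp: raise_def D1_iff tau_mult peak_mult tau_peak_letters)
qed

text \<open>Multiplying the rows by a letter leads one step down in the order; that the rows absorb the corresponding
  idempotent is then automatic.\<close>

lemma mat_step_left:
  assumes "v = down \<or> v = up"
  shows "mat_step (gram (map ((*) v) ws)) (gram ws)"
  using assms
proof
  assume "v = down"
  moreover have "word [- 1, 1] * (down * w) = down * w" for w
    using up_down_up(2) by (metis mult.assoc up_down(2))
  ultimately show ?thesis by (intro mat_step.intros(1)) (auto simp: o_def)
next
  assume "v = up"
  moreover have "word [1, - 1] * (up * w) = up * w" for w
    using up_down_up(1) by (metis mult.assoc up_down(1))
  ultimately show ?thesis by (intro mat_step.intros(2)) (auto simp: o_def)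
qed

text \<open>If a row \<open>u\<^sub>i\<close> rises above its end point, then \<open>raise\<close> vanishes on all entries of its row and column.
  For the other rows, \<open>raise\<close> turns the Gram matrix of the \<open>u\<^sub>i\<close> into \<open>\<iota>\<close> of the Gram matrix of the
  \<open>u\<^sub>i u\<^sup>*\<close>, and the order step between the former is one between the latter.\<close>

lemma raise_step_generic:
  assumes cB: "cstar_algebra B" and rep: "complete_order_rep B \<iota>" and v: "v = down \<or> v = up"
    and k: "length us = k"
    and t: "\<And>i. i < k \<Longrightarrow> tau (us ! i) = c"
    and Hb: "\<And>i j. i < k \<Longrightarrow> j < k \<Longrightarrow>
      peak (sg_star (v * us ! i) * (v * us ! j)) \<le> 0 \<longleftrightarrow> peak (us ! i) \<le> c \<and> peak (us ! j) \<le> c"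
  shows "mat_pos B k (\<lambda>i j. raise B \<iota> (sg_star (us ! i) * us ! j) \<ominus>\<^bsub>B\<^esub>
      raise B \<iota> (sg_star (v * us ! i) * (v * us ! j)))"
proof -
  interpret B: cstar_algebra B by (rule cB)
  note R = complete_order_repD[OF rep]
  define I where "I = filter (\<lambda>i. peak (us ! i) \<le> c) [0..<k]"
  define ws where "ws = map (\<lambda>i. us ! i * down) I"
  let ?n = "length I"
  have Ik: "I ! r < k" "peak (us ! (I ! r)) \<le> c" if "r < ?n" for r
    using nth_mem[OF that] by (auto simp: I_def)
  have wsn: "ws ! r = us ! (I ! r) * down" if "r < ?n" for r using that by (simp add: ws_def)
  have conj1: "sg_star (ws ! r) * ws ! s = up * (sg_star (us ! (I ! r)) * us ! (I ! s)) * down"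
    if "r < ?n" "s < ?n" for r s using that by (simp add: wsn sg_star_mult star_letters mult.assoc)
  have conj2: "sg_star (v * ws ! r) * (v * ws ! s) = up * (sg_star (v * us ! (I ! r)) * (v * us ! (I ! s))) * down"
    if "r < ?n" "s < ?n" for r s using that by (simp add: wsn sg_star_mult star_letters mult.assoc)
  have H1: "peak (sg_star (us ! i) * us ! j) \<le> 0 \<longleftrightarrow> peak (us ! i) \<le> c \<and> peak (us ! j) \<le> c" if "i < k" "j < k" for i j
    using that t by (auto simp: peak_mult peak_star tau_star)
  have tv: "tau (sg_star (v * us ! i) * (v * us ! j)) = 0" if "i < k" "j < k" for i j
    using that t by (simp add: tau_mult tau_star)
  have D1a: "gram (map ((*) v) ws) \<in> Mat_D1 ?n"
    unfolding gram_Mat_D1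
  proof (intro conjI allI impI)
    show "length (map ((*) v) ws) = ?n" by (simp add: ws_def)
    fix r s assume rs: "r < ?n" "s < ?n"
    have "peak (sg_star (v * us ! (I ! r)) * (v * us ! (I ! s))) \<le> 0"
      using Hb Ik[OF rs(1)] Ik[OF rs(2)] by simp
    then show "sg_star (map ((*) v) ws ! r) * map ((*) v) ws ! s \<in> D1"
      using rs tv[OF Ik(1)[OF rs(1)] Ik(1)[OF rs(2)]] conj2[OF rs]
      by (simp add: ws_def[symmetric] nth_map[of _ ws] D1_iff) (simp add: ws_def D1_iff tau_mult peak_mult tau_peak_letters)
  qed
  have D1b: "gram ws \<in> Mat_D1 ?n"
    unfolding gram_Mat_D1
  proof (intro conjI allI impI)
    show "length ws = ?n" by (simp add: ws_def)
    fix r s assume rs: "r < ?n" "s < ?n"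
    have "peak (sg_star (us ! (I ! r)) * us ! (I ! s)) \<le> 0" "tau (sg_star (us ! (I ! r)) * us ! (I ! s)) = 0"
      using H1 Ik[OF rs(1)] Ik[OF rs(2)] t by (simp_all add: tau_mult tau_star)
    then show "sg_star (ws ! r) * ws ! s \<in> D1"
      unfolding conj1[OF rs] by (simp add: D1_iff tau_mult[of _ down] peak_mult[of _ down] tau_mult[of up] peak_mult[of up] tau_peak_letters)
  qed
  have "mat_preceq ?n (gram (map ((*) v) ws)) (gram ws)"
    using mat_step_left[OF v, of ws] D1a D1b by (auto simp: mat_preceq_def Mat_D1_def)
  note P = R(4)[OF D1a D1b this]
  show ?thesis
  proof (rule B.mat_pos_pad[OF P])
    show "distinct I" "set I \<subseteq> {..<k}" by (auto simp: I_def)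
  next
    fix p r assume pr: "p < ?n" "r < ?n"
    have l: "length ws = ?n" by (simp add: ws_def)
    have 1: "raise B \<iota> (sg_star (us ! (I ! p)) * us ! (I ! r)) = \<iota> (gram ws ! p ! r)"
      using H1 Ik[OF pr(1)] Ik[OF pr(2)] conj1[OF pr] pr l by (simp add: raise_def)
    have 2: "raise B \<iota> (sg_star (v * us ! (I ! p)) * (v * us ! (I ! r))) = \<iota> (gram (map ((*) v) ws) ! p ! r)"
      using Hb Ik[OF pr(1)] Ik[OF pr(2)] conj2[OF pr] pr l by (simp add: raise_def)
    show "raise B \<iota> (sg_star (us ! (I ! p)) * us ! (I ! r)) \<ominus>\<^bsub>B\<^esub>
        raise B \<iota> (sg_star (v * us ! (I ! p)) * (v * us ! (I ! r))) =
      \<iota> (gram ws ! p ! r) \<ominus>\<^bsub>B\<^esub> \<iota> (gram (map ((*) v) ws) ! p ! r)"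
      by (simp only: 1 2)
  next
    fix i j assume ij: "i < k" "j < k" "i \<notin> set I \<or> j \<notin> set I"
    then have "\<not> (peak (us ! i) \<le> c \<and> peak (us ! j) \<le> c)" by (auto simp: I_def)
    then have "\<not> peak (sg_star (us ! i) * us ! j) \<le> 0" "\<not> peak (sg_star (v * us ! i) * (v * us ! j)) \<le> 0"
      using H1 Hb ij by auto
    then show "raise B \<iota> (sg_star (us ! i) * us ! j) \<ominus>\<^bsub>B\<^esub> raise B \<iota> (sg_star (v * us ! i) * (v * us ! j)) = \<zero>\<^bsub>B\<^esub>"
      by (simp add: raise_def B.diff_self)
  qed
qed

text \<open>Removing \<open>p\<close> or \<open>r\<close> between \<open>u\<^sub>i\<^sup>*\<close> and \<open>u\<^sub>j\<close> does not increase heights, so the larger matrix stays over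
  \<open>D1\<close>. It leaves the vanishing of \<open>raise\<close> unchanged, except when \<open>p\<close> is removed and the rows end at
  \<open>c \<le> 0\<close>. In this case \<open>raise\<close> vanishes on the smaller matrix, and on the larger one it is the
  Gram matrix of the \<open>\<iota>(u u\<^sub>i u\<^sup>*)\<close>, with zeros.\<close>

lemma raise_step:
  assumes cB: "cstar_algebra B" and rep: "complete_order_rep B \<iota>"
    and st: "mat_step a b" and a: "a \<in> Mat_D1 k"
  shows "b \<in> Mat_D1 k \<and> mat_pos B k (\<lambda>i j. raise B \<iota> (b ! i ! j) \<ominus>\<^bsub>B\<^esub> raise B \<iota> (a ! i ! j))"
proof -
  interpret B: cstar_algebra B by (rule cB)
  note R = complete_order_repD[OF rep]
  obtain v us where v: "v = down \<or> v = up" and ab: "a = gram (map ((*) v) us)" "b = gram us"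
    using st by (auto elim!: mat_step.cases)
  have k: "length us = k" and aD: "\<And>i j. i < k \<Longrightarrow> j < k \<Longrightarrow> sg_star (v * us ! i) * (v * us ! j) \<in> D1"
    using a unfolding ab gram_Mat_D1 by auto
  define c where "c = tau (us ! 0)"
  have t: "tau (us ! i) = c" if i: "i < k" for i
    using aD[of 0 i] i by (simp add: D1_iff tau_mult tau_star c_def)
  have Ha: "peak (sg_star (v * us ! i) * (v * us ! j)) =
      (if v = down then max (max (peak (us ! i)) 1 - c) (max 1 (peak (us ! j)) - c)
       else max (peak (us ! i) - c) (peak (us ! j) - c))" if ij: "i < k" "j < k" for i j
  proof -
    have pne: "up \<noteq> down" using tau_peak_letters by fastforce
    have "c \<le> peak (us ! i)" "c \<le> peak (us ! j)" using tau_le_peak t ij by metis+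
    then show ?thesis using v ij t peak_nonneg[of "us ! i"] peak_nonneg[of "us ! j"] pne
      by (auto simp: peak_mult peak_star tau_mult tau_star tau_peak_letters)
  qed
  have bD: "sg_star (us ! i) * us ! j \<in> D1" if ij: "i < k" "j < k" for i j
    using aD[OF ij] Ha[OF ij] t ij by (auto simp: D1_iff tau_mult tau_star peak_mult peak_star split: if_splits)
  have b: "b \<in> Mat_D1 k" unfolding ab gram_Mat_D1 using k bD by blast
  have "mat_pos B k (\<lambda>i j. raise B \<iota> (sg_star (us ! i) * us ! j) \<ominus>\<^bsub>B\<^esub>
      raise B \<iota> (sg_star (v * us ! i) * (v * us ! j)))"
  proof (cases "v = down \<and> c \<le> 0")
    case False
    show ?thesis
    proof (rule raise_step_generic[OF cB rep v k t])
      show "peak (sg_star (v * us ! i) * (v * us ! j)) \<le> 0 \<longleftrightarrow> peak (us ! i) \<le> c \<and> peak (us ! j) \<le> c"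
        if "i < k" "j < k" for i j using Ha[OF that] False by (auto split: if_splits)
    qed
  next
    case True
    define x where "x i = (if peak (us ! i) \<le> c then \<iota> (up * us ! i * down) else \<zero>\<^bsub>B\<^esub>)" for i
    have c0: "c = 0" if "peak (us ! i) \<le> c" for i using that True peak_nonneg[of "us ! i"] by linarith
    have D: "up * us ! i * down \<in> D1" if "i < k" "peak (us ! i) \<le> c" for i
      using that t c0[OF that(2)] by (simp add: D1_iff tau_mult peak_mult tau_peak_letters)
    show ?thesis
    proof (rule B.mat_pos_row[of k x])
      show "x i \<in> carrier B" if "i < k" for i using R(1)[OF D] that by (simp add: x_def)
      fix i j assume ij: "i < k" "j < k"
      have "\<not> peak (sg_star (v * us ! i) * (v * us ! j)) \<le> 0" using Ha[OF ij] True by auto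
      then have z: "raise B \<iota> (sg_star (v * us ! i) * (v * us ! j)) = \<zero>\<^bsub>B\<^esub>" by (simp add: raise_def)
      have H1: "peak (sg_star (us ! i) * us ! j) \<le> 0 \<longleftrightarrow> peak (us ! i) \<le> c \<and> peak (us ! j) \<le> c"
        using ij t by (auto simp: peak_mult peak_star tau_star)
      show "raise B \<iota> (sg_star (us ! i) * us ! j) \<ominus>\<^bsub>B\<^esub> raise B \<iota> (sg_star (v * us ! i) * (v * us ! j)) =
          cadj B (x i) \<otimes>\<^bsub>B\<^esub> x j"
      proof (cases "peak (us ! i) \<le> c \<and> peak (us ! j) \<le> c")
        case False
        then have "\<not> peak (sg_star (us ! i) * us ! j) \<le> 0" using H1 by blast
        then have "raise B \<iota> (sg_star (us ! i) * us ! j) = \<zero>\<^bsub>B\<^esub>" by (simp add: raise_def)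
        moreover have "cadj B (x i) \<otimes>\<^bsub>B\<^esub> x j = \<zero>\<^bsub>B\<^esub>"
          using False R(1)[OF D] ij by (auto simp: x_def)
        ultimately show ?thesis using z by (simp add: B.diff_self)
      next
        case T: True
        then have Di: "up * us ! i * down \<in> D1" and Dj: "up * us ! j * down \<in> D1" using D ij by auto
        have "down * (up * us ! j) = us ! j" using T t ij c0 by (intro down_up_absorb) auto
        then have e: "up * (sg_star (us ! i) * us ! j) * down = sg_star (up * us ! i * down) * (up * us ! j * down)"
          by (simp add: sg_star_mult star_letters mult.assoc) (metis mult.assoc)
        have "raise B \<iota> (sg_star (us ! i) * us ! j) = \<iota> (up * (sg_star (us ! i) * us ! j) * down)"
          using H1 T by (simp add: raise_def)
        also have "\<dots> = cadj B (x i) \<otimes>\<^bsub>B\<^esub> x j"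
          unfolding e using R(2)[OF D1_star[OF Di] Dj] R(3)[OF Di] T by (simp add: x_def)
        finally show ?thesis using z R(1)[OF Di] R(1)[OF Dj] T
          by (simp add: B.diff_eq_scale B.scale_simps x_def)
      qed
    qed
  qed
  then have "mat_pos B k (\<lambda>i j. raise B \<iota> (b ! i ! j) \<ominus>\<^bsub>B\<^esub> raise B \<iota> (a ! i ! j))"
    by (rule B.mat_pos_cong) (simp add: ab k)
  then show ?thesis using b by blast
qed

text \<open>Intermediate matrices of a chain of order steps are only required to have entries in \<open>A\<close>; by
  \<open>raise_step\<close> their entries belong to \<open>D1\<close> as soon as those of the smallest matrix do.\<close>

theorem raise_rep:
  assumes cB: "cstar_algebra B" and rep: "complete_order_rep B \<iota>"
  shows "complete_order_rep B (raise B \<iota>)"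
proof -
  interpret B: cstar_algebra B by (rule cB)
  note R = complete_order_repD[OF rep]
  have cl: "raise B \<iota> m \<in> carrier B" if "m \<in> D1" for m by (rule raise_closed[OF rep cB that])
  have D: "up * m * down \<in> D1" if "m \<in> D1" "peak m \<le> 0" for m
    using that by (simp add: D1_iff tau_mult peak_mult tau_peak_letters)
  show ?thesis
    unfolding complete_order_rep_def
  proof (intro conjI ballI allI impI)
    show "raise B \<iota> \<in> D1 \<rightarrow> carrier B" using cl by blast
  next
    fix s t assume st: "s \<in> D1" "t \<in> D1"
    have Hst: "peak (s * t) \<le> 0 \<longleftrightarrow> peak s \<le> 0 \<and> peak t \<le> 0" using st by (auto simp: peak_mult D1_iff)
    show "raise B \<iota> (s * t) = raise B \<iota> s \<otimes>\<^bsub>B\<^esub> raise B \<iota> t"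
    proof (cases "peak s \<le> 0 \<and> peak t \<le> 0")
      case True
      have "down * (up * t) = t" using True st by (intro down_up_absorb) (auto simp: D1_iff)
      then have "up * (s * t) * down = (up * s * down) * (up * t * down)"
        by (simp add: mult.assoc) (metis mult.assoc)
      then show ?thesis using True Hst R(2)[OF D D] st by (simp add: raise_def)
    next
      case False
      then show ?thesis using Hst cl[OF st(1)] cl[OF st(2)] by (auto simp: raise_def)
    qed
  next
    fix s assume s: "s \<in> D1"
    then have Hs: "peak (sg_star s) = peak s" by (simp add: peak_star D1_iff)
    have "sg_star (up * s * down) = up * sg_star s * down" by (simp add: sg_star_mult star_letters mult.assoc)
    then show "raise B \<iota> (sg_star s) = cadj B (raise B \<iota> s)"
      using Hs R(3)[OF D[OF s]] by (simp add: raise_def)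
  next
    fix k a b assume ab: "a \<in> Mat_D1 k" "b \<in> Mat_D1 k" "mat_preceq k a b"
    have "mat_step\<^sup>*\<^sup>* a b" using ab by (simp add: mat_preceq_def)
    then have "b \<in> Mat_D1 k \<and> mat_pos B k (\<lambda>i j. raise B \<iota> (b ! i ! j) \<ominus>\<^bsub>B\<^esub> raise B \<iota> (a ! i ! j))"
    proof (induction rule: rtranclp_induct)
      case base
      have m: "raise B \<iota> (a ! i ! j) \<in> carrier B" if "i < k" "j < k" for i j
        using ab(1) that cl by (auto simp: Mat_D1_def)
      have "mat_pos B k (\<lambda>i j. raise B \<iota> (a ! i ! j) \<ominus>\<^bsub>B\<^esub> raise B \<iota> (a ! i ! j))"
        by (rule B.mat_pos_row[of k "\<lambda>i. \<zero>\<^bsub>B\<^esub>"]) (auto simp: B.diff_self m)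
      then show ?case using ab(1) by blast
    next
      case (step y z)
      from step.IH have y: "y \<in> Mat_D1 k"
        and py: "mat_pos B k (\<lambda>i j. raise B \<iota> (y ! i ! j) \<ominus>\<^bsub>B\<^esub> raise B \<iota> (a ! i ! j))" by auto
      from raise_step[OF cB rep step.hyps(2) y] have z: "z \<in> Mat_D1 k"
        and pz: "mat_pos B k (\<lambda>i j. raise B \<iota> (z ! i ! j) \<ominus>\<^bsub>B\<^esub> raise B \<iota> (y ! i ! j))" by auto
      have "mat_pos B k (\<lambda>i j. raise B \<iota> (z ! i ! j) \<ominus>\<^bsub>B\<^esub> raise B \<iota> (a ! i ! j))"
      proof (rule B.mat_pos_cong[OF B.mat_pos_add[OF pz py]])
        fix i j assume ij: "i < k" "j < k"
        have m: "raise B \<iota> (z ! i ! j) \<in> carrier B" "raise B \<iota> (y ! i ! j) \<in> carrier B" "raise B \<iota> (a ! i ! j) \<in> carrier B"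
          using z y ab(1) ij cl by (auto simp: Mat_D1_def)
        show "(raise B \<iota> (z ! i ! j) \<ominus>\<^bsub>B\<^esub> raise B \<iota> (y ! i ! j)) \<oplus>\<^bsub>B\<^esub> (raise B \<iota> (y ! i ! j) \<ominus>\<^bsub>B\<^esub> raise B \<iota> (a ! i ! j)) =
            raise B \<iota> (z ! i ! j) \<ominus>\<^bsub>B\<^esub> raise B \<iota> (a ! i ! j)"
          by (rule B.lin3[OF m], simp)
      qed
      then show ?case using z by blast
    qed
    then show "mat_le B k (\<lambda>i j. raise B \<iota> (a ! i ! j)) (\<lambda>i j. raise B \<iota> (b ! i ! j))"
      by (simp add: mat_le_def)
  qed
qed

theorem raise_hom:
  assumes U: "universal_cstar B \<iota>"
  obtains h where "h \<in> star_hom B B" "\<And>s. s \<in> D1 \<Longrightarrow> h (\<iota> s) = raise B \<iota> s"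
proof -
  have cB: "cstar_algebra B" and rep: "complete_order_rep B \<iota>" and uni: "universal_for TYPE('a) B \<iota>"
    using U by (auto simp: universal_cstar_def)
  have "\<exists>!h. h \<in> star_hom B B \<inter> extensional (carrier B) \<and> (\<forall>s\<in>D1. raise B \<iota> s = h (\<iota> s))"
    using uni cB raise_rep[OF cB rep] unfolding universal_for_def by blast
  then show thesis using that by force
qed

section \<open>Closed ideals and compact operators\<close>

lemma star_homD:
  assumes "h \<in> star_hom B C"
  shows "x \<in> carrier B \<Longrightarrow> h x \<in> carrier C"
    "x \<in> carrier B \<Longrightarrow> y \<in> carrier B \<Longrightarrow> h (x \<oplus>\<^bsub>B\<^esub> y) = h x \<oplus>\<^bsub>C\<^esub> h y"
    "x \<in> carrier B \<Longrightarrow> h (c \<odot>\<^bsub>B\<^esub> x) = c \<odot>\<^bsub>C\<^esub> h x"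
    "x \<in> carrier B \<Longrightarrow> y \<in> carrier B \<Longrightarrow> h (x \<otimes>\<^bsub>B\<^esub> y) = h x \<otimes>\<^bsub>C\<^esub> h y"
    "x \<in> carrier B \<Longrightarrow> h (cadj B x) = cadj C (h x)"
  using assms by (auto simp: star_hom_def)

lemma star_hom_zero:
  assumes "cstar_algebra B" "cstar_algebra C" "h \<in> star_hom B C"
  shows "h \<zero>\<^bsub>B\<^esub> = \<zero>\<^bsub>C\<^esub>"
proof -
  interpret B: cstar_algebra B by fact
  interpret C: cstar_algebra C by fact
  show ?thesis using star_homD(3)[OF assms(3), of "\<zero>\<^bsub>B\<^esub>" 0] star_homD(1)[OF assms(3), of "\<zero>\<^bsub>B\<^esub>"]
    by (simp add: B.scale_simps C.scale_simps)
qed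

lemma star_hom_clim:
  assumes B: "cstar_algebra B" and C: "cstar_algebra C" and h: "h \<in> star_hom B C"
    and l: "cstar_algebra.clim B s x"
  shows "cstar_algebra.clim C (\<lambda>n. h (s n)) (h x)"
proof -
  interpret B: cstar_algebra B by (rule B)
  interpret C: cstar_algebra C by (rule C)
  note c = B.climD[OF l] and hh = star_homD[OF h]
  show ?thesis
  proof (rule C.climI)
    show "h (s n) \<in> carrier C" "h x \<in> carrier C" for n using c hh(1) by auto
    show "(\<lambda>n. cnorm B (s n \<ominus>\<^bsub>B\<^esub> x)) \<longlonglongrightarrow> 0" using l unfolding B.clim_def by blast
    show "cnorm C (h (s n) \<ominus>\<^bsub>C\<^esub> h x) \<le> cnorm B (s n \<ominus>\<^bsub>B\<^esub> x)" for n
      using star_hom_contractive[OF B C h, of "s n \<ominus>\<^bsub>B\<^esub> x"] c hh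
      by (simp add: B.diff_eq_scale C.diff_eq_scale)
  qed
qed

context cstar_algebra
begin

lemma span_submodule:
  assumes "V \<subseteq> carrier C"
  shows "submodule (complex_span C V) complex_ring C" "V \<subseteq> complex_span C V"
    "\<And>W. submodule W complex_ring C \<Longrightarrow> V \<subseteq> W \<Longrightarrow> complex_span C V \<subseteq> W"
proof -
  show "V \<subseteq> complex_span C V" by (auto simp: complex_span_def)
  show least: "complex_span C V \<subseteq> W" if "submodule W complex_ring C" "V \<subseteq> W" for W
    using that by (auto simp: complex_span_def)
  have sub: "complex_span C V \<subseteq> carrier C" by (rule least[OF carrier_is_submodule assms])
  show "submodule (complex_span C V) complex_ring C"
  proof (rule submoduleI[OF sub])
    show "\<zero> \<in> complex_span C V"
      unfolding complex_span_def
    proof (rule InterI)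
      fix W assume "W \<in> {W. submodule W complex_ring C \<and> V \<subseteq> W}"
      then have "submodule W complex_ring C" by blast
      note E = submoduleE[OF this]
      obtain z where "z \<in> W" using E(2) by blast
      then have "z \<oplus> \<ominus> z \<in> W" by (intro E(5) E(6))
      then show "\<zero> \<in> W" using \<open>z \<in> W\<close> E(1) M.r_neg[of z] by auto
    qed
    show "a \<odot> x \<in> complex_span C V" if "x \<in> complex_span C V" for a x
      using that submoduleE(4)[of _ a x] by (auto simp: complex_span_def)
  qed (auto simp: complex_span_def dest: submoduleE)
qed

lemma norm_closure_subspace:
  assumes S: "submodule S complex_ring C"
  shows "closed_subspace C (norm_closure C S)" "S \<subseteq> norm_closure C S"
proof -
  note E = submoduleE[OF S]
  have c: "x \<in> S \<Longrightarrow> x \<in> carrier C" for x using E(1) by blast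
  show sub: "S \<subseteq> norm_closure C S"
    using c by (auto simp: norm_closure_def intro!: bexI simp: diff_self)
  obtain z where "z \<in> S" using E(2) by blast
  then have "z \<oplus> \<ominus> z \<in> S" by (intro E(5) E(6))
  then have z: "\<zero> \<in> S" using \<open>z \<in> S\<close> c M.r_neg[of z] by auto
  have lim: "x \<in> norm_closure C S" if s: "\<And>n. s n \<in> S" and l: "clim s x" for s x
  proof -
    have "\<exists>y\<in>S. cnorm C (x \<ominus> y) < e" if e: "e > 0" for e
    proof -
      have "\<exists>N. \<forall>n\<ge>N. norm (cnorm C (s n \<ominus> x) - 0) < e"
        using l unfolding clim_def by (intro LIMSEQ_D[OF _ e]) auto
      then obtain N where "norm (cnorm C (s N \<ominus> x) - 0) < e" by blast
      then have "cnorm C (x \<ominus> s N) < e" using norm_diff_commute[OF climD(2)[OF l] c[OF s[of N]]] by simp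
      then show ?thesis using s by blast
    qed
    then show ?thesis using climD(2)[OF l] by (simp add: norm_closure_def)
  qed
  show "closed_subspace C (norm_closure C S)"
  proof (rule closed_subspaceI)
    show "norm_closure C S \<subseteq> carrier C" by (auto simp: norm_closure_def)
    show "\<zero> \<in> norm_closure C S" using sub z by blast
    show "x \<oplus> y \<in> norm_closure C S" if xy: "x \<in> norm_closure C S" "y \<in> norm_closure C S" for x y
    proof -
      obtain s where s: "\<And>n. s n \<in> S" "clim s x" using norm_closure_clim[OF xy(1) E(1)] by blast
      obtain t where t: "\<And>n. t n \<in> S" "clim t y" using norm_closure_clim[OF xy(2) E(1)] by blast
      show ?thesis by (rule lim[OF _ clim_add[OF s(2) t(2)]]) (rule E(5)[OF s(1) t(1)])
    qed
    show "a \<odot> x \<in> norm_closure C S" if x: "x \<in> norm_closure C S" for a x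
    proof -
      obtain s where s: "\<And>n. s n \<in> S" "clim s x" using norm_closure_clim[OF x E(1)] by blast
      show ?thesis by (rule lim[OF _ clim_smult[OF s(2)]]) (use E(4)[OF _ s(1)] in simp)
    qed
    show "x \<in> norm_closure C S" if s: "\<And>n. s n \<in> norm_closure C S" and l: "clim s x" for s x
    proof -
      have "\<exists>y\<in>S. cnorm C (x \<ominus> y) < e" if e: "e > 0" for e
      proof -
        have "\<exists>N. \<forall>n\<ge>N. norm (cnorm C (s n \<ominus> x) - 0) < e / 2"
          using l e unfolding clim_def by (intro LIMSEQ_D) auto
        then obtain N where N: "norm (cnorm C (s N \<ominus> x) - 0) < e / 2" by blast
        have m: "x \<in> carrier C" "s N \<in> carrier C" using climD[OF l] by auto
        have "\<forall>e>0. \<exists>y\<in>S. cnorm C (s N \<ominus> y) < e" using s[of N] by (simp add: norm_closure_def)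
        moreover have "e / 2 > 0" using e by simp
        ultimately obtain y where y: "y \<in> S" "cnorm C (s N \<ominus> y) < e / 2" by blast
        have "cnorm C (x \<ominus> y) \<le> cnorm C (x \<ominus> s N) + cnorm C (s N \<ominus> y)" by (rule norm_diff_trans[OF m c[OF y(1)]])
        moreover have "cnorm C (x \<ominus> s N) < e / 2" using N norm_diff_commute[OF m] by simp
        ultimately have "cnorm C (x \<ominus> y) < e" using y(2) by linarith
        then show ?thesis using y(1) by blast
      qed
      then show ?thesis using climD(2)[OF l] by (simp add: norm_closure_def)
    qed
  qed
qed

lemma closure_span_ideal:
  assumes V: "V \<subseteq> carrier C"
    and I: "\<And>T v. T \<in> carrier C \<Longrightarrow> v \<in> V \<Longrightarrow> T \<otimes> v \<in> V" "\<And>T v. T \<in> carrier C \<Longrightarrow> v \<in> V \<Longrightarrow> v \<otimes> T \<in> V"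
    and T: "T \<in> carrier C" and x: "x \<in> norm_closure C (complex_span C V)"
  shows "T \<otimes> x \<in> norm_closure C (complex_span C V)" "x \<otimes> T \<in> norm_closure C (complex_span C V)"
proof -
  let ?S = "complex_span C V"
  note S = span_submodule[OF V]
  note E = submoduleE[OF S(1)]
  note N = closed_subspaceD[OF norm_closure_subspace(1)[OF S(1)]]
  have c: "x \<in> ?S \<Longrightarrow> x \<in> carrier C" for x using E(1) by blast
  have pre: "submodule {x \<in> carrier C. F x \<in> ?S} complex_ring C"
    if "\<And>x. x \<in> carrier C \<Longrightarrow> F x \<in> carrier C"
      "\<And>x y. x \<in> carrier C \<Longrightarrow> y \<in> carrier C \<Longrightarrow> F (x \<oplus> y) = F x \<oplus> F y" "F \<zero> = \<zero>"
      "\<And>c x. x \<in> carrier C \<Longrightarrow> F (c \<odot> x) = c \<odot> F x" for F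
  proof -
    obtain z where "z \<in> ?S" using E(2) by blast
    then have "z \<oplus> \<ominus> z \<in> ?S" by (intro E(5) E(6))
    then have "\<zero> \<in> ?S" using \<open>z \<in> ?S\<close> c M.r_neg[of z] by auto
    then show ?thesis
      using that E(4,5) by (intro submoduleI) (auto simp: neg_eq_scale)
  qed
  have "submodule {x \<in> carrier C. T \<otimes> x \<in> ?S} complex_ring C"
    using T by (intro pre) (auto simp: distr_right smult_mult_right)
  from S(3)[OF this] have l: "T \<otimes> x \<in> ?S" if "x \<in> ?S" for x using I(1)[OF T] V S(2) that by blast
  have "submodule {x \<in> carrier C. x \<otimes> T \<in> ?S} complex_ring C"
    using T by (intro pre) (auto simp: distr_left smult_mult_left)
  from S(3)[OF this] have r: "x \<otimes> T \<in> ?S" if "x \<in> ?S" for x using I(2)[OF T] V S(2) that by blast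
  obtain s where s: "\<And>n. s n \<in> ?S" "clim s x" using norm_closure_clim[OF x E(1)] by blast
  have 1: "T \<otimes> s n \<in> norm_closure C ?S" "s n \<otimes> T \<in> norm_closure C ?S" for n
    using l[OF s(1)] r[OF s(1)] norm_closure_subspace(2)[OF S(1)] by blast+
  show "T \<otimes> x \<in> norm_closure C ?S" by (rule N(5)[OF 1(1) clim_mult[OF clim_const[OF T] s(2)]])
  show "x \<otimes> T \<in> norm_closure C ?S" by (rule N(5)[OF 1(2) clim_mult[OF s(2) clim_const[OF T]]])
qed

end

context hilbert_module
begin

interpretation LE: unital_cstar "adjointable_ops B E" by (rule L_unital)

lemma theta_mem:
  assumes "x \<in> carrier E" "y \<in> carrier E"
  shows "theta E x y \<in> carrier L"
proof (rule L_I[where S = "theta E y x"])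
  show "theta E x y \<in> extensional (carrier E)" by (simp add: theta_def)
  show "theta E x y z \<in> carrier E" "theta E y x z \<in> carrier E" if "z \<in> carrier E" for z
    using assms that by (simp_all add: theta_def)
  show "inn E (theta E x y z) w = inn E z (theta E y x w)" if "z \<in> carrier E" "w \<in> carrier E" for z w
    using assms that by (simp add: theta_def inn_ract_left inn_ract_right inn_cadj)
qed

lemma theta_mult:
  assumes x: "x \<in> carrier E" and y: "y \<in> carrier E" and T: "T \<in> carrier L"
  shows "T \<otimes>\<^bsub>L\<^esub> theta E x y = theta E (T x) y" "theta E x y \<otimes>\<^bsub>L\<^esub> T = theta E x (cadj L T y)"
proof -
  have m: "T x \<in> carrier E" "cadj L T y \<in> carrier E" using T x y adj(1)[OF T] by auto
  note t = theta_mem[OF x y] theta_mem[OF m(1) y] theta_mem[OF x m(2)]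
  show "T \<otimes>\<^bsub>L\<^esub> theta E x y = theta E (T x) y"
    by (rule L_ext[OF L_closed(5)[OF T t(1)] t(2)]) (use x y T in \<open>simp add: L_apply theta_def L_linear\<close>)
  show "theta E x y \<otimes>\<^bsub>L\<^esub> T = theta E x (cadj L T y)"
    by (rule L_ext[OF L_closed(5)[OF t(1) T] t(3)])
      (use x y T adj(3)[OF T] in \<open>auto simp: L_apply theta_def\<close>)
qed

text \<open>\<open>T \<theta>\<close> and \<open>\<theta> T\<close> are again rank one operators, and multiplication is continuous.\<close>

theorem compact_ops_closed_ideal:
  shows "closed_subspace L (compact_ops B E)"
    "T \<in> carrier L \<Longrightarrow> S \<in> compact_ops B E \<Longrightarrow> T \<otimes>\<^bsub>L\<^esub> S \<in> compact_ops B E \<and> S \<otimes>\<^bsub>L\<^esub> T \<in> compact_ops B E"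
    "x \<in> carrier E \<Longrightarrow> y \<in> carrier E \<Longrightarrow> theta E x y \<in> compact_ops B E"
proof -
  let ?V = "{theta E x y | x y. x \<in> carrier E \<and> y \<in> carrier E}"
  have V: "?V \<subseteq> carrier L" using theta_mem by blast
  note S = LE.span_submodule[OF V]
  show "closed_subspace L (compact_ops B E)"
    unfolding compact_ops_def by (rule LE.norm_closure_subspace(1)[OF S(1)])
  show "theta E x y \<in> compact_ops B E" if "x \<in> carrier E" "y \<in> carrier E"
    unfolding compact_ops_def using LE.norm_closure_subspace(2)[OF S(1)] S(2) that by blast
  show "T \<otimes>\<^bsub>L\<^esub> S \<in> compact_ops B E \<and> S \<otimes>\<^bsub>L\<^esub> T \<in> compact_ops B E"
    if T: "T \<in> carrier L" and S: "S \<in> compact_ops B E"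
  proof -
    have 1: "T \<otimes>\<^bsub>L\<^esub> v \<in> ?V" if T: "T \<in> carrier L" and v: "v \<in> ?V" for T v
    proof -
      obtain x y where xy: "x \<in> carrier E" "y \<in> carrier E" "v = theta E x y" using v by blast
      then show ?thesis using theta_mult(1)[OF xy(1,2) T] L_mem[OF T xy(1)] by blast
    qed
    have 2: "v \<otimes>\<^bsub>L\<^esub> T \<in> ?V" if T: "T \<in> carrier L" and v: "v \<in> ?V" for T v
    proof -
      obtain x y where xy: "x \<in> carrier E" "y \<in> carrier E" "v = theta E x y" using v by blast
      then show ?thesis using theta_mult(2)[OF xy(1,2) T] L_mem[OF adj(1)[OF T] xy(2)] by blast
    qed
    show ?thesis using LE.closure_span_ideal[OF V 1 2 T] S unfolding compact_ops_def by blast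
  qed
qed

text \<open>Preimages of closed ideals are closed ideals because \<open>\<phi>\<close> is contractive.\<close>

lemma J_ideal_closed_ideal:
  assumes phi: "\<phi> \<in> star_hom B L"
  shows "closed_ideal B (J_ideal B E \<phi>)"
proof -
  note h = star_homD[OF phi]
  note K = LE.closed_subspaceD[OF compact_ops_closed_ideal(1)]
  note KI = compact_ops_closed_ideal(2)
  have h0: "\<phi> \<zero>\<^bsub>B\<^esub> = \<zero>\<^bsub>L\<^esub>" by (rule star_hom_zero[OF B.cstar_algebra_axioms L_cstar phi])
  define N where "N = a_kernel B L \<phi>"
  have N: "b \<in> N \<longleftrightarrow> b \<in> carrier B \<and> \<phi> b = \<zero>\<^bsub>L\<^esub>" for b by (auto simp: N_def a_kernel_def')
  have NI: "c \<otimes>\<^bsub>B\<^esub> x \<in> N" if "c \<in> carrier B" "x \<in> N" for c x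
    using that h by (simp add: N)
  have J: "b \<in> J_ideal B E \<phi> \<longleftrightarrow> b \<in> carrier B \<and> \<phi> b \<in> compact_ops B E \<and> (\<forall>x\<in>N. b \<otimes>\<^bsub>B\<^esub> x = \<zero>\<^bsub>B\<^esub>)" for b
    by (auto simp: J_ideal_def annihilator_def N_def)
  have "closed_subspace B (J_ideal B E \<phi>)"
  proof (rule B.closed_subspaceI)
    show "J_ideal B E \<phi> \<subseteq> carrier B" using J by blast
    show "\<zero>\<^bsub>B\<^esub> \<in> J_ideal B E \<phi>" using K(2) by (simp add: J h0 N)
    show "x \<oplus>\<^bsub>B\<^esub> y \<in> J_ideal B E \<phi>" if "x \<in> J_ideal B E \<phi>" "y \<in> J_ideal B E \<phi>" for x y
      using that K(3) h by (simp add: J N B.distr_left)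
    show "c \<odot>\<^bsub>B\<^esub> x \<in> J_ideal B E \<phi>" if "x \<in> J_ideal B E \<phi>" for c x
      using that K(4) h by (simp add: J N B.smult_mult_left B.scale_simps)
    show "x \<in> J_ideal B E \<phi>" if s: "\<And>n. s n \<in> J_ideal B E \<phi>" and l: "B.clim s x" for s x
      unfolding J
    proof (intro conjI ballI)
      show "x \<in> carrier B" by (rule B.climD(2)[OF l])
      show "\<phi> x \<in> compact_ops B E"
        by (rule K(5)[OF _ star_hom_clim[OF B.cstar_algebra_axioms L_cstar phi l]]) (use s J in blast)
      fix y assume y: "y \<in> N"
      have "B.clim (\<lambda>n. s n \<otimes>\<^bsub>B\<^esub> y) (x \<otimes>\<^bsub>B\<^esub> y)" using y N by (intro B.clim_mult[OF l] B.clim_const) blast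
      moreover have "s n \<otimes>\<^bsub>B\<^esub> y = \<zero>\<^bsub>B\<^esub>" for n using s[of n] y J by blast
      ultimately have "B.clim (\<lambda>n. \<zero>\<^bsub>B\<^esub>) (x \<otimes>\<^bsub>B\<^esub> y)" by simp
      then show "x \<otimes>\<^bsub>B\<^esub> y = \<zero>\<^bsub>B\<^esub>" using B.clim_unique B.clim_const[of "\<zero>\<^bsub>B\<^esub>"] by blast
    qed
  qed
  moreover have "b \<otimes>\<^bsub>B\<^esub> x \<in> J_ideal B E \<phi> \<and> x \<otimes>\<^bsub>B\<^esub> b \<in> J_ideal B E \<phi>"
    if b: "b \<in> carrier B" and x: "x \<in> J_ideal B E \<phi>" for b x
  proof -
    have x': "x \<in> carrier B" "\<phi> x \<in> compact_ops B E" "\<And>y. y \<in> N \<Longrightarrow> x \<otimes>\<^bsub>B\<^esub> y = \<zero>\<^bsub>B\<^esub>" using x J by auto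
    have 1: "b \<otimes>\<^bsub>B\<^esub> x \<otimes>\<^bsub>B\<^esub> y = \<zero>\<^bsub>B\<^esub>" if "y \<in> N" for y
      using that x' b N by (simp add: B.mult_assoc)
    have 2: "x \<otimes>\<^bsub>B\<^esub> b \<otimes>\<^bsub>B\<^esub> y = \<zero>\<^bsub>B\<^esub>" if "y \<in> N" for y
      using that x' b N NI[OF b that] by (simp add: B.mult_assoc)
    show ?thesis unfolding J using 1 2 KI[OF h(1)[OF b] x'(2)] h(4) b x'(1) by simp
  qed
  ultimately show ?thesis by (simp add: closed_ideal_def closed_subspace_def)
qed

end

section \<open>The correspondence\<close>

lemma elem_tensor_mem:
  assumes "t \<in> D1" "c \<in> carrier B" "\<zero>\<^bsub>B\<^esub> \<in> carrier B"
  shows "elem_tensor B t c \<in> X_space B"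
proof -
  have "{s. elem_tensor B t c s \<noteq> \<zero>\<^bsub>B\<^esub>} \<subseteq> {t}" by (auto simp: elem_tensor_def)
  then have "finite {s. elem_tensor B t c s \<noteq> \<zero>\<^bsub>B\<^esub>}" by (rule finite_subset) simp
  then show ?thesis using assms by (auto simp: X_space_def elem_tensor_def)
qed

lemma (in cstar_algebra) X_form_elem:
  assumes "c \<in> carrier C" "d \<in> carrier C" "\<beta> (sg_star s * t) \<in> carrier C"
  shows "X_form C \<beta> (elem_tensor C s c) (elem_tensor C t d) = cadj C c \<otimes> \<beta> (sg_star s * t) \<otimes> d"
proof -
  have supp: "{u. elem_tensor C v b u \<noteq> \<zero>} = (if b = \<zero> then {} else {v})" for v b
    by (auto simp: elem_tensor_def)
  have et: "elem_tensor C v b v = b" for v b by (simp add: elem_tensor_def)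
  have fs: "finsum C f {v} = f v" if "f v \<in> carrier C" for f :: "alt_sg \<Rightarrow> 'c" and v
    using fsum_insert[of "{}" v f] that by (simp add: M.finsum_empty)
  show ?thesis
    unfolding X_form_def supp using assms
    by (auto simp: M.finsum_empty fsum_zero fs et)
qed

locale correspondence =
  fixes B :: "'b cstar" and E :: "('b, 'e) hmod" and \<iota> :: "alt_sg \<Rightarrow> 'b"
    and q :: "(alt_sg \<Rightarrow> 'b) \<Rightarrow> 'e" and \<phi> :: "'b \<Rightarrow> 'e \<Rightarrow> 'e"
  assumes U: "universal_cstar B \<iota>"
    and HC: "hilbert_completion B (\<iota> \<circ> alpha) E q"
    and LA: "left_action B \<iota> E q \<phi>"
begin

sublocale hilbert_module B E using HC by (simp add: hilbert_completion_def)

interpretation LE: unital_cstar "adjointable_ops B E" by (rule L_unital)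

lemma rep: "complete_order_rep B \<iota>" using U by (simp add: universal_cstar_def)

lemmas R = complete_order_repD[OF rep]

lemma phi: "\<phi> \<in> star_hom B L" using LA by (simp add: left_action_def)

lemmas hom = star_homD[OF phi]

abbreviation tens :: "alt_sg \<Rightarrow> 'b \<Rightarrow> 'e" where "tens t c \<equiv> q (elem_tensor B t c)"

lemma phi_tens: "s \<in> D1 \<Longrightarrow> t \<in> D1 \<Longrightarrow> c \<in> carrier B \<Longrightarrow> \<phi> (\<iota> s) (tens t c) = tens (s * t) c"
  using LA by (simp add: left_action_def)

lemma q_closed: "f \<in> X_space B \<Longrightarrow> q f \<in> carrier E"
  using HC by (auto simp: hilbert_completion_def)

lemma q_simps:
  "f \<in> X_space B \<Longrightarrow> g \<in> X_space B \<Longrightarrow> q (\<lambda>t. f t \<oplus>\<^bsub>B\<^esub> g t) = q f \<oplus>\<^bsub>E\<^esub> q g"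
  "f \<in> X_space B \<Longrightarrow> q (\<lambda>t. z \<odot>\<^bsub>B\<^esub> f t) = z \<odot>\<^bsub>E\<^esub> q f"
  "f \<in> X_space B \<Longrightarrow> b \<in> carrier B \<Longrightarrow> q (\<lambda>t. f t \<otimes>\<^bsub>B\<^esub> b) = ract E (q f) b"
  "f \<in> X_space B \<Longrightarrow> g \<in> X_space B \<Longrightarrow> inn E (q f) (q g) = X_form B (\<iota> \<circ> alpha) f g"
  "x \<in> carrier E \<Longrightarrow> e > 0 \<Longrightarrow> \<exists>f\<in>X_space B. nm (x \<ominus>\<^bsub>E\<^esub> q f) < e"
  using HC by (auto simp: hilbert_completion_def)

lemma et_mem: "t \<in> D1 \<Longrightarrow> c \<in> carrier B \<Longrightarrow> elem_tensor B t c \<in> X_space B"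
  by (rule elem_tensor_mem) auto

lemma tens_closed [simp]: "t \<in> D1 \<Longrightarrow> c \<in> carrier B \<Longrightarrow> tens t c \<in> carrier E"
  by (intro q_closed et_mem)

lemma tens_inn:
  assumes "s \<in> D1" "t \<in> D1" "c \<in> carrier B" "d \<in> carrier B"
  shows "inn E (tens s c) (tens t d) = cadj B c \<otimes>\<^bsub>B\<^esub> \<iota> (alpha (sg_star s * t)) \<otimes>\<^bsub>B\<^esub> d"
  using assms q_simps(4)[OF et_mem et_mem] B.X_form_elem[of c d "\<iota> \<circ> alpha" s t]
    R(1)[OF alpha_D1[OF D1_mult[OF D1_star]]] by simp

lemma tens_ract:
  assumes "t \<in> D1" "c \<in> carrier B" "b \<in> carrier B"
  shows "ract E (tens t c) b = tens t (c \<otimes>\<^bsub>B\<^esub> b)"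
proof -
  have "(\<lambda>s. elem_tensor B t c s \<otimes>\<^bsub>B\<^esub> b) = elem_tensor B t (c \<otimes>\<^bsub>B\<^esub> b)"
    using assms by (auto simp: elem_tensor_def)
  then show ?thesis using q_simps(3)[OF et_mem[OF assms(1,2)] assms(3)] by simp
qed

text \<open>Elements of \<open>X_space\<close> are finite sums of elementary tensors and have dense image, and adjointable
  operators are bounded.\<close>

lemma eq_on_tens:
  assumes T: "T \<in> carrier L" "T' \<in> carrier L"
    and eq: "\<And>t c. t \<in> D1 \<Longrightarrow> c \<in> carrier B \<Longrightarrow> T (tens t c) = T' (tens t c)"
  shows "T = T'"
proof (rule L_ext[OF T])
  have qf: "T (q f) = T' (q f)" if "f \<in> X_space B" for f
    using that
  proof (induction "card {t. f t \<noteq> \<zero>\<^bsub>B\<^esub>}" arbitrary: f rule: less_induct)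
    case less
    have fX: "finite {t. f t \<noteq> \<zero>\<^bsub>B\<^esub>}" "\<And>t. f t \<in> carrier B" "\<And>t. t \<notin> D1 \<Longrightarrow> f t = \<zero>\<^bsub>B\<^esub>"
      using less.prems by (auto simp: X_space_def)
    show ?case
    proof (cases "\<exists>t. f t \<noteq> \<zero>\<^bsub>B\<^esub>")
      case False
      then have "f = (\<lambda>t. 0 \<odot>\<^bsub>B\<^esub> f t)" using fX by (auto simp: B.scale_simps)
      then have "q f = 0 \<odot>\<^bsub>E\<^esub> q f" using q_simps(2)[OF less.prems, of 0] by simp
      then have "q f = \<zero>\<^bsub>E\<^esub>" using q_closed[OF less.prems] by (simp add: E.scale_simps)
      then show ?thesis using L_linear(2)[OF T(1), of "\<zero>\<^bsub>E\<^esub>" 0] L_linear(2)[OF T(2), of "\<zero>\<^bsub>E\<^esub>" 0] T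
        by (simp add: E.scale_simps)
    next
      case True
      then obtain t where t: "f t \<noteq> \<zero>\<^bsub>B\<^esub>" by blast
      then have tD: "t \<in> D1" using fX by blast
      define g where "g = f(t := \<zero>\<^bsub>B\<^esub>)"
      have sub: "{s. g s \<noteq> \<zero>\<^bsub>B\<^esub>} = {s. f s \<noteq> \<zero>\<^bsub>B\<^esub>} - {t}" by (auto simp: g_def)
      have gX: "g \<in> X_space B"
        using fX finite_Diff[OF fX(1)] unfolding X_space_def mem_Collect_eq sub by (auto simp: g_def)
      have "card {s. g s \<noteq> \<zero>\<^bsub>B\<^esub>} < card {s. f s \<noteq> \<zero>\<^bsub>B\<^esub>}"
        unfolding sub using fX(1) t by (intro card_Diff1_less) auto
      then have "T (q g) = T' (q g)" using less.hyps gX by blast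
      moreover have "f = (\<lambda>s. elem_tensor B t (f t) s \<oplus>\<^bsub>B\<^esub> g s)" using fX by (auto simp: elem_tensor_def g_def)
      then have "q f = tens t (f t) \<oplus>\<^bsub>E\<^esub> q g"
        using q_simps(1)[OF et_mem[OF tD fX(2)[of t]] gX] by simp
      ultimately show ?thesis using eq[OF tD fX(2)[of t]] L_linear(1)[OF T(1)] L_linear(1)[OF T(2)] tD fX(2)[of t] q_closed[OF gX]
        by simp
    qed
  qed
  fix x assume x: "x \<in> carrier E"
  have D: "T \<ominus>\<^bsub>L\<^esub> T' \<in> carrier L" using T by (rule L.M.minus_closed)
  let ?k = "cnorm L (T \<ominus>\<^bsub>L\<^esub> T')"
  have k: "0 \<le> ?k" by (rule norm_L_nonneg[OF D])
  have "nm ((T \<ominus>\<^bsub>L\<^esub> T') x) \<le> 0 + e" if e: "e > 0" for e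
  proof -
    have "e / (?k + 1) > 0" using e k by simp
    then obtain f where f: "f \<in> X_space B" "nm (x \<ominus>\<^bsub>E\<^esub> q f) < e / (?k + 1)" using q_simps(5)[OF x] by blast
    have qc: "q f \<in> carrier E" by (rule q_closed[OF f(1)])
    have d: "x \<ominus>\<^bsub>E\<^esub> q f \<in> carrier E" using x qc by simp
    have "(T \<ominus>\<^bsub>L\<^esub> T') (x \<ominus>\<^bsub>E\<^esub> q f) = (T \<ominus>\<^bsub>L\<^esub> T') x \<ominus>\<^bsub>E\<^esub> \<zero>\<^bsub>E\<^esub>"
      using qf[OF f(1)] T x qc D by (simp add: L_diff[OF D]) (simp add: L_minus_apply E.diff_self)
    also have "\<dots> = (T \<ominus>\<^bsub>L\<^esub> T') x" using L_mem[OF D x] by (simp add: E.diff_eq_scale E.scale_simps)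
    finally have "nm ((T \<ominus>\<^bsub>L\<^esub> T') x) \<le> ?k * nm (x \<ominus>\<^bsub>E\<^esub> q f)" using norm_L_bound[OF D d] by simp
    also have "\<dots> \<le> ?k * (e / (?k + 1))" using f(2) k by (intro mult_left_mono) auto
    also have "\<dots> \<le> e" using k e by (simp add: field_simps)
    finally show ?thesis by simp
  qed
  then have "nm ((T \<ominus>\<^bsub>L\<^esub> T') x) \<le> 0" by (rule field_le_epsilon)
  then have "nm ((T \<ominus>\<^bsub>L\<^esub> T') x) = 0" using nm_nonneg[OF L_mem[OF D x]] by linarith
  then have "T x \<ominus>\<^bsub>E\<^esub> T' x = \<zero>\<^bsub>E\<^esub>" using nm_eq_0[OF L_mem[OF D x]] T x by (simp add: L_minus_apply)
  then show "T x = T' x" using E.diff_eq_zero T x by auto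
qed

abbreviation "pp \<equiv> word [1, - 1]"
abbreviation "rr \<equiv> word [- 1, 1]"

lemma pp_D1: "pp \<in> D1" by (rule D1_gen)

lemma rr_D1: "rr \<in> D1"
  by (simp add: D1_iff up_down[symmetric] tau_mult peak_mult tau_peak_letters)

lemma stars: "sg_star pp = pp" "sg_star rr = rr"
  by (simp_all add: up_down[symmetric] sg_star_mult star_letters)

lemma absorb: "down * (pp * w) = down * w" "w * pp * up = w * up" "rr * (down * w) = down * w" "pp * (up * w) = up * w"
    "pp * pp = pp"
  using up_down_up by (metis mult.assoc up_down)+

lemma alpha_simps:
  "alpha (pp * t) = alpha t" "alpha (t * pp) = alpha t" "rr * alpha t = alpha t" "alpha t * rr = alpha t"
  "alpha pp = rr" "up * alpha t * down = pp * t * pp"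
  "alpha (s * (pp * t)) = alpha s * alpha t"
proof -
  show 1: "alpha (pp * t) = alpha t" by (simp add: alpha_def mult.assoc absorb)
  show "alpha (t * pp) = alpha t" using absorb(2)[of "down * t"] by (simp add: alpha_def mult.assoc)
  show "rr * alpha t = alpha t" by (simp add: alpha_def mult.assoc absorb)
  show "alpha t * rr = alpha t" using up_down_up(1) by (simp add: alpha_def mult.assoc up_down[symmetric])
  show "alpha pp = rr" by (metis alpha_def absorb(1) up_down(2) mult.assoc)
  show "up * alpha t * down = pp * t * pp" by (simp add: alpha_def mult.assoc up_down(1)[symmetric])
  show "alpha (s * (pp * t)) = alpha s * alpha t" by (simp add: alpha_def mult.assoc up_down(1)[symmetric])
qed

lemma alpha_star: "alpha (sg_star t) = sg_star (alpha t)"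
  by (simp add: alpha_def sg_star_mult star_letters mult.assoc)

abbreviation "e \<equiv> \<iota> rr"
text \<open>Right multiplication by \<open>e = \<iota>(r)\<close> replaces the unit, which \<open>B\<close> may lack: \<open>r\<close> is a unit for \<open>\<alpha>(D1)\<close>.\<close>

definition "\<eta> = tens pp e"

lemma e_simps: "e \<in> carrier B" "cadj B e = e" "t \<in> D1 \<Longrightarrow> e \<otimes>\<^bsub>B\<^esub> \<iota> (alpha t) = \<iota> (alpha t)"
  "t \<in> D1 \<Longrightarrow> \<iota> (alpha t) \<otimes>\<^bsub>B\<^esub> e = \<iota> (alpha t)"
  using R(1)[OF rr_D1] R(3)[OF rr_D1] R(2)[OF rr_D1 alpha_D1] R(2)[OF alpha_D1 rr_D1]
  by (simp_all add: stars alpha_simps)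

lemma eta_closed [simp]: "\<eta> \<in> carrier E"
  by (simp add: \<eta>_def pp_D1 e_simps)

text \<open>On \<open>t \<otimes> c\<close> the two operators have the values \<open>y = p t \<otimes> c\<close> and \<open>x = p \<otimes> f\<close> with \<open>f = \<iota>(\<alpha> t) c\<close>. All four
  inner products of \<open>x\<close> and \<open>y\<close> with each other are equal to \<open>f\<^sup>* f\<close>, so that \<open>x - y\<close> has norm 0.\<close>

lemma phi_pp_theta: "\<phi> (\<iota> pp) = theta E \<eta> \<eta>"
proof (rule eq_on_tens)
  show "\<phi> (\<iota> pp) \<in> carrier L" by (rule hom(1)[OF R(1)[OF pp_D1]])
  show "theta E \<eta> \<eta> \<in> carrier L" by (rule theta_mem) simp_all
  fix t c assume t: "t \<in> D1" and c: "c \<in> carrier B"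
  define a where "a = \<iota> (alpha t)"
  have a: "a \<in> carrier B" unfolding a_def by (rule R(1)[OF alpha_D1[OF t]])
  have ea: "e \<otimes>\<^bsub>B\<^esub> a = a" unfolding a_def by (rule e_simps(3)[OF t])
  define f where "f = a \<otimes>\<^bsub>B\<^esub> c"
  have f: "f \<in> carrier B" using a c by (simp add: f_def)
  have ef: "e \<otimes>\<^bsub>B\<^esub> f = f" using B.mult_assoc[OF e_simps(1) a c] ea by (simp add: f_def)
  have ptD: "pp * t \<in> D1" by (rule D1_mult[OF pp_D1 t])
  have "inn E \<eta> (tens t c) = f"
    unfolding \<eta>_def tens_inn[OF pp_D1 t e_simps(1) c]
    by (simp add: stars alpha_simps e_simps(2) a_def[symmetric] ea f_def)
  then have th: "theta E \<eta> \<eta> (tens t c) = tens pp f"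
    using t c by (simp add: theta_def) (simp add: \<eta>_def tens_ract[OF pp_D1 e_simps(1) f] ef)
  have ph: "\<phi> (\<iota> pp) (tens t c) = tens (pp * t) c" by (rule phi_tens[OF pp_D1 t c])
  let ?x = "tens pp f" and ?y = "tens (pp * t) c"
  have xy: "?x \<in> carrier E" "?y \<in> carrier E" using f c ptD pp_D1 by auto
  let ?K = "cadj B f \<otimes>\<^bsub>B\<^esub> f"
  have xx: "inn E ?x ?x = ?K"
    unfolding tens_inn[OF pp_D1 pp_D1 f f] using f ef
    by (simp add: stars absorb(5) alpha_simps(5) B.mult_assoc e_simps(1))
  have xy': "inn E ?x ?y = ?K"
    unfolding tens_inn[OF pp_D1 ptD f c] using f a c
    by (simp add: stars alpha_simps(1) a_def[symmetric] B.mult_assoc) (simp add: f_def)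
  have yx: "inn E ?y ?x = ?K"
    using inn_cadj[OF xy] f by (simp add: xy' B.cadj_mult B.cadj_cadj)
  have al: "\<iota> (alpha (sg_star t) * alpha t) = cadj B a \<otimes>\<^bsub>B\<^esub> a"
    using R(2)[OF alpha_D1[OF D1_star[OF t]] alpha_D1[OF t]] R(3)[OF alpha_D1[OF t]]
    by (simp add: a_def alpha_star)
  have "sg_star (pp * t) * (pp * t) = sg_star t * (pp * t)"
    by (simp add: sg_star_mult stars mult.assoc) (metis absorb(5) mult.assoc)
  then have yy: "inn E ?y ?y = ?K"
    unfolding tens_inn[OF ptD ptD c c] using a c
    by (simp add: alpha_simps(7) al f_def B.cadj_mult B.mult_assoc)
  have "inn E (?x \<ominus>\<^bsub>E\<^esub> ?y) (?x \<ominus>\<^bsub>E\<^esub> ?y) = \<zero>\<^bsub>B\<^esub>"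
    using xy f by (simp add: inn_diff_left inn_diff_right xx xy' yx yy B.diff_self)
  then have "?x \<ominus>\<^bsub>E\<^esub> ?y = \<zero>\<^bsub>E\<^esub>" using inn_eq_0 xy by simp
  then show "\<phi> (\<iota> pp) (tens t c) = theta E \<eta> \<eta> (tens t c)"
    using E.diff_eq_zero[OF xy] ph th by simp
qed

text \<open>\<open>F b = \<langle>\<eta>, \<phi>(b) \<eta>\<rangle>\<close> and the endomorphism \<open>h\<close> from \<open>raise_hom\<close> satisfy \<open>p b p = h(F b)\<close> on the generators, where
  both sides are \<open>\<iota>(p n p)\<close>, and therefore on all of \<open>B\<close>. If \<open>\<phi>(b) = 0\<close>, then \<open>p b b\<^sup>* p = h(F(b b\<^sup>*)) = 0\<close>.\<close>

lemma pp_annihilates_kernel: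
  assumes b: "b \<in> carrier B" "\<phi> b = \<zero>\<^bsub>L\<^esub>"
  shows "\<iota> pp \<otimes>\<^bsub>B\<^esub> b = \<zero>\<^bsub>B\<^esub>"
proof -
  obtain h where h: "h \<in> star_hom B B" "\<And>s. s \<in> D1 \<Longrightarrow> h (\<iota> s) = raise B \<iota> s"
    using raise_hom[OF U] by blast
  note hh = star_homD[OF h(1)]
  note cB = B.cstar_algebra_axioms
  define p where "p = \<iota> pp"
  have p: "p \<in> carrier B" "cadj B p = p"
    using R(1)[OF pp_D1] R(3)[OF pp_D1] by (simp_all add: p_def stars)
  define F where "F b = inn E \<eta> (\<phi> b \<eta>)" for b
  have phe: "\<phi> b \<eta> \<in> carrier E" if "b \<in> carrier B" for b using L_mem[OF hom(1)[OF that] eta_closed] .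
  have F: "F b \<in> carrier B" if "b \<in> carrier B" for b using phe[OF that] by (simp add: F_def)
  define W where "W = {b \<in> carrier B. p \<otimes>\<^bsub>B\<^esub> b \<otimes>\<^bsub>B\<^esub> p = h (F b)}"
  have W: "closed_subspace B W"
  proof (rule B.closed_subspaceI)
    show "W \<subseteq> carrier B" by (auto simp: W_def)
    have z: "F \<zero>\<^bsub>B\<^esub> = \<zero>\<^bsub>B\<^esub>"
      by (simp add: F_def star_hom_zero[OF cB L_cstar phi] L_apply)
    show "\<zero>\<^bsub>B\<^esub> \<in> W" using p by (simp add: W_def z star_hom_zero[OF cB cB h(1)])
    show "x \<oplus>\<^bsub>B\<^esub> y \<in> W" if "x \<in> W" "y \<in> W" for x y
    proof -
      have xy: "x \<in> carrier B" "y \<in> carrier B" using that by (auto simp: W_def)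
      have "F (x \<oplus>\<^bsub>B\<^esub> y) = F x \<oplus>\<^bsub>B\<^esub> F y"
        using xy phe by (simp add: F_def hom(2) L_apply inn_add_right)
      then show ?thesis using that xy p hh F by (simp add: W_def B.distr_left B.distr_right)
    qed
    show "c \<odot>\<^bsub>B\<^esub> x \<in> W" if "x \<in> W" for c x
    proof -
      have x: "x \<in> carrier B" using that by (auto simp: W_def)
      have "F (c \<odot>\<^bsub>B\<^esub> x) = c \<odot>\<^bsub>B\<^esub> F x" using x phe by (simp add: F_def hom(3) L_apply inn_smult_right)
      then show ?thesis using that x p hh F by (simp add: W_def B.smult_mult_left B.smult_mult_right)
    qed
    show "x \<in> W" if s: "\<And>n. s n \<in> W" and l: "B.clim s x" for s x
    proof -
      note c = B.climD[OF l]
      have "B.clim (\<lambda>n. F (s n)) (F x)"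
      proof (rule B.climI[OF F[OF c(1)] F[OF c(2)]])
        show "(\<lambda>n. nm \<eta> * (cnorm B (s n \<ominus>\<^bsub>B\<^esub> x) * nm \<eta>)) \<longlonglongrightarrow> 0"
          using l unfolding B.clim_def by (intro tendsto_mult_right_zero tendsto_mult_left_zero) auto
        fix n
        have D: "s n \<ominus>\<^bsub>B\<^esub> x \<in> carrier B" using c by simp
        have e: "\<phi> (s n \<ominus>\<^bsub>B\<^esub> x) \<eta> = \<phi> (s n) \<eta> \<ominus>\<^bsub>E\<^esub> \<phi> x \<eta>"
          using c hom phe by (simp add: B.diff_eq_scale E.diff_eq_scale L_apply)
        have "F (s n) \<ominus>\<^bsub>B\<^esub> F x = inn E \<eta> (\<phi> (s n \<ominus>\<^bsub>B\<^esub> x) \<eta>)"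
          unfolding e using c phe by (simp add: F_def inn_diff_right)
        then have "cnorm B (F (s n) \<ominus>\<^bsub>B\<^esub> F x) \<le> nm \<eta> * nm (\<phi> (s n \<ominus>\<^bsub>B\<^esub> x) \<eta>)"
          using cauchy_schwarz[OF eta_closed phe[OF D]] by simp
        also have "\<dots> \<le> nm \<eta> * (cnorm L (\<phi> (s n \<ominus>\<^bsub>B\<^esub> x)) * nm \<eta>)"
          using norm_L_bound[OF hom(1)[OF D] eta_closed] by (intro mult_left_mono) auto
        also have "\<dots> \<le> nm \<eta> * (cnorm B (s n \<ominus>\<^bsub>B\<^esub> x) * nm \<eta>)"
          using star_hom_contractive[OF cB L_cstar phi D] by (intro mult_left_mono mult_right_mono) auto
        finally show "cnorm B (F (s n) \<ominus>\<^bsub>B\<^esub> F x) \<le> nm \<eta> * (cnorm B (s n \<ominus>\<^bsub>B\<^esub> x) * nm \<eta>)" .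
      qed
      from star_hom_clim[OF cB cB h(1) this] have 1: "B.clim (\<lambda>n. h (F (s n))) (h (F x))" .
      have "B.clim (\<lambda>n. p \<otimes>\<^bsub>B\<^esub> s n \<otimes>\<^bsub>B\<^esub> p) (p \<otimes>\<^bsub>B\<^esub> x \<otimes>\<^bsub>B\<^esub> p)"
        by (intro B.clim_mult B.clim_const l p)
      moreover have "p \<otimes>\<^bsub>B\<^esub> s n \<otimes>\<^bsub>B\<^esub> p = h (F (s n))" for n using s[of n] by (simp add: W_def)
      ultimately have "B.clim (\<lambda>n. h (F (s n))) (p \<otimes>\<^bsub>B\<^esub> x \<otimes>\<^bsub>B\<^esub> p)" by simp
      then show ?thesis using B.clim_unique 1 c(2) by (auto simp: W_def)
    qed
  qed
  have gen: "\<iota> n \<in> W" if n: "n \<in> D1" for n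
  proof -
    have np: "n * pp \<in> D1" by (rule D1_mult[OF n pp_D1])
    have "F (\<iota> n) = inn E (tens pp e) (tens (n * pp) e)"
      using phi_tens[OF n pp_D1 e_simps(1)] by (simp add: F_def \<eta>_def)
    also have "\<dots> = \<iota> (alpha n)"
      unfolding tens_inn[OF pp_D1 np e_simps(1) e_simps(1)]
      by (simp add: stars alpha_simps(1,2) e_simps n)
    finally have "F (\<iota> n) = \<iota> (alpha n)" .
    then have "h (F (\<iota> n)) = raise B \<iota> (alpha n)" using h(2)[OF alpha_D1[OF n]] by simp
    also have "\<dots> = \<iota> (pp * n * pp)"
      using n by (simp add: raise_def tau_peak_alpha D1_iff alpha_simps(6))
    also have "\<dots> = p \<otimes>\<^bsub>B\<^esub> \<iota> n \<otimes>\<^bsub>B\<^esub> p"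
      using R(2)[OF D1_mult[OF pp_D1 n] pp_D1] R(2)[OF pp_D1 n] by (simp add: p_def)
    finally show ?thesis using R(1)[OF n] by (simp add: W_def)
  qed
  have "carrier B \<subseteq> W" by (rule universal_dense[OF U W]) (use gen in blast)
  moreover have bb: "b \<otimes>\<^bsub>B\<^esub> cadj B b \<in> carrier B" using b by simp
  ultimately have "p \<otimes>\<^bsub>B\<^esub> (b \<otimes>\<^bsub>B\<^esub> cadj B b) \<otimes>\<^bsub>B\<^esub> p = h (F (b \<otimes>\<^bsub>B\<^esub> cadj B b))" by (auto simp: W_def)
  also have "\<phi> (b \<otimes>\<^bsub>B\<^esub> cadj B b) = \<zero>\<^bsub>L\<^esub>" using b hom by simp
  then have "F (b \<otimes>\<^bsub>B\<^esub> cadj B b) = \<zero>\<^bsub>B\<^esub>" by (simp add: F_def L_apply)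
  finally have z: "p \<otimes>\<^bsub>B\<^esub> (b \<otimes>\<^bsub>B\<^esub> cadj B b) \<otimes>\<^bsub>B\<^esub> p = \<zero>\<^bsub>B\<^esub>" by (simp add: star_hom_zero[OF cB cB h(1)])
  define y where "y = cadj B (p \<otimes>\<^bsub>B\<^esub> b)"
  have y: "y \<in> carrier B" using p b by (simp add: y_def)
  have "cadj B y \<otimes>\<^bsub>B\<^esub> y = p \<otimes>\<^bsub>B\<^esub> (b \<otimes>\<^bsub>B\<^esub> cadj B b) \<otimes>\<^bsub>B\<^esub> p"
    using p b by (simp add: y_def B.cadj_cadj B.cadj_mult B.mult_assoc)
  then have "(cnorm B y)\<^sup>2 = 0" using B.cstar_identity[OF y] z by simp
  then have "cnorm B (p \<otimes>\<^bsub>B\<^esub> b) = 0" using p b by (simp add: y_def B.norm_cadj)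
  then show ?thesis using B.cnorm_eq_0[of "p \<otimes>\<^bsub>B\<^esub> b"] p b by (simp add: p_def)
qed

lemma pp_in_J: "\<iota> pp \<in> J_ideal B E \<phi>"
proof -
  have "\<phi> (\<iota> pp) \<in> compact_ops B E"
    unfolding phi_pp_theta by (rule compact_ops_closed_ideal(3)) simp_all
  moreover have "\<iota> pp \<otimes>\<^bsub>B\<^esub> x = \<zero>\<^bsub>B\<^esub>" if "x \<in> a_kernel B L \<phi>" for x
    using that by (intro pp_annihilates_kernel) (auto simp: a_kernel_def')
  ultimately show ?thesis using R(1)[OF pp_D1] by (simp add: J_ideal_def annihilator_def)
qed

end

theorem corollary6p12:
  fixes B :: "'b cstar" and E :: "('b, 'e) hmod"
    and \<iota> :: "alt_sg \<Rightarrow> 'b" and q :: "(alt_sg \<Rightarrow> 'b) \<Rightarrow> 'e" and \<phi> :: "'b \<Rightarrow> 'e \<Rightarrow> 'e"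
  assumes "universal_cstar B \<iota>"
    and "hilbert_completion B (\<iota> \<circ> alpha) E q"
    and "left_action B \<iota> E q \<phi>"
  shows "closed_ideal_gen B {\<iota> (word [1, -1])} \<subseteq> J_ideal B E \<phi>"
proof -
  interpret correspondence B E \<iota> q \<phi> using assms by (rule correspondence.intro)
  have "closed_ideal B (J_ideal B E \<phi>)" by (rule J_ideal_closed_ideal[OF phi])
  then show ?thesis using pp_in_J unfolding closed_ideal_gen_def by (intro Inter_lower) simp
qed

end
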